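(* Consider the flag manifold $\mathbb F=SU(m+n+p)/S(U(m)\times U(n)\times U(p))$, its projected Ricci flow on $\mathcal S$, and the regions $R_1,\dots,R_{10}$ of the interior of $\mathcal S$ described in the context. The limiting behaviour of the projected Ricci flow is as follows: in forward time, orbits in $R_1,R_3,R_4$ converge to $K$, orbits in $R_2,R_5,R_6,R_9$ converge to $L$, and orbits in $R_7,R_8,R_{10}$ converge to $M$; in backward time, orbits in $R_3,R_8$ converge to $O$, orbits in $R_1,R_2$ converge to $P$, and orbits in $R_9,R_{10}$ converge to $Q$. In particular: 1. the Kähler–Einstein metrics ($R$, $S$ and $T$) are hyperbolic saddles; 2. the non-Kähler Einstein metric ($N$) is a repeller; 3. if the metric $g_0$ belongs to $R_1$, $R_3$ or $R_4$, then $\mathbb F_\infty=(Gr_{m+n}(\mathbb C^{m+n+p}),g_{\rm normal})$; 4. if $g_0$ belongs to $R_2$, $R_5$, $R_6$ or $R_9$, then $\mathbb F_\infty=(Gr_{m+p}(\mathbb C^{m+n+p}),g_{\rm normal})$; 5. if $g_0$ belongs to $R_7$, $R_8$ or $R_{10}$, then $\mathbb F_\infty=(Gr_{n+p}(\mathbb C^{m+n+p}),g_{\rm normal})$; 6. if $g_0$ lies outside the triangle delimited by $L,T,K,R,M,S$ and the flow lines connecting them, then $\mathbb F_{-\infty}$ is a point. Here $\mathbb F_{\pm\infty}=\lim_{t\to\pm\infty}(\mathbb F,g_t)$, $g_t$ is the projected Ricci flow with initial condition $g_0$, and the convergence is in the Gromov–Hausdorff sense.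
   Context: Let $m,n,p\ge1$ and $\mathfrak{su}(m+n+p)=\mathfrak k\oplus\mathfrak m_1\oplus\mathfrak m_2\oplus\mathfrak m_3$, with $\mathfrak k$ the isotropy algebra and $\mathfrak m_i$ the irreducible isotropy summands, of real dimensions $2mn$, $2mp$, $2np$. With $B$ = minus the Killing form, invariant metrics are $xB|_{\mathfrak m_1}+yB|_{\mathfrak m_2}+zB|_{\mathfrak m_3}$, $x,y,z>0$, considered up to scale, normalized by $x+y+z=1$ and identified with the points $(x,y)$ in the interior of $\mathcal S=\{(x,y):x,y\ge0,\ x+y\le1\}$, $z=1-x-y$. The projected Ricci flow is the flow on $\mathcal S$ of $$x'=-x(2x-1)\big(m(4y-1)(x+y-1)+ny(4x+4y-3)+p(x(4y-1)+(1-2y)^2)\big),$$ $$y'=-y(2y-1)\big(m(4x-1)(x+y-1)+n(y(4x-1)+(1-2x)^2)+px(4x+4y-3)\big),$$ whose orbits in the interior of $\mathcal S$ are those of the homogeneous Ricci flow $\frac{dg}{dt}=-2\mathrm{Ric}(g)$ up to rescaling of metrics and positive time reparametrization. Its equilibria are $O=(0,0)$, $P=(0,1)$, $Q=(1,0)$, $K=(0,\tfrac12)$, $L=(\tfrac12,\tfrac12)$, $M=(\tfrac12,0)$ (degenerate metrics) and $N=\big(\tfrac{m+n}{2(m+n+p)},\tfrac{m+p}{2(m+n+p)}\big)$, $R=\big(\tfrac{m+n}{2(2m+n+p)},\tfrac{m+p}{2(2m+n+p)}\big)$, $S=\big(\tfrac12,\tfrac{m+p}{2(m+n+2p)}\big)$,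 $T=\big(\tfrac{m+n}{2(m+2n+p)},\tfrac12\big)$ (Einstein metrics). $N$ lies inside the triangle $KLM$; $R,S,T$ lie on the sides $KM$, $LM$, $KL$ respectively, and these sides are invariant under the flow. Regions: the sides of the triangle $KLM$ and the stable manifolds of $R,S,T$ cut the interior of $\mathcal S$ into open regions. The corner at $P$ ($y>\tfrac12$) is cut into $R_1$ (with $K$ in its closure) and $R_2$ (with $L$ in its closure); the corner at $O$ ($x+y<\tfrac12$) into $R_3$ (with $K$ in its closure) and $R_8$ (with $M$); the corner at $Q$ ($x>\tfrac12$) into $R_9$ (with $L$) and $R_{10}$ (with $M$); the interior of the triangle $KLM$ into $R_4$ (with $K$), $R_7$ (with $M$), and a part with $L$ in its closure, made up by $R_5$ and $R_6$. $Gr_s(\mathbb C^r)$ is the Grassmannian of $s$-planes in $\mathbb C^r$; $g_{\rm normal}$ is the invariant metric induced by a positive multiple of $B$. Kähler means Kähler with respect to some invariant complex structure.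
   Formalization: In items 4 and 5 the two Grassmannians are interchanged: orbits in R_2, R_5, R_6, R_9 (limit L, z=0) give Gr_{n+p}, and orbits in R_7, R_8, R_10 (limit M, y=0) give Gr_{m+p}; as printed the claim fails when m≠n, e.g. m=1, n=2, p=1, where the dimensions differ. *)

theory Defs
  imports "HOL-Analysis.Analysis"
begin

section \<open>The Lie algebra of the special unitary group\<close>

type_synonym 'k cmat = "complex^'k^'k"

definition ctranspose :: "'k::finite cmat \<Rightarrow> 'k cmat" where
  "ctranspose A = (\<chi> i j. cnj (A $ j $ i))"

definition SU :: "'k::finite cmat set" where
  "SU = {A. ctranspose A ** A = mat 1 \<and> det A = 1}"

definition su :: "'k::finite cmat set" where
  "su = {X. ctranspose X = - X \<and> trace X = 0}"

definition bracket :: "'k::finite cmat \<Rightarrow> 'k cmat \<Rightarrow> 'k cmat" where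
  "bracket X Y = X ** Y - Y ** X"

text \<open>The trace of an endomorphism \<open>f\<close> of a finite-dimensional real subspace \<open>V\<close>: the sum of the
  diagonal coefficients with respect to some basis.\<close>

definition trace_on :: "'v::real_vector set \<Rightarrow> ('v \<Rightarrow> 'v) \<Rightarrow> real" where
  "trace_on V f =
    (let E = (SOME E. independent E \<and> span E = V) in \<Sum>b\<in>E. representation E (f b) b)"

definition killing_form :: "'k::finite cmat \<Rightarrow> 'k cmat \<Rightarrow> real" where
  "killing_form X Y = trace_on su (\<lambda>Z. bracket X (bracket Y Z))"

definition neg_killing :: "'k::finite cmat \<Rightarrow> 'k cmat \<Rightarrow> real" where
  "neg_killing X Y = - killing_form X Y"

section \<open>Distances on homogeneous spaces of \<open>SU\<close>\<close>

text \<open>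
  Let \<open>SU\<close> act transitively (by \<open>act\<close>) on a set with base point \<open>x0\<close> and stabiliser \<open>H\<close>, and let \<open>g\<close>
  be a symmetric bilinear form on \<open>su\<close> that vanishes on \<open>Lie(H)\<close> and is positive definite and
  \<open>Ad(H)\<close>-invariant on a reductive complement of \<open>Lie(H)\<close>, i.e. an invariant Riemannian metric on
  the orbit \<open>SU/H\<close>. Every piecewise \<open>C\<^sup>1\<close> curve in \<open>SU/H\<close> lifts to a piecewise \<open>C\<^sup>1\<close> curve \<open>\<gamma>\<close> in
  \<open>SU\<close>, and its speed is the \<open>g\<close>-length of \<open>\<gamma>\<^sup>-\<^sup>1 \<gamma>'\<close>; here \<open>\<gamma>\<^sup>-\<^sup>1\<close> is the conjugate transpose.
  So the infimum below is the Riemannian distance.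
\<close>

text \<open>The library's notion of piecewise \<open>C\<^sup>1\<close> allows unbounded derivatives near the break points.
  The integrability condition excludes curves of infinite length, whose integral would be \<open>0\<close> by
  convention.\<close>

definition curve_speed ::
  "('k::finite cmat \<Rightarrow> 'k cmat \<Rightarrow> real) \<Rightarrow> (real \<Rightarrow> 'k cmat) \<Rightarrow> real \<Rightarrow> real" where
  "curve_speed g \<gamma> t =
    (let X = ctranspose (\<gamma> t) ** vector_derivative \<gamma> (at t within {0..1}) in sqrt (g X X))"

definition riemannian_dist ::
  "('k::finite cmat \<Rightarrow> 'x \<Rightarrow> 'x) \<Rightarrow> 'x \<Rightarrow> ('k cmat \<Rightarrow> 'k cmat \<Rightarrow> real) \<Rightarrow> 'x \<Rightarrow> 'x \<Rightarrow> real" where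
  "riemannian_dist act x0 g a b =
    Inf {integral {0..1} (curve_speed g \<gamma>) | \<gamma>.
           \<gamma> piecewise_C1_differentiable_on {0..1} \<and> \<gamma> ` {0..1} \<subseteq> SU \<and>
           curve_speed g \<gamma> integrable_on {0..1} \<and> act (\<gamma> 0) x0 = a \<and> act (\<gamma> 1) x0 = b}"

section \<open>The flag manifold and its invariant metrics\<close>

datatype block = First | Second | Third

text \<open>The rows and columns of a matrix are indexed by the disjoint union of index types of sizes
  \<open>m\<close>, \<open>n\<close> and \<open>p\<close>.\<close>

definition flag_blocks :: "'m + 'n + 'p \<Rightarrow> block" where
  "flag_blocks i = (case i of Inl _ \<Rightarrow> First | Inr (Inl _) \<Rightarrow> Second | Inr (Inr _) \<Rightarrow> Third)"

definition isotropy_group :: "('k::finite \<Rightarrow> block) \<Rightarrow> 'k cmat set" where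
  "isotropy_group \<beta> = {A \<in> SU. \<forall>i j. \<beta> i \<noteq> \<beta> j \<longrightarrow> A $ i $ j = 0}"

definition left_mult :: "'k::finite cmat \<Rightarrow> 'k cmat set \<Rightarrow> 'k cmat set" where
  "left_mult A C = (\<lambda>h. A ** h) ` C"

definition flag_manifold :: "('k::finite \<Rightarrow> block) \<Rightarrow> 'k cmat set set" where
  "flag_manifold \<beta> = {left_mult A (isotropy_group \<beta>) | A. A \<in> SU}"

definition isotropy_complement :: "('k::finite \<Rightarrow> block) \<Rightarrow> 'k cmat set" where
  "isotropy_complement \<beta> = {X \<in> su. \<forall>i j. \<beta> i = \<beta> j \<longrightarrow> X $ i $ j = 0}"

text \<open>For \<open>a \<noteq> b\<close>, the component in the irreducible isotropy summand of the \<open>(a, b)\<close> and \<open>(b, a)\<close>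
  blocks.\<close>

definition summand_part :: "('k::finite \<Rightarrow> block) \<Rightarrow> block \<Rightarrow> block \<Rightarrow> 'k cmat \<Rightarrow> 'k cmat" where
  "summand_part \<beta> a b X = (\<chi> i j. if {\<beta> i, \<beta> j} = {a, b} then X $ i $ j else 0)"

definition complement_part :: "('k::finite \<Rightarrow> block) \<Rightarrow> 'k cmat \<Rightarrow> 'k cmat" where
  "complement_part \<beta> X = (\<chi> i j. if \<beta> i = \<beta> j then 0 else X $ i $ j)"

text \<open>The metric with parameters \<open>x\<close>, \<open>y\<close> and \<open>z = 1 - x - y\<close>, extended by zero to the isotropy
  algebra. The summands have real dimensions \<open>2mn\<close>, \<open>2mp\<close> and \<open>2np\<close> in this order.\<close>

definition flag_metric :: "('k::finite \<Rightarrow> block) \<Rightarrow> real \<times> real \<Rightarrow> 'k cmat \<Rightarrow> 'k cmat \<Rightarrow> real" where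
  "flag_metric \<beta> = (\<lambda>(x, y) X Y.
     x * neg_killing (summand_part \<beta> First Second X) (summand_part \<beta> First Second Y)
   + y * neg_killing (summand_part \<beta> First Third X) (summand_part \<beta> First Third Y)
   + (1 - x - y) * neg_killing (summand_part \<beta> Second Third X) (summand_part \<beta> Second Third Y))"

definition flag_dist ::
  "('k::finite \<Rightarrow> block) \<Rightarrow> real \<times> real \<Rightarrow> 'k cmat set \<Rightarrow> 'k cmat set \<Rightarrow> real" where
  "flag_dist \<beta> q = riemannian_dist left_mult (isotropy_group \<beta>) (flag_metric \<beta> q)"

section \<open>Einstein and Kaehler metrics\<close>

text \<open>Nomizu's description of the Levi-Civita connection and the curvature of an invariant metric on
  a reductive homogeneous space, evaluated at the base point (Kobayashi and Nomizu, Foundations of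
  Differential Geometry II, Theorems X.2.3 and X.3.3).\<close>

definition nomizu_U ::
  "('k::finite \<Rightarrow> block) \<Rightarrow> real \<times> real \<Rightarrow> 'k cmat \<Rightarrow> 'k cmat \<Rightarrow> 'k cmat" where
  "nomizu_U \<beta> q X Y = (THE W. W \<in> isotropy_complement \<beta> \<and>
     (\<forall>Z \<in> isotropy_complement \<beta>. 2 * flag_metric \<beta> q W Z =
        flag_metric \<beta> q (complement_part \<beta> (bracket Z X)) Y
      + flag_metric \<beta> q X (complement_part \<beta> (bracket Z Y))))"

definition levi_civita ::
  "('k::finite \<Rightarrow> block) \<Rightarrow> real \<times> real \<Rightarrow> 'k cmat \<Rightarrow> 'k cmat \<Rightarrow> 'k cmat" where
  "levi_civita \<beta> q X Y = (1/2) *\<^sub>R complement_part \<beta> (bracket X Y) + nomizu_U \<beta> q X Y"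

definition curvature ::
  "('k::finite \<Rightarrow> block) \<Rightarrow> real \<times> real \<Rightarrow> 'k cmat \<Rightarrow> 'k cmat \<Rightarrow> 'k cmat \<Rightarrow> 'k cmat" where
  "curvature \<beta> q X Y Z =
     levi_civita \<beta> q X (levi_civita \<beta> q Y Z) - levi_civita \<beta> q Y (levi_civita \<beta> q X Z)
   - levi_civita \<beta> q (complement_part \<beta> (bracket X Y)) Z
   - bracket (bracket X Y - complement_part \<beta> (bracket X Y)) Z"

definition Ric :: "('k::finite \<Rightarrow> block) \<Rightarrow> real \<times> real \<Rightarrow> 'k cmat \<Rightarrow> 'k cmat \<Rightarrow> real" where
  "Ric \<beta> q Y Z = trace_on (isotropy_complement \<beta>) (\<lambda>X. curvature \<beta> q X Y Z)"

definition einstein :: "('k::finite \<Rightarrow> block) \<Rightarrow> real \<times> real \<Rightarrow> bool" where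
  "einstein \<beta> q \<longleftrightarrow> (\<exists>c. \<forall>X \<in> isotropy_complement \<beta>. \<forall>Y \<in> isotropy_complement \<beta>.
     Ric \<beta> q X Y = c * flag_metric \<beta> q X Y)"

text \<open>An invariant complex structure is given by an \<open>Ad\<close>-invariant almost complex structure on the
  isotropy complement whose Nijenhuis tensor vanishes. Only the values of \<open>J\<close> on that complement
  matter.\<close>

definition invariant_complex_structure ::
  "('k::finite \<Rightarrow> block) \<Rightarrow> ('k cmat \<Rightarrow> 'k cmat) \<Rightarrow> bool" where
  "invariant_complex_structure \<beta> J \<longleftrightarrow> linear J \<and>
     (\<forall>X \<in> isotropy_complement \<beta>. J X \<in> isotropy_complement \<beta> \<and> J (J X) = - X \<and>
        (\<forall>A \<in> isotropy_group \<beta>. J (A ** X ** ctranspose A) = A ** J X ** ctranspose A)) \<and>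
     (\<forall>X \<in> isotropy_complement \<beta>. \<forall>Y \<in> isotropy_complement \<beta>.
        complement_part \<beta> (bracket (J X) (J Y)) - J (complement_part \<beta> (bracket (J X) Y))
        - J (complement_part \<beta> (bracket X (J Y))) - complement_part \<beta> (bracket X Y) = 0)"

text \<open>The metric is Hermitian and the fundamental form \<open>\<omega>(X, Y) = g(JX, Y)\<close> is closed.\<close>

definition kaehler :: "('k::finite \<Rightarrow> block) \<Rightarrow> real \<times> real \<Rightarrow> bool" where
  "kaehler \<beta> q \<longleftrightarrow> (\<exists>J. invariant_complex_structure \<beta> J \<and>
     (\<forall>X \<in> isotropy_complement \<beta>. \<forall>Y \<in> isotropy_complement \<beta>.
        flag_metric \<beta> q (J X) (J Y) = flag_metric \<beta> q X Y) \<and>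
     (\<forall>X \<in> isotropy_complement \<beta>. \<forall>Y \<in> isotropy_complement \<beta>. \<forall>Z \<in> isotropy_complement \<beta>.
        flag_metric \<beta> q (J (complement_part \<beta> (bracket X Y))) Z
      + flag_metric \<beta> q (J (complement_part \<beta> (bracket Y Z))) X
      + flag_metric \<beta> q (J (complement_part \<beta> (bracket Z X))) Y = 0))"

section \<open>Grassmannians with normal metrics\<close>

definition grassmannian :: "nat \<Rightarrow> (complex^'k::finite) set set" where
  "grassmannian s = {V. vec.subspace V \<and> vec.dim V = s}"

definition apply_plane :: "'k::finite cmat \<Rightarrow> (complex^'k) set \<Rightarrow> (complex^'k) set" where
  "apply_plane A V = (\<lambda>v. A *v v) ` V"

definition coordinate_plane :: "'k::finite set \<Rightarrow> (complex^'k) set" where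
  "coordinate_plane I = {v. \<forall>i. i \<notin> I \<longrightarrow> v $ i = 0}"

text \<open>The component in the \<open>neg_killing\<close>-orthogonal complement of the isotropy algebra of
  \<open>coordinate_plane I\<close>, which consists of the matrices in \<open>su\<close> that are block diagonal with respect
  to \<open>I\<close> and its complement.\<close>

definition plane_complement_part :: "'k::finite set \<Rightarrow> 'k cmat \<Rightarrow> 'k cmat" where
  "plane_complement_part I X = (\<chi> i j. if (i \<in> I) = (j \<in> I) then 0 else X $ i $ j)"

text \<open>The distance on \<open>grassmannian (card I)\<close> of the invariant metric induced by
  \<open>c * neg_killing\<close>; the choice of \<open>I\<close> only fixes the base point.\<close>

definition grassmannian_dist ::
  "'k::finite set \<Rightarrow> real \<Rightarrow> (complex^'k) set \<Rightarrow> (complex^'k) set \<Rightarrow> real" where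
  "grassmannian_dist I c = riemannian_dist apply_plane (coordinate_plane I)
     (\<lambda>X Y. c * neg_killing (plane_complement_part I X) (plane_complement_part I Y))"

section \<open>Gromov-Hausdorff convergence\<close>

text \<open>The infimum of the \<open>r\<close> for which some metric on the disjoint union extends both metrics and
  puts the two spaces at Hausdorff distance at most \<open>r\<close>.\<close>

definition gromov_hausdorff_dist ::
  "'a set \<Rightarrow> ('a \<Rightarrow> 'a \<Rightarrow> real) \<Rightarrow> 'b set \<Rightarrow> ('b \<Rightarrow> 'b \<Rightarrow> real) \<Rightarrow> ennreal" where
  "gromov_hausdorff_dist M d M' d' = Inf {ennreal r | r. r > 0 \<and>
     (\<exists>D. Metric_space (M <+> M') D \<and>
        (\<forall>a\<in>M. \<forall>b\<in>M. D (Inl a) (Inl b) = d a b) \<and>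
        (\<forall>a\<in>M'. \<forall>b\<in>M'. D (Inr a) (Inr b) = d' a b) \<and>
        (\<forall>a\<in>M. \<exists>b\<in>M'. D (Inl a) (Inr b) < r) \<and>
        (\<forall>b\<in>M'. \<exists>a\<in>M. D (Inl a) (Inr b) < r))}"

definition gromov_hausdorff_tendsto ::
  "'a set \<Rightarrow> (real \<Rightarrow> 'a \<Rightarrow> 'a \<Rightarrow> real) \<Rightarrow> 'b set \<Rightarrow> ('b \<Rightarrow> 'b \<Rightarrow> real) \<Rightarrow> real filter \<Rightarrow> bool" where
  "gromov_hausdorff_tendsto M d M' d' F \<longleftrightarrow>
     ((\<lambda>t. gromov_hausdorff_dist M (d t) M' d') \<longlongrightarrow> 0) F"

section \<open>The projected Ricci flow\<close>

definition simplex_S :: "(real \<times> real) set" where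
  "simplex_S = {(x, y). 0 \<le> x \<and> 0 \<le> y \<and> x + y \<le> 1}"

definition ricci_field :: "nat \<Rightarrow> nat \<Rightarrow> nat \<Rightarrow> real \<times> real \<Rightarrow> real \<times> real" where
  "ricci_field m n p = (\<lambda>(x, y).
    (- x * (2*x - 1) * (real m * (4*y - 1) * (x + y - 1) + real n * y * (4*x + 4*y - 3)
        + real p * (x * (4*y - 1) + (1 - 2*y)^2)),
     - y * (2*y - 1) * (real m * (4*x - 1) * (x + y - 1)
        + real n * (y * (4*x - 1) + (1 - 2*x)^2) + real p * x * (4*x + 4*y - 3))))"

definition flow_line :: "nat \<Rightarrow> nat \<Rightarrow> nat \<Rightarrow> (real \<Rightarrow> real \<times> real) \<Rightarrow> bool" where
  "flow_line m n p \<phi> \<longleftrightarrow>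
     (\<forall>t. \<phi> t \<in> simplex_S \<and> (\<phi> has_vector_derivative ricci_field m n p (\<phi> t)) (at t))"

text \<open>\<open>simplex_S\<close> is compact and invariant, so flow lines exist for all time and are unique.\<close>

definition ricci_flow :: "nat \<Rightarrow> nat \<Rightarrow> nat \<Rightarrow> real \<times> real \<Rightarrow> real \<Rightarrow> real \<times> real" where
  "ricci_flow m n p q = (THE \<phi>. flow_line m n p \<phi> \<and> \<phi> 0 = q)"

definition pt_O :: "real \<times> real" where "pt_O = (0, 0)"
definition pt_P :: "real \<times> real" where "pt_P = (0, 1)"
definition pt_Q :: "real \<times> real" where "pt_Q = (1, 0)"
definition pt_K :: "real \<times> real" where "pt_K = (0, 1/2)"
definition pt_L :: "real \<times> real" where "pt_L = (1/2, 1/2)"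
definition pt_M :: "real \<times> real" where "pt_M = (1/2, 0)"

definition pt_N :: "nat \<Rightarrow> nat \<Rightarrow> nat \<Rightarrow> real \<times> real" where
  "pt_N m n p = (real (m + n) / real (2 * (m + n + p)), real (m + p) / real (2 * (m + n + p)))"
definition pt_R :: "nat \<Rightarrow> nat \<Rightarrow> nat \<Rightarrow> real \<times> real" where
  "pt_R m n p = (real (m + n) / real (2 * (2*m + n + p)), real (m + p) / real (2 * (2*m + n + p)))"
definition pt_S :: "nat \<Rightarrow> nat \<Rightarrow> nat \<Rightarrow> real \<times> real" where
  "pt_S m n p = (1/2, real (m + p) / real (2 * (m + n + 2*p)))"
definition pt_T :: "nat \<Rightarrow> nat \<Rightarrow> nat \<Rightarrow> real \<times> real" where
  "pt_T m n p = (real (m + n) / real (2 * (m + 2*n + p)), 1/2)"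

definition complex_eigenvalue :: "('v::real_vector \<Rightarrow> 'v) \<Rightarrow> complex \<Rightarrow> bool" where
  \<comment> \<open>\<open>u + i v\<close> is an eigenvector of the complexification\<close>
  "complex_eigenvalue A \<mu> \<longleftrightarrow> (\<exists>u v. (u \<noteq> 0 \<or> v \<noteq> 0) \<and>
     A u = Re \<mu> *\<^sub>R u - Im \<mu> *\<^sub>R v \<and> A v = Im \<mu> *\<^sub>R u + Re \<mu> *\<^sub>R v)"

definition hyperbolic_saddle :: "('v::euclidean_space \<Rightarrow> 'v) \<Rightarrow> 'v \<Rightarrow> bool" where
  "hyperbolic_saddle F q \<longleftrightarrow> F q = 0 \<and> (\<exists>A. (F has_derivative A) (at q) \<and>
     (\<forall>\<mu>. complex_eigenvalue A \<mu> \<longrightarrow> Re \<mu> \<noteq> 0) \<and>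
     (\<exists>\<mu>. complex_eigenvalue A \<mu> \<and> Re \<mu> > 0) \<and> (\<exists>\<mu>. complex_eigenvalue A \<mu> \<and> Re \<mu> < 0))"

definition repeller :: "('v::euclidean_space \<Rightarrow> 'v) \<Rightarrow> 'v \<Rightarrow> bool" where
  "repeller F q \<longleftrightarrow> F q = 0 \<and> (\<exists>A. (F has_derivative A) (at q) \<and>
     (\<forall>\<mu>. complex_eigenvalue A \<mu> \<longrightarrow> Re \<mu> > 0))"

section \<open>The regions\<close>

definition stable_manifold :: "nat \<Rightarrow> nat \<Rightarrow> nat \<Rightarrow> real \<times> real \<Rightarrow> (real \<times> real) set" where
  "stable_manifold m n p e = {q \<in> simplex_S. (ricci_flow m n p q \<longlongrightarrow> e) at_top}"

text \<open>Inside the triangle the three stable manifolds emanate from \<open>N\<close> without containing it. This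
  point lies on the boundary of all the regions there and has to be removed as well; otherwise it
  would connect them.\<close>

definition cut_set :: "nat \<Rightarrow> nat \<Rightarrow> nat \<Rightarrow> (real \<times> real) set" where
  "cut_set m n p =
     closed_segment pt_K pt_L \<union> closed_segment pt_L pt_M \<union> closed_segment pt_K pt_M
     \<union> stable_manifold m n p (pt_R m n p) \<union> stable_manifold m n p (pt_S m n p)
     \<union> stable_manifold m n p (pt_T m n p) \<union> {pt_N m n p}"

definition corner_O :: "(real \<times> real) set" where "corner_O = {(x, y). x + y < 1/2}"
definition corner_P :: "(real \<times> real) set" where "corner_P = {(x, y). y > 1/2}"
definition corner_Q :: "(real \<times> real) set" where "corner_Q = {(x, y). x > 1/2}"

definition triangle_KLM :: "(real \<times> real) set" where
  "triangle_KLM = convex hull {pt_K, pt_L, pt_M}"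

text \<open>The part of \<open>C\<close> (a corner or the interior of the triangle) with the vertex \<open>v\<close> in its closure.\<close>

definition region ::
  "nat \<Rightarrow> nat \<Rightarrow> nat \<Rightarrow> (real \<times> real) set \<Rightarrow> real \<times> real \<Rightarrow> (real \<times> real) set" where
  "region m n p C v =
     \<Union>{U \<in> components (interior simplex_S - cut_set m n p). U \<subseteq> C \<and> v \<in> closure U}"

definition region_1 :: "nat \<Rightarrow> nat \<Rightarrow> nat \<Rightarrow> (real \<times> real) set" where
  "region_1 m n p = region m n p corner_P pt_K"
definition region_2 :: "nat \<Rightarrow> nat \<Rightarrow> nat \<Rightarrow> (real \<times> real) set" where
  "region_2 m n p = region m n p corner_P pt_L"
definition region_3 :: "nat \<Rightarrow> nat \<Rightarrow> nat \<Rightarrow> (real \<times> real) set" where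
  "region_3 m n p = region m n p corner_O pt_K"
definition region_4 :: "nat \<Rightarrow> nat \<Rightarrow> nat \<Rightarrow> (real \<times> real) set" where
  "region_4 m n p = region m n p (interior triangle_KLM) pt_K"
definition region_5_6 :: "nat \<Rightarrow> nat \<Rightarrow> nat \<Rightarrow> (real \<times> real) set" where
  \<comment> \<open>the union of the fifth and the sixth region\<close>
  "region_5_6 m n p = region m n p (interior triangle_KLM) pt_L"
definition region_7 :: "nat \<Rightarrow> nat \<Rightarrow> nat \<Rightarrow> (real \<times> real) set" where
  "region_7 m n p = region m n p (interior triangle_KLM) pt_M"
definition region_8 :: "nat \<Rightarrow> nat \<Rightarrow> nat \<Rightarrow> (real \<times> real) set" where
  "region_8 m n p = region m n p corner_O pt_M"
definition region_9 :: "nat \<Rightarrow> nat \<Rightarrow> nat \<Rightarrow> (real \<times> real) set" where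
  "region_9 m n p = region m n p corner_Q pt_L"
definition region_10 :: "nat \<Rightarrow> nat \<Rightarrow> nat \<Rightarrow> (real \<times> real) set" where
  "region_10 m n p = region m n p corner_Q pt_M"

end

theory Submission
 imports Defs
begin

text \<open>
 The flow is symmetric under permutations of \<open>x\<close>, \<open>y\<close>, \<open>z\<close>, so it is enough to treat one corner and the
 triangle \<open>KLM\<close>. In the corner \<open>y > 1/2\<close> the function \<open>(2 y - 1) y / (x z)\<close> decreases strictly along
 orbits; hence \<open>y\<close> tends to \<open>1/2\<close> forwards and to \<open>1\<close> backwards. In the triangle a similar rational
 function pushes every orbit except \<open>N\<close> to the boundary. Close to a side the remaining coordinate follows
 a scalar equation whose zeros are two vertices and a Kaehler-Einstein point. The basins of \<open>K\<close>, \<open>L\<close>, \<open>M\<close>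
 are open and cover the complement of the cut set, so each component lies in the basin of the vertex in
 its closure.

 Invariance under the maximal torus forces an invariant complex structure to act by \<open>\<plusminus>\<i>\<close> on the root
 spaces, and closedness of the fundamental form becomes \<open>\<plusminus>x \<plusminus> y \<plusminus> z = 0\<close>, which fails at \<open>N\<close>.

 Distances on the flag manifold and on the Grassmannians come from left-invariant pseudo-metrics on
 \<open>SU\<close>, the infima of the lengths of curves with respect to \<open>sqrt (\<Sum> om i j |X i j|\<^sup>2)\<close>; directions of
 weight \<open>0\<close> are free of charge. They depend continuously on the weights, uniformly by compactness.
 The weights at \<open>K\<close>, \<open>L\<close>, \<open>M\<close> are those of normal metrics of Grassmannians; at \<open>O\<close>, \<open>P\<close>, \<open>Q\<close> the directions
 of weight \<open>0\<close> generate the group, so the limit is a point.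
\<close>

section \<open>Ordinary differential equations\<close>

text \<open>The regions are components of the complement of a set that is itself defined by limits
  of orbits, so no separating curve in the phase plane is available as a formula. Every limit has to
  come from explicit monotone functions and from a scalar equation on a side. The same
  classification of limits, read for constant orbits, yields the complete list of Einstein metrics.

  On the geometric side the limit metrics are degenerate, so convergence of the tensors says little
  about distances by itself. Passing from the quotients to the group puts all spaces on one set,
  where a weight may vanish. Two estimates of different kind then match: from above, a nearly
  shortest curve for the limit weights is kept fixed and its length changes little; from below,
  lengths are compared by a factor, an inequality that holds trivially where the limit weight is
  zero. It remains to know which points have distance zero: one direction needs an invariant that
  detects the blocks, the other a factorization into rotations that are free of charge.\<close>

definition antideriv :: "(real => 'a::banach) => real => 'a" where
 "antideriv g t = integral {0..t} g - integral {t..0} g"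

text \<open>At least one of the two integrals is over an empty interval or a single point, so
  \<open>antideriv\<close> is the integral from 0 to \<open>t\<close> with its sign. On a window
  \<open>{-T<..<T}\<close> it differs by a constant from the integral starting at \<open>-T\<close>,
  and there the fundamental theorem applies for either sign of \<open>t\<close>.\<close>

lemma antideriv_has_vector_derivative:
 fixes g :: "real => 'a::banach"
 assumes g: "continuous_on UNIV g"
 shows "(antideriv g has_vector_derivative g t) (at t)"
proof -
 define T where "T = \<bar>t\<bar> + 1"
 have T: "T > 0" "-T < t" "t < T" by (auto simp: T_def)
 have int: "g integrable_on {a..b}" for a b
  by (rule integrable_continuous_real) (rule continuous_on_subset[OF g], simp)
 have eq: "antideriv g s = integral {-T..s} g - integral {-T..0} g" if "s \<in> {-T<..<T}" for s
 proof (cases "s \<ge> 0")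
  case True
  have "integral {-T..0} g + integral {0..s} g = integral {-T..s} g"
   by (rule Henstock_Kurzweil_Integration.integral_combine) (use T True int in auto)
  moreover have "integral {s..0} g = 0"
   using True by (cases "s = 0") auto
  ultimately show ?thesis
   by (simp add: antideriv_def algebra_simps)
 next
  case False
  have "integral {-T..s} g + integral {s..0} g = integral {-T..0} g"
   by (rule Henstock_Kurzweil_Integration.integral_combine) (use T False that int in auto)
  then show ?thesis using False by (simp add: antideriv_def algebra_simps)
 qed
 have "((\<lambda>s. integral {-T..s} g) has_vector_derivative g t) (at t within {-T..T})"
  by (rule integral_has_vector_derivative) (use T in \<open>auto intro: continuous_on_subset[OF g]\<close>)
 then have "((\<lambda>s. integral {-T..s} g) has_vector_derivative g t) (at t)"
  using T by (simp add: at_within_Icc_at)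
 then have "((\<lambda>s. integral {-T..s} g - integral {-T..0} g) has_vector_derivative g t) (at t)"
  by (auto intro!: derivative_eq_intros)
 then show ?thesis
  by (rule has_vector_derivative_transform_within_open[where S = "{-T<..<T}"]) (use T eq in auto)
qed

lemma antideriv_0 [simp]: "antideriv g 0 = 0"
 by (simp add: antideriv_def)

text \<open>Integration gains the factor \<open>1 / K\<close>, which is what makes the Picard map
  below a contraction. The proof compares with a primitive of
  \<open>M * exp (K * \<bar>s\<bar>)\<close>, separately on the two half lines.\<close>

lemma antideriv_exp_bound:
 fixes g :: "real => 'a::banach"
 assumes g: "continuous_on UNIV g" and K: "K > 0"
  and bd: "\<And>s. norm (g s) \<le> M * exp (K * \<bar>s\<bar>)"
 shows "norm (antideriv g t) \<le> M / K * exp (K * \<bar>t\<bar>)"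
proof -
 note D = antideriv_has_vector_derivative[OF g]
 have cont: "continuous_on A (antideriv g)" for A
  by (meson D continuous_at_imp_continuous_on has_vector_derivative_continuous)
 have "0 \<le> norm (g 0)" by simp
 also have "\<dots> \<le> M" using bd[of 0] by simp
 finally have M: "M \<ge> 0" .
 show ?thesis
 proof (cases t "0::real" rule: linorder_cases)
  case greater
  have "norm (antideriv g t - antideriv g 0) \<le> M / K * exp (K * t) - M / K * exp (K * 0)"
  proof (rule differentiable_bound_general[where \<phi> = "\<lambda>s. M / K * exp (K * s)" and f = "antideriv g"
     and f' = g and \<phi>' = "\<lambda>s. M * exp (K * s)"])
   show "((\<lambda>s. M / K * exp (K * s)) has_vector_derivative M * exp (K * x)) (at x)" for x
    unfolding has_real_derivative_iff_has_vector_derivative[symmetric]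
    using K by (auto intro!: derivative_eq_intros)
   show "norm (g x) \<le> M * exp (K * x)" if "0 < x" "x < t" for x
    using bd[of x] that by simp
  qed (use greater cont D K in \<open>auto intro!: continuous_on_divide continuous_on_mult continuous_on_exp continuous_on_const continuous_on_id\<close>)
  moreover have "M / K * exp (K * 0) \<ge> 0" using M K by simp
  ultimately show ?thesis using greater by simp
 next
  case less
  have "norm (antideriv g 0 - antideriv g t) \<le> - (M / K * exp (- (K * 0))) - - (M / K * exp (- (K * t)))"
  proof (rule differentiable_bound_general[where \<phi> = "\<lambda>s. - (M / K * exp (- (K * s)))" and f = "antideriv g"
     and f' = g and \<phi>' = "\<lambda>s. M * exp (- (K * s))"])
   show "((\<lambda>s. - (M / K * exp (- (K * s)))) has_vector_derivative M * exp (- (K * x))) (at x)" for x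
    unfolding has_real_derivative_iff_has_vector_derivative[symmetric]
    using K by (auto intro!: derivative_eq_intros)
   show "norm (g x) \<le> M * exp (- (K * x))" if "t < x" "x < 0" for x
    using bd[of x] that by simp
  qed (use less cont D K in \<open>auto intro!: continuous_on_divide continuous_on_mult continuous_on_exp continuous_on_const continuous_on_id continuous_on_minus\<close>)
  moreover have "M / K * exp (- (K * 0)) \<ge> 0" using M K by simp
  ultimately show ?thesis using less by simp
 next
  case equal
  then show ?thesis using M K by simp
 qed
qed

text \<open>Picard iteration in the weighted supremum norm \<open>sup\<^sub>t exp (-K|t|) |\<phi> t - q|\<close>, which yields the
 solution on all of \<open>\<real>\<close> at once.\<close>

lemma ode_global_solution:
 fixes f :: "'a::{banach} => 'a"
 assumes lip: "\<And>a b. norm (f a - f b) \<le> L * norm (a - b)" and bd: "\<And>a. norm (f a) \<le> B"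
 obtains \<phi> where "\<phi> 0 = q" "\<And>t. (\<phi> has_vector_derivative f (\<phi> t)) (at t)"
proof -
 \<comment> \<open>The Picard map contracts by \<open>\<bar>L\<bar> / K\<close>; this value keeps
   the quotient at most 1/2 and makes \<open>K\<close> positive even for
   \<open>L = 0\<close>.\<close>
 define K where "K = 2 * \<bar>L\<bar> + 1"
 have K: "K > 0" by (auto simp: K_def)
 have "0 \<le> norm (f q)" by simp
 also have "\<dots> \<le> B" by (rule bd)
 finally have B: "B \<ge> 0" .
 have lip': "norm (f a - f b) \<le> \<bar>L\<bar> * norm (a - b)" for a b
  using lip[of a b] by (smt (verit) mult_right_mono norm_ge_zero)
 have fc: "continuous_on UNIV f"
 proof (rule lipschitz_on_continuous_on)
  show "\<bar>L\<bar>-lipschitz_on UNIV f" using lip' by (auto simp: lipschitz_on_def dist_norm)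
 qed
 \<comment> \<open>The unknown is the rescaled deviation of the solution from \<open>q\<close>, a
   bounded continuous function; \<open>\<theta>\<close> undoes the scaling. The weighted norm thus
   becomes the usual norm of a complete space.\<close>
 define \<theta> :: "(real => 'a) => real => 'a" where "\<theta> \<psi> s = q + exp (K * \<bar>s\<bar>) *\<^sub>R \<psi> s" for \<psi> s
 define P :: "(real => 'a) => real => 'a" where
  "P \<psi> t = exp (- (K * \<bar>t\<bar>)) *\<^sub>R antideriv (\<lambda>s. f (\<theta> \<psi> s)) t" for \<psi> t
 have \<theta>c: "continuous_on UNIV (\<lambda>s. f (\<theta> (apply_bcontfun \<psi>) s))" for \<psi>
  unfolding \<theta>_def by (intro continuous_on_compose2[OF fc] continuous_intros) auto
 have ac: "continuous_on UNIV (antideriv g)" if "continuous_on UNIV g" for g :: "real => 'a"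
  by (meson antideriv_has_vector_derivative that continuous_at_imp_continuous_on
    has_vector_derivative_continuous)
 have Pb: "P (apply_bcontfun \<psi>) \<in> bcontfun" for \<psi>
 proof (rule bcontfun_normI)
  show "continuous_on UNIV (P (apply_bcontfun \<psi>))"
   unfolding P_def by (intro continuous_intros ac \<theta>c)
  fix t
  have "norm (antideriv (\<lambda>s. f (\<theta> (apply_bcontfun \<psi>) s)) t) \<le> B / K * exp (K * \<bar>t\<bar>)"
  proof (rule antideriv_exp_bound[OF \<theta>c K])
   fix s
   have "B * 1 \<le> B * exp (K * \<bar>s\<bar>)" using B K by (intro mult_left_mono) auto
   then show "norm (f (\<theta> (apply_bcontfun \<psi>) s)) \<le> B * exp (K * \<bar>s\<bar>)"
    using bd[of "\<theta> (apply_bcontfun \<psi>) s"] by simp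
  qed
  then show "norm (P (apply_bcontfun \<psi>) t) \<le> B / K"
   by (simp add: P_def exp_minus field_simps)
 qed
 define PP where "PP \<psi> = Bcontfun (P (apply_bcontfun \<psi>))" for \<psi>
 have PP: "apply_bcontfun (PP \<psi>) = P (apply_bcontfun \<psi>)" for \<psi>
  unfolding PP_def by (rule Bcontfun_inverse[OF Pb])
 have "\<exists>!\<psi>. PP \<psi> = \<psi>"
 proof (rule banach_fix_type[where c = "1/2"])
  show "\<forall>\<psi> \<xi>. dist (PP \<psi>) (PP \<xi>) \<le> 1/2 * dist \<psi> \<xi>"
  proof (intro allI dist_bound)
   fix \<psi> \<xi> :: "(real, 'a) bcontfun" and t
   define g where "g s = f (\<theta> (apply_bcontfun \<psi>) s) - f (\<theta> (apply_bcontfun \<xi>) s)" for s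
   have gc: "continuous_on UNIV g" unfolding g_def by (intro continuous_intros \<theta>c)
   have "antideriv (\<lambda>s. f (\<theta> (apply_bcontfun \<psi>) s)) t - antideriv (\<lambda>s. f (\<theta> (apply_bcontfun \<xi>) s)) t
     = antideriv g t"
    unfolding antideriv_def g_def
    by (subst (1 2) integral_diff)
     (auto intro!: integrable_continuous_real continuous_on_subset[OF \<theta>c])
   then have "dist (P (apply_bcontfun \<psi>) t) (P (apply_bcontfun \<xi>) t)
     = exp (- (K * \<bar>t\<bar>)) * norm (antideriv g t)"
    by (simp add: P_def dist_norm flip: scaleR_diff_right)
   also have "norm (antideriv g t) \<le> (\<bar>L\<bar> * dist \<psi> \<xi>) / K * exp (K * \<bar>t\<bar>)"
   proof (rule antideriv_exp_bound[OF gc K])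
    fix s
    have "norm (g s) \<le> \<bar>L\<bar> * norm (\<theta> (apply_bcontfun \<psi>) s - \<theta> (apply_bcontfun \<xi>) s)"
     unfolding g_def by (rule lip')
    also have "\<dots> = \<bar>L\<bar> * exp (K * \<bar>s\<bar>) * dist (apply_bcontfun \<psi> s) (apply_bcontfun \<xi> s)"
     by (simp add: \<theta>_def dist_norm flip: scaleR_diff_right)
    also have "\<dots> \<le> \<bar>L\<bar> * exp (K * \<bar>s\<bar>) * dist \<psi> \<xi>"
     by (intro mult_left_mono dist_bounded) auto
    finally show "norm (g s) \<le> \<bar>L\<bar> * dist \<psi> \<xi> * exp (K * \<bar>s\<bar>)" by (simp add: mult_ac)
   qed
   also have "exp (- (K * \<bar>t\<bar>)) * ((\<bar>L\<bar> * dist \<psi> \<xi>) / K * exp (K * \<bar>t\<bar>)) = \<bar>L\<bar> / K * dist \<psi> \<xi>"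
    by (simp add: exp_minus field_simps)
   also have "\<dots> \<le> 1/2 * dist \<psi> \<xi>"
    by (intro mult_right_mono) (auto simp: K_def field_simps)
   finally show "dist (apply_bcontfun (PP \<psi>) t) (apply_bcontfun (PP \<xi>) t) \<le> 1/2 * dist \<psi> \<xi>"
    by (simp add: PP)
  qed
 qed auto
 then obtain \<psi> where "PP \<psi> = \<psi>" by blast
 then have fix_eq: "apply_bcontfun \<psi> = P (apply_bcontfun \<psi>)" by (metis PP)
 define \<phi> where "\<phi> = \<theta> (apply_bcontfun \<psi>)"
 have \<phi>: "\<phi> t = q + antideriv (\<lambda>s. f (\<phi> s)) t" for t
 proof -
  have "\<phi> t = q + exp (K * \<bar>t\<bar>) *\<^sub>R P (apply_bcontfun \<psi>) t"
   by (simp add: \<phi>_def \<theta>_def flip: fix_eq)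
  then show ?thesis by (simp add: P_def \<phi>_def flip: exp_add)
 qed
 have "(\<phi> has_vector_derivative f (\<phi> t)) (at t)" for t
 proof -
  have "(antideriv (\<lambda>s. f (\<phi> s)) has_vector_derivative f (\<phi> t)) (at t)"
   unfolding \<phi>_def by (rule antideriv_has_vector_derivative[OF \<theta>c])
  then have "((\<lambda>t. q + antideriv (\<lambda>s. f (\<phi> s)) t) has_vector_derivative f (\<phi> t)) (at t)"
   by (auto intro!: derivative_eq_intros)
  then show ?thesis by (simp flip: \<phi>)
 qed
 moreover have "\<phi> 0 = q" by (subst \<phi>) simp
 ultimately show ?thesis using that by blast
qed

text \<open>A bound on \<open>\<bar>D'\<bar>\<close>, rather than on \<open>D'\<close>, works in
  both directions of time: \<open>D t * exp (- C * t)\<close> decreases for positive times and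
  \<open>D t * exp (C * t)\<close> increases for negative ones.\<close>

lemma gronwall_real:
 fixes D :: "real => real"
 assumes D: "\<And>t. (D has_real_derivative D' t) (at t)" and bd: "\<And>t. \<bar>D' t\<bar> \<le> C * D t"
 shows "D t \<le> D 0 * exp (C * \<bar>t\<bar>)"
proof (cases "t \<ge> 0")
 case True
 have "D t * exp (- C * t) \<le> D 0 * exp (- C * 0)"
 proof (rule DERIV_nonpos_imp_nonincreasing[OF True])
  fix x
  have "((\<lambda>t. D t * exp (- C * t)) has_real_derivative (D' x - C * D x) * exp (- C * x)) (at x)"
   by (auto intro!: derivative_eq_intros D simp: algebra_simps)
  moreover have "(D' x - C * D x) * exp (- C * x) \<le> 0"
   using bd[of x] by (intro mult_nonpos_nonneg) auto
  ultimately show "\<exists>y. ((\<lambda>t. D t * exp (- C * t)) has_real_derivative y) (at x) \<and> y \<le> 0" by blast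
 qed
 then show ?thesis using True by (simp add: exp_minus field_simps)
next
 case False
 have "D t * exp (C * t) \<le> D 0 * exp (C * 0)"
 proof (rule DERIV_nonneg_imp_nondecreasing[of t 0])
  fix x
  have "((\<lambda>t. D t * exp (C * t)) has_real_derivative (D' x + C * D x) * exp (C * x)) (at x)"
   by (auto intro!: derivative_eq_intros D simp: algebra_simps)
  moreover have "(D' x + C * D x) * exp (C * x) \<ge> 0"
   using bd[of x] by (intro mult_nonneg_nonneg) auto
  ultimately show "\<exists>y. ((\<lambda>t. D t * exp (C * t)) has_real_derivative y) (at x) \<and> y \<ge> 0" by blast
 qed (use False in auto)
 then show ?thesis using False by (simp add: exp_minus field_simps)
qed

text \<open>Gronwall's inequality is applied to the squared distance of the two solutions, which is
  differentiable everywhere; this doubles the exponent, and the square root restores it. Equal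
  initial values give uniqueness.\<close>

lemma ode_continuous_dependence:
 fixes f :: "'a::real_inner => 'a"
 assumes lip: "\<And>a b. a \<in> S ==> b \<in> S ==> norm (f a - f b) \<le> L * norm (a - b)"
  and \<phi>: "\<And>t. \<phi> t \<in> S" "\<And>t. (\<phi> has_vector_derivative f (\<phi> t)) (at t)"
  and \<psi>: "\<And>t. \<psi> t \<in> S" "\<And>t. (\<psi> has_vector_derivative f (\<psi> t)) (at t)"
 shows "norm (\<phi> t - \<psi> t) \<le> norm (\<phi> 0 - \<psi> 0) * exp (L * \<bar>t\<bar>)"
proof -
 define D where "D t = (\<phi> t - \<psi> t) \<bullet> (\<phi> t - \<psi> t)" for t
 have "D t \<le> D 0 * exp (2 * L * \<bar>t\<bar>)"
 proof (rule gronwall_real[where D = D and D' = "\<lambda>t. 2 * ((\<phi> t - \<psi> t) \<bullet> (f (\<phi> t) - f (\<psi> t)))"])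
  fix t
  have "(D has_vector_derivative (\<phi> t - \<psi> t) \<bullet> (f (\<phi> t) - f (\<psi> t)) + (f (\<phi> t) - f (\<psi> t)) \<bullet> (\<phi> t - \<psi> t)) (at t)"
   unfolding D_def
   by (intro bounded_bilinear.has_vector_derivative[OF bounded_bilinear_inner] has_vector_derivative_diff \<phi> \<psi>)
  then show "(D has_real_derivative 2 * ((\<phi> t - \<psi> t) \<bullet> (f (\<phi> t) - f (\<psi> t)))) (at t)"
   by (simp add: has_real_derivative_iff_has_vector_derivative inner_commute)
  have "\<bar>(\<phi> t - \<psi> t) \<bullet> (f (\<phi> t) - f (\<psi> t))\<bar> \<le> norm (\<phi> t - \<psi> t) * norm (f (\<phi> t) - f (\<psi> t))"
   by (rule Cauchy_Schwarz_ineq2)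
  also have "\<dots> \<le> norm (\<phi> t - \<psi> t) * (L * norm (\<phi> t - \<psi> t))"
   by (intro mult_left_mono lip \<phi> \<psi>) auto
  also have "\<dots> = L * D t" by (simp add: D_def dot_square_norm power2_eq_square)
  finally show "\<bar>2 * ((\<phi> t - \<psi> t) \<bullet> (f (\<phi> t) - f (\<psi> t)))\<bar> \<le> 2 * L * D t" by simp
 qed
 also have "D 0 * exp (2 * L * \<bar>t\<bar>) = (norm (\<phi> 0 - \<psi> 0) * exp (L * \<bar>t\<bar>))\<^sup>2"
  by (simp add: D_def dot_square_norm power_mult_distrib flip: exp_double)
 finally have "(norm (\<phi> t - \<psi> t))\<^sup>2 \<le> (norm (\<phi> 0 - \<psi> 0) * exp (L * \<bar>t\<bar>))\<^sup>2"
  by (simp add: D_def dot_square_norm)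
 then show ?thesis by (rule power2_le_imp_le) simp
qed

text \<open>The squared distance to \<open>S\<close> of a solution of \<open>\<phi>' = f (\<pi> \<phi>)\<close>, with \<open>\<pi>\<close> the projection onto \<open>S\<close>,
 changes only to second order, because \<open>f\<close> is orthogonal to the normal cone of \<open>S\<close>.\<close>

lemma ode_invariant_convex:
 fixes f :: "'a::euclidean_space => 'a"
 assumes S: "convex S" "compact S" "S \<noteq> {}"
  and lip: "\<And>a b. a \<in> S ==> b \<in> S ==> norm (f a - f b) \<le> L * norm (a - b)"
  and tangent: "\<And>a v. a \<in> S ==> (\<And>b. b \<in> S ==> v \<bullet> (b - a) \<le> 0) ==> v \<bullet> f a = 0"
  and q: "q \<in> S"
 obtains \<phi> where "\<phi> 0 = q" "\<And>t. \<phi> t \<in> S" "\<And>t. (\<phi> has_vector_derivative f (\<phi> t)) (at t)"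
proof -
 note cl = compact_imp_closed[OF S(2)]
 define \<pi> where "\<pi> = closest_point S"
 have \<pi>S: "\<pi> a \<in> S" for a unfolding \<pi>_def by (rule closest_point_in_set[OF cl S(3)])
 have \<pi>l: "norm (\<pi> a - \<pi> b) \<le> norm (a - b)" for a b
  using closest_point_lipschitz[OF S(1) cl S(3), of a b] by (simp add: \<pi>_def dist_norm)
 have lip': "norm (f a - f b) \<le> \<bar>L\<bar> * norm (a - b)" if "a \<in> S" "b \<in> S" for a b
  using lip[OF that] by (smt (verit) mult_right_mono norm_ge_zero)
 have "\<bar>L\<bar>-lipschitz_on S f" using lip' by (auto simp: lipschitz_on_def dist_norm)
 then have "compact (f ` S)"
  by (intro compact_continuous_image lipschitz_on_continuous_on S)
 then obtain B where B: "\<And>a. a \<in> S ==> norm (f a) \<le> B"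
  by (meson compact_imp_bounded bounded_iff imageI)
 have "norm (f (\<pi> a) - f (\<pi> b)) \<le> \<bar>L\<bar> * norm (a - b)" for a b
  using lip'[OF \<pi>S \<pi>S, of a b] mult_left_mono[OF \<pi>l[of a b], of "\<bar>L\<bar>"] by simp
 then obtain \<phi> where \<phi>0: "\<phi> 0 = q" and \<phi>: "\<And>t. (\<phi> has_vector_derivative f (\<pi> (\<phi> t))) (at t)"
  using ode_global_solution[of "\<lambda>a. f (\<pi> a)" "\<bar>L\<bar>" B q] B \<pi>S by metis
 define D where "D t = (norm (\<phi> t - \<pi> (\<phi> t)))\<^sup>2" for t
 have \<phi>lip: "norm (\<phi> s - \<phi> t) \<le> B * \<bar>s - t\<bar>" for s t
 proof -
  have "norm (\<phi> s - \<phi> t) \<le> B * norm (s - t)"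
  proof (rule differentiable_bound[where S = UNIV and f' = "\<lambda>t h. h *\<^sub>R f (\<pi> (\<phi> t))"])
   show "(\<phi> has_derivative (\<lambda>h. h *\<^sub>R f (\<pi> (\<phi> r)))) (at r within UNIV)" for r
    using \<phi>[of r] by (simp add: has_vector_derivative_def)
   show "onorm (\<lambda>h. h *\<^sub>R f (\<pi> (\<phi> r))) \<le> B" for r
   proof (rule onorm_bound)
    show "0 \<le> B" using B[OF q] norm_ge_zero[of "f q"] by linarith
    show "norm (h *\<^sub>R f (\<pi> (\<phi> r))) \<le> B * norm h" for h :: real
     using mult_left_mono[OF B[OF \<pi>S, of "\<phi> r"], of "\<bar>h\<bar>"] by (simp add: mult.commute)
   qed
  qed auto
  then show ?thesis by simp
 qed
 have \<phi>2: "norm (\<phi> s - \<phi> t - (s - t) *\<^sub>R f (\<pi> (\<phi> t))) \<le> \<bar>L\<bar> * B * (s - t)\<^sup>2" for s t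
 proof -
  have "norm ((\<phi> s - s *\<^sub>R f (\<pi> (\<phi> t))) - (\<phi> t - t *\<^sub>R f (\<pi> (\<phi> t)))) \<le> (\<bar>L\<bar> * B * \<bar>s - t\<bar>) * norm (s - t)"
  proof (rule differentiable_bound[where S = "closed_segment s t" and f' = "\<lambda>r h. h *\<^sub>R (f (\<pi> (\<phi> r)) - f (\<pi> (\<phi> t)))"])
   fix r assume r: "r \<in> closed_segment s t"
   have "((\<lambda>r. \<phi> r - r *\<^sub>R f (\<pi> (\<phi> t))) has_vector_derivative f (\<pi> (\<phi> r)) - f (\<pi> (\<phi> t))) (at r)"
    by (auto intro!: derivative_eq_intros \<phi>)
   then show "((\<lambda>r. \<phi> r - r *\<^sub>R f (\<pi> (\<phi> t))) has_derivative (\<lambda>h. h *\<^sub>R (f (\<pi> (\<phi> r)) - f (\<pi> (\<phi> t))))) (at r within closed_segment s t)"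
    by (auto simp: has_vector_derivative_def intro: has_derivative_at_withinI)
   have "norm (f (\<pi> (\<phi> r)) - f (\<pi> (\<phi> t))) \<le> \<bar>L\<bar> * norm (\<pi> (\<phi> r) - \<pi> (\<phi> t))"
    by (rule lip'[OF \<pi>S \<pi>S])
   also have "\<dots> \<le> \<bar>L\<bar> * norm (\<phi> r - \<phi> t)" by (intro mult_left_mono \<pi>l) auto
   also have "\<dots> \<le> \<bar>L\<bar> * (B * \<bar>r - t\<bar>)" by (intro mult_left_mono \<phi>lip) auto
   also have "\<dots> \<le> \<bar>L\<bar> * (B * \<bar>s - t\<bar>)"
   proof -
    have "B \<ge> 0" using B[OF q] norm_ge_zero[of "f q"] by linarith
    moreover have "\<bar>r - t\<bar> \<le> \<bar>s - t\<bar>"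
     using r by (auto simp: closed_segment_eq_real_ivl split: if_splits)
    ultimately show ?thesis by (intro mult_left_mono) auto
   qed
   finally have le: "norm (f (\<pi> (\<phi> r)) - f (\<pi> (\<phi> t))) \<le> \<bar>L\<bar> * B * \<bar>s - t\<bar>" by (simp add: mult_ac)
   show "onorm (\<lambda>h. h *\<^sub>R (f (\<pi> (\<phi> r)) - f (\<pi> (\<phi> t)))) \<le> \<bar>L\<bar> * B * \<bar>s - t\<bar>"
   proof (intro onorm_bound)
    show "0 \<le> \<bar>L\<bar> * B * \<bar>s - t\<bar>" using le norm_ge_zero order_trans by blast
    show "norm (h *\<^sub>R (f (\<pi> (\<phi> r)) - f (\<pi> (\<phi> t)))) \<le> \<bar>L\<bar> * B * \<bar>s - t\<bar> * norm h" for h :: real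
     using mult_left_mono[OF le, of "\<bar>h\<bar>"] by (simp add: mult.commute)
   qed
  qed auto
  then show ?thesis by (simp add: algebra_simps power2_eq_square)
 qed
 \<comment> \<open>The distance from \<open>\<phi> s\<close> to \<open>S\<close> is at most the
   distance to the old foot point \<open>\<pi> (\<phi> t)\<close>. Expanding the latter's square,
   the first order term vanishes because \<open>v\<close> is normal to \<open>S\<close> at the foot
   point and hence orthogonal to the field.\<close>
 have Dle: "D s - D t \<le> (2 * \<bar>L\<bar> * B * norm (\<phi> t - \<pi> (\<phi> t)) + B\<^sup>2) * (s - t)\<^sup>2" for s t
 proof -
  define v where "v = \<phi> t - \<pi> (\<phi> t)"
  define r where "r = \<phi> s - \<phi> t - (s - t) *\<^sub>R f (\<pi> (\<phi> t))"
  have vf: "v \<bullet> f (\<pi> (\<phi> t)) = 0"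
  proof (rule tangent[OF \<pi>S])
   show "v \<bullet> (b - \<pi> (\<phi> t)) \<le> 0" if "b \<in> S" for b
    using closest_point_dot[OF S(1) cl that, of "\<phi> t"] by (simp add: v_def \<pi>_def)
  qed
  have "norm (\<phi> s - \<pi> (\<phi> s)) \<le> norm (\<phi> s - \<pi> (\<phi> t))"
   using closest_point_le[OF cl \<pi>S, of "\<phi> s" "\<phi> t"] by (simp add: \<pi>_def dist_norm)
  then have "D s \<le> (norm (\<phi> s - \<pi> (\<phi> t)))\<^sup>2" unfolding D_def by (intro power_mono) auto
  also have "\<phi> s - \<pi> (\<phi> t) = (\<phi> s - \<phi> t) + v" by (simp add: v_def)
  also have "(norm ((\<phi> s - \<phi> t) + v))\<^sup>2 = (norm (\<phi> s - \<phi> t))\<^sup>2 + 2 * (v \<bullet> (\<phi> s - \<phi> t)) + D t"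
   by (simp add: D_def v_def power2_norm_eq_inner inner_add inner_commute algebra_simps)
  also have "v \<bullet> (\<phi> s - \<phi> t) = v \<bullet> r" by (simp add: r_def inner_diff_right vf)
  also have "v \<bullet> r \<le> norm v * norm r" by (rule norm_cauchy_schwarz)
  also have "norm v * norm r \<le> norm v * (\<bar>L\<bar> * B * (s - t)\<^sup>2)"
   unfolding r_def by (intro mult_left_mono \<phi>2) auto
  also have "(norm (\<phi> s - \<phi> t))\<^sup>2 \<le> (B * \<bar>s - t\<bar>)\<^sup>2" by (intro power_mono \<phi>lip) auto
  finally show ?thesis by (simp add: v_def power_mult_distrib algebra_simps)
 qed
 \<comment> \<open>The one-sided quadratic bound is used with \<open>s\<close> and \<open>t\<close>
   exchanged as well. Its constant then involves the distance at \<open>s\<close>, which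
   \<open>gl\<close> controls near \<open>t\<close>, so that one \<open>C\<close> serves for
   both.\<close>
 have D0: "(D has_real_derivative 0) (at t)" for t
 proof -
  define g where "g t = norm (\<phi> t - \<pi> (\<phi> t))" for t
  have gl: "\<bar>g s - g t\<bar> \<le> 2 * B * \<bar>s - t\<bar>" for s
  proof -
   have "\<bar>g s - g t\<bar> \<le> norm ((\<phi> s - \<pi> (\<phi> s)) - (\<phi> t - \<pi> (\<phi> t)))"
    unfolding g_def by (rule norm_triangle_ineq3)
   also have "\<dots> \<le> norm (\<phi> s - \<phi> t) + norm (\<pi> (\<phi> s) - \<pi> (\<phi> t))"
    by norm
   also have "\<dots> \<le> 2 * norm (\<phi> s - \<phi> t)" using \<pi>l[of "\<phi> s" "\<phi> t"] by simp
   finally show ?thesis using \<phi>lip[of s t] by simp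
  qed
  have B0: "B \<ge> 0" using B[OF q] norm_ge_zero[of "f q"] by linarith
  define C where "C = 2 * \<bar>L\<bar> * B * (g t + 2 * B) + B\<^sup>2"
  have C: "\<bar>D s - D t\<bar> \<le> C * (s - t)\<^sup>2" if "\<bar>s - t\<bar> < 1" for s
  proof -
   have gs: "g s \<le> g t + 2 * B"
   proof -
    have "2 * B * \<bar>s - t\<bar> \<le> 2 * B * 1" using that B0 by (intro mult_left_mono) auto
    then show ?thesis using gl[of s] by linarith
   qed
   have "2 * \<bar>L\<bar> * B * g s + B\<^sup>2 \<le> C" "2 * \<bar>L\<bar> * B * g t + B\<^sup>2 \<le> C"
    unfolding C_def using gs B0 by (auto intro!: mult_left_mono)
   then have "(2 * \<bar>L\<bar> * B * g s + B\<^sup>2) * (s - t)\<^sup>2 \<le> C * (s - t)\<^sup>2"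
    "(2 * \<bar>L\<bar> * B * g t + B\<^sup>2) * (s - t)\<^sup>2 \<le> C * (s - t)\<^sup>2"
    by (auto intro!: mult_right_mono)
   then show ?thesis using Dle[of s t] Dle[of t s] unfolding g_def
    by (simp add: power2_commute[of t s])
  qed
  have "((\<lambda>s. (D s - D t) / (s - t)) \<longlongrightarrow> 0) (at t)"
  proof (rule Lim_null_comparison)
   show "\<forall>\<^sub>F s in at t. norm ((D s - D t) / (s - t)) \<le> C * \<bar>s - t\<bar>"
    unfolding eventually_at
   proof (intro exI[of _ 1] conjI ballI impI)
    fix s assume "s \<noteq> t \<and> dist s t < 1"
    then show "norm ((D s - D t) / (s - t)) \<le> C * \<bar>s - t\<bar>"
     using C[of s] by (simp add: dist_real_def abs_divide divide_le_eq power2_eq_square mult.assoc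
       flip: abs_mult)
   qed simp
   show "((\<lambda>s. C * \<bar>s - t\<bar>) \<longlongrightarrow> 0) (at t)"
    by (auto intro!: tendsto_eq_intros)
  qed
  then show ?thesis by (simp add: has_field_derivative_iff)
 qed
 have "D t = D 0" for t
  using DERIV_isconst_all[of D t 0] D0 by blast
 moreover have "\<pi> q = q" using q by (simp add: \<pi>_def closest_point_self)
 ultimately have "D t = 0" for t by (simp add: D_def \<phi>0)
 then have fixd: "\<pi> (\<phi> t) = \<phi> t" for t by (simp add: D_def)
 show ?thesis
 proof (rule that[of \<phi>])
  show "\<phi> 0 = q" by (rule \<phi>0)
  show "\<phi> t \<in> S" for t by (metis fixd \<pi>S)
  show "(\<phi> has_vector_derivative f (\<phi> t)) (at t)" for t using \<phi>[of t] by (simp add: fixd)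
 qed
qed

section \<open>Asymptotics of scalar functions\<close>

text \<open>Barbalat's lemma, with the integral of \<open>e\<close> controlled by the bounded function \<open>V\<close>.\<close>

lemma dissipation_tendsto_0:
 fixes V e :: "real => real"
 assumes V: "\<And>t. t \<ge> 0 ==> (V has_real_derivative - e t) (at t)"
  and e: "\<And>t. t \<ge> 0 ==> e t \<ge> 0" and V0: "\<And>t. t \<ge> 0 ==> V t \<ge> B"
  and lip: "\<And>s t. s \<ge> 0 ==> t \<ge> 0 ==> \<bar>e s - e t\<bar> \<le> C * \<bar>s - t\<bar>"
 shows "(e \<longlongrightarrow> 0) at_top"
proof -
 have C: "C \<ge> 0" using lip[of 0 1] by simp
 have dec: "V t \<le> V s" if "0 \<le> s" "s \<le> t" for s t
 proof (rule DERIV_nonpos_imp_nonincreasing[OF that(2)])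
  show "\<exists>y. (V has_real_derivative y) (at x) \<and> y \<le> 0" if "s \<le> x" for x
   using V[of x] e[of x] that \<open>0 \<le> s\<close> by (intro exI[of _ "- e x"]) auto
 qed
 define l where "l = Inf (V ` {0..})"
 have bb: "bdd_below (V ` {0..})" using V0 by (auto intro!: bdd_belowI)
 have l: "V t \<ge> l" if "t \<ge> 0" for t unfolding l_def using that bb by (intro cInf_lower) auto
 show ?thesis
 proof (rule order_tendstoI)
  fix a :: real assume "a < 0"
  then show "\<forall>\<^sub>F t in at_top. a < e t"
   using e by (intro eventually_mono[OF eventually_ge_at_top[of 0]]) force
 next
  fix a :: real assume a: "0 < a"
  \<comment> \<open>During a time \<open>h\<close> the Lipschitz condition lets \<open>e\<close>
    drop by at most \<open>a / 2\<close>. Reaching the value \<open>a\<close> would thus cost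
    \<open>V\<close> at least \<open>h * (a / 2)\<close>, more than remains above its infimum
    \<open>l\<close>; the added 1 covers \<open>C = 0\<close>.\<close>
  define h where "h = a / (2 * (C + 1))"
  have h: "h > 0" "C * h \<le> a / 2" using a C by (auto simp: h_def field_simps)
  have "\<exists>v\<in>V ` {0..}. v < l + h * (a / 2)"
   unfolding l_def using h a by (intro cInf_lessD) auto
  then obtain T where T: "T \<ge> 0" "V T < l + h * (a / 2)" by auto
  have "e t < a" if t: "t \<ge> T" for t
  proof (rule ccontr)
   assume "\<not> e t < a"
   then have ea: "e t \<ge> a" by simp
   have "\<exists>z. t < z \<and> z < t + h \<and> V (t + h) - V t = (t + h - t) * - e z"
    by (rule MVT2[OF _ V]) (use h t T in auto)
   then obtain z where z: "t < z" "z < t + h" "V (t + h) - V t = h * - e z" by auto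
   have "e t - e z \<le> C * \<bar>t - z\<bar>" using lip[of t z] z t T by auto
   also have "\<dots> \<le> C * h" using z C by (intro mult_left_mono) auto
   finally have "e z \<ge> a / 2" using h ea by linarith
   then have "h * (a / 2) \<le> h * e z" using h by (intro mult_left_mono) auto
   moreover have "V (t + h) = V t - h * e z" using z(3) by simp
   ultimately have "V (t + h) \<le> V t - h * (a / 2)" by linarith
   moreover have "V t \<le> V T" using dec T t by auto
   ultimately show False using l[of "t + h"] T t h by auto
  qed
  then show "\<forall>\<^sub>F t in at_top. e t < a" using eventually_ge_at_top[of T] by (rule eventually_mono[rotated])
 qed
qed

text \<open>At the last time before \<open>b\<close> with \<open>f \<ge> 0\<close>, either
  \<open>f\<close> vanishes, and its positive derivative makes it positive right afterwards, or it
  is positive and has a later zero by the intermediate value theorem. Both contradict the choice of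
  that time.\<close>

lemma barrier_nonneg:
 fixes f :: "real => real"
 assumes f: "\<And>t. t \<ge> a ==> (f has_real_derivative f' t) (at t)"
  and pos: "\<And>t. t \<ge> a ==> f t = 0 ==> f' t > 0" and fa: "f a \<ge> 0" and b: "b \<ge> a"
 shows "f b \<ge> 0"
proof (rule ccontr)
 assume "\<not> f b \<ge> 0"
 then have fb: "f b < 0" by simp
 define A where "A = {t \<in> {a..b}. f t \<ge> 0}"
 have cont: "continuous_on {a..b} f"
  by (rule DERIV_continuous_on) (auto intro: has_field_derivative_at_within f)
 have "closed A"
  unfolding A_def using continuous_closed_preimage[OF cont, of "{0..}"]
  by (simp add: vimage_def Int_def)
 then have "compact ({a..b} \<inter> A)" by (rule compact_Int_closed[OF compact_Icc])
 moreover have "{a..b} \<inter> A = A" by (auto simp: A_def)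
 ultimately have "compact A" by simp
 moreover have "A \<noteq> {}" using fa b by (auto simp: A_def)
 ultimately obtain s where s: "s \<in> A" "\<And>t. t \<in> A ==> t \<le> s" by (meson compact_attains_sup)
 have sb: "a \<le> s" "s < b" "f s \<ge> 0" using s(1) fb by (auto simp: A_def order.order_iff_strict)
 have neg: "f t < 0" if "s < t" "t \<le> b" for t using s(2)[of t] that sb by (force simp: A_def)
 show False
 proof (cases "f s = 0")
  case True
  then obtain d where d: "d > 0" "\<And>h. h > 0 ==> h < d ==> f s < f (s + h)"
   using DERIV_pos_inc_right[OF f[OF sb(1)] pos[OF sb(1)]] by auto
  define h where "h = min (d / 2) (b - s)"
  have "h > 0" "h < d" "s + h \<le> b" using d sb by (auto simp: h_def)
  then show False using d(2)[of h] neg[of "s + h"] True by simp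
 next
  case False
  have "\<exists>x\<ge>s. x \<le> b \<and> f x = 0"
   by (rule IVT2'[of f b 0 s, simplified]) (use sb fb cont in \<open>auto intro: continuous_on_subset\<close>)
  then obtain x where "s \<le> x" "x \<le> b" "f x = 0" by auto
  then show False using neg[of x] False by (cases "x = s") auto
 qed
qed

text \<open>Once the perturbation \<open>r\<close> is smaller than \<open>h c\<close>, the level
  \<open>c\<close> can only be crossed upwards, hence at most once.\<close>

lemma barrier_eventually_one_sided:
 fixes x :: "real => real"
 assumes x: "\<And>t. t \<ge> T ==> (x has_real_derivative h (x t) + r t) (at t)"
  and r: "(r \<longlongrightarrow> 0) at_top" and c: "h c > 0"
 shows "(\<forall>\<^sub>F t in at_top. x t \<ge> c) \<or> (\<forall>\<^sub>F t in at_top. x t \<le> c)"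
proof -
 have "\<forall>\<^sub>F t in at_top. r t > - h c" using r c by (intro order_tendstoD) auto
 then obtain T1 where T1: "\<And>t. t \<ge> T1 ==> r t > - h c" by (auto simp: eventually_at_top_linorder)
 define T2 where "T2 = max T T1"
 show ?thesis
 proof (cases "\<exists>t1\<ge>T2. x t1 \<ge> c")
  case True
  then obtain t1 where t1: "t1 \<ge> T2" "x t1 \<ge> c" by auto
  have "x t - c \<ge> 0" if "t \<ge> t1" for t
  proof (rule barrier_nonneg[where f = "\<lambda>t. x t - c" and f' = "\<lambda>t. h (x t) + r t"])
   show "((\<lambda>t. x t - c) has_real_derivative h (x s) + r s) (at s)" if "s \<ge> t1" for s
    using x[of s] that t1 by (auto intro!: derivative_eq_intros simp: T2_def)
   show "h (x s) + r s > 0" if "s \<ge> t1" "x s - c = 0" for s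
    using T1[of s] that t1 by (auto simp: T2_def)
  qed (use t1 that in auto)
  then have "\<forall>\<^sub>F t in at_top. x t \<ge> c" unfolding eventually_at_top_linorder by (intro exI[of _ t1]) simp
  then show ?thesis ..
 next
  case False
  then have "\<forall>\<^sub>F t in at_top. x t \<le> c"
   unfolding eventually_at_top_linorder by (intro exI[of _ T2]) (meson le_cases)
  then show ?thesis ..
 qed
qed

lemma no_bounded_drift:
 fixes x :: "real => real"
 assumes x: "\<And>t. t \<ge> T ==> (x has_real_derivative d t) (at t)"
  and bd: "\<And>t. t \<ge> T ==> x t \<le> b" and d: "\<And>t. t \<ge> T ==> d t \<ge> k" and k: "k > 0"
 shows False
proof -
 define s where "s = T + (b - x T + 1) / k"
 have s: "T < s" using bd[of T] k by (auto simp: s_def)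
 have "\<exists>z. T < z \<and> z < s \<and> x s - x T = (s - T) * d z"
  by (rule MVT2[OF s x])
 then obtain z where z: "T < z" "x s - x T = (s - T) * d z" by auto
 have "(s - T) * k \<le> (s - T) * d z" using d[of z] z s by (intro mult_left_mono) auto
 then have "x s - x T \<ge> b - x T + 1" using z k by (simp add: s_def)
 then show False using bd[of s] s by simp
qed

text \<open>A level that is not a zero of \<open>h\<close> is eventually crossed in one direction
  only, so it cannot lie strictly between the lower and the upper limit of \<open>x\<close>. Zeros
  being finite in number, such levels are dense and the two limits agree. At a common limit with
  \<open>h \<noteq> 0\<close> the solution would drift with a definite speed and leave
  \<open>[a, b]\<close>.\<close>

lemma scalar_asymptotically_autonomous:
 fixes x :: "real => real"
 assumes x: "\<And>t. t \<ge> T ==> (x has_real_derivative h (x t) + r t) (at t)"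
  and bd: "\<And>t. t \<ge> T ==> a \<le> x t \<and> x t \<le> b"
  and r: "(r \<longlongrightarrow> 0) at_top" and h: "continuous_on UNIV h"
  and Z: "finite Z" "\<And>c. a \<le> c ==> c \<le> b ==> h c = 0 ==> c \<in> Z"
 shows "\<exists>c\<in>Z. (x \<longlongrightarrow> c) at_top"
proof -
 have side: "(\<forall>\<^sub>F t in at_top. x t \<ge> c) \<or> (\<forall>\<^sub>F t in at_top. x t \<le> c)" if "h c \<noteq> 0" for c
 proof (cases "h c > 0")
  case True
  show ?thesis by (rule barrier_eventually_one_sided[OF x r True])
 next
  case False
  have "(\<forall>\<^sub>F t in at_top. - x t \<ge> - c) \<or> (\<forall>\<^sub>F t in at_top. - x t \<le> - c)"
  proof (rule barrier_eventually_one_sided[where h = "\<lambda>y. - h (- y)" and r = "\<lambda>t. - r t"])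
   show "((\<lambda>t. - x t) has_real_derivative - h (- (- x t)) + - r t) (at t)" if "t \<ge> T" for t
    using x[OF that] by (auto intro!: derivative_eq_intros)
   show "((\<lambda>t. - r t) \<longlongrightarrow> 0) at_top" using r by (auto intro: tendsto_eq_intros)
  qed (use False that in auto)
  then show ?thesis by auto
 qed
 \<comment> \<open>The eventual lower bounds of \<open>x\<close>; their supremum \<open>l\<close> is
   the lower limit.\<close>
 define A where "A = {c. \<forall>\<^sub>F t in at_top. x t \<ge> c}"
 have aA: "a \<in> A" unfolding A_def mem_Collect_eq eventually_at_top_linorder using bd by blast
 have Ab: "c \<le> b" if c: "c \<in> A" for c
 proof -
  obtain T1 where "\<And>t. t \<ge> T1 ==> x t \<ge> c"
   using c unfolding A_def mem_Collect_eq eventually_at_top_linorder by blast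
  from this[of "max T T1"] bd[of "max T T1"] show ?thesis by simp
 qed
 define l where "l = Sup A"
 have bA: "bdd_above A" by (rule bdd_aboveI[OF Ab])
 have lim: "(x \<longlongrightarrow> l) at_top"
 proof (rule order_tendstoI)
  fix c assume "c < l"
  then obtain c' where "c' \<in> A" "c < c'" unfolding l_def using less_cSup_iff[of A c] aA bA by auto
  then show "\<forall>\<^sub>F t in at_top. c < x t" unfolding A_def by (auto elim: eventually_mono)
 next
  fix c assume c: "l < c"
  have "infinite {l<..<c}" using c by (rule infinite_Ioo)
  then have "infinite ({l<..<c} - Z)" using Z(1) by simp
  then obtain c' where c': "l < c'" "c' < c" "c' \<notin> Z" by (metis Diff_iff finite.emptyI greaterThanLessThan_iff ex_in_conv)
  show "\<forall>\<^sub>F t in at_top. x t < c"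
  proof (cases "c' \<le> b")
   case True
   have "a \<le> c'" using cSup_upper[OF aA bA] c' by (simp add: l_def)
   then have "h c' \<noteq> 0" using Z(2) True c' by blast
   moreover have "c' \<notin> A" using cSup_upper[OF _ bA, of c'] c' by (force simp: l_def)
   ultimately have "\<forall>\<^sub>F t in at_top. x t \<le> c'" using side[of c'] by (auto simp: A_def)
   then show ?thesis by (rule eventually_mono) (use c' in auto)
  next
   case False
   show ?thesis using eventually_ge_at_top[of T]
    by (rule eventually_mono) (use bd False c' in force)
  qed
 qed
 have "a \<le> l" unfolding l_def by (rule cSup_upper[OF aA bA])
 moreover have "l \<le> b" unfolding l_def using Ab aA by (intro cSup_least) auto
 moreover have "h l = 0"
 proof (rule ccontr)
  assume hl: "h l \<noteq> 0"
  have "isCont h l" using h by (simp add: continuous_on_eq_continuous_at)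
  then have "((\<lambda>t. h (x t) + r t) \<longlongrightarrow> h l + 0) at_top"
   by (intro tendsto_add r isCont_tendsto_compose[OF _ lim])
  then have hr: "((\<lambda>t. h (x t) + r t) \<longlongrightarrow> h l) at_top" by simp
  show False
  proof (cases "h l > 0")
   case True
   then have "\<forall>\<^sub>F t in at_top. h (x t) + r t > h l / 2" using hr by (intro order_tendstoD) auto
   then obtain T1 where T1: "\<And>t. t \<ge> T1 ==> h (x t) + r t > h l / 2" by (auto simp: eventually_at_top_linorder)
   show False
    by (rule no_bounded_drift[of "max T T1" x "\<lambda>t. h (x t) + r t" b "h l / 2"])
     (use x bd T1 True in \<open>auto simp: less_imp_le\<close>)
  next
   case False
   then have "\<forall>\<^sub>F t in at_top. h (x t) + r t < h l / 2" using hr hl by (intro order_tendstoD) auto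
   then obtain T1 where T1: "\<And>t. t \<ge> T1 ==> h (x t) + r t < h l / 2" by (auto simp: eventually_at_top_linorder)
   show False
   proof (rule no_bounded_drift[of "max T T1" "\<lambda>t. - x t" "\<lambda>t. - (h (x t) + r t)" "- a" "- (h l / 2)"])
    show "((\<lambda>t. - x t) has_real_derivative - (h (x t) + r t)) (at t)" if "t \<ge> max T T1" for t
     using x[of t] that by (auto intro!: derivative_eq_intros)
    show "- (h l / 2) \<le> - (h (x t) + r t)" if "t \<ge> max T T1" for t using T1[of t] that by simp
   qed (use bd False hl in auto)
  qed
 qed
 ultimately show ?thesis using Z(2) lim by blast
qed

text \<open>A zero at time \<open>s\<close> would spread to time 0: the square of \<open>f\<close>
  satisfies a linear equation with bounded coefficient, so it becomes monotone after multiplication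
  by an exponential. Without zeros the sign cannot change. This gives the invariance of the sides
  and of the interior of the simplex.\<close>

lemma deriv_mult_self_sign:
 fixes f :: "real => real"
 assumes f: "\<And>t. (f has_real_derivative f t * g t) (at t)" and g: "\<And>t. \<bar>g t\<bar> \<le> C" and pos: "f 0 > 0"
 shows "f t > 0"
proof -
 have nz: "f s \<noteq> 0" for s
 proof
  assume fs: "f s = 0"
  have C: "C \<ge> 0" using g[of 0] by linarith
  define D where "D t = (f (t + s))\<^sup>2" for t
  have D: "(D has_real_derivative 2 * D t * g (t + s)) (at t)" for t
  proof -
   have "((\<lambda>t. f (t + s)) has_real_derivative f (t + s) * g (t + s)) (at t)"
    using f[of "t + s"] by (simp add: DERIV_shift)
   then show ?thesis unfolding D_def by (auto intro!: derivative_eq_intros simp: power2_eq_square)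
  qed
  show False
  proof (cases "s \<ge> 0")
   case True
   have "D 0 * exp (2 * C * 0) \<ge> D (- s) * exp (2 * C * - s)"
   proof (rule DERIV_nonneg_imp_nondecreasing[of "- s" 0 "\<lambda>t. D t * exp (2 * C * t)"])
    fix x
    have "((\<lambda>t. D t * exp (2 * C * t)) has_real_derivative 2 * D x * exp (2 * C * x) * (g (x + s) + C)) (at x)"
     by (auto intro!: derivative_eq_intros D simp: algebra_simps)
    moreover have "2 * D x * exp (2 * C * x) * (g (x + s) + C) \<ge> 0"
     using g[of "x + s"] by (intro mult_nonneg_nonneg) (auto simp: D_def)
    ultimately show "\<exists>y. ((\<lambda>t. D t * exp (2 * C * t)) has_real_derivative y) (at x) \<and> y \<ge> 0" by blast
   qed (use True in auto)
   then show False using fs pos by (simp add: D_def mult_le_0_iff zero_less_mult_iff not_less[symmetric])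
  next
   case False
   have "D (- s) * exp (- 2 * C * - s) \<le> D 0 * exp (- 2 * C * 0)"
   proof (rule DERIV_nonpos_imp_nonincreasing[of 0 "- s" "\<lambda>t. D t * exp (- 2 * C * t)"])
    fix x
    have "((\<lambda>t. D t * exp (- 2 * C * t)) has_real_derivative 2 * D x * exp (- 2 * C * x) * (g (x + s) - C)) (at x)"
     by (auto intro!: derivative_eq_intros D simp: algebra_simps)
    moreover have "2 * D x * exp (- 2 * C * x) * (g (x + s) - C) \<le> 0"
     using g[of "x + s"] by (intro mult_nonneg_nonpos) (auto simp: D_def)
    ultimately show "\<exists>y. ((\<lambda>t. D t * exp (- 2 * C * t)) has_real_derivative y) (at x) \<and> y \<le> 0" by blast
   qed (use False in auto)
   then show False using fs pos by (simp add: D_def mult_le_0_iff zero_less_mult_iff not_less[symmetric])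
  qed
 qed
 have cont: "continuous_on A f" for A
  by (rule DERIV_continuous_on) (auto intro: has_field_derivative_at_within f)
 show ?thesis
 proof (rule ccontr)
  assume "\<not> f t > 0"
  then have "f t < 0" using nz[of t] by simp
  then have "\<exists>x. f x = 0"
   using IVT'[of f t 0 0] IVT2'[of f t 0 0] pos cont by (cases "t \<le> 0") (auto simp: less_imp_le)
  then show False using nz by blast
 qed
qed

section \<open>Orbits in the interior of the simplex\<close>

text \<open>With \<open>a = x\<close>, \<open>b = y\<close> and \<open>c = 1 - x - y\<close>, the polynomials for which
 \<open>a' = a (1 - 2 a) gf m p n b a c\<close>, \<open>b' = b (1 - 2 b) gf m n p a b c\<close> and
 \<open>c' = c (1 - 2 c) gf n m p a c b\<close>. In this form the flow is symmetric under simultaneous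
 permutations of \<open>(a, b, c)\<close> and \<open>(p, n, m)\<close>.\<close>

definition gf :: "real => real => real => real => real => real => real" where
 "gf m n p a b c = m * c * (b + c - 3 * a) + n * ((a - c)\<^sup>2 + b * (a + c)) + p * a * (a + b - 3 * c)"

lemma power2_tendsto_0_iff: "((\<lambda>t. (f t)\<^sup>2) \<longlongrightarrow> 0) F \<longleftrightarrow> (f \<longlongrightarrow> 0) F" for f :: "'a => real"
proof
 assume "((\<lambda>t. (f t)\<^sup>2) \<longlongrightarrow> 0) F"
 then have "((\<lambda>t. sqrt ((f t)\<^sup>2)) \<longlongrightarrow> sqrt 0) F" by (rule tendsto_real_sqrt)
 then show "(f \<longlongrightarrow> 0) F" by (simp add: tendsto_rabs_zero_iff)
next
 assume "(f \<longlongrightarrow> 0) F"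
 then show "((\<lambda>t. (f t)\<^sup>2) \<longlongrightarrow> 0) F" using tendsto_power[of f 0 F 2] by simp
qed

definition bddf :: "(real => real) => bool" where
 "bddf f \<longleftrightarrow> (\<exists>C. \<forall>t\<ge>0. \<bar>f t\<bar> \<le> C)"

text \<open>With these rules the boundedness of any polynomial in the coordinates, and so the
  Lipschitz condition in Barbalat's lemma, is read off from its shape.\<close>

lemma bddf_intros:
 "bddf (\<lambda>_. k)"
 "bddf f ==> bddf g ==> bddf (\<lambda>t. f t + g t)"
 "bddf f ==> bddf g ==> bddf (\<lambda>t. f t - g t)"
 "bddf f ==> bddf (\<lambda>t. - f t)"
 "bddf f ==> bddf g ==> bddf (\<lambda>t. f t * g t)"
 "bddf f ==> bddf (\<lambda>t. f t ^ i)"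
proof -
 show mult: "bddf (\<lambda>t. f t * g t)" if "bddf f" "bddf g" for f g
 proof -
  obtain C D where "\<And>t. t \<ge> 0 ==> \<bar>f t\<bar> \<le> C" "\<And>t. t \<ge> 0 ==> \<bar>g t\<bar> \<le> D"
   using \<open>bddf f\<close> \<open>bddf g\<close> unfolding bddf_def by blast
  then have "\<bar>f t * g t\<bar> \<le> \<bar>C\<bar> * \<bar>D\<bar>" if "t \<ge> 0" for t
   unfolding abs_mult using that by (intro mult_mono) fastforce+
  then show ?thesis unfolding bddf_def by blast
 qed
 show const: "bddf (\<lambda>_. k)" for k unfolding bddf_def by blast
 show add: "bddf (\<lambda>t. f t + g t)" if "bddf f" "bddf g" for f g
  using that unfolding bddf_def by (meson abs_triangle_ineq add_mono order_trans)
 show "bddf (\<lambda>t. - f t)" if "bddf f" using that unfolding bddf_def by simp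
 then show "bddf (\<lambda>t. f t - g t)" if "bddf f" "bddf g"
  using that unfolding bddf_def by (meson abs_triangle_ineq4 add_mono order_trans)
 show "bddf (\<lambda>t. f t ^ i)" if "bddf f"
  by (induction i) (auto intro: const mult that)
qed

lemma bddf_imp_lipschitz:
 assumes f: "\<And>t. t \<ge> 0 ==> (f has_real_derivative f' t) (at t)" and "bddf f'"
 obtains C where "\<And>s t. s \<ge> 0 ==> t \<ge> 0 ==> \<bar>f s - f t\<bar> \<le> C * \<bar>s - t\<bar>"
proof -
 obtain C where C: "\<And>t. t \<ge> 0 ==> \<bar>f' t\<bar> \<le> C" using \<open>bddf f'\<close> unfolding bddf_def by blast
 have "norm (f s - f t) \<le> C * norm (s - t)" if "s \<ge> 0" "t \<ge> 0" for s t
  by (rule field_differentiable_bound[of "{0..}" f f'])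
   (use C that f in \<open>auto intro: has_field_derivative_at_within\<close>)
 then show ?thesis using that by auto
qed

text \<open>Stated for three functions rather than for orbits in the plane, so that a permutation of
  the coordinates is a reinterpretation of the locale. The parameters \<open>p\<close>,
  \<open>n\<close>, \<open>m\<close> belong to \<open>a\<close>, \<open>b\<close>, \<open>c\<close>
  and are permuted along; \<open>swap_bc\<close> and \<open>swap_ab\<close> generate all
  permutations.\<close>

locale rflow =
 fixes m n p :: real and a b c :: "real => real"
 assumes mnp: "m > 0" "n > 0" "p > 0"
  and apos: "a t > 0" and bpos: "b t > 0" and cpos: "c t > 0"
  and sum1: "a t + b t + c t = 1"
  and da: "(a has_real_derivative a t * (1 - 2 * a t) * gf m p n (b t) (a t) (c t)) (at t)"
  and db: "(b has_real_derivative b t * (1 - 2 * b t) * gf m n p (a t) (b t) (c t)) (at t)"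
  and dc: "(c has_real_derivative c t * (1 - 2 * c t) * gf n m p (a t) (c t) (b t)) (at t)"
begin

abbreviation "ga t \<equiv> gf m p n (b t) (a t) (c t)"
abbreviation "gb t \<equiv> gf m n p (a t) (b t) (c t)"
abbreviation "gc t \<equiv> gf n m p (a t) (c t) (b t)"

lemma swap_bc: "rflow n m p a c b"
 using mnp apos bpos cpos sum1 da db dc
 by unfold_locales (auto simp: gf_def algebra_simps power2_eq_square)

lemma swap_ab: "rflow m p n b a c"
 using mnp apos bpos cpos sum1 da db dc
 by unfold_locales (auto simp: gf_def algebra_simps power2_eq_square)

lemma lt1: "a t < 1" "b t < 1" "c t < 1"
 using apos[of t] bpos[of t] cpos[of t] sum1[of t] by linarith+

lemma bddf_abc: "bddf a" "bddf b" "bddf c"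
 unfolding bddf_def using apos bpos cpos lt1 by (auto intro!: exI[of _ 1] simp: abs_le_iff less_imp_le
  intro: order_trans[of _ 0])

lemma gf_bound: obtains C where "\<And>t. \<bar>gb t\<bar> \<le> C"
proof -
 define F where "F = (\<lambda>(x, y, z). gf m n p x y z)"
 have "compact ({0..1::real} \<times> {0..1::real} \<times> {0..1::real})" by (intro compact_Times compact_Icc)
 moreover have "continuous_on ({0..1} \<times> {0..1} \<times> {0..1}) F"
  unfolding F_def gf_def case_prod_beta by (intro continuous_intros)
 ultimately have "bounded (F ` ({0..1} \<times> {0..1} \<times> {0..1}))"
  by (intro compact_imp_bounded compact_continuous_image)
 then obtain C where C: "\<And>w. w \<in> {0..1} \<times> {0..1} \<times> {0..1} ==> norm (F w) \<le> C"
  unfolding bounded_iff by blast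
 have "\<bar>gb t\<bar> \<le> C" for t
  using C[of "(a t, b t, c t)"] apos[of t] bpos[of t] cpos[of t] lt1[of t] by (simp add: F_def less_imp_le)
 then show ?thesis using that by blast
qed

text \<open>The factor \<open>1 - 2 * b\<close> of the field turns its own evolution into a linear
  homogeneous equation, which makes the side \<open>b = 1/2\<close> invariant.\<close>

lemma u_deriv: "((\<lambda>t. 1 - 2 * b t) has_real_derivative
  (1 - 2 * b t) * (- 2 * b t * gb t)) (at t)"
 by (auto intro!: derivative_eq_intros db)

lemma gf_factor_bound: obtains C where "\<And>t. \<bar>- 2 * b t * gb t\<bar> \<le> C"
proof -
 obtain C where C: "\<And>t. \<bar>gb t\<bar> \<le> C" by (rule gf_bound) blast
 have "\<bar>- 2 * b t * gb t\<bar> \<le> 2 * C" for t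
 proof -
  have "\<bar>b t\<bar> * \<bar>gb t\<bar> \<le> 1 * C"
   using C[of t] bpos[of t] lt1(2)[of t] by (intro mult_mono) auto
  then show ?thesis by (simp add: abs_mult)
 qed
 then show ?thesis using that by blast
qed

lemma corner_invariant: assumes "b 0 > 1/2" shows "b t > 1/2"
proof -
 obtain C where C: "\<And>t. \<bar>- 2 * b t * gb t\<bar> \<le> C" by (rule gf_factor_bound) blast
 have "2 * b t - 1 > 0"
 proof (rule deriv_mult_self_sign[where C = C and f = "\<lambda>t. 2 * b t - 1"])
  show "((\<lambda>t. 2 * b t - 1) has_real_derivative (2 * b t - 1) * (- 2 * b t * gb t)) (at t)" for t
   using DERIV_minus[OF u_deriv[of t]] by (simp add: algebra_simps)
 qed (use C assms in auto)
 then show ?thesis by simp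
qed

lemma side_invariant: assumes "b 0 < 1/2" shows "b t < 1/2"
proof -
 obtain C where C: "\<And>t. \<bar>- 2 * b t * gb t\<bar> \<le> C" by (rule gf_factor_bound) blast
 have "1 - 2 * b t > 0" by (rule deriv_mult_self_sign[OF u_deriv C]) (use assms in auto)
 then show ?thesis by simp
qed

text \<open>If the orbit tends to the side \<open>b = 1/2\<close>, its coordinate \<open>a\<close> follows the flow on that side up
 to an error that tends to \<open>0\<close>.\<close>

lemma edge_limit:
 assumes "(b \<longlongrightarrow> 1/2) at_top"
 shows "\<exists>l \<in> {0, 1/2, (m + n) / (2 * (m + 2 * n + p))}. (a \<longlongrightarrow> l) at_top"
proof -
 \<comment> \<open>The field for \<open>a\<close> restricted to the side, where
   \<open>c = 1/2 - a\<close>. The last factor vanishes at the first coordinate of \<open>T\<close>;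
   the remainder \<open>r\<close> contains the factor \<open>v\<close>.\<close>
 define h where "h x = x * (1 - 2 * x) * ((m + 2 * n + p) * x - (m + n) / 2)" for x
 define v where "v t = b t - 1/2" for t
 define r where "r t = a t * (1 - 2 * a t) * (v t * (m * (4 * a t - 1 + 4 * v t) + n * (4 * a t + 1 + 4 * v t)
  + p * (4 * a t + 4 * v t)))" for t
 have D: "(a has_real_derivative h (a t) + r t) (at t)" for t
 proof -
  have c: "c t = 1 - a t - b t" using sum1[of t] by linarith
  have "a t * (1 - 2 * a t) * ga t = h (a t) + r t"
   unfolding h_def r_def v_def gf_def c by (simp add: field_simps power2_eq_square)
  then show ?thesis using da[of t] by simp
 qed
 have v0: "(v \<longlongrightarrow> 0) at_top"
  unfolding v_def using tendsto_diff[OF assms tendsto_const[of "1/2"]] by simp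
 obtain C where C: "\<And>t. t \<ge> 0 ==> \<bar>a t * (1 - 2 * a t) * (m * (4 * a t - 1 + 4 * v t) + n * (4 * a t + 1 + 4 * v t)
  + p * (4 * a t + 4 * v t))\<bar> \<le> C"
 proof -
  have "bddf (\<lambda>t. a t * (1 - 2 * a t) * (m * (4 * a t - 1 + 4 * v t) + n * (4 * a t + 1 + 4 * v t)
   + p * (4 * a t + 4 * v t)))"
   unfolding v_def by (intro bddf_intros bddf_abc)
  then show ?thesis using that unfolding bddf_def by blast
 qed
 have "(r \<longlongrightarrow> 0) at_top"
 proof (rule Lim_null_comparison)
  show "((\<lambda>t. \<bar>v t\<bar> * C) \<longlongrightarrow> 0) at_top" using tendsto_mult[OF tendsto_rabs[OF v0] tendsto_const[of C]] by simp
  show "\<forall>\<^sub>F t in at_top. norm (r t) \<le> \<bar>v t\<bar> * C"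
   using eventually_ge_at_top[of 0]
  proof (rule eventually_mono)
   fix t :: real assume "t \<ge> 0"
   from mult_left_mono[OF C[OF this], of "\<bar>v t\<bar>"] show "norm (r t) \<le> \<bar>v t\<bar> * C"
    unfolding r_def by (simp add: abs_mult mult_ac)
  qed
 qed
 then show ?thesis
 proof (rule scalar_asymptotically_autonomous[where T = 0 and a = 0 and b = 1 and h = h, OF D, rotated])
  show "continuous_on UNIV h" unfolding h_def by (intro continuous_intros)
  show "0 \<le> a t \<and> a t \<le> 1" for t using apos[of t] lt1[of t] by simp
  show "x \<in> {0, 1/2, (m + n) / (2 * (m + 2 * n + p))}" if "h x = 0" for x
  proof -
   have "x = 0 \<or> 1 - 2 * x = 0 \<or> (m + 2 * n + p) * x - (m + n) / 2 = 0"
    using that unfolding h_def mult_eq_0_iff by blast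
   moreover have "m + 2 * n + p > 0" using mnp by simp
   then have "x = (m + n) / (2 * (m + 2 * n + p))" if "(m + 2 * n + p) * x - (m + n) / 2 = 0"
    using that by (simp add: field_simps)
   ultimately show ?thesis by auto
  qed
 qed auto
qed

text \<open>Since \<open>2 * b - 1 = b - a - c\<close> on the simplex, this is homogeneous of degree
  0, a function of the metric up to scale. It vanishes on the side \<open>b = 1/2\<close> and tends
  to infinity at the vertex \<open>b = 1\<close>.\<close>

definition w :: "real => real" where "w t = (2 * b t - 1) * b t / (a t * c t)"

text \<open>The logarithmic rate of decrease of \<open>w\<close>, arranged so that every summand is
  nonnegative in the corner, where \<open>b\<close> exceeds both \<open>a\<close> and
  \<open>c\<close>.\<close>

definition e :: "real => real" where
 "e t = m * (b t - a t) * (2 * b t - 1) + p * (b t - c t) * (2 * b t - 1)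
  + n * (2 * (2 * b t - 1)\<^sup>2 + 3 * (2 * b t - 1) * (a t + c t) + 4 * a t * c t)"

lemma w_deriv: "(w has_real_derivative - w t * e t) (at t)"
proof -
 define A B G where "A = (1 - 2 * a t) * ga t"
  and "B = (1 - 2 * b t) * gb t"
  and "G = (1 - 2 * c t) * gc t"
 have da': "(a has_real_derivative a t * A) (at t)" using da[of t] by (simp add: A_def mult_ac)
 have db': "(b has_real_derivative b t * B) (at t)" using db[of t] by (simp add: B_def mult_ac)
 have dc': "(c has_real_derivative c t * G) (at t)" using dc[of t] by (simp add: G_def mult_ac)
 have ne: "a t \<noteq> 0" "c t \<noteq> 0" using apos[of t] cpos[of t] by auto
 have d: "(w has_real_derivative ((2 * (b t * B) * b t + (2 * b t - 1) * (b t * B)) * (a t * c t)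
   - (2 * b t - 1) * b t * (a t * A * c t + a t * (c t * G))) / (a t * c t)\<^sup>2) (at t)"
  unfolding w_def using ne
  by (auto intro!: derivative_eq_intros da' db' dc' simp: power2_eq_square algebra_simps)
 have "((2 * (b t * B) * b t + (2 * b t - 1) * (b t * B)) * (a t * c t)
   - (2 * b t - 1) * b t * (a t * A * c t + a t * (c t * G))) / (a t * c t)\<^sup>2
   = b t / (a t * c t) * (2 * b t * B + (2 * b t - 1) * (B - A - G))"
  using ne by (simp add: field_simps power2_eq_square)
 also have "2 * b t * B + (2 * b t - 1) * (B - A - G) = - (2 * b t - 1) * e t"
 proof -
  have c: "c t = 1 - a t - b t" using sum1[of t] by linarith
  show ?thesis unfolding A_def B_def G_def e_def gf_def c by (simp add: field_simps power2_eq_square)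
 qed
 also have "b t / (a t * c t) * (- (2 * b t - 1) * e t) = - w t * e t" using ne by (simp add: w_def field_simps)
 finally show ?thesis using d by (simp only:)
qed

section \<open>Orbits in the corner \<open>b > 1/2\<close>: the side in forward time, the vertex in
  backward time\<close>

context
 assumes corner: "b 0 > 1/2"
begin

lemma u_pos: "2 * b t - 1 > 0"
 using corner_invariant[OF corner, of t] by simp

lemma w_pos: "w t > 0"
 using u_pos[of t] apos[of t] bpos[of t] cpos[of t] by (simp add: w_def)

lemma e_ge: "e t \<ge> 2 * n * (2 * b t - 1)\<^sup>2"
proof -
 have "b t - a t > 0" "b t - c t > 0" using u_pos[of t] sum1[of t] apos[of t] cpos[of t] by linarith+
 then have "m * (b t - a t) * (2 * b t - 1) \<ge> 0" "p * (b t - c t) * (2 * b t - 1) \<ge> 0"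
  using mnp u_pos[of t] by (simp_all add: less_imp_le)
 moreover have "n * (2 * (2 * b t - 1)\<^sup>2) \<le> n * (2 * (2 * b t - 1)\<^sup>2 + 3 * (2 * b t - 1) * (a t + c t) + 4 * a t * c t)"
  using mnp u_pos[of t] apos[of t] cpos[of t] by (intro mult_left_mono) auto
 ultimately show ?thesis unfolding e_def by linarith
qed

lemma e_pos: "e t > 0"
proof -
 have "2 * n * (2 * b t - 1)\<^sup>2 > 0" using mnp u_pos[of t] by simp
 then show ?thesis using e_ge[of t] by linarith
qed

lemma w_decreasing: assumes "s \<le> t" shows "w t \<le> w s"
proof (rule DERIV_nonpos_imp_nonincreasing[OF assms])
 show "\<exists>y. (w has_real_derivative y) (at x) \<and> y \<le> 0" for x
  using w_deriv[of x] w_pos[of x] e_pos[of x] by (intro exI[of _ "- w x * e x"]) simp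
qed

text \<open>Barbalat's lemma shows that the rate \<open>w * e\<close> at which \<open>w\<close>
  decreases tends to 0. It dominates \<open>n * (2 * b - 1) ^ 3\<close>, because \<open>w\<close> is
  at least \<open>(2 * b - 1) / 2\<close> and \<open>e\<close> at least \<open>2 * n\<close> times
  the square of \<open>2 * b - 1\<close>.\<close>

lemma corner_to_edge: "(b \<longlongrightarrow> 1/2) at_top"
proof -
 \<comment> \<open>The derivative of \<open>e\<close> is written out only to exhibit it as a
   polynomial in bounded functions.\<close>
 define e' where "e' t = (m * (- a t * (1 - 2 * a t) * ga t + b t * (1 - 2 * b t) * gb t) * (2 * b t - 1)
   + m * (b t - a t) * (2 * (b t * (1 - 2 * b t) * gb t))
   + p * (- c t * (1 - 2 * c t) * gc t + b t * (1 - 2 * b t) * gb t) * (2 * b t - 1)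
   + p * (b t - c t) * (2 * (b t * (1 - 2 * b t) * gb t))
   + n * (4 * (2 * b t - 1) * (2 * (b t * (1 - 2 * b t) * gb t))
    + 3 * (2 * (b t * (1 - 2 * b t) * gb t)) * (a t + c t)
    + 3 * (2 * b t - 1) * (a t * (1 - 2 * a t) * ga t + c t * (1 - 2 * c t) * gc t)
    + 4 * (a t * (1 - 2 * a t) * ga t) * c t + 4 * a t * (c t * (1 - 2 * c t) * gc t)))" for t
 have de: "(e has_real_derivative e' t) (at t)" for t
  unfolding e_def e'_def by (auto intro!: derivative_eq_intros da db dc simp: power2_eq_square algebra_simps)
 have be: "bddf e" unfolding e_def by (intro bddf_intros bddf_abc)
 have be': "bddf e'" unfolding e'_def gf_def by (intro bddf_intros bddf_abc)
 have bw: "bddf w" unfolding bddf_def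
  using w_decreasing[of 0] w_pos by (intro exI[of _ "w 0"]) (simp add: abs_of_pos)
 have bd: "bddf (\<lambda>t. - w t * e t * e t + w t * e' t)" by (intro bddf_intros bw be be')
 have dwe: "((\<lambda>t. w t * e t) has_real_derivative - w t * e t * e t + w t * e' t) (at t)" for t
  by (auto intro!: derivative_eq_intros w_deriv de)
 obtain C where C: "\<And>s t. s \<ge> 0 ==> t \<ge> 0 ==> \<bar>w s * e s - w t * e t\<bar> \<le> C * \<bar>s - t\<bar>"
  by (rule bddf_imp_lipschitz[of "\<lambda>t. w t * e t", OF dwe bd]) blast
 have we0: "((\<lambda>t. w t * e t) \<longlongrightarrow> 0) at_top"
 proof (rule dissipation_tendsto_0[where V = w and B = 0 and C = C])
  show "(w has_real_derivative - (w t * e t)) (at t)" for t using w_deriv[of t] by simp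
  show "w t * e t \<ge> 0" "w t \<ge> 0" for t using w_pos[of t] e_pos[of t] by simp_all
 qed (rule C)
 have cube: "(2 * b t - 1) ^ 3 \<le> w t * e t / n" for t
 proof -
  have "a t * c t \<le> 1 * 1" using apos[of t] cpos[of t] lt1[of t] by (intro mult_mono) auto
  then have "(2 * b t - 1) * b t * (a t * c t) \<le> (2 * b t - 1) * b t * 1"
   using u_pos[of t] bpos[of t] by (intro mult_left_mono) auto
  then have "(2 * b t - 1) * b t \<le> w t"
   unfolding w_def using apos[of t] cpos[of t] by (simp add: field_simps)
  moreover have "(2 * b t - 1) * (1/2) \<le> (2 * b t - 1) * b t"
   using u_pos[of t] by (intro mult_left_mono) auto
  ultimately have "(2 * b t - 1) / 2 \<le> w t" by simp
  then have "(2 * b t - 1) / 2 * (2 * n * (2 * b t - 1)\<^sup>2) \<le> w t * e t"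
   using e_ge[of t] w_pos[of t] mnp by (intro mult_mono) auto
  then show ?thesis using mnp by (simp add: field_simps power3_eq_cube power2_eq_square)
 qed
 have "((\<lambda>t. (2 * b t - 1) ^ 3) \<longlongrightarrow> 0) at_top"
 proof (rule tendsto_sandwich[of "\<lambda>_. 0" _ _ "\<lambda>t. w t * e t / n"])
  show "((\<lambda>t. w t * e t / n) \<longlongrightarrow> 0) at_top" using tendsto_divide[OF we0 tendsto_const[of n]] mnp by simp
  show "\<forall>\<^sub>F t in at_top. 0 \<le> (2 * b t - 1) ^ 3" using u_pos by (intro always_eventually allI) (simp add: less_imp_le)
 qed (use cube in auto)
 then have "((\<lambda>t. root 3 ((2 * b t - 1) ^ 3)) \<longlongrightarrow> root 3 0) at_top" by (rule tendsto_real_root)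
 moreover have "root 3 ((2 * b t - 1) ^ 3) = 2 * b t - 1" for t using u_pos[of t] by (simp add: real_root_power_cancel)
 ultimately have "((\<lambda>t. 2 * b t - 1) \<longlongrightarrow> 0) at_top" by simp
 then have "((\<lambda>t. ((2 * b t - 1) + 1) / 2) \<longlongrightarrow> (0 + 1) / 2) at_top" by (intro tendsto_intros) auto
 then show ?thesis by simp
qed

text \<open>Backwards in time \<open>b\<close> grows where \<open>gb > 0\<close>, but
  \<open>gb\<close> can be negative while \<open>a c\<close> is large. The function \<open>w\<close>
  helps, as \<open>a c = (2 b - 1) b / w\<close> and \<open>w\<close> grows backwards: close to the
  side \<open>a c\<close> is small, so \<open>b\<close> turns away from it, and
  \<open>2 b - 1\<close> stays above some \<open>\<mu> > 0\<close>. Then \<open>w\<close> grows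
  exponentially, \<open>a c\<close> becomes small for good, and \<open>1 - b\<close> decays
  exponentially.\<close>

lemma corner_backward: "(b \<longlongrightarrow> 1) at_bot"
proof -
 \<comment> \<open>With this value the negative part \<open>3 (m + p) a c\<close> of
   \<open>gb\<close> is at most \<open>n / 4 * (a + c)\<close>, half of the lower bound
   \<open>n / 2 * (a + c)\<close> for the positive part.\<close>
 define \<epsilon> where "\<epsilon> = n / (6 * (m + p))"
 have \<epsilon>: "\<epsilon> > 0" using mnp by (simp add: \<epsilon>_def)
 have gf_ge: "gb t \<ge> n / 4 * (1 - b t)" if ac: "a t * c t \<le> \<epsilon>\<^sup>2" for t
 proof -
  have mono: "0 \<le> (a t + c t)" using apos[of t] cpos[of t] by simp
  have "(a t * c t) * (a t * c t) \<le> \<epsilon>\<^sup>2 * ((a t + c t)\<^sup>2 / 4)"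
   using ac apos[of t] cpos[of t] sum_squares_bound[of "a t" "c t"]
   by (intro mult_mono) (auto simp: power2_eq_square algebra_simps)
  then have "(a t * c t)\<^sup>2 \<le> (\<epsilon> * (a t + c t) / 2)\<^sup>2" by (simp add: power2_eq_square algebra_simps)
  then have ac2: "a t * c t \<le> \<epsilon> * (a t + c t) / 2"
   by (rule power2_le_imp_le) (use \<epsilon> mono in auto)
  have "3 * (m + p) * (a t * c t) \<le> 3 * (m + p) * (\<epsilon> * (a t + c t) / 2)"
   using ac2 mnp by (intro mult_left_mono) auto
  also have "\<dots> = n / 4 * (a t + c t)" using mnp by (simp add: \<epsilon>_def field_simps)
  finally have 1: "3 * (m + p) * (a t * c t) \<le> n / 4 * (a t + c t)" .
  have "1/2 * (a t + c t) \<le> b t * (a t + c t)" using u_pos[of t] mono by (intro mult_right_mono) auto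
  then have "1/2 * (a t + c t) \<le> (a t - c t)\<^sup>2 + b t * (a t + c t)"
   using zero_le_power2[of "a t - c t"] by linarith
  then have "n * (1/2 * (a t + c t)) \<le> n * ((a t - c t)\<^sup>2 + b t * (a t + c t))"
   using mnp by (intro mult_left_mono) auto
  have "m * c t * (b t + c t) \<ge> 0" "p * a t * (a t + b t) \<ge> 0"
   using mnp apos[of t] bpos[of t] cpos[of t] by simp_all
  have "gb t \<ge> n / 4 * (a t + c t)"
  proof -
   have "gb t = n * ((a t - c t)\<^sup>2 + b t * (a t + c t))
     + m * c t * (b t + c t) + p * a t * (a t + b t) - 3 * (m + p) * (a t * c t)"
    unfolding gf_def by (simp add: algebra_simps)
   moreover have "n * (1/2 * (a t + c t)) = n / 4 * (a t + c t) + n / 4 * (a t + c t)"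
    by (simp add: field_simps)
   ultimately show ?thesis
    using 1 \<open>n * (1/2 * (a t + c t)) \<le> n * ((a t - c t)\<^sup>2 + b t * (a t + c t))\<close>
     \<open>m * c t * (b t + c t) \<ge> 0\<close> \<open>p * a t * (a t + b t) \<ge> 0\<close> by linarith
  qed
  moreover have "a t + c t = 1 - b t" using sum1[of t] by simp
  ultimately show ?thesis by simp
 qed
 have ac: "a t * c t = (2 * b t - 1) * b t / w t" for t
  using apos[of t] cpos[of t] u_pos[of t] bpos[of t] by (simp add: w_def)
 \<comment> \<open>On the level \<open>2 b - 1 = \<mu>\<close> the bound
   \<open>\<epsilon>\<^sup>2 * w 0\<close> and the backward growth of \<open>w\<close> give
   \<open>a c \<le> \<epsilon>\<^sup>2\<close>, so \<open>gb > 0\<close> there and the level is a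
   barrier.\<close>
 define \<mu> where "\<mu> = min (2 * b 0 - 1) (\<epsilon>\<^sup>2 * w 0)"
 have \<mu>: "\<mu> > 0" using u_pos[of 0] \<epsilon> w_pos[of 0] by (simp add: \<mu>_def)
 have u_ge: "2 * b t - 1 \<ge> \<mu>" if "t \<le> 0" for t
 proof -
  have "(\<lambda>s. 2 * b (- s) - 1 - \<mu>) (- t) \<ge> 0"
  proof (rule barrier_nonneg[where f = "\<lambda>s. 2 * b (- s) - 1 - \<mu>" and b = "- t" and a = 0 and f' = "\<lambda>s. - 2 * (b (- s) * (1 - 2 * b (- s)) * gf m n p (a (- s)) (b (- s)) (c (- s)))"])
   fix s :: real assume s: "s \<ge> 0"
   have "((\<lambda>s. b (- s)) has_real_derivative - (b (- s) * (1 - 2 * b (- s)) * gf m n p (a (- s)) (b (- s)) (c (- s)))) (at s)"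
    using DERIV_mirror[of b _ s] db[of "- s"] by simp
   then show "((\<lambda>s. 2 * b (- s) - 1 - \<mu>) has_real_derivative
     - 2 * (b (- s) * (1 - 2 * b (- s)) * gf m n p (a (- s)) (b (- s)) (c (- s)))) (at s)"
    by (auto intro!: derivative_eq_intros)
   assume z: "2 * b (- s) - 1 - \<mu> = 0"
   have "a (- s) * c (- s) \<le> (\<epsilon>\<^sup>2 * w 0) * 1 / w (- s)"
    unfolding ac using z u_pos[of "- s"] bpos[of "- s"] lt1[of "- s"] w_pos[of "- s"] w_pos[of 0]
    by (intro divide_right_mono mult_mono) (auto simp: \<mu>_def)
   also have "\<dots> \<le> \<epsilon>\<^sup>2 * w (- s) * 1 / w (- s)"
    using w_decreasing[of "- s" 0] s w_pos[of "- s"] by (intro divide_right_mono mult_right_mono mult_left_mono) auto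
   also have "\<dots> = \<epsilon>\<^sup>2" using w_pos[of "- s"] by simp
   finally have "gf m n p (a (- s)) (b (- s)) (c (- s)) \<ge> n / 4 * (1 - b (- s))" by (rule gf_ge)
   moreover have "n / 4 * (1 - b (- s)) > 0" using mnp lt1[of "- s"] by simp
   ultimately have "gf m n p (a (- s)) (b (- s)) (c (- s)) > 0" by linarith
   then have "b (- s) * (2 * b (- s) - 1) * gf m n p (a (- s)) (b (- s)) (c (- s)) > 0"
    using u_pos[of "- s"] bpos[of "- s"] by simp
   then show "- 2 * (b (- s) * (1 - 2 * b (- s)) * gf m n p (a (- s)) (b (- s)) (c (- s))) > 0"
    by (simp add: algebra_simps)
  qed (use that in \<open>auto simp: \<mu>_def\<close>)
  then show ?thesis by simp
 qed
 define \<kappa> where "\<kappa> = 2 * n * \<mu>\<^sup>2"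
 have \<kappa>: "\<kappa> > 0" using mnp \<mu> by (simp add: \<kappa>_def)
 have w_ge: "w t \<ge> w 0 * exp (- \<kappa> * t)" if "t \<le> 0" for t
 proof -
  have "w 0 * exp (\<kappa> * 0) \<le> w t * exp (\<kappa> * t)"
  proof (rule DERIV_nonpos_imp_nonincreasing[OF that, where f = "\<lambda>t. w t * exp (\<kappa> * t)"])
   fix x :: real assume "t \<le> x" "x \<le> 0"
   have "((\<lambda>t. w t * exp (\<kappa> * t)) has_real_derivative w x * exp (\<kappa> * x) * (\<kappa> - e x)) (at x)"
    by (auto intro!: derivative_eq_intros w_deriv simp: algebra_simps)
   moreover have "\<mu>\<^sup>2 \<le> (2 * b x - 1)\<^sup>2" using u_ge[OF \<open>x \<le> 0\<close>] \<mu> by (intro power_mono) auto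
   then have "\<kappa> \<le> 2 * n * (2 * b x - 1)\<^sup>2"
    using mnp unfolding \<kappa>_def by (intro mult_left_mono) auto
   then have "\<kappa> \<le> e x" using e_ge[of x] by linarith
   then have "w x * exp (\<kappa> * x) * (\<kappa> - e x) \<le> 0"
    using w_pos[of x] by (intro mult_nonneg_nonpos) auto
   ultimately show "\<exists>y. ((\<lambda>t. w t * exp (\<kappa> * t)) has_real_derivative y) (at x) \<and> y \<le> 0" by blast
  qed
  then show ?thesis by (simp add: exp_minus field_simps)
 qed
 obtain T where T: "T \<le> 0" "\<And>t. t \<le> T ==> a t * c t \<le> \<epsilon>\<^sup>2"
 proof -
  define T where "T = - (1 / (w 0 * \<epsilon>\<^sup>2)) / \<kappa>"
  have T: "exp (- \<kappa> * t) \<ge> 1 / (w 0 * \<epsilon>\<^sup>2)" if "t \<le> T" for t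
  proof -
   have "\<kappa> * t \<le> \<kappa> * T" using that \<kappa> by (intro mult_left_mono) auto
   also have "\<dots> = - (1 / (w 0 * \<epsilon>\<^sup>2))" using \<kappa> by (simp add: T_def)
   finally show ?thesis using exp_ge_add_one_self[of "- \<kappa> * t"] by simp
  qed
  have "a t * c t \<le> \<epsilon>\<^sup>2" if "t \<le> min T 0" for t
  proof -
   have "1 / \<epsilon>\<^sup>2 = w 0 * (1 / (w 0 * \<epsilon>\<^sup>2))" using w_pos[of 0] by simp
   also have "\<dots> \<le> w 0 * exp (- \<kappa> * t)" using T[of t] that w_pos[of 0] by (intro mult_left_mono) auto
   also have "\<dots> \<le> w t" using w_ge[of t] that by simp
   finally have wt: "1 \<le> w t * \<epsilon>\<^sup>2" using \<epsilon> by (simp add: field_simps)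
   have "a t * c t \<le> 1 * 1 / w t"
    unfolding ac using u_pos[of t] bpos[of t] lt1[of t] w_pos[of t]
    by (intro divide_right_mono mult_mono) auto
   also have "\<dots> \<le> \<epsilon>\<^sup>2" using wt w_pos[of t] by (simp add: field_simps)
   finally show ?thesis .
  qed
  then show ?thesis using that[of "min T 0"] by auto
 qed
 \<comment> \<open>The product of the lower bounds \<open>1/2\<close> for \<open>b\<close>,
   \<open>\<mu>\<close> for \<open>2 b - 1\<close>, and \<open>n / 4\<close> for the quotient of
   \<open>gb\<close> by \<open>1 - b\<close>.\<close>
 define k where "k = \<mu> * n / 8"
 have k: "k > 0" using \<mu> mnp by (simp add: k_def)
 have b_ge: "1 - b t \<le> exp (- k * T) * exp (k * t)" if "t \<le> T" for t
 proof -
  have "(1 - b t) * exp (- k * t) \<le> (1 - b T) * exp (- k * T)"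
  proof (rule DERIV_nonneg_imp_nondecreasing[OF that, where f = "\<lambda>t. (1 - b t) * exp (- k * t)"])
   fix x assume x: "t \<le> x" "x \<le> T"
   have "((\<lambda>t. (1 - b t) * exp (- k * t)) has_real_derivative
     (b x * (2 * b x - 1) * gf m n p (a x) (b x) (c x) - k * (1 - b x)) * exp (- k * x)) (at x)"
    by (auto intro!: derivative_eq_intros db simp: algebra_simps)
   moreover have "(1/2) * \<mu> * (n / 4 * (1 - b x)) \<le> b x * (2 * b x - 1) * gf m n p (a x) (b x) (c x)"
    using u_pos[of x] \<mu> mnp lt1[of x] u_ge[of x] T(1) x gf_ge[OF T(2)[OF x(2)]] by (intro mult_mono) auto
   then have "k * (1 - b x) \<le> b x * (2 * b x - 1) * gf m n p (a x) (b x) (c x)" by (simp add: k_def mult_ac)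
   then have "(b x * (2 * b x - 1) * gf m n p (a x) (b x) (c x) - k * (1 - b x)) * exp (- k * x) \<ge> 0"
    by (intro mult_nonneg_nonneg) auto
   ultimately show "\<exists>y. ((\<lambda>t. (1 - b t) * exp (- k * t)) has_real_derivative y) (at x) \<and> y \<ge> 0" by blast
  qed
  also have "\<dots> \<le> 1 * exp (- k * T)" using bpos[of T] by (intro mult_right_mono) auto
  finally show ?thesis by (simp add: exp_minus field_simps)
 qed
 have "((\<lambda>t. 1 - b t) \<longlongrightarrow> 0) at_bot"
 proof (rule tendsto_sandwich[of "\<lambda>_. 0" _ _ "\<lambda>t. exp (- k * T) * exp (k * t)"])
  show "\<forall>\<^sub>F t in at_bot. 0 \<le> 1 - b t" using lt1 by (intro always_eventually) (auto simp: less_imp_le)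
  show "\<forall>\<^sub>F t in at_bot. 1 - b t \<le> exp (- k * T) * exp (k * t)"
   using eventually_le_at_bot[of T] by (rule eventually_mono) (rule b_ge)
  have "((\<lambda>t. exp (k * t)) \<longlongrightarrow> 0) at_bot"
   using k by (intro filterlim_compose[OF exp_at_bot] filterlim_tendsto_pos_mult_at_bot[OF tendsto_const])
    (auto simp: filterlim_ident)
  then show "((\<lambda>t. exp (- k * T) * exp (k * t)) \<longlongrightarrow> 0) at_bot"
   using tendsto_mult_right_zero by blast
 qed auto
 then have "((\<lambda>t. 1 - (1 - b t)) \<longlongrightarrow> 1 - 0) at_bot" by (intro tendsto_intros)
 then show ?thesis by simp
qed

end

text \<open>Near \<open>K\<close> the functions \<open>1 - 2 b\<close> and \<open>1 - 2 c\<close>, whose zero sets are the two invariant sides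
 through \<open>K\<close>, both decay exponentially.\<close>

lemma vertex_attracts:
 assumes k: "k > 0"
  and rate: "\<And>x y z. x + y + z = 1 ==> (1 - 2 * y)\<^sup>2 + (1 - 2 * z)\<^sup>2 < \<delta> ==>
   2 * y * gf m n p x y z \<ge> k \<and> 2 * z * gf n m p x z y \<ge> k"
  and start: "(1 - 2 * b T)\<^sup>2 + (1 - 2 * c T)\<^sup>2 < \<delta>"
 shows "(b \<longlongrightarrow> 1/2) at_top \<and> (c \<longlongrightarrow> 1/2) at_top"
proof -
 define E where "E t = (1 - 2 * b t)\<^sup>2 + (1 - 2 * c t)\<^sup>2" for t
 define E' where "E' t = - 2 * ((1 - 2 * b t)\<^sup>2 * (2 * b t * gb t)
  + (1 - 2 * c t)\<^sup>2 * (2 * c t * gc t))" for t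
 have dE: "(E has_real_derivative E' t) (at t)" for t
  unfolding E_def E'_def by (auto intro!: derivative_eq_intros db dc simp: power2_eq_square algebra_simps)
 have E'_le: "E' t \<le> - 2 * k * E t" if "E t < \<delta>" for t
 proof -
  have "k \<le> 2 * b t * gb t" "k \<le> 2 * c t * gc t"
   using rate[OF sum1[of t]] that by (auto simp: E_def)
  then have "(1 - 2 * b t)\<^sup>2 * k \<le> (1 - 2 * b t)\<^sup>2 * (2 * b t * gb t)"
   "(1 - 2 * c t)\<^sup>2 * k \<le> (1 - 2 * c t)\<^sup>2 * (2 * c t * gc t)"
   by (intro mult_left_mono; simp)+
  then show ?thesis unfolding E'_def E_def by (simp add: algebra_simps)
 qed
 have E0: "E t \<ge> 0" for t by (simp add: E_def)
 \<comment> \<open>A level strictly above the initial value and strictly below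
   \<open>\<delta>\<close>: on it the rate bound is available, and being positive it gives the
   strict inequality of the barrier argument.\<close>
 define \<delta>' where "\<delta>' = (E T + \<delta>) / 2"
 have \<delta>': "E T < \<delta>'" "\<delta>' < \<delta>" "0 < \<delta>'" using start[folded E_def] E0[of T] by (auto simp: \<delta>'_def)
 have stay: "E t < \<delta>" if "t \<ge> T" for t
 proof -
  have "(\<lambda>t. \<delta>' - E t) t \<ge> 0"
  proof (rule barrier_nonneg[where f = "\<lambda>t. \<delta>' - E t" and b = t and a = T and f' = "\<lambda>t. - E' t"])
   show "((\<lambda>t. \<delta>' - E t) has_real_derivative - E' s) (at s)" for s
    by (auto intro!: derivative_eq_intros dE)
   show "- E' s > 0" if "\<delta>' - E s = 0" for s
   proof -
    have "E' s \<le> - 2 * k * \<delta>'" using E'_le[of s] that \<delta>' by simp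
    moreover have "2 * k * \<delta>' > 0" using k \<delta>' by simp
    ultimately show ?thesis by linarith
   qed
  qed (use \<delta>' that in auto)
  then show ?thesis using \<delta>' by simp
 qed
 have dec: "E t \<le> E T * exp (2 * k * T) * exp (- 2 * k * t)" if "t \<ge> T" for t
 proof -
  have "E t * exp (2 * k * t) \<le> E T * exp (2 * k * T)"
  proof (rule DERIV_nonpos_imp_nonincreasing[OF that, where f = "\<lambda>t. E t * exp (2 * k * t)"])
   fix x assume "T \<le> x"
   have "((\<lambda>t. E t * exp (2 * k * t)) has_real_derivative (E' x + 2 * k * E x) * exp (2 * k * x)) (at x)"
    by (auto intro!: derivative_eq_intros dE simp: algebra_simps)
   moreover have "(E' x + 2 * k * E x) * exp (2 * k * x) \<le> 0"
    using E'_le[OF stay[OF \<open>T \<le> x\<close>]] by (intro mult_nonpos_nonneg) auto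
   ultimately show "\<exists>y. ((\<lambda>t. E t * exp (2 * k * t)) has_real_derivative y) (at x) \<and> y \<le> 0" by blast
  qed
  then show ?thesis by (simp add: exp_minus field_simps)
 qed
 have Elim: "(E \<longlongrightarrow> 0) at_top"
 proof (rule tendsto_sandwich[of "\<lambda>_. 0" _ _ "\<lambda>t. E T * exp (2 * k * T) * exp (- 2 * k * t)"])
  show "\<forall>\<^sub>F t in at_top. E t \<le> E T * exp (2 * k * T) * exp (- 2 * k * t)"
   using eventually_ge_at_top[of T] by (rule eventually_mono) (rule dec)
  have "((\<lambda>t. exp (- 2 * k * t)) \<longlongrightarrow> 0) at_top"
   using k by (intro filterlim_compose[OF exp_at_bot] filterlim_tendsto_neg_mult_at_bot[OF tendsto_const])
    (auto simp: filterlim_ident)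
  then show "((\<lambda>t. E T * exp (2 * k * T) * exp (- 2 * k * t)) \<longlongrightarrow> 0) at_top"
   using tendsto_mult_right_zero by blast
 qed (use E0 in auto)
 have lim: "(f \<longlongrightarrow> 1/2) at_top" if "\<And>t. (1 - 2 * f t)\<^sup>2 \<le> E t" for f
 proof -
  have "((\<lambda>t. (1 - 2 * f t)\<^sup>2) \<longlongrightarrow> 0) at_top"
   by (rule tendsto_sandwich[OF _ _ tendsto_const Elim]) (use that in auto)
  then have "((\<lambda>t. 1 - 2 * f t) \<longlongrightarrow> 0) at_top" by (simp add: power2_tendsto_0_iff)
  then have "((\<lambda>t. (1 - (1 - 2 * f t)) / 2) \<longlongrightarrow> (1 - 0) / 2) at_top" by (intro tendsto_intros) auto
  then show ?thesis by simp
 qed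
 show ?thesis by (intro conjI lim) (auto simp: E_def)
qed

end

text \<open>At the vertex \<open>x = 0\<close>, \<open>y = z = 1/2\<close> both rates equal
  \<open>(m + n) / 2\<close>, and by continuity half of this survives nearby. The factor 4 in the
  radius converts \<open>1 - 2 * y\<close> into the distance of \<open>y\<close> from 1/2.\<close>

lemma vertex_rate_exists:
 fixes m n p :: real
 assumes "m > 0" "n > 0" "p > 0"
 shows "\<exists>\<delta>>0. \<forall>x y z. x + y + z = 1 \<longrightarrow> (1 - 2 * y)\<^sup>2 + (1 - 2 * z)\<^sup>2 < \<delta> \<longrightarrow>
   2 * y * gf m n p x y z \<ge> (m + n) / 4 \<and> 2 * z * gf n m p x z y \<ge> (m + n) / 4"
proof -
 define F where "F = (\<lambda>(y, z). min (2 * y * gf m n p (1 - y - z) y z) (2 * z * gf n m p (1 - y - z) z y))"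
 have "isCont F (1/2, 1/2)"
  unfolding F_def gf_def case_prod_beta by (intro continuous_intros)
 moreover have "F (1/2, 1/2) = (m + n) / 2" by (simp add: F_def gf_def power2_eq_square)
 ultimately have "(F \<longlongrightarrow> (m + n) / 2) (at (1/2, 1/2))" by (simp add: isCont_def)
 then have "\<forall>\<^sub>F q in at (1/2, 1/2). F q > (m + n) / 4" using assms by (intro order_tendstoD) auto
 then obtain d where d: "d > 0" "\<And>q. q \<noteq> (1/2, 1/2) ==> dist q (1/2, 1/2) < d ==> F q > (m + n) / 4"
  unfolding eventually_at by blast
 have "F q > (m + n) / 4" if "dist q (1/2, 1/2) < d" for q
  using d(2)[OF _ that] \<open>F (1/2, 1/2) = (m + n) / 2\<close> assms by (cases "q = (1/2, 1/2)") auto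
 moreover have "dist (y, z) (1/2, 1/2) < d" if "(1 - 2 * y)\<^sup>2 + (1 - 2 * z)\<^sup>2 < 4 * d\<^sup>2" for y z :: real
 proof -
  have "(1 - 2 * y)\<^sup>2 + (1 - 2 * z)\<^sup>2 = 4 * ((y - 1/2)\<^sup>2 + (z - 1/2)\<^sup>2)"
   by (simp add: power2_eq_square algebra_simps)
  then have "sqrt ((y - 1/2)\<^sup>2 + (z - 1/2)\<^sup>2) < sqrt (d\<^sup>2)" using that by (intro real_sqrt_less_mono) simp
  then show ?thesis using d(1) by (simp add: dist_prod_def dist_real_def)
 qed
 ultimately have "\<And>y z. (1 - 2 * y)\<^sup>2 + (1 - 2 * z)\<^sup>2 < 4 * d\<^sup>2 ==> F (y, z) > (m + n) / 4" by blast
 then have "(m + n) / 4 \<le> 2 * y * gf m n p x y z \<and> (m + n) / 4 \<le> 2 * z * gf n m p x z y"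
  if "x + y + z = 1" "(1 - 2 * y)\<^sup>2 + (1 - 2 * z)\<^sup>2 < 4 * d\<^sup>2" for x y z
 proof -
  have "x = 1 - y - z" using that by simp
  then show ?thesis using \<open>\<And>y z. (1 - 2 * y)\<^sup>2 + (1 - 2 * z)\<^sup>2 < 4 * d\<^sup>2 ==> F (y, z) > (m + n) / 4\<close>[OF that(2)]
   by (simp add: F_def less_imp_le)
 qed
 then show ?thesis using d(1) by (intro exI[of _ "4 * d\<^sup>2"]) auto
qed

text \<open>The radius \<open>\<delta>\<close> depends on the parameters only, not on the orbit;
  this uniformity is what makes the basins open.\<close>

lemma rflow_vertex_basin:
 fixes m n p :: real
 assumes "m > 0" "n > 0" "p > 0"
 shows "\<exists>\<delta>>0. \<forall>a b c T. rflow m n p a b c \<longrightarrow> (1 - 2 * b T)\<^sup>2 + (1 - 2 * c T)\<^sup>2 < \<delta> \<longrightarrow>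
  (b \<longlongrightarrow> 1/2) at_top \<and> (c \<longlongrightarrow> 1/2) at_top"
proof -
 obtain \<delta> where \<delta>: "\<delta> > 0" "\<And>x y z. x + y + z = 1 ==> (1 - 2 * y)\<^sup>2 + (1 - 2 * z)\<^sup>2 < \<delta> ==>
   2 * y * gf m n p x y z \<ge> (m + n) / 4 \<and> 2 * z * gf n m p x z y \<ge> (m + n) / 4"
  using vertex_rate_exists[OF assms] by blast
 have "(m + n) / 4 > 0" using assms by simp
 then show ?thesis using rflow.vertex_attracts[OF _ _ \<delta>(2)] \<delta>(1) by blast
qed

text \<open>Late enough, at least one factor is below \<open>\<eta>\<close>, and never two at once.
  The half line is then covered by disjoint open sets, and by connectedness the same factor stays
  small forever. The other two remain above \<open>\<eta>\<close>, so this factor inherits the limit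
  of the product.\<close>

lemma product_tendsto_0_cases:
 fixes f1 f2 f3 :: "real => real"
 assumes cont: "continuous_on UNIV f1" "continuous_on UNIV f2" "continuous_on UNIV f3"
  and pos: "\<And>t. f1 t > 0" "\<And>t. f2 t > 0" "\<And>t. f3 t > 0"
  and lim: "((\<lambda>t. f1 t * f2 t * f3 t) \<longlongrightarrow> 0) at_top" and \<eta>: "\<eta> > 0"
  and sep: "\<And>t. \<not> (f1 t < \<eta> \<and> f2 t < \<eta>)" "\<And>t. \<not> (f1 t < \<eta> \<and> f3 t < \<eta>)" "\<And>t. \<not> (f2 t < \<eta> \<and> f3 t < \<eta>)"
 shows "(f1 \<longlongrightarrow> 0) at_top \<or> (f2 \<longlongrightarrow> 0) at_top \<or> (f3 \<longlongrightarrow> 0) at_top"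
proof -
 have "\<forall>\<^sub>F t in at_top. f1 t * f2 t * f3 t < \<eta> * \<eta> * \<eta>" using lim \<eta> by (intro order_tendstoD) auto
 then obtain T where T: "\<And>t. t \<ge> T ==> f1 t * f2 t * f3 t < \<eta> * \<eta> * \<eta>" by (auto simp: eventually_at_top_linorder)
 have cover: "f1 t < \<eta> \<or> f2 t < \<eta> \<or> f3 t < \<eta>" if "t \<ge> T" for t
 proof (rule ccontr)
  assume "\<not> (f1 t < \<eta> \<or> f2 t < \<eta> \<or> f3 t < \<eta>)"
  then have "\<eta> * \<eta> * \<eta> \<le> f1 t * f2 t * f3 t" using \<eta> by (intro mult_mono) auto
  then show False using T[OF that] by simp
 qed
 have main: "(g1 \<longlongrightarrow> 0) at_top"
  if g: "continuous_on UNIV g1" "continuous_on UNIV g2" "continuous_on UNIV g3"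
   "\<And>t. g1 t > 0" "\<And>t. g2 t > 0" "\<And>t. g3 t > 0"
   "((\<lambda>t. g1 t * (g2 t * g3 t)) \<longlongrightarrow> 0) at_top"
   "\<And>t. t \<ge> T ==> g1 t < \<eta> \<or> g2 t < \<eta> \<or> g3 t < \<eta>"
   "\<And>t. \<not> (g1 t < \<eta> \<and> (g2 t < \<eta> \<or> g3 t < \<eta>))" "g1 T < \<eta>" for g1 g2 g3 :: "real => real"
 proof -
  have "{t. g1 t < \<eta>} \<inter> {T..} = {} \<or> ({t. g2 t < \<eta>} \<union> {t. g3 t < \<eta>}) \<inter> {T..} = {}"
   by (rule connectedD) (use g in \<open>auto intro!: open_Un open_Collect_less continuous_on_const\<close>)
  then have ge: "g2 t \<ge> \<eta>" "g3 t \<ge> \<eta>" if "t \<ge> T" for t using g(10) that by force+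
  show ?thesis
  proof (rule tendsto_sandwich[of "\<lambda>_. 0" _ _ "\<lambda>t. g1 t * (g2 t * g3 t) / (\<eta> * \<eta>)"])
   show "\<forall>\<^sub>F t in at_top. g1 t \<le> g1 t * (g2 t * g3 t) / (\<eta> * \<eta>)"
    using eventually_ge_at_top[of T]
   proof (rule eventually_mono)
    fix t assume "t \<ge> T"
    then have "\<eta> * \<eta> \<le> g2 t * g3 t" using ge \<eta> by (intro mult_mono) (auto intro: order_trans[of 0 \<eta>])
    then have "g1 t * (\<eta> * \<eta>) \<le> g1 t * (g2 t * g3 t)" using g(4)[of t] by (intro mult_left_mono) auto
    then show "g1 t \<le> g1 t * (g2 t * g3 t) / (\<eta> * \<eta>)" using \<eta> by (simp add: field_simps)
   qed
   show "((\<lambda>t. g1 t * (g2 t * g3 t) / (\<eta> * \<eta>)) \<longlongrightarrow> 0) at_top"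
    using tendsto_divide[OF g(7) tendsto_const[of "\<eta> * \<eta>"]] \<eta> by simp
  qed (use g(4) in \<open>auto simp: less_imp_le\<close>)
 qed
 have "f1 T < \<eta> \<or> f2 T < \<eta> \<or> f3 T < \<eta>" by (rule cover) simp
 then show ?thesis
 proof (elim disjE)
  assume "f1 T < \<eta>"
  then have "(f1 \<longlongrightarrow> 0) at_top"
   by (intro main[of f1 f2 f3]) (use cont pos sep cover lim in \<open>auto simp: mult.assoc\<close>)
  then show ?thesis ..
 next
  assume "f2 T < \<eta>"
  then have "(f2 \<longlongrightarrow> 0) at_top"
   by (intro main[of f2 f1 f3]) (insert cont pos sep cover lim, simp_all add: mult_ac, blast+)
  then show ?thesis by blast
 next
  assume "f3 T < \<eta>"
  then have "(f3 \<longlongrightarrow> 0) at_top"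
   by (intro main[of f3 f1 f2]) (insert cont pos sep cover lim, simp_all add: mult_ac, blast+)
  then show ?thesis by blast
 qed
qed

text \<open>Jensen's inequality for two points, from the tangent of \<open>ln\<close> at 1 after
  division by the weighted mean \<open>M\<close>.\<close>

lemma weighted_ln_concave:
 fixes n m x y :: real
 assumes "n > 0" "m > 0" "x > 0" "y > 0"
 shows "n * ln x + m * ln y \<le> (n + m) * ln ((n * x + m * y) / (n + m))"
proof -
 define M where "M = (n * x + m * y) / (n + m)"
 have M: "M > 0" using assms by (simp add: M_def add_pos_pos)
 have "n * ln (x / M) + m * ln (y / M) \<le> n * (x / M - 1) + m * (y / M - 1)"
  using assms M by (intro add_mono mult_left_mono ln_le_minus_one) auto
 also have "\<dots> = (n * x + m * y) / M - (n + m)" by (simp add: right_diff_distrib add_divide_distrib)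
 also have "(n * x + m * y) / M = n + m"
 proof -
  have "n * x + m * y > 0" using assms by (simp add: add_pos_pos)
  then show ?thesis using assms by (simp add: M_def)
 qed
 finally have "n * ln (x / M) + m * ln (y / M) \<le> 0" by simp
 then have "n * (ln x - ln M) + m * (ln y - ln M) \<le> 0" using assms M by (simp add: ln_div)
 then show ?thesis unfolding M_def[symmetric] by (simp add: algebra_simps)
qed

section \<open>Orbits in the triangle\<close>

context rflow
begin

lemma edge_cases:
 assumes "(b \<longlongrightarrow> 1/2) at_top"
 shows "(a \<longlongrightarrow> 0) at_top \<or> (a \<longlongrightarrow> 1/2) at_top \<or> (a \<longlongrightarrow> (m + n) / (2 * (m + 2 * n + p))) at_top"
 using edge_limit[OF assms] by auto

text \<open>The rate of decrease of \<open>V\<close>. As a quadratic form it is positive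
  semidefinite, by the sum of squares that follows, and vanishes exactly where
  \<open>a : b : c = (m + n) : (m + p) : (n + p)\<close>, that is, on the simplex, at
  \<open>N\<close>.\<close>

definition q :: "real => real" where
 "q t = 2 * ((m + p) * (n + p) * (a t)\<^sup>2 + (m + n) * (n + p) * (b t)\<^sup>2 + (m + n) * (m + p) * (c t)\<^sup>2
  - 2 * m * (n + p) * a t * b t - 2 * n * (m + p) * a t * c t - 2 * p * (m + n) * b t * c t)"

lemma q_squares:
 "(m + n) * (m + p) * (n + p) * q t = 2 * (m * (n + p)\<^sup>2 * ((m + p) * a t - (m + n) * b t)\<^sup>2
  + n * (m + p)\<^sup>2 * ((n + p) * a t - (m + n) * c t)\<^sup>2 + p * (m + n)\<^sup>2 * ((n + p) * b t - (m + p) * c t)\<^sup>2)"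
 unfolding q_def by algebra

lemma q_nonneg: "q t \<ge> 0"
proof -
 have "(m + n) * (m + p) * (n + p) * q t \<ge> 0" unfolding q_squares using mnp by simp
 moreover have "(m + n) * (m + p) * (n + p) > 0" using mnp by simp
 ultimately show ?thesis by (simp add: zero_le_mult_iff)
qed

text \<open>Two of the three squares are dropped and the common factor is cancelled. Two of the
  three proportions, together with \<open>a + b + c = 1\<close>, already determine the
  point.\<close>

lemma q_ge: "2 * m * (n + p) * ((m + p) * a t - (m + n) * b t)\<^sup>2 \<le> (m + n) * (m + p) * q t"
 "2 * n * (m + p) * ((n + p) * a t - (m + n) * c t)\<^sup>2 \<le> (m + n) * (n + p) * q t"
proof -
 have aux: "2 * k * r * D \<le> K" if "K * r = 2 * (k * r\<^sup>2 * D + Y + Z)" "Y \<ge> 0" "Z \<ge> 0" "r > 0" for K r k D Y Z :: real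
 proof -
  have "(2 * k * r * D) * r \<le> K * r" using that by (simp add: power2_eq_square algebra_simps)
  then show ?thesis using \<open>r > 0\<close> by (simp only: mult_le_cancel_right_pos)
 qed
 define d1 d2 d3 where "d1 = ((m + p) * a t - (m + n) * b t)\<^sup>2" and "d2 = ((n + p) * a t - (m + n) * c t)\<^sup>2"
  and "d3 = ((n + p) * b t - (m + p) * c t)\<^sup>2"
 note sq = q_squares[of t, folded d1_def d2_def d3_def]
 have nn: "d1 \<ge> 0" "d2 \<ge> 0" "d3 \<ge> 0" by (simp_all add: d1_def d2_def d3_def)
 have "2 * m * (n + p) * d1 \<le> (m + n) * (m + p) * q t"
 proof (rule aux[where r = "n + p" and D = d1 and Y = "n * (m + p)\<^sup>2 * d2" and Z = "p * (m + n)\<^sup>2 * d3"])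
  have "(m + n) * (m + p) * q t * (n + p) = (m + n) * (m + p) * (n + p) * q t" by simp
  then show "(m + n) * (m + p) * q t * (n + p) = 2 * (m * (n + p)\<^sup>2 * d1 + n * (m + p)\<^sup>2 * d2 + p * (m + n)\<^sup>2 * d3)"
   using sq by (simp only:)
 qed (use mnp nn in auto)
 then show "2 * m * (n + p) * ((m + p) * a t - (m + n) * b t)\<^sup>2 \<le> (m + n) * (m + p) * q t"
  by (simp only: d1_def)
 have "2 * n * (m + p) * d2 \<le> (m + n) * (n + p) * q t"
 proof (rule aux[where r = "m + p" and D = d2 and Y = "m * (n + p)\<^sup>2 * d1" and Z = "p * (m + n)\<^sup>2 * d3"])
  have "(m + n) * (n + p) * q t * (m + p) = (m + n) * (m + p) * (n + p) * q t" by simp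
  then show "(m + n) * (n + p) * q t * (m + p) = 2 * (n * (m + p)\<^sup>2 * d2 + m * (n + p)\<^sup>2 * d1 + p * (m + n)\<^sup>2 * d3)"
   using sq by (simp only: add_ac)
 qed (use mnp nn in auto)
 then show "2 * n * (m + p) * ((n + p) * a t - (m + n) * c t)\<^sup>2 \<le> (m + n) * (n + p) * q t"
  by (simp only: d2_def)
qed

text \<open>The logarithm of \<open>(1-2a)\<^bsup>2p\<^esup> (1-2b)\<^bsup>2n\<^esup> (1-2c)\<^bsup>2m\<^esup> / (a\<^bsup>m+n\<^esup> b\<^bsup>m+p\<^esup> c\<^bsup>n+p\<^esup>)\<close>, normalized to vanish
 at \<open>N\<close>, where it is maximal.\<close>

definition V :: "real => real" where
 "V t = 2 * p * ln ((m + n + p) * (1 - 2 * a t) / p) + 2 * n * ln ((m + n + p) * (1 - 2 * b t) / n)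
  + 2 * m * ln ((m + n + p) * (1 - 2 * c t) / m) - (m + n) * ln (2 * (m + n + p) * a t / (m + n))
  - (m + p) * ln (2 * (m + n + p) * b t / (m + p)) - (n + p) * ln (2 * (m + n + p) * c t / (n + p))"

context
 assumes tri: "a 0 < 1/2" "b 0 < 1/2" "c 0 < 1/2"
begin

lemma tri_pos: "1 - 2 * a t > 0" "1 - 2 * b t > 0" "1 - 2 * c t > 0"
 using side_invariant[of t] rflow.side_invariant[OF swap_ab, of t] rflow.side_invariant[OF swap_bc, of t] tri
 by auto

text \<open>The factor \<open>a (1 - 2 a)\<close> of the field makes the logarithmic derivatives of
  both \<open>a\<close> and \<open>1 - 2 a\<close> polynomial. With the exponents in
  \<open>V\<close> the sum becomes a quadratic form on the plane \<open>a + b + c = 1\<close>. The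
  normalizing constants inside the logarithms do not affect the derivative.\<close>

lemma V_deriv: "(V has_real_derivative - q t) (at t)"
proof -
 define A B G where "A = gf m p n (b t) (a t) (c t)"
  and "B = gf m n p (a t) (b t) (c t)" and "G = gf n m p (a t) (c t) (b t)"
 note d = da[of t, folded A_def] db[of t, folded B_def] dc[of t, folded G_def]
 have N: "m + n + p > 0" using mnp by simp
 have lnd: "((\<lambda>t. ln (h t)) has_real_derivative X) (at t)"
  if "(h has_real_derivative h t * X) (at t)" "h t > 0" for h X
  using DERIV_chain2[OF DERIV_ln_divide[OF that(2)] that(1)] that(2) by simp
 have ln1: "((\<lambda>t. ln (K * (1 - 2 * f t) / k)) has_real_derivative - 2 * f t * g) (at t)"
  if f: "(f has_real_derivative f t * (1 - 2 * f t) * g) (at t)" and "1 - 2 * f t > 0" "K > 0" "k > 0" for f g K k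
 proof (rule lnd)
  have "((\<lambda>t. K * (1 - 2 * f t) / k) has_real_derivative K * (0 - 2 * (f t * (1 - 2 * f t) * g)) / k) (at t)"
   by (intro DERIV_cdivide DERIV_cmult DERIV_diff DERIV_const f)
  moreover have "K * (0 - 2 * (f t * (1 - 2 * f t) * g)) / k = K * (1 - 2 * f t) / k * (- 2 * f t * g)"
   by simp
  ultimately show "((\<lambda>t. K * (1 - 2 * f t) / k) has_real_derivative K * (1 - 2 * f t) / k * (- 2 * f t * g)) (at t)"
   by (simp only:)
 qed (use that in simp)
 have ln2: "((\<lambda>t. ln (K * f t / k)) has_real_derivative (1 - 2 * f t) * g) (at t)"
  if f: "(f has_real_derivative f t * (1 - 2 * f t) * g) (at t)" and "f t > 0" "K > 0" "k > 0" for f g K k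
 proof (rule lnd)
  have "((\<lambda>t. K * f t / k) has_real_derivative K * (f t * (1 - 2 * f t) * g) / k) (at t)"
   by (intro DERIV_cdivide DERIV_cmult f)
  then show "((\<lambda>t. K * f t / k) has_real_derivative K * f t / k * ((1 - 2 * f t) * g)) (at t)"
   by (simp add: mult_ac)
 qed (use that in simp)
 have "(V has_real_derivative 2 * p * (- 2 * a t * A) + 2 * n * (- 2 * b t * B) + 2 * m * (- 2 * c t * G)
   - (m + n) * ((1 - 2 * a t) * A) - (m + p) * ((1 - 2 * b t) * B) - (n + p) * ((1 - 2 * c t) * G)) (at t)"
  unfolding V_def using N mnp apos[of t] bpos[of t] cpos[of t] tri_pos[of t]
  by (intro DERIV_add DERIV_diff DERIV_cmult ln1 ln2 d) auto
 moreover have "2 * p * (- 2 * a t * A) + 2 * n * (- 2 * b t * B) + 2 * m * (- 2 * c t * G)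
   - (m + n) * ((1 - 2 * a t) * A) - (m + p) * ((1 - 2 * b t) * B) - (n + p) * ((1 - 2 * c t) * G) = - q t"
 proof -
  have c: "c t = 1 - a t - b t" using sum1[of t] by linarith
  show ?thesis unfolding A_def B_def G_def q_def gf_def c by (simp add: field_simps power2_eq_square)
 qed
 ultimately show ?thesis by simp
qed

text \<open>Each denominator of \<open>V\<close> is the sum of two of its numerators, for instance
  \<open>2 a = (1 - 2 b) + (1 - 2 c)\<close>. Concavity of \<open>ln\<close> is used for the three
  pairs, and each numerator occurs in two of them, which accounts for the exponents
  \<open>2 p\<close>, \<open>2 n\<close>, \<open>2 m\<close>.\<close>

lemma V_le_0: "V t \<le> 0"
proof -
 define N where "N = m + n + p"
 define x y z where "x = N * (1 - 2 * a t) / p" and "y = N * (1 - 2 * b t) / n" and "z = N * (1 - 2 * c t) / m"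
 have xyz: "x > 0" "y > 0" "z > 0" using mnp tri_pos[of t] by (simp_all add: x_def y_def z_def N_def)
 have s: "1 - 2 * b t + (1 - 2 * c t) = 2 * a t" "1 - 2 * a t + (1 - 2 * c t) = 2 * b t"
  "1 - 2 * a t + (1 - 2 * b t) = 2 * c t" using sum1[of t] by linarith+
 have "n * y + m * z = 2 * N * a t" "p * x + m * z = 2 * N * b t" "p * x + n * y = 2 * N * c t"
 proof -
  have e: "p * x = N * (1 - 2 * a t)" "n * y = N * (1 - 2 * b t)" "m * z = N * (1 - 2 * c t)"
   using mnp by (simp_all add: x_def y_def z_def)
  show "n * y + m * z = 2 * N * a t" "p * x + m * z = 2 * N * b t" "p * x + n * y = 2 * N * c t"
   unfolding e distrib_left[symmetric] s by simp_all
 qed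
 then have "n * ln y + m * ln z \<le> (m + n) * ln (2 * N * a t / (m + n))"
  "p * ln x + m * ln z \<le> (m + p) * ln (2 * N * b t / (m + p))"
  "p * ln x + n * ln y \<le> (n + p) * ln (2 * N * c t / (n + p))"
  using weighted_ln_concave[of n m y z] weighted_ln_concave[of p m x z] weighted_ln_concave[of p n x y] mnp xyz
  by (simp_all add: add.commute)
 then show ?thesis unfolding V_def N_def[symmetric] x_def[symmetric] y_def[symmetric] z_def[symmetric]
  by linarith
qed

lemma V_decreasing: assumes "s \<le> t" shows "V t \<le> V s"
proof (rule DERIV_nonpos_imp_nonincreasing[OF assms])
 show "\<exists>y. (V has_real_derivative y) (at x) \<and> y \<le> 0" for x
  using V_deriv[of x] q_nonneg[of x] by (intro exI[of _ "- q x"]) simp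
qed

text \<open>\<open>V\<close> itself may tend to minus infinity. Its exponential is bounded below by
  0 and decreases at the rate \<open>exp V * q\<close>, so Barbalat's lemma applies to it.\<close>

lemma exp_V_q_tendsto_0: "((\<lambda>t. exp (V t) * q t) \<longlongrightarrow> 0) at_top"
proof -
 define A B G where "A t = a t * (1 - 2 * a t) * gf m p n (b t) (a t) (c t)"
  and "B t = b t * (1 - 2 * b t) * gf m n p (a t) (b t) (c t)"
  and "G t = c t * (1 - 2 * c t) * gf n m p (a t) (c t) (b t)" for t
 define q' where "q' t = 2 * ((m + p) * (n + p) * (2 * a t * A t) + (m + n) * (n + p) * (2 * b t * B t)
  + (m + n) * (m + p) * (2 * c t * G t) - 2 * m * (n + p) * (A t * b t + a t * B t)
  - 2 * n * (m + p) * (A t * c t + a t * G t) - 2 * p * (m + n) * (B t * c t + b t * G t))" for t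
 have dq: "(q has_real_derivative q' t) (at t)" for t
  unfolding q_def q'_def A_def B_def G_def
  by (auto intro!: derivative_eq_intros da db dc simp: algebra_simps)
 have bq: "bddf q" unfolding q_def by (intro bddf_intros bddf_abc)
 have bq': "bddf q'" unfolding q'_def A_def B_def G_def gf_def by (intro bddf_intros bddf_abc)
 have bV: "bddf (\<lambda>t. exp (V t))" unfolding bddf_def using V_le_0 by (intro exI[of _ 1]) auto
 have bd: "bddf (\<lambda>t. exp (V t) * q' t - exp (V t) * q t * q t)" by (intro bddf_intros bV bq bq')
 have d: "((\<lambda>t. exp (V t) * q t) has_real_derivative exp (V t) * q' t - exp (V t) * q t * q t) (at t)" for t
  by (auto intro!: derivative_eq_intros V_deriv dq simp: algebra_simps)
 obtain C where C: "\<And>s t. s \<ge> 0 ==> t \<ge> 0 ==> \<bar>exp (V s) * q s - exp (V t) * q t\<bar> \<le> C * \<bar>s - t\<bar>"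
  by (rule bddf_imp_lipschitz[of "\<lambda>t. exp (V t) * q t", OF d bd]) blast
 show ?thesis
 proof (rule dissipation_tendsto_0[where V = "\<lambda>t. exp (V t)" and B = 0 and C = C])
  show "((\<lambda>t. exp (V t)) has_real_derivative - (exp (V t) * q t)) (at t)" for t
   by (auto intro!: derivative_eq_intros V_deriv)
  show "exp (V t) * q t \<ge> 0" for t using q_nonneg by simp
 qed (use C in auto)
qed

text \<open>If \<open>V\<close> is bounded below, then \<open>q\<close> tends to 0 and the orbit to
  \<open>N\<close>, where \<open>V\<close> has its maximum 0. A decreasing function with values at
  most 0 can tend to 0 only if it vanishes identically; then \<open>q\<close> vanishes at time 0 and
  the orbit starts at \<open>N\<close>.\<close>

lemma V_dichotomy: "(a 0 = (m + n) / (2 * (m + n + p)) \<and> b 0 = (m + p) / (2 * (m + n + p)))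
 \<or> filterlim V at_bot at_top"
proof (cases "\<exists>B. \<forall>t\<ge>0. V t \<ge> B")
 case True
 then obtain B where B: "\<And>t. t \<ge> 0 ==> V t \<ge> B" by blast
 have "(q \<longlongrightarrow> 0) at_top"
 proof (rule tendsto_sandwich[of "\<lambda>_. 0" _ _ "\<lambda>t. exp (- B) * (exp (V t) * q t)"])
  show "\<forall>\<^sub>F t in at_top. q t \<le> exp (- B) * (exp (V t) * q t)"
   using eventually_ge_at_top[of 0]
  proof (rule eventually_mono)
   fix t :: real assume "t \<ge> 0"
   then have "1 * q t \<le> exp (V t - B) * q t" using B q_nonneg by (intro mult_right_mono) auto
   then show "q t \<le> exp (- B) * (exp (V t) * q t)" by (simp add: exp_diff exp_minus field_simps)
  qed
  show "((\<lambda>t. exp (- B) * (exp (V t) * q t)) \<longlongrightarrow> 0) at_top"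
   using tendsto_mult_right_zero[OF exp_V_q_tendsto_0] by blast
 qed (use q_nonneg in auto)
 have sq: "(f \<longlongrightarrow> 0) at_top" if "k > 0" "\<And>t. k * (f t)\<^sup>2 \<le> K * q t" for f k K
 proof -
  have "((\<lambda>t. (f t)\<^sup>2) \<longlongrightarrow> 0) at_top"
  proof (rule tendsto_sandwich[of "\<lambda>_. 0" _ _ "\<lambda>t. K / k * q t"])
   show "((\<lambda>t. K / k * q t) \<longlongrightarrow> 0) at_top" using tendsto_mult_right_zero[OF \<open>(q \<longlongrightarrow> 0) at_top\<close>] by blast
   show "\<forall>\<^sub>F t in at_top. (f t)\<^sup>2 \<le> K / k * q t" using that by (simp add: field_simps)
  qed auto
  then show ?thesis by (simp add: power2_tendsto_0_iff)
 qed
 define N where "N = m + n + p"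
 have N: "N > 0" using mnp by (simp add: N_def)
 define d1 d2 where "d1 t = (m + p) * a t - (m + n) * b t" and "d2 t = (n + p) * a t - (m + n) * c t" for t
 have d1: "(d1 \<longlongrightarrow> 0) at_top" unfolding d1_def by (rule sq[OF _ q_ge(1)]) (use mnp in simp)
 have d2: "(d2 \<longlongrightarrow> 0) at_top" unfolding d2_def by (rule sq[OF _ q_ge(2)]) (use mnp in simp)
 \<comment> \<open>Adding the two deviations to \<open>(m + n) (a + b + c)\<close> collects the
   coefficient \<open>2 N\<close> of \<open>a\<close>.\<close>
 have aeq: "a t = ((m + n) + d1 t + d2 t) / (2 * N)" for t
 proof -
  have "(m + n) * (a t + b t + c t) = (m + n)" by (simp add: sum1)
  then have "2 * N * a t = (m + n) + d1 t + d2 t" unfolding d1_def d2_def N_def by (simp add: algebra_simps)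
  then show ?thesis using N by (simp add: field_simps)
 qed
 have beq: "b t = ((m + p) * a t - d1 t) / (m + n)" and ceq: "c t = ((n + p) * a t - d2 t) / (m + n)" for t
  unfolding d1_def d2_def using mnp by (simp_all add: field_simps)
 have "((\<lambda>t. ((m + n) + d1 t + d2 t) / (2 * N)) \<longlongrightarrow> ((m + n) + 0 + 0) / (2 * N)) at_top"
  using N by (intro tendsto_intros d1 d2) auto
 then have alim: "(a \<longlongrightarrow> (m + n) / (2 * N)) at_top" by (simp flip: aeq)
 have "((\<lambda>t. ((m + p) * a t - d1 t) / (m + n)) \<longlongrightarrow> ((m + p) * ((m + n) / (2 * N)) - 0) / (m + n)) at_top"
  using mnp by (intro tendsto_intros d1 alim) auto
 then have blim: "(b \<longlongrightarrow> (m + p) / (2 * N)) at_top" using mnp N by (simp flip: beq)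
 have "((\<lambda>t. ((n + p) * a t - d2 t) / (m + n)) \<longlongrightarrow> ((n + p) * ((m + n) / (2 * N)) - 0) / (m + n)) at_top"
  using mnp by (intro tendsto_intros d2 alim) auto
 then have clim: "(c \<longlongrightarrow> (n + p) / (2 * N)) at_top" using mnp N by (simp flip: ceq)
 have ln1: "((\<lambda>t. ln (N * (1 - 2 * f t) / k)) \<longlongrightarrow> 0) at_top" if "(f \<longlongrightarrow> l) at_top" "1 - 2 * l = k / N" "k > 0" for f l k
 proof -
  have "((\<lambda>t. ln (N * (1 - 2 * f t) / k)) \<longlongrightarrow> ln (N * (1 - 2 * l) / k)) at_top"
   using that N by (intro tendsto_intros that) auto
  then show ?thesis using that N by simp
 qed
 have ln2: "((\<lambda>t. ln (2 * N * f t / k)) \<longlongrightarrow> 0) at_top" if "(f \<longlongrightarrow> k / (2 * N)) at_top" "k > 0" for f k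
 proof -
  have "((\<lambda>t. ln (2 * N * f t / k)) \<longlongrightarrow> ln (2 * N * (k / (2 * N)) / k)) at_top"
   using that N by (intro tendsto_intros that) auto
  then show ?thesis using that N by simp
 qed
 have "(V \<longlongrightarrow> 2 * p * 0 + 2 * n * 0 + 2 * m * 0 - (m + n) * 0 - (m + p) * 0 - (n + p) * 0) at_top"
  unfolding V_def N_def[symmetric]
  by (intro tendsto_add tendsto_diff tendsto_mult tendsto_const ln1[OF alim] ln1[OF blim] ln1[OF clim]
    ln2[OF alim] ln2[OF blim] ln2[OF clim]) (use mnp N in \<open>simp_all add: N_def field_simps\<close>)
 then have Vlim: "(V \<longlongrightarrow> 0) at_top" by simp
 have "V t = 0" for t
 proof (rule antisym[OF V_le_0])
  show "0 \<le> V t"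
  proof (rule tendsto_upperbound[OF Vlim])
   show "\<forall>\<^sub>F s in at_top. V s \<le> V t" using eventually_ge_at_top[of t] by (rule eventually_mono) (rule V_decreasing)
  qed simp
 qed
 then have "V = (\<lambda>_. 0)" by auto
 then have "(V has_real_derivative 0) (at 0)" by simp
 then have q0: "q 0 = 0" using DERIV_unique[OF V_deriv[of 0]] by force
 have "2 * m * (n + p) * (d1 0)\<^sup>2 \<le> 0" "2 * n * (m + p) * (d2 0)\<^sup>2 \<le> 0"
  unfolding d1_def d2_def using q_ge[of 0] q0 by simp_all
 then have "d1 0 = 0" "d2 0 = 0" using mnp by (simp_all add: mult_le_0_iff)
 then have "a 0 = (m + n) / (2 * N)" using aeq[of 0] by simp
 moreover have "b 0 = (m + p) / (2 * N)" using beq[of 0] \<open>d1 0 = 0\<close> \<open>a 0 = (m + n) / (2 * N)\<close> mnp by simp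
 ultimately show ?thesis by (simp add: N_def)
next
 case False
 have "filterlim V at_bot at_top"
  unfolding filterlim_at_bot
 proof
  fix Z
  obtain t0 where "t0 \<ge> 0" "V t0 < Z" using False by (meson not_le)
  then have "\<forall>t\<ge>t0. V t \<le> Z" using V_decreasing by (meson less_imp_le order_trans)
  then show "\<forall>\<^sub>F t in at_top. V t \<le> Z" unfolding eventually_at_top_linorder by blast
 qed
 then show ?thesis ..
qed

text \<open>In the triangle all logarithms are negative and each of \<open>m\<close>,
  \<open>n\<close>, \<open>p\<close> is at most \<open>N\<close>. Raising the exponents of the
  numerators to \<open>2 N\<close> and dropping the denominators can only decrease \<open>V\<close>,
  up to the constant \<open>C0\<close>; so \<open>V\<close> cannot go to minus infinity unless the
  product goes to 0.\<close>

lemma product_tendsto_0: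
 assumes "filterlim V at_bot at_top"
 shows "((\<lambda>t. (1 - 2 * a t) * (1 - 2 * b t) * (1 - 2 * c t)) \<longlongrightarrow> 0) at_top"
proof -
 define N where "N = m + n + p"
 have N: "N > 0" using mnp by (simp add: N_def)
 define C0 where "C0 = 2 * p * ln (N / p) + 2 * n * ln (N / n) + 2 * m * ln (N / m)
  - (m + n) * ln (2 * N / (m + n)) - (m + p) * ln (2 * N / (m + p)) - (n + p) * ln (2 * N / (n + p))"
 define U where "U t = (1 - 2 * a t) * (1 - 2 * b t) * (1 - 2 * c t)" for t
 have U: "U t > 0" for t using tri_pos[of t] by (simp add: U_def)
 have V_ge: "V t \<ge> 2 * N * ln (U t) + C0" for t
 proof -
  have l1: "ln (N * x / k) = ln (N / k) + ln x" if "x > 0" "k > 0" for x k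
   using that N by (simp add: ln_mult ln_div)
  have l2: "ln (2 * N * x / k) = ln (2 * N / k) + ln x" if "x > 0" "k > 0" for x k
   using that N by (simp add: ln_mult ln_div)
  have V: "V t = C0 + 2 * p * ln (1 - 2 * a t) + 2 * n * ln (1 - 2 * b t) + 2 * m * ln (1 - 2 * c t)
    - (m + n) * ln (a t) - (m + p) * ln (b t) - (n + p) * ln (c t)"
  proof -
   have k: "m + n > 0" "m + p > 0" "n + p > 0" using mnp by simp_all
   show ?thesis
    unfolding V_def N_def[symmetric] C0_def l1[OF tri_pos(1) mnp(3)] l1[OF tri_pos(2) mnp(2)]
     l1[OF tri_pos(3) mnp(1)] l2[OF apos k(1)] l2[OF bpos k(2)] l2[OF cpos k(3)]
    by (simp only: algebra_simps)
  qed
  have lnU: "ln (U t) = ln (1 - 2 * a t) + ln (1 - 2 * b t) + ln (1 - 2 * c t)"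
   unfolding U_def using tri_pos[of t] by (simp add: ln_mult)
  have "2 * N * ln (1 - 2 * a t) \<le> 2 * p * ln (1 - 2 * a t)" "2 * N * ln (1 - 2 * b t) \<le> 2 * n * ln (1 - 2 * b t)"
   "2 * N * ln (1 - 2 * c t) \<le> 2 * m * ln (1 - 2 * c t)"
   using mnp apos[of t] bpos[of t] cpos[of t] tri_pos[of t] N_def
   by (auto intro!: mult_right_mono_neg)
  moreover have "(m + n) * ln (a t) \<le> 0" "(m + p) * ln (b t) \<le> 0" "(n + p) * ln (c t) \<le> 0"
   using mnp apos[of t] bpos[of t] cpos[of t] lt1[of t] by (auto intro!: mult_nonneg_nonpos simp: less_imp_le)
  ultimately show ?thesis unfolding V lnU by (simp add: algebra_simps)
 qed
 have "(U \<longlongrightarrow> 0) at_top"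
 proof (rule order_tendstoI)
  show "\<forall>\<^sub>F t in at_top. x < U t" if "x < 0" for x using U that by (intro always_eventually allI) (meson less_trans)
  fix x :: real assume x: "0 < x"
  have "\<forall>\<^sub>F t in at_top. V t \<le> 2 * N * ln (x / 2) + C0" using assms by (simp add: filterlim_at_bot)
  then show "\<forall>\<^sub>F t in at_top. U t < x"
  proof (rule eventually_mono)
   fix t assume "V t \<le> 2 * N * ln (x / 2) + C0"
   then have "2 * N * ln (U t) \<le> 2 * N * ln (x / 2)" using V_ge[of t] by linarith
   then have "ln (U t) \<le> ln (x / 2)" using N by simp
   then have "U t \<le> x / 2" using U x by simp
   then show "U t < x" using x by simp
  qed
 qed
 then show ?thesis by (simp add: U_def[abs_def])
qed

end

end

lemma (in rflow) swap_cab: "rflow n p m c a b"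
 by (rule rflow.swap_ab[OF swap_bc])

text \<open>Either the orbit enters the attracting neighbourhood of some vertex, or it avoids all
  three. In the second case no two of the factors \<open>1 - 2 a\<close>, \<open>1 - 2 b\<close>,
  \<open>1 - 2 c\<close> are small together, and the vanishing of their product singles out one
  side.\<close>

lemma (in rflow) triangle_forward:
 assumes tri: "a 0 < 1/2" "b 0 < 1/2" "c 0 < 1/2"
  and notN: "\<not> (a 0 = (m + n) / (2 * (m + n + p)) \<and> b 0 = (m + p) / (2 * (m + n + p)))"
 shows "((b \<longlongrightarrow> 1/2) at_top \<and> (c \<longlongrightarrow> 1/2) at_top) \<or> ((a \<longlongrightarrow> 1/2) at_top \<and> (b \<longlongrightarrow> 1/2) at_top)
  \<or> ((a \<longlongrightarrow> 1/2) at_top \<and> (c \<longlongrightarrow> 1/2) at_top)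
  \<or> (a \<longlongrightarrow> 1/2) at_top \<or> (b \<longlongrightarrow> 1/2) at_top \<or> (c \<longlongrightarrow> 1/2) at_top"
proof -
 have prod: "((\<lambda>t. (1 - 2 * a t) * (1 - 2 * b t) * (1 - 2 * c t)) \<longlongrightarrow> 0) at_top"
  using product_tendsto_0[OF tri] V_dichotomy[OF tri] notN by blast
 obtain \<delta>1 where \<delta>1: "\<delta>1 > 0" "\<And>T. (1 - 2 * b T)\<^sup>2 + (1 - 2 * c T)\<^sup>2 < \<delta>1 ==> (b \<longlongrightarrow> 1/2) at_top \<and> (c \<longlongrightarrow> 1/2) at_top"
  using rflow_vertex_basin[OF mnp] rflow_axioms by blast
 obtain \<delta>2 where \<delta>2: "\<delta>2 > 0" "\<And>T. (1 - 2 * a T)\<^sup>2 + (1 - 2 * b T)\<^sup>2 < \<delta>2 ==> (a \<longlongrightarrow> 1/2) at_top \<and> (b \<longlongrightarrow> 1/2) at_top"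
  using rflow_vertex_basin[OF mnp(2,3,1)] swap_cab by blast
 obtain \<delta>3 where \<delta>3: "\<delta>3 > 0" "\<And>T. (1 - 2 * a T)\<^sup>2 + (1 - 2 * c T)\<^sup>2 < \<delta>3 ==> (a \<longlongrightarrow> 1/2) at_top \<and> (c \<longlongrightarrow> 1/2) at_top"
  using rflow_vertex_basin[OF mnp(1,3,2)] swap_ab by blast
 define \<delta> where "\<delta> = min \<delta>1 (min \<delta>2 \<delta>3)"
 \<comment> \<open>Two positive factors below \<open>\<eta>\<close> have a sum of squares below
   \<open>\<delta>\<close>, which would place the orbit near a vertex.\<close>
 define \<eta> where "\<eta> = sqrt (\<delta> / 2)"
 have \<eta>: "\<eta> > 0" "\<eta>\<^sup>2 = \<delta> / 2" using \<delta>1(1) \<delta>2(1) \<delta>3(1) by (auto simp: \<eta>_def \<delta>_def)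
 show ?thesis
 proof (cases "\<exists>T. (1 - 2 * b T)\<^sup>2 + (1 - 2 * c T)\<^sup>2 < \<delta>1 \<or> (1 - 2 * a T)\<^sup>2 + (1 - 2 * b T)\<^sup>2 < \<delta>2
   \<or> (1 - 2 * a T)\<^sup>2 + (1 - 2 * c T)\<^sup>2 < \<delta>3")
  case True
  then show ?thesis using \<delta>1(2) \<delta>2(2) \<delta>3(2) by blast
 next
  case False
  have small: "x\<^sup>2 + y\<^sup>2 < \<delta>" if "x < \<eta>" "y < \<eta>" "x > 0" "y > 0" for x y
  proof -
   have "x\<^sup>2 < \<eta>\<^sup>2" "y\<^sup>2 < \<eta>\<^sup>2" using that by (auto intro: power_strict_mono)
   then show ?thesis using \<eta> by simp
  qed
  have dl: "\<delta> \<le> \<delta>1" "\<delta> \<le> \<delta>2" "\<delta> \<le> \<delta>3" by (auto simp: \<delta>_def)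
  have "((\<lambda>t. 1 - 2 * a t) \<longlongrightarrow> 0) at_top \<or> ((\<lambda>t. 1 - 2 * b t) \<longlongrightarrow> 0) at_top \<or> ((\<lambda>t. 1 - 2 * c t) \<longlongrightarrow> 0) at_top"
  proof (rule product_tendsto_0_cases[OF _ _ _ _ _ _ prod \<eta>(1)])
   show "continuous_on UNIV (\<lambda>t. 1 - 2 * a t)" "continuous_on UNIV (\<lambda>t. 1 - 2 * b t)" "continuous_on UNIV (\<lambda>t. 1 - 2 * c t)"
    using DERIV_isCont[OF da] DERIV_isCont[OF db] DERIV_isCont[OF dc]
    by (auto simp: continuous_on_eq_continuous_at intro!: continuous_intros)
   show "\<not> (1 - 2 * a t < \<eta> \<and> 1 - 2 * b t < \<eta>)" "\<not> (1 - 2 * a t < \<eta> \<and> 1 - 2 * c t < \<eta>)"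
    "\<not> (1 - 2 * b t < \<eta> \<and> 1 - 2 * c t < \<eta>)" for t
   proof -
    have ge: "\<not> (1 - 2 * b t)\<^sup>2 + (1 - 2 * c t)\<^sup>2 < \<delta>" "\<not> (1 - 2 * a t)\<^sup>2 + (1 - 2 * b t)\<^sup>2 < \<delta>"
     "\<not> (1 - 2 * a t)\<^sup>2 + (1 - 2 * c t)\<^sup>2 < \<delta>"
     using False dl by (meson less_le_trans)+
    note p = tri_pos[OF tri, of t]
    show "\<not> (1 - 2 * a t < \<eta> \<and> 1 - 2 * b t < \<eta>)" using small[OF _ _ p(1,2)] ge(2) by blast
    show "\<not> (1 - 2 * a t < \<eta> \<and> 1 - 2 * c t < \<eta>)" using small[OF _ _ p(1,3)] ge(3) by blast
    show "\<not> (1 - 2 * b t < \<eta> \<and> 1 - 2 * c t < \<eta>)" using small[OF _ _ p(2,3)] ge(1) by blast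
   qed
  qed (use tri_pos[OF tri] in auto)
  moreover have lim: "(f \<longlongrightarrow> 1/2) at_top" if "((\<lambda>t. 1 - 2 * f t) \<longlongrightarrow> 0) at_top" for f :: "real => real"
  proof -
   have "((\<lambda>t. (1 - (1 - 2 * f t)) / 2) \<longlongrightarrow> (1 - 0) / 2) at_top" using that by (intro tendsto_intros) auto
   then show ?thesis by simp
  qed
  ultimately show ?thesis by blast
 qed
qed

section \<open>The projected Ricci flow\<close>

lemma mem_simplex_S: "(x, y) \<in> simplex_S \<longleftrightarrow> 0 \<le> x \<and> 0 \<le> y \<and> x + y \<le> 1"
 by (simp add: simplex_S_def)

abbreviation "int_S \<equiv> interior simplex_S"

lemma interior_simplex_S: "interior simplex_S = {(x, y). 0 < x \<and> 0 < y \<and> x + y < 1}"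
proof (rule interior_unique)
 show "{(x, y). 0 < x \<and> 0 < y \<and> x + y < 1} \<subseteq> simplex_S" by (auto simp: simplex_S_def)
 show "open {(x, y). 0 < x \<and> 0 < y \<and> x + y < (1::real)}"
  unfolding case_prod_beta by (intro open_Collect_conj open_Collect_less continuous_intros)
 fix T :: "(real \<times> real) set" assume T: "T \<subseteq> simplex_S" "open T"
 show "T \<subseteq> {(x, y). 0 < x \<and> 0 < y \<and> x + y < 1}"
 proof
  fix q assume "q \<in> T"
  then obtain e where e: "e > 0" "ball q e \<subseteq> T" using T(2) open_contains_ball by blast
  obtain x y where q: "q = (x, y)" by fastforce
  have "(x - e/2, y) \<in> ball q e" "(x, y - e/2) \<in> ball q e" "(x + e/2, y) \<in> ball q e"
   using e(1) by (simp_all add: q dist_Pair_Pair dist_real_def)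
  then have "(x - e/2, y) \<in> simplex_S" "(x, y - e/2) \<in> simplex_S" "(x + e/2, y) \<in> simplex_S"
   using e(2) T(1) by blast+
  then show "q \<in> {(x, y). 0 < x \<and> 0 < y \<and> x + y < 1}" using e(1) by (simp add: q mem_simplex_S)
 qed
qed

lemma convex_simplex_S: "convex simplex_S"
proof -
 have "simplex_S = {q. (1, 0) \<bullet> q \<ge> 0} \<inter> {q. (0, 1) \<bullet> q \<ge> 0} \<inter> {q. (1, 1) \<bullet> q \<le> 1}"
  by (auto simp: simplex_S_def)
 then show ?thesis by (elim ssubst) (intro convex_Int convex_halfspace_ge convex_halfspace_le)
qed

lemma compact_simplex_S: "compact simplex_S"
proof -
 have "simplex_S = {q. (1, 0) \<bullet> q \<ge> 0} \<inter> {q. (0, 1) \<bullet> q \<ge> 0} \<inter> {q. (1, 1) \<bullet> q \<le> 1}"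
  by (auto simp: simplex_S_def)
 then have "closed simplex_S" by (elim ssubst) (intro closed_Int closed_halfspace_ge closed_halfspace_le)
 moreover have "simplex_S \<subseteq> cbox (0, 0) (1, 1)" by (auto simp: simplex_S_def cbox_Pair_eq)
 then have "bounded simplex_S" using bounded_cbox bounded_subset by blast
 ultimately show ?thesis by (simp add: compact_eq_bounded_closed)
qed

text \<open>One constant serves as Lipschitz constant and as bound; the Lipschitz estimate for a
  product needs both for each factor.\<close>

definition lipS :: "(real \<times> real => real) => bool" where
 "lipS f \<longleftrightarrow> (\<exists>L. \<forall>a\<in>simplex_S. \<forall>b\<in>simplex_S. \<bar>f a - f b\<bar> \<le> L * norm (a - b) \<and> \<bar>f a\<bar> \<le> L)"

lemma lipS_intros:
 "lipS (\<lambda>_. k)" "lipS fst" "lipS snd"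
 "lipS f ==> lipS g ==> lipS (\<lambda>q. f q + g q)"
 "lipS f ==> lipS g ==> lipS (\<lambda>q. f q - g q)"
 "lipS f ==> lipS g ==> lipS (\<lambda>q. f q * g q)"
 "lipS f ==> lipS (\<lambda>q. f q ^ i)"
proof -
 show const: "lipS (\<lambda>_. k)" for k unfolding lipS_def by (intro exI[of _ "\<bar>k\<bar>"]) auto
 have fs: "\<bar>fst a - fst b\<bar> \<le> 1 * norm (a - b)" "\<bar>snd a - snd b\<bar> \<le> 1 * norm (a - b)" for a b :: "real \<times> real"
  using norm_fst_le[of "fst (a - b)" "snd (a - b)"] norm_snd_le[of "snd (a - b)" "fst (a - b)"]
  unfolding prod.collapse by simp_all
 then show "lipS fst" "lipS snd" unfolding lipS_def
  by (auto intro!: exI[of _ 1] simp: simplex_S_def)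
 show "lipS (\<lambda>q. f q + g q)" if "lipS f" "lipS g" for f g
 proof -
  from that obtain L M where L: "\<forall>a\<in>simplex_S. \<forall>b\<in>simplex_S. \<bar>f a - f b\<bar> \<le> L * norm (a - b) \<and> \<bar>f a\<bar> \<le> L"
   and M: "\<forall>a\<in>simplex_S. \<forall>b\<in>simplex_S. \<bar>g a - g b\<bar> \<le> M * norm (a - b) \<and> \<bar>g a\<bar> \<le> M"
   unfolding lipS_def by blast
  have "\<bar>f a + g a - (f b + g b)\<bar> \<le> (L + M) * norm (a - b) \<and> \<bar>f a + g a\<bar> \<le> L + M"
   if "a \<in> simplex_S" "b \<in> simplex_S" for a b
  proof -
   have "\<bar>f a - f b\<bar> \<le> L * norm (a - b)" "\<bar>f a\<bar> \<le> L" "\<bar>g a - g b\<bar> \<le> M * norm (a - b)" "\<bar>g a\<bar> \<le> M"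
    using L M that by blast+
   then show ?thesis unfolding distrib_right by (intro conjI; linarith)
  qed
  then show ?thesis unfolding lipS_def by blast
 qed note add = this
 show mult: "lipS (\<lambda>q. f q * g q)" if "lipS f" "lipS g" for f g
 proof -
  from that obtain L M where L: "\<forall>a\<in>simplex_S. \<forall>b\<in>simplex_S. \<bar>f a - f b\<bar> \<le> L * norm (a - b) \<and> \<bar>f a\<bar> \<le> L"
   and M: "\<forall>a\<in>simplex_S. \<forall>b\<in>simplex_S. \<bar>g a - g b\<bar> \<le> M * norm (a - b) \<and> \<bar>g a\<bar> \<le> M"
   unfolding lipS_def by blast
  have "\<bar>f a * g a - f b * g b\<bar> \<le> (2 * \<bar>L\<bar> * \<bar>M\<bar>) * norm (a - b) \<and> \<bar>f a * g a\<bar> \<le> 2 * \<bar>L\<bar> * \<bar>M\<bar>"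
   if ab: "a \<in> simplex_S" "b \<in> simplex_S" for a b
  proof -
   have 1: "\<bar>f a - f b\<bar> \<le> L * norm (a - b)" "\<bar>f a\<bar> \<le> L" "\<bar>g a - g b\<bar> \<le> M * norm (a - b)" "\<bar>g a\<bar> \<le> M" "\<bar>g b\<bar> \<le> M"
    using L M ab by blast+
   then have 2: "\<bar>L\<bar> = L" "\<bar>M\<bar> = M" by linarith+
   have "f a * g a - f b * g b = f a * (g a - g b) + (f a - f b) * g b" by (simp add: algebra_simps)
   then have "\<bar>f a * g a - f b * g b\<bar> \<le> \<bar>f a\<bar> * \<bar>g a - g b\<bar> + \<bar>f a - f b\<bar> * \<bar>g b\<bar>"
    by (metis abs_triangle_ineq abs_mult)
   also have "\<dots> \<le> L * (M * norm (a - b)) + (L * norm (a - b)) * M"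
    using 1 2 by (intro add_mono mult_mono) auto
   finally have "\<bar>f a * g a - f b * g b\<bar> \<le> (2 * L * M) * norm (a - b)" by (simp add: algebra_simps)
   moreover have "\<bar>f a * g a\<bar> \<le> L * M" unfolding abs_mult using 1 2 by (intro mult_mono) auto
   moreover have "0 \<le> L * M" using 2 by (metis abs_ge_zero mult_nonneg_nonneg)
   ultimately show ?thesis using 2 by simp
  qed
  then show ?thesis unfolding lipS_def by blast
 qed
 show "lipS (\<lambda>q. f q - g q)" if "lipS f" "lipS g" for f g
  using add[OF that(1) mult[OF const[of "-1"] that(2)]] by simp
 show "lipS (\<lambda>q. f q ^ i)" if "lipS f" by (induction i) (auto intro: const mult that)
qed

lemma ricci_field_eq:
 "ricci_field m n p (x, y) = (x * (1 - 2 * x) * gf (real m) (real p) (real n) y x (1 - x - y),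
   y * (1 - 2 * y) * gf (real m) (real n) (real p) x y (1 - x - y))"
proof -
 define M N P where "M = real m" and "N = real n" and "P = real p"
 show ?thesis unfolding ricci_field_def prod.case gf_def M_def[symmetric] N_def[symmetric] P_def[symmetric]
  by (simp add: algebra_simps power2_eq_square)
qed

lemma ricci_field_fst: "fst (ricci_field m n p q) =
  fst q * (1 - 2 * fst q) * gf (real m) (real p) (real n) (snd q) (fst q) (1 - fst q - snd q)"
 and ricci_field_snd: "snd (ricci_field m n p q) =
  snd q * (1 - 2 * snd q) * gf (real m) (real n) (real p) (fst q) (snd q) (1 - fst q - snd q)"
 by (cases q, simp add: ricci_field_eq)+

text \<open>The velocities of the three coordinates cancel, which gives the third coordinate an
  equation of the same form as the other two.\<close>

lemma gf_sum_zero: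
 assumes "x + y + z = (1::real)"
 shows "x * (1 - 2 * x) * gf m p n y x z + y * (1 - 2 * y) * gf m n p x y z + z * (1 - 2 * z) * gf n m p x z y = 0"
proof -
 have z: "z = 1 - x - y" using assms by simp
 show ?thesis unfolding z gf_def by (simp add: algebra_simps power2_eq_square)
qed

lemma ricci_field_lipschitz:
 obtains L where "\<And>a b. a \<in> simplex_S ==> b \<in> simplex_S ==>
  norm (ricci_field m n p a - ricci_field m n p b) \<le> L * norm (a - b)"
proof -
 have "lipS (\<lambda>q. fst (ricci_field m n p q))" "lipS (\<lambda>q. snd (ricci_field m n p q))"
  unfolding ricci_field_fst ricci_field_snd gf_def by (intro lipS_intros)+
 then obtain L M where L: "\<forall>a\<in>simplex_S. \<forall>b\<in>simplex_S. \<bar>fst (ricci_field m n p a) - fst (ricci_field m n p b)\<bar> \<le> L * norm (a - b)"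
  and M: "\<forall>a\<in>simplex_S. \<forall>b\<in>simplex_S. \<bar>snd (ricci_field m n p a) - snd (ricci_field m n p b)\<bar> \<le> M * norm (a - b)"
  unfolding lipS_def by meson
 have "norm (ricci_field m n p a - ricci_field m n p b) \<le> (L + M) * norm (a - b)"
  if "a \<in> simplex_S" "b \<in> simplex_S" for a b
 proof -
  have "norm (ricci_field m n p a - ricci_field m n p b)
    \<le> norm (fst (ricci_field m n p a - ricci_field m n p b)) + norm (snd (ricci_field m n p a - ricci_field m n p b))"
   by (metis norm_Pair_le prod.collapse)
  also have "\<dots> \<le> L * norm (a - b) + M * norm (a - b)"
   using L M that by (intro add_mono) auto
  finally show ?thesis by (simp add: distrib_right)
 qed
 then show ?thesis using that by blast
qed

text \<open>Testing the normal vector \<open>v\<close> at the three vertices gives three nonnegative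
  products of a coordinate with a slack, and they add up to 0; hence each product vanishes. Every
  component of the field contains its coordinate as a factor, so the inner product is a combination
  of such products.\<close>

lemma ricci_field_tangent:
 assumes q: "q \<in> simplex_S" and v: "\<And>b. b \<in> simplex_S ==> v \<bullet> (b - q) \<le> 0"
 shows "v \<bullet> ricci_field m n p q = 0"
proof -
 obtain x y where q': "q = (x, y)" by fastforce
 obtain v1 v2 where v': "v = (v1, v2)" by fastforce
 define z s where "z = 1 - x - y" and "s = v1 * x + v2 * y"
 have xyz: "x \<ge> 0" "y \<ge> 0" "z \<ge> 0" using q by (auto simp: q' mem_simplex_S z_def)
 have "s \<ge> 0" "v2 \<le> s" "v1 \<le> s"
  using v[of "(0, 0)"] v[of "(0, 1)"] v[of "(1, 0)"]
  by (auto simp: q' v' mem_simplex_S s_def algebra_simps)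
 then have nn: "z * s \<ge> 0" "x * (s - v1) \<ge> 0" "y * (s - v2) \<ge> 0" using xyz by simp_all
 have "z * s + x * (s - v1) + y * (s - v2) = 0" by (simp add: z_def s_def algebra_simps)
 then have zero: "z * s = 0" "x * (s - v1) = 0" "y * (s - v2) = 0" using nn by linarith+
 define F1 F2 F3 where "F1 = (1 - 2 * x) * gf m p n y x z" and "F2 = (1 - 2 * y) * gf m n p x y z"
  and "F3 = (1 - 2 * z) * gf n m p x z y"
 have sum: "x * F1 + y * F2 + z * F3 = 0"
  using gf_sum_zero[of x y z m p n] by (simp add: F1_def F2_def F3_def z_def mult.assoc)
 have "v \<bullet> ricci_field m n p q = v1 * (x * F1) + v2 * (y * F2)"
  by (simp add: q' v' ricci_field_eq F1_def F2_def z_def mult.assoc)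
 also have "\<dots> = s * (x * F1 + y * F2) - (x * (s - v1)) * F1 - (y * (s - v2)) * F2" by (simp add: algebra_simps)
 also have "\<dots> = s * (x * F1 + y * F2)" by (simp add: zero)
 also have "x * F1 + y * F2 = - (z * F3)" using sum by linarith
 also have "s * - (z * F3) = - (z * s) * F3" by simp
 also have "\<dots> = 0" by (simp add: zero)
 finally show ?thesis .
qed

lemma flow_line_unique:
 assumes "flow_line m n p \<phi>" "flow_line m n p \<psi>" "\<phi> 0 = \<psi> 0"
 shows "\<phi> = \<psi>"
proof
 fix t
 obtain L where L: "\<And>a b. a \<in> simplex_S ==> b \<in> simplex_S ==>
  norm (ricci_field m n p a - ricci_field m n p b) \<le> L * norm (a - b)"
  using ricci_field_lipschitz by blast
 have "norm (\<phi> t - \<psi> t) \<le> norm (\<phi> 0 - \<psi> 0) * exp (L * \<bar>t\<bar>)"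
  by (rule ode_continuous_dependence[OF L]) (use assms in \<open>auto simp: flow_line_def\<close>)
 then show "\<phi> t = \<psi> t" using assms(3) by simp
qed

lemma ricci_flow:
 assumes "q \<in> simplex_S"
 shows "flow_line m n p (ricci_flow m n p q)" "ricci_flow m n p q 0 = q"
proof -
 obtain L where L: "\<And>a b. a \<in> simplex_S ==> b \<in> simplex_S ==>
  norm (ricci_field m n p a - ricci_field m n p b) \<le> L * norm (a - b)"
  using ricci_field_lipschitz by blast
 obtain \<phi> where "\<phi> 0 = q" "\<And>t. \<phi> t \<in> simplex_S"
   "\<And>t. (\<phi> has_vector_derivative ricci_field m n p (\<phi> t)) (at t)"
  by (rule ode_invariant_convex[OF convex_simplex_S compact_simplex_S _ L ricci_field_tangent assms])
   (use assms in auto)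
 then have "flow_line m n p \<phi> \<and> \<phi> 0 = q" by (simp add: flow_line_def)
 then have "flow_line m n p (ricci_flow m n p q) \<and> ricci_flow m n p q 0 = q"
  unfolding ricci_flow_def
 proof (rule theI[of "\<lambda>\<phi>. flow_line m n p \<phi> \<and> \<phi> 0 = q" \<phi>])
  show "\<psi> = \<phi>" if "flow_line m n p \<psi> \<and> \<psi> 0 = q" for \<psi>
   using flow_line_unique[of m n p \<psi> \<phi>] that \<open>flow_line m n p \<phi> \<and> \<phi> 0 = q\<close> by metis
 qed
 then show "flow_line m n p (ricci_flow m n p q)" "ricci_flow m n p q 0 = q" by blast+
qed

lemma ricci_flow_continuous: "continuous_on simplex_S (\<lambda>q. ricci_flow m n p q t)"
proof -
 obtain L where L: "\<And>a b. a \<in> simplex_S ==> b \<in> simplex_S ==>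
  norm (ricci_field m n p a - ricci_field m n p b) \<le> L * norm (a - b)"
  using ricci_field_lipschitz by blast
 have "norm (ricci_flow m n p q t - ricci_flow m n p q' t) \<le> norm (q - q') * exp (L * \<bar>t\<bar>)"
  if "q \<in> simplex_S" "q' \<in> simplex_S" for q q'
  using ode_continuous_dependence[OF L, where \<phi> = "ricci_flow m n p q" and \<psi> = "ricci_flow m n p q'" and t = t]
   ricci_flow[OF that(1)] ricci_flow[OF that(2)] by (simp add: flow_line_def)
 then have "(exp (L * \<bar>t\<bar>))-lipschitz_on simplex_S (\<lambda>q. ricci_flow m n p q t)"
  by (auto simp: lipschitz_on_def dist_norm mult.commute)
 then show ?thesis by (rule lipschitz_on_continuous_on)
qed

definition coord3 :: "real \<times> real => real" where "coord3 q = 1 - fst q - snd q"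

lemma simplex_bound:
 assumes "continuous_on simplex_S f"
 obtains C where "\<And>q. q \<in> simplex_S ==> \<bar>f q :: real\<bar> \<le> C"
proof -
 have "bounded (f ` simplex_S)"
  by (intro compact_imp_bounded compact_continuous_image assms compact_simplex_S)
 then show ?thesis using that unfolding bounded_iff by auto
qed

text \<open>Each of the three coordinates satisfies an equation \<open>f' = f g\<close> with
  \<open>g\<close> bounded on the compact simplex. So positivity at time 0 persists for all times,
  and the orbit is an instance of the locale.\<close>

lemma interior_rflow:
 assumes mnp: "m > 0" "n > 0" "p > 0" and q: "q \<in> int_S"
 shows "rflow (real m) (real n) (real p) (\<lambda>t. fst (ricci_flow m n p q t)) (\<lambda>t. snd (ricci_flow m n p q t))
  (\<lambda>t. coord3 (ricci_flow m n p q t))"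
proof -
 define \<phi> where "\<phi> = ricci_flow m n p q"
 have qS: "q \<in> simplex_S" using q interior_subset by blast
 have \<phi>: "\<phi> 0 = q" "\<And>t. \<phi> t \<in> simplex_S" "\<And>t. (\<phi> has_vector_derivative ricci_field m n p (\<phi> t)) (at t)"
  using ricci_flow[OF qS, of m n p] by (auto simp: \<phi>_def flow_line_def)
 define F1 F2 F3 where "F1 q = (1 - 2 * fst q) * gf m p n (snd q) (fst q) (coord3 q)"
  and "F2 q = (1 - 2 * snd q) * gf m n p (fst q) (snd q) (coord3 q)"
  and "F3 q = (1 - 2 * coord3 q) * gf n m p (fst q) (coord3 q) (snd q)" for q
 have d1: "((\<lambda>t. fst (\<phi> t)) has_real_derivative fst (\<phi> t) * F1 (\<phi> t)) (at t)" for t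
  using bounded_linear.has_vector_derivative[OF bounded_linear_fst \<phi>(3)[of t]]
  by (simp add: ricci_field_fst F1_def coord3_def has_real_derivative_iff_has_vector_derivative mult.assoc)
 have d2: "((\<lambda>t. snd (\<phi> t)) has_real_derivative snd (\<phi> t) * F2 (\<phi> t)) (at t)" for t
  using bounded_linear.has_vector_derivative[OF bounded_linear_snd \<phi>(3)[of t]]
  by (simp add: ricci_field_snd F2_def coord3_def has_real_derivative_iff_has_vector_derivative mult.assoc)
 have d3: "((\<lambda>t. coord3 (\<phi> t)) has_real_derivative coord3 (\<phi> t) * F3 (\<phi> t)) (at t)" for t
 proof -
  have "((\<lambda>t. coord3 (\<phi> t)) has_real_derivative 0 - fst (\<phi> t) * F1 (\<phi> t) - snd (\<phi> t) * F2 (\<phi> t)) (at t)"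
   unfolding coord3_def by (intro DERIV_diff d1 d2 DERIV_const)
  moreover have "0 - fst (\<phi> t) * F1 (\<phi> t) - snd (\<phi> t) * F2 (\<phi> t) = coord3 (\<phi> t) * F3 (\<phi> t)"
   using gf_sum_zero[of "fst (\<phi> t)" "snd (\<phi> t)" "coord3 (\<phi> t)" m p n]
   by (simp add: F1_def F2_def F3_def coord3_def[of "\<phi> t"] mult.assoc)
  ultimately show ?thesis by simp
 qed
 have cont: "continuous_on simplex_S F1" "continuous_on simplex_S F2" "continuous_on simplex_S F3"
  unfolding F1_def F2_def F3_def gf_def coord3_def by (intro continuous_intros)+
 have q0: "fst q > 0" "snd q > 0" "coord3 q > 0"
  using q by (auto simp: interior_simplex_S coord3_def)
 obtain C1 C2 C3 where C: "\<And>q. q \<in> simplex_S ==> \<bar>F1 q\<bar> \<le> C1" "\<And>q. q \<in> simplex_S ==> \<bar>F2 q\<bar> \<le> C2"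
  "\<And>q. q \<in> simplex_S ==> \<bar>F3 q\<bar> \<le> C3"
  using simplex_bound[OF cont(1)] simplex_bound[OF cont(2)] simplex_bound[OF cont(3)] by metis
 have "fst (\<phi> t) > 0" "snd (\<phi> t) > 0" "coord3 (\<phi> t) > 0" for t
  using deriv_mult_self_sign[OF d1 C(1)[OF \<phi>(2)]] deriv_mult_self_sign[OF d2 C(2)[OF \<phi>(2)]]
   deriv_mult_self_sign[OF d3 C(3)[OF \<phi>(2)]] q0 \<phi>(1) by auto
 then show ?thesis
  unfolding \<phi>_def[symmetric] using mnp d1 d2 d3
  by unfold_locales (auto simp: F1_def F2_def F3_def mult.assoc coord3_def[of "\<phi> _"])
qed

lemma ricci_flow_interior:
 assumes "m > 0" "n > 0" "p > 0" "q \<in> int_S"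
 shows "ricci_flow m n p q t \<in> int_S"
 using rflow.apos[OF interior_rflow[OF assms], of t] rflow.bpos[OF interior_rflow[OF assms], of t]
  rflow.cpos[OF interior_rflow[OF assms], of t]
 by (auto simp: interior_simplex_S coord3_def case_prod_beta)

lemma tendsto_prod_iff: "(f \<longlongrightarrow> (u, v)) F \<longleftrightarrow> ((\<lambda>t. fst (f t)) \<longlongrightarrow> u) F \<and> ((\<lambda>t. snd (f t)) \<longlongrightarrow> v) F"
 using tendsto_fst[of f "(u, v)" F] tendsto_snd[of f "(u, v)" F] tendsto_Pair[of "\<lambda>t. fst (f t)" u F "\<lambda>t. snd (f t)" v]
 by auto

lemma tendsto_coord3:
 "((\<lambda>t. coord3 (f t)) \<longlongrightarrow> w) F ==> ((\<lambda>t. fst (f t)) \<longlongrightarrow> u) F ==> ((\<lambda>t. snd (f t)) \<longlongrightarrow> 1 - u - w) F"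
 "((\<lambda>t. coord3 (f t)) \<longlongrightarrow> w) F ==> ((\<lambda>t. snd (f t)) \<longlongrightarrow> v) F ==> ((\<lambda>t. fst (f t)) \<longlongrightarrow> 1 - v - w) F"
proof -
 assume w: "((\<lambda>t. coord3 (f t)) \<longlongrightarrow> w) F"
 show "((\<lambda>t. snd (f t)) \<longlongrightarrow> 1 - u - w) F" if "((\<lambda>t. fst (f t)) \<longlongrightarrow> u) F"
  using tendsto_diff[OF tendsto_diff[OF tendsto_const[of 1] that] w] by (simp add: coord3_def)
 show "((\<lambda>t. fst (f t)) \<longlongrightarrow> 1 - v - w) F" if "((\<lambda>t. snd (f t)) \<longlongrightarrow> v) F"
  using tendsto_diff[OF tendsto_diff[OF tendsto_const[of 1] that] w] by (simp add: coord3_def)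
qed

section \<open>Limits of orbits and the regions of the simplex\<close>

context
 fixes m n p :: nat
 assumes mnp: "m > 0" "n > 0" "p > 0"
begin

abbreviation "flow \<equiv> ricci_flow m n p"

lemma side_KL:
 assumes q: "q \<in> int_S" and lim: "((\<lambda>t. snd (flow q t)) \<longlongrightarrow> 1/2) at_top"
 shows "(flow q \<longlongrightarrow> pt_K) at_top \<or> (flow q \<longlongrightarrow> pt_L) at_top
  \<or> (flow q \<longlongrightarrow> pt_T m n p) at_top"
 using rflow.edge_cases[OF interior_rflow[OF mnp q]] lim
 unfolding pt_K_def pt_L_def pt_T_def tendsto_prod_iff by auto

lemma side_LM:
 assumes q: "q \<in> int_S" and lim: "((\<lambda>t. fst (flow q t)) \<longlongrightarrow> 1/2) at_top"
 shows "(flow q \<longlongrightarrow> pt_M) at_top \<or> (flow q \<longlongrightarrow> pt_L) at_top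
  \<or> (flow q \<longlongrightarrow> pt_S m n p) at_top"
 using rflow.edge_cases[OF rflow.swap_ab[OF interior_rflow[OF mnp q]]] lim
 unfolding pt_M_def pt_L_def pt_S_def tendsto_prod_iff by (auto simp: algebra_simps)

lemma side_KM:
 assumes q: "q \<in> int_S" and lim: "((\<lambda>t. coord3 (flow q t)) \<longlongrightarrow> 1/2) at_top"
 shows "(flow q \<longlongrightarrow> pt_K) at_top \<or> (flow q \<longlongrightarrow> pt_M) at_top
  \<or> (flow q \<longlongrightarrow> pt_R m n p) at_top"
proof -
 define l where "l = (real n + real m) / (2 * (real n + 2 * real m + real p))"
 have D: "real n + 2 * real m + real p > 0" using mnp by simp
 have R: "pt_R m n p = (l, 1 - l - 1/2)"
  unfolding pt_R_def l_def using D by (simp add: field_simps)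
 consider "((\<lambda>t. fst (flow q t)) \<longlongrightarrow> 0) at_top" | "((\<lambda>t. fst (flow q t)) \<longlongrightarrow> 1/2) at_top"
  | "((\<lambda>t. fst (flow q t)) \<longlongrightarrow> l) at_top"
  using rflow.edge_cases[OF rflow.swap_bc[OF interior_rflow[OF mnp q]] lim] unfolding l_def by blast
 then show ?thesis
 proof cases
  case 1
  then show ?thesis using tendsto_coord3(1)[OF lim 1] by (simp add: pt_K_def tendsto_prod_iff)
 next
  case 2
  then show ?thesis using tendsto_coord3(1)[OF lim 2] by (simp add: pt_M_def tendsto_prod_iff)
 next
  case 3
  then show ?thesis using tendsto_coord3(1)[OF lim 3] by (simp add: R tendsto_prod_iff)
 qed
qed

lemma ricci_flow_0: "q \<in> int_S ==> flow q 0 = q"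
 using ricci_flow(2) interior_subset by blast

text \<open>The cut set consists of precisely the exceptions met on the way: the three sides, which
  leave only the open corners and the open triangle; the point \<open>N\<close>, excluded in the
  triangle; and the orbits that follow a side to its Kaehler-Einstein point.\<close>

lemma forward_limits:
 assumes q: "q \<in> int_S - cut_set m n p"
 shows "(flow q \<longlongrightarrow> pt_K) at_top \<or> (flow q \<longlongrightarrow> pt_L) at_top
  \<or> (flow q \<longlongrightarrow> pt_M) at_top"
proof -
 have qi: "q \<in> int_S" using q by blast
 then have qS: "q \<in> simplex_S" using interior_subset by blast
 interpret rflow "real m" "real n" "real p" "\<lambda>t. fst (flow q t)" "\<lambda>t. snd (flow q t)"
  "\<lambda>t. coord3 (flow q t)" by (rule interior_rflow[OF mnp qi])
 have q0: "flow q 0 = q" by (rule ricci_flow_0[OF qi])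
 obtain x y where xy: "q = (x, y)" by fastforce
 have pos: "0 < x" "0 < y" "x + y < 1" using qi by (auto simp: interior_simplex_S xy)
 have nr: "\<not> (flow q \<longlongrightarrow> pt_R m n p) at_top" "\<not> (flow q \<longlongrightarrow> pt_S m n p) at_top"
  "\<not> (flow q \<longlongrightarrow> pt_T m n p) at_top" and nN: "q \<noteq> pt_N m n p"
  using q qS by (auto simp: cut_set_def stable_manifold_def)
 have "y \<noteq> 1/2"
 proof
  assume "y = 1/2"
  then have "q = (1 - 2 * x) *\<^sub>R pt_K + (2 * x) *\<^sub>R pt_L" by (simp add: xy pt_K_def pt_L_def field_simps)
  then have "q \<in> closed_segment pt_K pt_L"
   unfolding closed_segment_def using pos \<open>y = 1/2\<close> by (auto intro!: exI[of _ "2 * x"])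
  then show False using q by (simp add: cut_set_def)
 qed
 have "x \<noteq> 1/2"
 proof
  assume "x = 1/2"
  then have "q = (1 - (1 - 2 * y)) *\<^sub>R pt_L + (1 - 2 * y) *\<^sub>R pt_M" by (simp add: xy pt_L_def pt_M_def field_simps)
  then have "q \<in> closed_segment pt_L pt_M"
   unfolding closed_segment_def using pos \<open>x = 1/2\<close> by (auto intro!: exI[of _ "1 - 2 * y"])
  then show False using q by (simp add: cut_set_def)
 qed
 have "x + y \<noteq> 1/2"
 proof
  assume s: "x + y = 1/2"
  then have "q = (1 - 2 * x) *\<^sub>R pt_K + (2 * x) *\<^sub>R pt_M" by (simp add: xy pt_K_def pt_M_def field_simps)
  then have "q \<in> closed_segment pt_K pt_M"
   unfolding closed_segment_def using pos s by (auto intro!: exI[of _ "2 * x"])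
  then show False using q by (simp add: cut_set_def)
 qed
 consider "y > 1/2" | "x > 1/2" | "x + y < 1/2" | "x < 1/2" "y < 1/2" "x + y > 1/2"
  using \<open>y \<noteq> 1/2\<close> \<open>x \<noteq> 1/2\<close> \<open>x + y \<noteq> 1/2\<close> by linarith
 then show ?thesis
 proof cases
  case 1
  then have "((\<lambda>t. snd (flow q t)) \<longlongrightarrow> 1/2) at_top" using corner_to_edge 1 q0 xy by simp
  then show ?thesis using side_KL[OF qi] nr by blast
 next
  case 2
  then have "((\<lambda>t. fst (flow q t)) \<longlongrightarrow> 1/2) at_top"
   using rflow.corner_to_edge[OF swap_ab] 2 q0 xy by simp
  then show ?thesis using side_LM[OF qi] nr by blast
 next
  case 3
  then have "((\<lambda>t. coord3 (flow q t)) \<longlongrightarrow> 1/2) at_top"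
   using rflow.corner_to_edge[OF swap_bc] 3 q0 xy by (simp add: coord3_def)
  then show ?thesis using side_KM[OF qi] nr by blast
 next
  case 4
  have "\<not> (x = (real m + real n) / (2 * (real m + real n + real p)) \<and> y = (real m + real p) / (2 * (real m + real n + real p)))"
   using nN by (auto simp: xy pt_N_def algebra_simps)
  then have "((\<lambda>t. fst (flow q t)) \<longlongrightarrow> 1/2) at_top \<or> ((\<lambda>t. snd (flow q t)) \<longlongrightarrow> 1/2) at_top
    \<or> ((\<lambda>t. coord3 (flow q t)) \<longlongrightarrow> 1/2) at_top"
   using triangle_forward 4 by (auto simp: q0 coord3_def) (auto simp: xy)
  then show ?thesis using side_KL[OF qi] side_LM[OF qi] side_KM[OF qi] nr by blast
 qed
qed

lemma backward_P: assumes q: "q \<in> int_S" "snd q > 1/2"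
 shows "(flow q \<longlongrightarrow> pt_P) at_bot"
proof -
 interpret rflow "real m" "real n" "real p" "\<lambda>t. fst (flow q t)" "\<lambda>t. snd (flow q t)"
  "\<lambda>t. coord3 (flow q t)" by (rule interior_rflow[OF mnp q(1)])
 have lim: "((\<lambda>t. snd (flow q t)) \<longlongrightarrow> 1) at_bot"
  by (rule corner_backward) (use q ricci_flow_0[OF q(1)] in simp)
 have "((\<lambda>t. fst (flow q t)) \<longlongrightarrow> 0) at_bot"
 proof (rule tendsto_sandwich[of "\<lambda>_. 0" _ _ "\<lambda>t. 1 - snd (flow q t)"])
  show "((\<lambda>t. 1 - snd (flow q t)) \<longlongrightarrow> 0) at_bot" using tendsto_diff[OF tendsto_const[of 1] lim] by simp
  show "\<forall>\<^sub>F t in at_bot. fst (flow q t) \<le> 1 - snd (flow q t)"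
   using cpos by (intro always_eventually allI) (smt (verit) coord3_def)
 qed (use apos in \<open>auto intro!: always_eventually less_imp_le\<close>)
 then show ?thesis using lim by (simp add: pt_P_def tendsto_prod_iff)
qed

lemma backward_Q: assumes q: "q \<in> int_S" "fst q > 1/2"
 shows "(flow q \<longlongrightarrow> pt_Q) at_bot"
proof -
 interpret rflow "real m" "real n" "real p" "\<lambda>t. fst (flow q t)" "\<lambda>t. snd (flow q t)"
  "\<lambda>t. coord3 (flow q t)" by (rule interior_rflow[OF mnp q(1)])
 have lim: "((\<lambda>t. fst (flow q t)) \<longlongrightarrow> 1) at_bot"
  by (rule rflow.corner_backward[OF swap_ab]) (use q ricci_flow_0[OF q(1)] in simp)
 have "((\<lambda>t. snd (flow q t)) \<longlongrightarrow> 0) at_bot"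
 proof (rule tendsto_sandwich[of "\<lambda>_. 0" _ _ "\<lambda>t. 1 - fst (flow q t)"])
  show "((\<lambda>t. 1 - fst (flow q t)) \<longlongrightarrow> 0) at_bot" using tendsto_diff[OF tendsto_const[of 1] lim] by simp
  show "\<forall>\<^sub>F t in at_bot. snd (flow q t) \<le> 1 - fst (flow q t)"
   using cpos by (intro always_eventually allI) (smt (verit) coord3_def)
 qed (use bpos in \<open>auto intro!: always_eventually less_imp_le\<close>)
 then show ?thesis using lim by (simp add: pt_Q_def tendsto_prod_iff)
qed

lemma backward_O: assumes q: "q \<in> int_S" "fst q + snd q < 1/2"
 shows "(flow q \<longlongrightarrow> pt_O) at_bot"
proof -
 interpret rflow "real m" "real n" "real p" "\<lambda>t. fst (flow q t)" "\<lambda>t. snd (flow q t)"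
  "\<lambda>t. coord3 (flow q t)" by (rule interior_rflow[OF mnp q(1)])
 have lim: "((\<lambda>t. coord3 (flow q t)) \<longlongrightarrow> 1) at_bot"
  by (rule rflow.corner_backward[OF swap_bc]) (use q ricci_flow_0[OF q(1)] in \<open>simp add: coord3_def\<close>)
 have l0: "((\<lambda>t. 1 - coord3 (flow q t)) \<longlongrightarrow> 0) at_bot" using tendsto_diff[OF tendsto_const[of 1] lim] by simp
 have "((\<lambda>t. fst (flow q t)) \<longlongrightarrow> 0) at_bot" "((\<lambda>t. snd (flow q t)) \<longlongrightarrow> 0) at_bot"
  by (rule tendsto_sandwich[OF _ _ tendsto_const l0];
    use apos bpos in \<open>auto simp: less_imp_le coord3_def intro!: always_eventually\<close>)+
 then show ?thesis by (simp add: pt_O_def tendsto_prod_iff)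
qed

text \<open>The basin of an attracting vertex is the set of points whose orbit enters a fixed neighbourhood
 of it, so it is open by continuous dependence on the initial value.\<close>

definition basin :: "real \<times> real => (real \<times> real) set" where
 "basin v = {q \<in> int_S. (flow q \<longlongrightarrow> v) at_top}"

text \<open>Convergence to \<open>v\<close> brings an orbit into \<open>W\<close>, and entering
  \<open>W\<close> at any time suffices for convergence. For time 0 this says that points of
  \<open>W\<close> are in the basin themselves, so every set accumulating at \<open>v\<close> meets
  it.\<close>

lemma basin_open:
 assumes W: "open W" "v \<in> W"
  and "\<And>q T. q \<in> int_S ==> flow q T \<in> W ==> (flow q \<longlongrightarrow> v) at_top"
 shows "open (basin v)" "v \<in> closure U ==> U \<subseteq> int_S ==> U \<inter> basin v \<noteq> {}"
proof -
 have "basin v = (\<Union>T. {q \<in> int_S. flow q T \<in> W})"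
 proof (intro equalityI subsetI)
  fix q assume q: "q \<in> basin v"
  then have "\<forall>\<^sub>F t in at_top. flow q t \<in> W"
   using W unfolding basin_def by (auto intro: topological_tendstoD)
  then obtain T where "flow q T \<in> W" by (auto simp: eventually_at_top_linorder)
  then show "q \<in> (\<Union>T. {q \<in> int_S. flow q T \<in> W})" using q by (auto simp: basin_def)
 qed (use assms(3) in \<open>auto simp: basin_def\<close>)
 moreover have "open {q \<in> int_S. flow q T \<in> W}" for T
 proof -
  have "continuous_on (int_S) (\<lambda>q. flow q T)"
   using ricci_flow_continuous interior_subset continuous_on_subset by blast
  from continuous_open_preimage[OF this open_interior W(1)] show ?thesis
   by (simp add: vimage_def Int_def)
 qed
 ultimately show "open (basin v)" by auto
 assume U: "v \<in> closure U" "U \<subseteq> int_S"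
 then obtain q where "q \<in> U" "q \<in> W" using W by (meson closure_iff_nhds_not_empty disjoint_iff order_refl)
 then show "U \<inter> basin v \<noteq> {}"
  using assms(3)[of q 0] ricci_flow_0[of q] U(2) by (auto simp: basin_def)
qed

lemma basin_vertex:
 assumes v: "v \<in> {pt_K, pt_L, pt_M}"
 shows "open (basin v)" "v \<in> closure U ==> U \<subseteq> int_S ==> U \<inter> basin v \<noteq> {}"
proof -
 have pos: "real m > 0" "real n > 0" "real p > 0" using mnp by simp_all
 have "\<exists>W. open W \<and> v \<in> W \<and> (\<forall>q T. q \<in> int_S \<longrightarrow> flow q T \<in> W \<longrightarrow> (flow q \<longlongrightarrow> v) at_top)"
 proof -
  consider "v = pt_K" | "v = pt_L" | "v = pt_M" using v by blast
  then show ?thesis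
  proof cases
   case 1
   obtain \<delta> where \<delta>: "\<delta> > 0" "\<And>a b c T. rflow (real m) (real n) (real p) a b c ==> (1 - 2 * b T)\<^sup>2 + (1 - 2 * c T)\<^sup>2 < \<delta> ==>
     (b \<longlongrightarrow> 1/2) at_top \<and> (c \<longlongrightarrow> 1/2) at_top"
    using rflow_vertex_basin[OF pos] by blast
   define W where "W = {q. (1 - 2 * snd q)\<^sup>2 + (1 - 2 * coord3 q)\<^sup>2 < \<delta>}"
   have "open W" unfolding W_def coord3_def by (intro open_Collect_less continuous_intros)
   moreover have "v \<in> W" using \<delta>(1) by (simp add: 1 pt_K_def W_def coord3_def)
   moreover have "(flow q \<longlongrightarrow> v) at_top" if "q \<in> int_S" "flow q T \<in> W" for q T
    using \<delta>(2)[OF interior_rflow[OF mnp that(1)], of T] that(2)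
     tendsto_coord3(2)[of "flow q" "1/2" at_top "1/2"] by (simp add: W_def 1 pt_K_def tendsto_prod_iff)
   ultimately show ?thesis by blast
  next
   case 2
   obtain \<delta> where \<delta>: "\<delta> > 0" "\<And>a b c T. rflow (real n) (real p) (real m) a b c ==> (1 - 2 * b T)\<^sup>2 + (1 - 2 * c T)\<^sup>2 < \<delta> ==>
     (b \<longlongrightarrow> 1/2) at_top \<and> (c \<longlongrightarrow> 1/2) at_top"
    using rflow_vertex_basin[OF pos(2,3,1)] by blast
   define W where "W = {q. (1 - 2 * fst q)\<^sup>2 + (1 - 2 * snd q)\<^sup>2 < \<delta>}"
   have "open W" unfolding W_def by (intro open_Collect_less continuous_intros)
   moreover have "v \<in> W" using \<delta>(1) by (simp add: 2 pt_L_def W_def)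
   moreover have "(flow q \<longlongrightarrow> v) at_top" if "q \<in> int_S" "flow q T \<in> W" for q T
    using \<delta>(2)[OF rflow.swap_cab[OF interior_rflow[OF mnp that(1)]], of T] that(2)
    by (simp add: W_def 2 pt_L_def tendsto_prod_iff)
   ultimately show ?thesis by blast
  next
   case 3
   obtain \<delta> where \<delta>: "\<delta> > 0" "\<And>a b c T. rflow (real m) (real p) (real n) a b c ==> (1 - 2 * b T)\<^sup>2 + (1 - 2 * c T)\<^sup>2 < \<delta> ==>
     (b \<longlongrightarrow> 1/2) at_top \<and> (c \<longlongrightarrow> 1/2) at_top"
    using rflow_vertex_basin[OF pos(1,3,2)] by blast
   define W where "W = {q. (1 - 2 * fst q)\<^sup>2 + (1 - 2 * coord3 q)\<^sup>2 < \<delta>}"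
   have "open W" unfolding W_def coord3_def by (intro open_Collect_less continuous_intros)
   moreover have "v \<in> W" using \<delta>(1) by (simp add: 3 pt_M_def W_def coord3_def)
   moreover have "(flow q \<longlongrightarrow> v) at_top" if "q \<in> int_S" "flow q T \<in> W" for q T
    using \<delta>(2)[OF rflow.swap_ab[OF interior_rflow[OF mnp that(1)]], of T] that(2)
     tendsto_coord3(1)[of "flow q" "1/2" at_top "1/2"] by (simp add: W_def 3 pt_M_def tendsto_prod_iff)
   ultimately show ?thesis by blast
  qed
 qed
 then show "open (basin v)" "v \<in> closure U ==> U \<subseteq> int_S ==> U \<inter> basin v \<noteq> {}"
  using basin_open(1)[of _ v] basin_open(2)[of _ v U] by meson+
qed

lemma region_subset: "region m n p C v \<subseteq> C \<inter> int_S"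
 unfolding region_def using in_components_subset by fastforce

lemma region_forward:
 assumes v: "v \<in> {pt_K, pt_L, pt_M}" and q: "q \<in> region m n p C v"
 shows "(flow q \<longlongrightarrow> v) at_top"
proof -
 obtain U where U: "U \<in> components (int_S - cut_set m n p)" "v \<in> closure U" "q \<in> U"
  using q unfolding region_def by blast
 have sub: "U \<subseteq> int_S - cut_set m n p" by (rule in_components_subset[OF U(1)])
 \<comment> \<open>The basins of the two other vertices are merged, since connectedness compares two
   open sets.\<close>
 define B where "B = (\<Union>u\<in>{pt_K, pt_L, pt_M} - {v}. basin u)"
 have "U \<subseteq> basin v \<union> B"
  using forward_limits sub unfolding B_def basin_def by blast
 moreover have "basin v \<inter> B = {}"
  unfolding B_def basin_def using tendsto_unique[OF trivial_limit_at_top_linorder] by fastforce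
 moreover have "open B" unfolding B_def using basin_vertex(1) by blast
 ultimately have "basin v \<inter> U = {} \<or> B \<inter> U = {}"
  using connectedD[OF in_components_connected[OF U(1)] basin_vertex(1)[OF v], of B] by blast
 moreover have "U \<inter> basin v \<noteq> {}" using basin_vertex(2)[OF v U(2)] sub by blast
 ultimately have "U \<subseteq> basin v" using \<open>U \<subseteq> basin v \<union> B\<close> by blast
 then show ?thesis using U(3) by (auto simp: basin_def)
qed

lemma regions_forward:
 "q \<in> region_1 m n p \<union> region_3 m n p \<union> region_4 m n p ==> q \<in> int_S \<and> (flow q \<longlongrightarrow> pt_K) at_top"
 "q \<in> region_2 m n p \<union> region_5_6 m n p \<union> region_9 m n p ==> q \<in> int_S \<and> (flow q \<longlongrightarrow> pt_L) at_top"
 "q \<in> region_7 m n p \<union> region_8 m n p \<union> region_10 m n p ==> q \<in> int_S \<and> (flow q \<longlongrightarrow> pt_M) at_top"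
 unfolding region_1_def region_2_def region_3_def region_4_def region_5_6_def region_7_def region_8_def
  region_9_def region_10_def
 using region_forward[of pt_K q] region_forward[of pt_L q] region_forward[of pt_M q] region_subset by blast+

lemma regions_backward:
 "q \<in> region_3 m n p \<union> region_8 m n p ==> (flow q \<longlongrightarrow> pt_O) at_bot"
 "q \<in> region_1 m n p \<union> region_2 m n p ==> (flow q \<longlongrightarrow> pt_P) at_bot"
 "q \<in> region_9 m n p \<union> region_10 m n p ==> (flow q \<longlongrightarrow> pt_Q) at_bot"
proof -
 have mem_corner: "q \<in> corner_O \<longleftrightarrow> fst q + snd q < 1/2" "q \<in> corner_P \<longleftrightarrow> snd q > 1/2" "q \<in> corner_Q \<longleftrightarrow> fst q > 1/2" for q
  by (auto simp: corner_O_def corner_P_def corner_Q_def)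
 have r: "q \<in> region m n p C v ==> q \<in> C \<and> q \<in> int_S" for C v using region_subset by blast
 show "q \<in> region_3 m n p \<union> region_8 m n p ==> (flow q \<longlongrightarrow> pt_O) at_bot"
  unfolding region_3_def region_8_def using r[of corner_O pt_K] r[of corner_O pt_M] backward_O[of q]
  by (auto simp: mem_corner)
 show "q \<in> region_1 m n p \<union> region_2 m n p ==> (flow q \<longlongrightarrow> pt_P) at_bot"
  unfolding region_1_def region_2_def using r[of corner_P pt_K] r[of corner_P pt_L] backward_P[of q]
  by (auto simp: mem_corner)
 show "q \<in> region_9 m n p \<union> region_10 m n p ==> (flow q \<longlongrightarrow> pt_Q) at_bot"
  unfolding region_9_def region_10_def using r[of corner_Q pt_L] r[of corner_Q pt_M] backward_Q[of q]
  by (auto simp: mem_corner)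
qed

lemma outside_triangle_backward:
 assumes q: "q \<in> int_S - triangle_KLM"
 shows "\<exists>v\<in>{pt_O, pt_P, pt_Q}. (flow q \<longlongrightarrow> v) at_bot"
proof -
 obtain x y where xy: "q = (x, y)" by fastforce
 have "y > 1/2 \<or> x > 1/2 \<or> x + y < 1/2"
 proof (rule ccontr)
  assume "\<not> ?thesis"
  then have le: "y \<le> 1/2" "x \<le> 1/2" "x + y \<ge> 1/2" by auto
  \<comment> \<open>The barycentric coordinates with respect to \<open>K\<close>, \<open>L\<close>,
    \<open>M\<close>: each is proportional to the distance from the opposite side.\<close>
  have "q = (1 - 2 * x) *\<^sub>R pt_K + (2 * x + 2 * y - 1) *\<^sub>R pt_L + (1 - 2 * y) *\<^sub>R pt_M"
   by (simp add: xy pt_K_def pt_L_def pt_M_def field_simps)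
  then have "q \<in> triangle_KLM" unfolding triangle_KLM_def convex_hull_3 mem_Collect_eq using le
   by (intro exI[of _ "1 - 2 * x"] exI[of _ "2 * x + 2 * y - 1"] exI[of _ "1 - 2 * y"] conjI) auto
  then show False using q by blast
 qed
 then show ?thesis using backward_P[of q] backward_Q[of q] backward_O[of q] q by (auto simp: xy)
qed

end

section \<open>Linearization at the Einstein metrics\<close>

definition matrix22 :: "real => real => real => real => real \<times> real => real \<times> real" where
 "matrix22 a b c d = (\<lambda>(h, k). (a * h + b * k, c * h + d * k))"

text \<open>The components of the complex vector with real part \<open>u\<close> and imaginary part
  \<open>v\<close> are annihilated by the characteristic polynomial at \<open>\<mu>\<close>, and one
  of them is nonzero. The two equations are the real and the imaginary part of the characteristic
  equation.\<close>

lemma matrix22_eigenvalue: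
 assumes "complex_eigenvalue (matrix22 a b c d) \<mu>"
 shows "(Re \<mu>)\<^sup>2 - (Im \<mu>)\<^sup>2 - (a + d) * Re \<mu> + (a * d - b * c) = 0" "Im \<mu> * (2 * Re \<mu> - (a + d)) = 0"
proof -
 obtain u v where uv: "u \<noteq> 0 \<or> v \<noteq> 0" "matrix22 a b c d u = Re \<mu> *\<^sub>R u - Im \<mu> *\<^sub>R v"
  "matrix22 a b c d v = Im \<mu> *\<^sub>R u + Re \<mu> *\<^sub>R v"
  using assms unfolding complex_eigenvalue_def by blast
 define w1 w2 where "w1 = Complex (fst u) (fst v)" and "w2 = Complex (snd u) (snd v)"
 have 1: "of_real a * w1 + of_real b * w2 = \<mu> * w1" and 2: "of_real c * w1 + of_real d * w2 = \<mu> * w2"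
  using uv(2,3) by (auto simp: complex_eq_iff w1_def w2_def matrix22_def case_prod_beta prod_eq_iff algebra_simps)
 have ne: "w1 \<noteq> 0 \<or> w2 \<noteq> 0" using uv(1) by (auto simp: w1_def w2_def complex_eq_iff prod_eq_iff)
 define Q where "Q = \<mu>\<^sup>2 - of_real (a + d) * \<mu> + of_real (a * d - b * c)"
 have "Q * w1 = 0" "Q * w2 = 0" unfolding Q_def of_real_add of_real_mult of_real_diff using 1 2 by algebra+
 then have "Q = 0" using ne by auto
 then have "Re Q = 0" "Im Q = 0" by simp_all
 then show "(Re \<mu>)\<^sup>2 - (Im \<mu>)\<^sup>2 - (a + d) * Re \<mu> + (a * d - b * c) = 0" "Im \<mu> * (2 * Re \<mu> - (a + d)) = 0"
  by (simp_all add: Q_def power2_eq_square algebra_simps)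
qed

lemma matrix22_repelling:
 assumes "complex_eigenvalue (matrix22 a b c d) \<mu>" and tr: "a + d > 0" and dt: "a * d - b * c > 0"
 shows "Re \<mu> > 0"
proof (cases "Im \<mu> = 0")
 case True
 show ?thesis
 proof (rule ccontr)
  assume n: "\<not> Re \<mu> > 0"
  have "(a + d) * Re \<mu> \<le> 0" using n tr by (intro mult_nonneg_nonpos) auto
  then show False using matrix22_eigenvalue(1)[OF assms(1)] dt True zero_le_power2[of "Re \<mu>"] by simp
 qed
qed (use matrix22_eigenvalue(2)[OF assms(1)] tr in auto)

text \<open>The vector \<open>(b, \<rho> - a)\<close> satisfies the first row identically and the
  second by the characteristic equation. If it is zero, then the matrix is lower triangular,
  \<open>a \<noteq> d\<close> because the determinant is negative, and \<open>(a - d, c)\<close> is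
  an eigenvector.\<close>

lemma matrix22_real_eigenvalue:
 assumes "\<rho>\<^sup>2 - (a + d) * \<rho> + (a * d - b * c) = 0" and dt: "a * d - b * c < 0"
 shows "complex_eigenvalue (matrix22 a b c d) (complex_of_real \<rho>)"
proof -
 have "\<exists>u. u \<noteq> 0 \<and> matrix22 a b c d u = \<rho> *\<^sub>R u"
 proof (cases "b = 0 \<and> \<rho> = a")
  case True
  then have "a \<noteq> d" using dt by (metis diff_zero mult_zero_left not_square_less_zero)
  then show ?thesis using True
   by (intro exI[of _ "(a - d, c)"]) (auto simp: matrix22_def zero_prod_def algebra_simps)
 next
  case False
  have "c * b + d * (\<rho> - a) = \<rho> * (\<rho> - a)" using assms(1) by (simp add: power2_eq_square algebra_simps)
  then show ?thesis using False
   by (intro exI[of _ "(b, \<rho> - a)"]) (auto simp: matrix22_def zero_prod_def algebra_simps)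
 qed
 then obtain u where "u \<noteq> 0" "matrix22 a b c d u = \<rho> *\<^sub>R u" by blast
 moreover have "matrix22 a b c d 0 = 0" by (simp add: matrix22_def zero_prod_def)
 ultimately show ?thesis unfolding complex_eigenvalue_def by (intro exI[of _ u] exI[of _ 0]) simp
qed

lemma matrix22_saddle:
 assumes dt: "a * d - b * c < 0"
 shows "\<forall>\<mu>. complex_eigenvalue (matrix22 a b c d) \<mu> \<longrightarrow> Re \<mu> \<noteq> 0"
  "\<exists>\<mu>. complex_eigenvalue (matrix22 a b c d) \<mu> \<and> Re \<mu> > 0"
  "\<exists>\<mu>. complex_eigenvalue (matrix22 a b c d) \<mu> \<and> Re \<mu> < 0"
proof -
 show "\<forall>\<mu>. complex_eigenvalue (matrix22 a b c d) \<mu> \<longrightarrow> Re \<mu> \<noteq> 0"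
 proof (intro allI impI notI)
  fix \<mu> assume "complex_eigenvalue (matrix22 a b c d) \<mu>" "Re \<mu> = 0"
  then show False using matrix22_eigenvalue(1)[of a b c d \<mu>] dt zero_le_power2[of "Im \<mu>"] by simp
 qed
 define r where "r = sqrt ((a + d)\<^sup>2 - 4 * (a * d - b * c))"
 have nn: "(a + d)\<^sup>2 - 4 * (a * d - b * c) > (a + d)\<^sup>2" using dt by simp
 then have "(a + d)\<^sup>2 - 4 * (a * d - b * c) \<ge> 0" using zero_le_power2[of "a + d"] by linarith
 then have r2: "r\<^sup>2 = (a + d)\<^sup>2 - 4 * (a * d - b * c)" by (simp add: r_def)
 have "\<bar>a + d\<bar> < r" unfolding r_def using nn by (simp add: real_less_rsqrt)
 then have s: "(a + d + r) / 2 > 0" "(a + d - r) / 2 < 0" by auto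
 have "((a + d + r) / 2)\<^sup>2 - (a + d) * ((a + d + r) / 2) + (a * d - b * c) = 0"
  "((a + d - r) / 2)\<^sup>2 - (a + d) * ((a + d - r) / 2) + (a * d - b * c) = 0"
  using r2 by (simp_all add: power2_eq_square field_simps)
 note ev = this[THEN matrix22_real_eigenvalue, OF dt]
 show "\<exists>\<mu>. complex_eigenvalue (matrix22 a b c d) \<mu> \<and> Re \<mu> > 0"
  using ev(1) s(1) by (intro exI[of _ "complex_of_real ((a + d + r) / 2)"]) (simp only: Re_complex_of_real)
 show "\<exists>\<mu>. complex_eigenvalue (matrix22 a b c d) \<mu> \<and> Re \<mu> < 0"
  using ev(2) s(2) by (intro exI[of _ "complex_of_real ((a + d - r) / 2)"]) (simp only: Re_complex_of_real)
qed

section \<open>Jacobians at the four Einstein metrics\<close>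

definition G1 :: "real => real => real => real => real => real" where
 "G1 m n p x y = m * (4*y - 1) * (x + y - 1) + n * y * (4*x + 4*y - 3) + p * (x * (4*y - 1) + (1 - 2*y)^2)"

definition G2 :: "real => real => real => real => real => real" where
 "G2 m n p x y = m * (4*x - 1) * (x + y - 1) + n * (y * (4*x - 1) + (1 - 2*x)^2) + p * x * (4*x + 4*y - 3)"

lemma ricci_field_G: "ricci_field m n p q =
 (fst q * (1 - 2 * fst q) * G1 m n p (fst q) (snd q), snd q * (1 - 2 * snd q) * G2 m n p (fst q) (snd q))"
 unfolding ricci_field_def G1_def G2_def case_prod_beta by (simp add: algebra_simps)

lemma ricci_field_has_derivative:
 fixes m n p :: nat
 defines "M \<equiv> real m" and "N \<equiv> real n" and "P \<equiv> real p"
 shows "(ricci_field m n p has_derivative matrix22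
   ((1 - 4*x) * G1 M N P x y + x * (1 - 2*x) * (M * (4*y - 1) + 4 * N * y + P * (4*y - 1)))
   (x * (1 - 2*x) * (M * (4*x + 8*y - 5) + N * (4*x + 8*y - 3) + P * (4*x + 8*y - 4)))
   (y * (1 - 2*y) * (M * (8*x + 4*y - 5) + N * (8*x + 4*y - 4) + P * (8*x + 4*y - 3)))
   ((1 - 4*y) * G2 M N P x y + y * (1 - 2*y) * (M * (4*x - 1) + N * (4*x - 1) + 4 * P * x))) (at (x, y))"
proof -
 have "((\<lambda>q. fst q * (1 - 2 * fst q) * G1 M N P (fst q) (snd q)) has_derivative
   (\<lambda>q. ((1 - 4*x) * G1 M N P x y + x * (1 - 2*x) * (M * (4*y - 1) + 4 * N * y + P * (4*y - 1))) * fst q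
    + (x * (1 - 2*x) * (M * (4*x + 8*y - 5) + N * (4*x + 8*y - 3) + P * (4*x + 8*y - 4))) * snd q)) (at (x, y))"
  unfolding G1_def power2_eq_square
  by (rule derivative_eq_intros refl)+ (auto simp: fun_eq_iff algebra_simps)
 moreover have "((\<lambda>q. snd q * (1 - 2 * snd q) * G2 M N P (fst q) (snd q)) has_derivative
   (\<lambda>q. (y * (1 - 2*y) * (M * (8*x + 4*y - 5) + N * (8*x + 4*y - 4) + P * (8*x + 4*y - 3))) * fst q
    + ((1 - 4*y) * G2 M N P x y + y * (1 - 2*y) * (M * (4*x - 1) + N * (4*x - 1) + 4 * P * x)) * snd q)) (at (x, y))"
  unfolding G2_def power2_eq_square
  by (rule derivative_eq_intros refl)+ (auto simp: fun_eq_iff algebra_simps)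
 ultimately have "((\<lambda>q. (fst q * (1 - 2 * fst q) * G1 M N P (fst q) (snd q), snd q * (1 - 2 * snd q) * G2 M N P (fst q) (snd q)))
  has_derivative (\<lambda>q. (((1 - 4*x) * G1 M N P x y + x * (1 - 2*x) * (M * (4*y - 1) + 4 * N * y + P * (4*y - 1))) * fst q
    + (x * (1 - 2*x) * (M * (4*x + 8*y - 5) + N * (4*x + 8*y - 3) + P * (4*x + 8*y - 4))) * snd q,
    (y * (1 - 2*y) * (M * (8*x + 4*y - 5) + N * (8*x + 4*y - 4) + P * (8*x + 4*y - 3))) * fst q
    + ((1 - 4*y) * G2 M N P x y + y * (1 - 2*y) * (M * (4*x - 1) + N * (4*x - 1) + 4 * P * x)) * snd q))) (at (x, y))"
  by (rule has_derivative_Pair)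
 then show ?thesis
  unfolding matrix22_def case_prod_beta M_def N_def P_def
  by (subst ext[of "ricci_field m n p", OF ricci_field_G]) simp
qed

lemma pos_point:
 fixes s :: real
 assumes "s > 0" "A > 0" "A < s" "x = A / (2 * s)"
 shows "x > 0" "1 - 2 * x > 0"
proof -
 show "x > 0" using assms by simp
 have "2 * x = A / s" using assms by simp
 also have "\<dots> < 1" using assms by simp
 finally show "1 - 2 * x > 0" by simp
qed

text \<open>Covers \<open>N\<close> and \<open>R\<close>, whose coordinates have the same numerators
  over different denominators. Multiplication by \<open>4 * s\<^sup>2\<close> leaves polynomials in
  \<open>2 * s * x\<close> and \<open>2 * s * y\<close>, where the numerators can be
  inserted.\<close>

lemma G_zero:
 assumes s: "s > 0" and xs: "2 * s * x = M + N" "2 * s * y = M + P" and s_def: "s = M + N + P \<or> s = 2 * M + N + P"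
 shows "G1 M N P x y = 0" "G2 M N P x y = 0"
proof -
 have "4 * s\<^sup>2 * G1 M N P x y = M * (2 * (2 * s*y) - s) * ((2 * s*x) + (2 * s*y) - 2 * s) * 2
   + N * (2 * s*y) * (2 * (2 * s*x) + 2 * (2 * s*y) - 3 * s) * 2 + P * ((2 * s*x) * (2 * (2 * s*y) - s) * 2 + (2 * s - 2*(2 * s*y))\<^sup>2)"
  unfolding G1_def by (simp add: power2_eq_square algebra_simps)
 also have "\<dots> = 0" unfolding xs using s_def by (elim disjE) (simp_all add: power2_eq_square algebra_simps)
 finally show "G1 M N P x y = 0" using s by simp
 have "4 * s\<^sup>2 * G2 M N P x y = M * (2 * (2 * s*x) - s) * ((2 * s*x) + (2 * s*y) - 2 * s) * 2
   + N * ((2 * s*y) * (2 * (2 * s*x) - s) * 2 + (2 * s - 2*(2 * s*x))\<^sup>2) + P * (2 * s*x) * (2 * (2 * s*x) + 2 * (2 * s*y) - 3 * s) * 2"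
  unfolding G2_def by (simp add: power2_eq_square algebra_simps)
 also have "\<dots> = 0" unfolding xs using s_def by (elim disjE) (simp_all add: power2_eq_square algebra_simps)
 finally show "G2 M N P x y = 0" using s by simp
qed

text \<open>As \<open>G1\<close> and \<open>G2\<close> vanish at \<open>N\<close>, the rows of the
  Jacobian are positive multiples \<open>k\<close>, \<open>l\<close> of the gradients of
  \<open>G1\<close> and \<open>G2\<close>, whose entries are integral combinations of
  \<open>M\<close>, \<open>N\<close>, \<open>P\<close>. Trace and determinant are then visibly
  positive.\<close>

lemma pt_N_repeller:
 assumes "m > 0" "n > 0" "p > 0"
 shows "repeller (ricci_field m n p) (pt_N m n p)"
proof -
 define M N P where "M = real m" and "N = real n" and "P = real p"
 have pos: "M > 0" "N > 0" "P > 0" using assms by (simp_all add: M_def N_def P_def)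
 define s x y where "s = M + N + P" and "x = (M + N) / (2 * s)" and "y = (M + P) / (2 * s)"
 have s: "s > 0" using pos by (simp add: s_def)
 have q: "pt_N m n p = (x, y)" by (simp add: pt_N_def x_def y_def s_def M_def N_def P_def)
 have xs: "2 * s * x = M + N" "2 * s * y = M + P" using s by (simp_all add: x_def y_def)
 have G: "G1 M N P x y = 0" "G2 M N P x y = 0" by (rule G_zero[OF s xs]; simp add: s_def)+
 define k l where "k = x * (1 - 2*x)" and "l = y * (1 - 2*y)"
 have kl: "k > 0" "l > 0"
  using pos_point[OF s _ _ x_def] pos_point[OF s _ _ y_def] pos by (simp_all add: k_def l_def s_def)
 have e: "M * (4*y - 1) + 4 * N * y + P * (4*y - 1) = M + P"
  "M * (4*x + 8*y - 5) + N * (4*x + 8*y - 3) + P * (4*x + 8*y - 4) = M - N"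
  "M * (8*x + 4*y - 5) + N * (8*x + 4*y - 4) + P * (8*x + 4*y - 3) = M - P"
  "M * (4*x - 1) + N * (4*x - 1) + 4 * P * x = M + N"
  using xs unfolding s_def by (simp_all add: algebra_simps)
 have D: "(ricci_field m n p has_derivative matrix22 (k * (M + P)) (k * (M - N)) (l * (M - P)) (l * (M + N))) (at (x, y))"
  using ricci_field_has_derivative[of m n p x y]
  unfolding M_def[symmetric] N_def[symmetric] P_def[symmetric] G e by (simp add: k_def l_def)
 have tr: "k * (M + P) + l * (M + N) > 0" using kl pos by (simp add: add_pos_pos)
 have "k * (M + P) * (l * (M + N)) - k * (M - N) * (l * (M - P)) = k * l * (2 * M * (N + P))"
  by (simp add: algebra_simps)
 also have "\<dots> > 0" using kl pos by (simp add: add_pos_pos)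
 finally have dt: "k * (M + P) * (l * (M + N)) - k * (M - N) * (l * (M - P)) > 0" .
 have "ricci_field m n p (x, y) = 0"
  by (simp add: ricci_field_G M_def[symmetric] N_def[symmetric] P_def[symmetric] G zero_prod_def)
 then show ?thesis unfolding repeller_def q using D matrix22_repelling[OF _ tr dt] by blast
qed

lemma hyperbolic_saddleI:
 assumes "(F has_derivative matrix22 a b c d) (at q)" "F q = 0" "a * d - b * c < 0"
 shows "hyperbolic_saddle F q"
 unfolding hyperbolic_saddle_def using assms(1,2) matrix22_saddle[OF assms(3)] by blast

text \<open>The rows of the Jacobian are again positive multiples of the gradients of
  \<open>G1\<close> and \<open>G2\<close>, so only the sign of the determinant of these gradients
  matters. After multiplication by \<open>s\<^sup>2\<close> it is minus a sum of nonnegative terms,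
  one of them positive.\<close>

lemma pt_R_saddle:
 assumes "m > 0" "n > 0" "p > 0"
 shows "hyperbolic_saddle (ricci_field m n p) (pt_R m n p)"
proof -
 define M N P where "M = real m" and "N = real n" and "P = real p"
 have pos: "M > 0" "N > 0" "P > 0" using assms by (simp_all add: M_def N_def P_def)
 define s x y where "s = 2 * M + N + P" and "x = (M + N) / (2 * s)" and "y = (M + P) / (2 * s)"
 have s: "s > 0" using pos by (simp add: s_def)
 have q: "pt_R m n p = (x, y)" by (simp add: pt_R_def x_def y_def s_def M_def N_def P_def)
 have xs: "2 * s * x = M + N" "2 * s * y = M + P" using s by (simp_all add: x_def y_def)
 have G: "G1 M N P x y = 0" "G2 M N P x y = 0" by (rule G_zero[OF s xs]; simp add: s_def)+
 define k l where "k = x * (1 - 2*x)" and "l = y * (1 - 2*y)"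
 have kl: "k > 0" "l > 0"
  using pos_point[OF s _ _ x_def] pos_point[OF s _ _ y_def] pos by (simp_all add: k_def l_def s_def)
 define a b c d where "a = M * (4*y - 1) + 4 * N * y + P * (4*y - 1)"
  and "b = M * (4*x + 8*y - 5) + N * (4*x + 8*y - 3) + P * (4*x + 8*y - 4)"
  and "c = M * (8*x + 4*y - 5) + N * (8*x + 4*y - 4) + P * (8*x + 4*y - 3)"
  and "d = M * (4*x - 1) + N * (4*x - 1) + 4 * P * x"
 have e: "s * a = (M + P) * (N + P)" "s * d = (M + N) * (N + P)"
  "s * b = - (4 * M\<^sup>2 + 3 * M * (N + P) + N * (N + P))" "s * c = - (4 * M\<^sup>2 + 3 * M * (N + P) + P * (N + P))"
 proof -
  have "s * a = M * (2 * (2 * s*y) - s) + 2 * N * (2 * s*y) + P * (2 * (2 * s*y) - s)" unfolding a_def by (simp add: algebra_simps)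
  then show "s * a = (M + P) * (N + P)" unfolding xs by (simp add: s_def algebra_simps)
  have "s * d = M * (2 * (2 * s*x) - s) + N * (2 * (2 * s*x) - s) + 2 * P * (2 * s*x)" unfolding d_def by (simp add: algebra_simps)
  then show "s * d = (M + N) * (N + P)" unfolding xs by (simp add: s_def algebra_simps)
  have "s * b = M * (2 * (2 * s*x) + 4 * (2 * s*y) - 5 * s) + N * (2 * (2 * s*x) + 4 * (2 * s*y) - 3 * s) + P * (2 * (2 * s*x) + 4 * (2 * s*y) - 4 * s)"
   unfolding b_def by (simp add: algebra_simps)
  then show "s * b = - (4 * M\<^sup>2 + 3 * M * (N + P) + N * (N + P))" unfolding xs by (simp add: s_def power2_eq_square algebra_simps)
  have "s * c = M * (4 * (2 * s*x) + 2 * (2 * s*y) - 5 * s) + N * (4 * (2 * s*x) + 2 * (2 * s*y) - 4 * s) + P * (4 * (2 * s*x) + 2 * (2 * s*y) - 3 * s)"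
   unfolding c_def by (simp add: algebra_simps)
  then show "s * c = - (4 * M\<^sup>2 + 3 * M * (N + P) + P * (N + P))" unfolding xs by (simp add: s_def power2_eq_square algebra_simps)
 qed
 have D: "(ricci_field m n p has_derivative matrix22 (k * a) (k * b) (l * c) (l * d)) (at (x, y))"
  using ricci_field_has_derivative[of m n p x y]
  unfolding M_def[symmetric] N_def[symmetric] P_def[symmetric] G by (simp add: k_def l_def a_def b_def c_def d_def)
 have "s\<^sup>2 * (a * d - b * c) = (s * a) * (s * d) - (s * b) * (s * c)" by (simp add: power2_eq_square algebra_simps)
 also have "\<dots> = - ((4 * M\<^sup>2 + 3 * M * (N + P))\<^sup>2 + 3 * M\<^sup>2 * (N + P)\<^sup>2 + 2 * M * (N + P)^3)"
  unfolding e by (simp add: power2_eq_square power3_eq_cube algebra_simps)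
 also have "\<dots> < 0"
 proof -
  have "2 * M * (N + P)^3 > 0" "3 * M\<^sup>2 * (N + P)\<^sup>2 \<ge> 0" "(4 * M\<^sup>2 + 3 * M * (N + P))\<^sup>2 \<ge> 0"
   using pos by simp_all
  then show ?thesis by linarith
 qed
 finally have "a * d - b * c < 0" using s by (simp add: mult_less_0_iff)
 then have "k * l * (a * d - b * c) < 0" using kl by (simp add: mult_pos_neg)
 then have dt: "k * a * (l * d) - k * b * (l * c) < 0" by (simp add: algebra_simps)
 have "ricci_field m n p (x, y) = 0"
  by (simp add: ricci_field_G M_def[symmetric] N_def[symmetric] P_def[symmetric] G zero_prod_def)
 then show ?thesis unfolding q by (intro hyperbolic_saddleI[OF D _ dt])
qed

text \<open>On \<open>y = 1/2\<close> the factor \<open>1 - 2 * y\<close> removes the lower left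
  entry, so the Jacobian is triangular: it expands along the side, since \<open>s > 0\<close>, and
  contracts across it, since \<open>G2 > 0\<close>. At \<open>S\<close> the coordinates exchange
  roles.\<close>

lemma pt_T_saddle:
 assumes "m > 0" "n > 0" "p > 0"
 shows "hyperbolic_saddle (ricci_field m n p) (pt_T m n p)"
proof -
 define M N P where "M = real m" and "N = real n" and "P = real p"
 have pos: "M > 0" "N > 0" "P > 0" using assms by (simp_all add: M_def N_def P_def)
 define s x where "s = M + 2 * N + P" and "x = (M + N) / (2 * s)"
 have s: "s > 0" using pos by (simp add: s_def)
 have q: "pt_T m n p = (x, 1/2)" by (simp add: pt_T_def x_def s_def M_def N_def P_def)
 have xs: "2 * s * x = M + N" using s by (simp_all add: x_def)
 have "2 * G1 M N P x (1/2) = 2 * s * x - (M + N)" unfolding G1_def s_def by (simp add: field_simps)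
 then have G: "G1 M N P x (1/2) = 0" using xs by simp
 have "2 * s\<^sup>2 * G2 M N P x (1/2) = M * (2 * (2 * s*x) - s) * ((2 * s*x) - s)
   + N * (s * (2 * (2 * s*x) - s) + 2 * (s - (2 * s*x))\<^sup>2) + P * (2 * s*x) * (2 * (2 * s*x) - s)"
  unfolding G2_def by (simp add: power2_eq_square field_simps)
 also have "\<dots> = N * ((M + N)\<^sup>2 + (N + P)\<^sup>2 - (P - M)\<^sup>2)"
  unfolding xs unfolding s_def by (simp add: power2_eq_square algebra_simps)
 also have "\<dots> > 0"
 proof -
  have "(M + N)\<^sup>2 + (N + P)\<^sup>2 - (P - M)\<^sup>2 = 2 * N * N + 2 * M * N + 2 * N * P + 2 * M * P"
   by (simp add: power2_eq_square algebra_simps)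
  then show ?thesis using pos by (simp add: add_pos_pos)
 qed
 finally have G2: "G2 M N P x (1/2) > 0" using s by (simp add: zero_less_mult_iff)
 have k: "x * (1 - 2*x) > 0" using pos_point[OF s _ _ x_def] pos by (simp add: s_def)
 have D: "(ricci_field m n p has_derivative matrix22 (x * (1 - 2*x) * s)
   (x * (1 - 2*x) * (M * (4*x + 8*(1/2) - 5) + N * (4*x + 8*(1/2) - 3) + P * (4*x + 8*(1/2) - 4)))
   0 (- G2 M N P x (1/2))) (at (x, 1/2))"
  using ricci_field_has_derivative[of m n p x "1/2"]
  unfolding M_def[symmetric] N_def[symmetric] P_def[symmetric] G by (simp add: s_def algebra_simps)
 have "ricci_field m n p (x, 1/2) = 0"
  by (simp add: ricci_field_G M_def[symmetric] N_def[symmetric] P_def[symmetric] G zero_prod_def)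
 then show ?thesis unfolding q
  by (intro hyperbolic_saddleI[OF D]) (use k s G2 in simp_all)
qed

lemma pt_S_saddle:
 assumes "m > 0" "n > 0" "p > 0"
 shows "hyperbolic_saddle (ricci_field m n p) (pt_S m n p)"
proof -
 define M N P where "M = real m" and "N = real n" and "P = real p"
 have pos: "M > 0" "N > 0" "P > 0" using assms by (simp_all add: M_def N_def P_def)
 define s y where "s = M + N + 2 * P" and "y = (M + P) / (2 * s)"
 have s: "s > 0" using pos by (simp add: s_def)
 have q: "pt_S m n p = (1/2, y)" by (simp add: pt_S_def y_def s_def M_def N_def P_def)
 have ys: "2 * s * y = M + P" using s by (simp_all add: y_def)
 have "2 * G2 M N P (1/2) y = 2 * s * y - (M + P)" unfolding G2_def s_def by (simp add: field_simps)
 then have G: "G2 M N P (1/2) y = 0" using ys by simp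
 have "2 * s\<^sup>2 * G1 M N P (1/2) y = M * (2 * (2 * s*y) - s) * ((2 * s*y) - s)
   + N * (2 * s*y) * (2 * (2 * s*y) - s) + P * (s * (2 * (2 * s*y) - s) + 2 * (s - (2 * s*y))\<^sup>2)"
  unfolding G1_def by (simp add: power2_eq_square field_simps)
 also have "\<dots> = P * ((M + P)\<^sup>2 + (N + P)\<^sup>2 - (N - M)\<^sup>2)"
  unfolding ys unfolding s_def by (simp add: power2_eq_square algebra_simps)
 also have "\<dots> > 0"
 proof -
  have "(M + P)\<^sup>2 + (N + P)\<^sup>2 - (N - M)\<^sup>2 = 2 * P * P + 2 * M * P + 2 * N * P + 2 * M * N"
   by (simp add: power2_eq_square algebra_simps)
  then show ?thesis using pos by (simp add: add_pos_pos)
 qed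
 finally have G1: "G1 M N P (1/2) y > 0" using s by (simp add: zero_less_mult_iff)
 have k: "y * (1 - 2*y) > 0" using pos_point[OF s _ _ y_def] pos by (simp add: s_def)
 have D: "(ricci_field m n p has_derivative matrix22 (- G1 M N P (1/2) y) 0
   (y * (1 - 2*y) * (M * (8*(1/2) + 4*y - 5) + N * (8*(1/2) + 4*y - 4) + P * (8*(1/2) + 4*y - 3)))
   (y * (1 - 2*y) * s)) (at (1/2, y))"
  using ricci_field_has_derivative[of m n p "1/2" y]
  unfolding M_def[symmetric] N_def[symmetric] P_def[symmetric] G by (simp add: s_def algebra_simps)
 have "ricci_field m n p (1/2, y) = 0"
  by (simp add: ricci_field_G M_def[symmetric] N_def[symmetric] P_def[symmetric] G zero_prod_def)
 then show ?thesis unfolding q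
  by (intro hyperbolic_saddleI[OF D]) (use k s G1 in \<open>auto intro!: mult_neg_pos\<close>)
qed

section \<open>Traces and the Killing form\<close>

text \<open>\<open>trace_on\<close> refers to an unspecified basis of \<open>V\<close>. For a linear
  projection \<open>P\<close> of the ambient space onto \<open>V\<close>, orthogonal or not, the
  trace of \<open>F\<close> after \<open>P\<close> on the ambient space is the trace on
  \<open>V\<close>, and there the standard basis is at hand.\<close>

lemma trace_on_eq_sum_Basis:
 fixes V :: "'v::euclidean_space set"
 assumes V: "subspace V" and P: "linear P" "\<And>x. P x \<in> V" "\<And>x. x \<in> V ==> P x = x"
  and F: "linear F" "\<And>x. x \<in> V ==> F x \<in> V" and f: "\<And>x. x \<in> V ==> f x = F x"
 shows "trace_on V f = (\<Sum>e\<in>Basis. F (P e) \<bullet> e)"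
proof -
 define E where "E = (SOME E. independent E \<and> span E = V)"
 obtain B where "B \<subseteq> V" "independent B" "V \<subseteq> span B" using maximal_independent_subset by blast
 then have "\<exists>E. independent E \<and> span E = V" using V by (metis span_minimal subset_antisym)
 then have E: "independent E" "span E = V" unfolding E_def by (rule someI2_ex; blast)+
 have fin: "finite E" by (rule independent_imp_finite[OF E(1)])
 have EV: "b \<in> V" if "b \<in> E" for b using that E(2) span_base by blast
 \<comment> \<open>The coordinate functional of \<open>b\<close>, extended to the ambient space by
   \<open>P\<close>; summing over the standard basis turns it into its value at
   \<open>F b\<close>.\<close>
 define r where "r b x = representation E (P x) b" for b x
 have r_lin: "linear (r b)" for b
 proof (rule linearI)
  show "r b (x + y) = r b x + r b y" for x y
   using representation_add[OF E(1), of "P y" "P x"] P(2) E(2) by (simp add: r_def linear_add[OF P(1)])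
  show "r b (c *\<^sub>R x) = c *\<^sub>R r b x" for c x
   using representation_scale[OF E(1), of "P x" c] P(2) E(2) by (simp add: r_def linear_scale[OF P(1)])
 qed
 have "(\<Sum>e\<in>Basis. F (P e) \<bullet> e) = (\<Sum>e\<in>Basis. (\<Sum>b\<in>E. r b e * (F b \<bullet> e)))"
 proof (rule sum.cong[OF refl])
  fix e :: 'v
  have "P e = (\<Sum>b\<in>E. r b e *\<^sub>R b)"
   using sum_representation_eq[OF E(1), of "P e" E] P(2)[of e] E(2) fin by (simp add: r_def)
  then have "F (P e) = (\<Sum>b\<in>E. r b e *\<^sub>R F b)" by (simp add: linear_sum[OF F(1)] linear_scale[OF F(1)])
  then show "F (P e) \<bullet> e = (\<Sum>b\<in>E. r b e * (F b \<bullet> e))" by (simp add: inner_sum_left)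
 qed
 also have "\<dots> = (\<Sum>b\<in>E. \<Sum>e\<in>Basis. r b e * (F b \<bullet> e))" by (rule sum.swap)
 also have "\<dots> = (\<Sum>b\<in>E. representation E (f b) b)"
 proof (rule sum.cong[OF refl])
  fix b assume b: "b \<in> E"
  have "(\<Sum>e\<in>Basis. r b e * (F b \<bullet> e)) = r b (\<Sum>e\<in>Basis. (F b \<bullet> e) *\<^sub>R e)"
   by (simp add: linear_sum[OF r_lin] linear_scale[OF r_lin] mult.commute)
  also have "\<dots> = r b (F b)" by (simp add: euclidean_representation)
  finally show "(\<Sum>e\<in>Basis. r b e * (F b \<bullet> e)) = representation E (f b) b"
   using F(2)[OF EV[OF b]] P(3) f[OF EV[OF b]] by (simp add: r_def)
 qed
 finally show ?thesis unfolding trace_on_def E_def[symmetric] Let_def by simp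
qed

section \<open>Traces over skew-Hermitian matrices\<close>

definition unit_mat :: "'k::finite => 'k => 'k cmat" where
 "unit_mat i j = (\<chi> a b. if a = i \<and> b = j then 1 else 0)"

definition cscale :: "complex => 'k::finite cmat => 'k cmat" where
 "cscale c X = (\<chi> i j. c * X $ i $ j)"

lemma cscale_nth [simp]: "cscale c X $ i $ j = c * X $ i $ j"
 by (simp add: cscale_def)

lemma ctranspose_nth [simp]: "ctranspose X $ i $ j = cnj (X $ j $ i)"
 by (simp add: ctranspose_def)

lemma unit_mat_nth [simp]: "unit_mat i j $ a $ b = (if a = i \<and> b = j then 1 else 0)"
 by (simp add: unit_mat_def)

lemma cmat_eq_iff: "X = Y \<longleftrightarrow> (\<forall>i j. X $ i $ j = Y $ i $ j)" for X Y :: "'k::finite cmat"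
 by (simp add: vec_eq_iff)

lemma sum_Basis_vec:
 "sum h (Basis :: ('e::euclidean_space ^ 'k::finite) set) = (\<Sum>i\<in>UNIV. \<Sum>b\<in>Basis. h (axis i b))"
proof -
 have B: "(Basis :: ('e ^ 'k) set) = (\<lambda>(i, b). axis i b) ` (UNIV \<times> Basis)"
  by (auto simp: Basis_vec_def)
 have inj: "inj_on (\<lambda>(i, b). axis i b :: 'e ^ 'k) (UNIV \<times> Basis)"
  by (auto simp: inj_on_def axis_eq_axis nonzero_Basis)
 have "sum h (Basis :: ('e ^ 'k) set) = sum (h \<circ> (\<lambda>(i, b). axis i b)) (UNIV \<times> Basis)"
  unfolding B by (rule sum.reindex[OF inj])
 then show ?thesis by (simp add: sum.cartesian_product case_prod_beta o_def)
qed

lemma sum_Basis_cmat: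
 fixes g :: "'k::finite cmat => real"
 shows "(\<Sum>e\<in>Basis. g e) = (\<Sum>i\<in>UNIV. \<Sum>j\<in>UNIV. g (unit_mat i j) + g (cscale \<i> (unit_mat i j)))"
proof -
 have ax: "axis i (axis j 1) = unit_mat i j" "axis i (axis j \<i>) = cscale \<i> (unit_mat i j)" for i j :: 'k
  by (auto simp: cmat_eq_iff axis_def unit_mat_def)
 show ?thesis
  unfolding sum_Basis_vec by (simp add: sum_Basis_vec Basis_complex_def ax)
qed

lemma inner_unit_mat: "X \<bullet> unit_mat i j = Re (X $ i $ j)" "X \<bullet> cscale \<i> (unit_mat i j) = Im (X $ i $ j)"
proof -
 have ax: "cscale \<i> (unit_mat i j) = axis i (axis j \<i>)" "unit_mat i j = axis i (axis j 1)"
  by (auto simp: cmat_eq_iff axis_def unit_mat_def)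
 show "X \<bullet> unit_mat i j = Re (X $ i $ j)" unfolding ax(2) by (simp add: inner_axis inner_complex_def)
 show "X \<bullet> cscale \<i> (unit_mat i j) = Im (X $ i $ j)" unfolding ax(1) by (simp add: inner_axis inner_complex_def)
qed

definition clinear_map :: "('k::finite cmat => 'k cmat) => bool" where
 "clinear_map F \<longleftrightarrow> (\<forall>X Y. F (X + Y) = F X + F Y) \<and> (\<forall>c X. F (cscale c X) = cscale c (F X))"

lemma scaleR_cscale: "r *\<^sub>R X = cscale (of_real r) X"
 by (simp add: cmat_eq_iff complex_eq_iff)

lemma clinear_map_linear: "clinear_map F ==> linear F"
 by (rule linearI) (auto simp: clinear_map_def scaleR_cscale)

text \<open>The skew-Hermitian matrices are a real form of all complex matrices, so the real trace
  of a complex linear map over them is its complex trace. Concretely, in the contributions of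
  \<open>unit_mat i j\<close> and \<open>cscale \<i> (unit_mat i j)\<close> the parts from the
  transposed position cancel.\<close>

lemma sum_Basis_skew_part:
 assumes F: "clinear_map F"
 shows "(\<Sum>e\<in>Basis. F ((1/2) *\<^sub>R (e - ctranspose e)) \<bullet> e) = (\<Sum>i\<in>UNIV. \<Sum>j\<in>UNIV. Re (F (unit_mat i j) $ i $ j))"
proof -
 note lin = clinear_map_linear[OF F]
 have cs: "F (cscale c X) = cscale c (F X)" for c X using F by (simp add: clinear_map_def)
 have 1: "ctranspose (unit_mat i j) = unit_mat j i" "ctranspose (cscale \<i> (unit_mat i j)) = - cscale \<i> (unit_mat j i)"
  for i j :: 'a by (auto simp: cmat_eq_iff)
 show ?thesis unfolding sum_Basis_cmat
 proof (intro sum.cong refl)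
  fix i j :: 'a
  show "F ((1/2) *\<^sub>R (unit_mat i j - ctranspose (unit_mat i j))) \<bullet> unit_mat i j
   + F ((1/2) *\<^sub>R (cscale \<i> (unit_mat i j) - ctranspose (cscale \<i> (unit_mat i j)))) \<bullet> cscale \<i> (unit_mat i j)
   = Re (F (unit_mat i j) $ i $ j)"
   unfolding 1 inner_unit_mat linear_scale[OF lin] linear_diff[OF lin] linear_add[OF lin] linear_neg[OF lin] cs
   by (simp add: field_simps)
 qed
qed

lemma bracket_nth: "bracket X Y $ i $ j = (\<Sum>l\<in>UNIV. X $ i $ l * Y $ l $ j - Y $ i $ l * X $ l $ j)"
 by (simp add: bracket_def matrix_matrix_mult_def sum_subtractf)

lemma matrix_mul_unit_mat:
 "(A ** unit_mat i j) $ a $ b = (if b = j then A $ a $ i else 0)"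
 "(unit_mat i j ** A) $ a $ b = (if a = i then A $ j $ b else 0)" for A :: "'k::finite cmat"
 by (simp_all add: matrix_matrix_mult_def if_distrib[of "\<lambda>x. _ * x"] if_distrib[of "\<lambda>x. x * _"] cong: if_cong
   flip: if_if_eq_conj)

lemma ctranspose_mult: "ctranspose (A ** B) = ctranspose B ** ctranspose A"
 by (simp add: cmat_eq_iff matrix_matrix_mult_def mult.commute)

lemma ctranspose_simps [simp]: "ctranspose (ctranspose A) = A" "ctranspose (A + B) = ctranspose A + ctranspose B"
 "ctranspose (A - B) = ctranspose A - ctranspose B" "ctranspose (- A) = - ctranspose A"
 "ctranspose (r *\<^sub>R A) = r *\<^sub>R ctranspose A" "ctranspose (mat 1) = mat 1"
 by (auto simp: cmat_eq_iff mat_def)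

lemma matrix_mult_diff: "A ** (B - C) = A ** B - A ** C" "(A - B) ** C = A ** C - B ** C" for A B C :: "'k::finite cmat"
 by (simp_all add: cmat_eq_iff matrix_matrix_mult_def algebra_simps sum_subtractf)

lemma trace_scaleR: "trace (r *\<^sub>R A) = r *\<^sub>R trace A" for A :: "'k::finite cmat"
 by (simp add: trace_def scaleR_sum_right)

lemma matrix_mult_minus: "(- A) ** B = - (A ** B)" "A ** (- B) = - (A ** B)" for A B :: "'k::finite cmat"
 by (simp_all add: cmat_eq_iff matrix_matrix_mult_def sum_negf)

lemma su_iff: "X \<in> su \<longleftrightarrow> ctranspose X = - X \<and> trace X = 0"
 by (simp add: su_def)

lemma subspace_su: "subspace (su :: 'k::finite cmat set)"
proof (rule subspaceI)
 show "0 \<in> (su :: 'k cmat set)" by (auto simp: su_iff trace_def cmat_eq_iff)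
 show "X + Y \<in> su" if "X \<in> su" "Y \<in> su" for X Y :: "'k cmat"
  using that by (simp add: su_iff trace_add)
 show "c *\<^sub>R X \<in> su" if "X \<in> su" for c and X :: "'k cmat"
  using that by (simp add: su_iff trace_scaleR)
qed

lemma bracket_su: "X \<in> su ==> Y \<in> su ==> bracket X Y \<in> su"
proof -
 assume X: "X \<in> su" and Y: "Y \<in> su"
 have "ctranspose (bracket X Y) = - bracket X Y"
  using X Y by (simp add: bracket_def ctranspose_mult su_iff matrix_mult_minus)
 moreover have "trace (bracket X Y) = 0" by (simp add: bracket_def trace_sub trace_mul_sym[of X Y])
 ultimately show ?thesis by (simp add: su_iff)
qed

text \<open>The right side is \<open>2 k Re (tr (X Y))\<close> for size \<open>k\<close>. The double
  bracket extends complex linearly to all matrices and kills the scalar ones, so its trace over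
  \<open>su\<close> is the trace over all matrices. Each of the four terms of the double commutator
  is a product of two traces, and those containing \<open>trace X\<close> or \<open>trace Y\<close>
  vanish.\<close>

lemma killing_form_eq:
 fixes X Y :: "'k::finite cmat"
 assumes "X \<in> su" "Y \<in> su"
 shows "killing_form X Y = 2 * real CARD('k) * (\<Sum>i\<in>UNIV. \<Sum>j\<in>UNIV. Re (X $ i $ j * Y $ j $ i))"
proof -
 define F where "F Z = bracket X (bracket Y Z)" for Z
 define k where "k = real CARD('k)"
 have k: "k > 0" by (simp add: k_def)
 define S :: "'k cmat => 'k cmat" where "S Z = (1/2) *\<^sub>R (Z - ctranspose Z)" for Z
 define P where "P Z = S Z - cscale (trace (S Z) / of_real k) (mat 1)" for Z
 have Fc: "clinear_map F"
  unfolding clinear_map_def F_def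
  by (auto simp: cmat_eq_iff bracket_nth sum.distrib sum_subtractf sum_distrib_left algebra_simps)
 \<comment> \<open>Hence removing the trace part in the projection \<open>P\<close> does not change
   the sum, and only the skew part \<open>S\<close> remains.\<close>
 have Fmat: "F (Z - cscale c (mat 1)) = F Z" for Z c
 proof -
  have "F (cscale c (mat 1)) = 0"
  proof -
   have "bracket Y (cscale c (mat 1)) = 0"
    by (auto simp: cmat_eq_iff bracket_nth mat_def sum_subtractf if_distrib[of "\<lambda>x. _ * x"] if_distrib[of "\<lambda>x. x * _"]
      cong: if_cong)
   then show ?thesis by (simp add: F_def bracket_def)
  qed
  then show ?thesis using linear_diff[OF clinear_map_linear[OF Fc]] by simp
 qed
 have tr_lin: "trace (A + B) = trace A + trace B" "trace (r *\<^sub>R A) = of_real r * trace A" for A B :: "'k cmat" and r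
  by (simp_all only: trace_add trace_scaleR scaleR_conv_of_real[where 'a = complex])
 have S_lin: "S (A + B) = S A + S B" "S (r *\<^sub>R A) = r *\<^sub>R S A" for A B r
  unfolding S_def by (simp_all add: algebra_simps)
 have Plin: "linear P"
 proof (rule linearI)
  show "P (A + B) = P A + P B" for A B
   unfolding P_def S_lin tr_lin by (simp add: cmat_eq_iff algebra_simps add_divide_distrib)
  show "P (r *\<^sub>R A) = r *\<^sub>R P A" for r A
   unfolding P_def S_lin tr_lin by (simp add: cmat_eq_iff algebra_simps scaleR_cscale)
 qed
 have trS: "cnj (trace (S Z)) = - trace (S Z)" for Z
  unfolding trace_def S_def by (simp add: sum_negf[symmetric] scaleR_cscale algebra_simps)
 have Pin: "P Z \<in> su" for Z
 proof -
  have "trace (cscale c (mat 1 :: 'k cmat)) = of_real k * c" for c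
   by (simp add: trace_def mat_def k_def)
  then have "trace (P Z) = 0" using k by (simp add: P_def trace_sub)
  moreover have "ctranspose (P Z) = - P Z"
   using trS[of Z] by (auto simp: P_def cmat_eq_iff S_def mat_def scaleR_cscale algebra_simps)
  ultimately show ?thesis by (simp add: su_iff)
 qed
 have Pid: "P Z = Z" if "Z \<in> su" for Z
 proof -
  have "S Z = Z" using that by (simp add: S_def su_iff scaleR_2[symmetric])
  moreover have "trace Z = 0" using that by (simp add: su_iff)
  ultimately have "P Z = Z - cscale 0 (mat 1)" by (simp add: P_def)
  then show ?thesis by (simp add: cmat_eq_iff)
 qed
 have "killing_form X Y = (\<Sum>e\<in>Basis. F (P e) \<bullet> e)"
  unfolding killing_form_def
  by (rule trace_on_eq_sum_Basis[OF subspace_su Plin Pin Pid clinear_map_linear[OF Fc]])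
   (use assms bracket_su in \<open>auto simp: F_def\<close>)
 also have "\<dots> = (\<Sum>e\<in>Basis. F (S e) \<bullet> e)" unfolding P_def Fmat ..
 also have "\<dots> = (\<Sum>i\<in>UNIV. \<Sum>j\<in>UNIV. Re (F (unit_mat i j) $ i $ j))"
  unfolding S_def by (rule sum_Basis_skew_part[OF Fc])
 also have "\<dots> = (\<Sum>i\<in>UNIV. \<Sum>j\<in>UNIV. Re ((X ** Y) $ i $ i - X $ i $ i * Y $ j $ j - Y $ i $ i * X $ j $ j + (Y ** X) $ j $ j))"
 proof (intro sum.cong refl arg_cong[where f = Re])
  fix i j :: 'k
  have "F (unit_mat i j) = X ** Y ** unit_mat i j - X ** unit_mat i j ** Y - Y ** unit_mat i j ** X + unit_mat i j ** (Y ** X)"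
   by (simp add: F_def bracket_def matrix_mul_assoc matrix_mult_diff)
  moreover have "(A ** unit_mat i j ** B) $ i $ j = A $ i $ i * B $ j $ j" for A B :: "'k cmat"
  proof -
   have "(A ** unit_mat i j ** B) $ i $ j = (\<Sum>l\<in>UNIV. (A ** unit_mat i j) $ i $ l * B $ l $ j)"
    by (simp add: matrix_matrix_mult_def)
   also have "\<dots> = A $ i $ i * B $ j $ j"
    unfolding matrix_mul_unit_mat by (simp add: if_distrib[of "\<lambda>x. x * _"] cong: if_cong)
   finally show ?thesis .
  qed
  ultimately show "F (unit_mat i j) $ i $ j = (X ** Y) $ i $ i - X $ i $ i * Y $ j $ j - Y $ i $ i * X $ j $ j + (Y ** X) $ j $ j"
   by (simp add: matrix_mul_unit_mat)
 qed
 also have "\<dots> = Re (of_real k * trace (X ** Y) - 2 * (trace X * trace Y) + of_real k * trace (Y ** X))"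
 proof -
  have "(\<Sum>i\<in>UNIV. \<Sum>j\<in>UNIV. a i - b i * c j - d i * e j + f j)
    = of_real k * sum a UNIV - sum b UNIV * sum c UNIV - sum d UNIV * sum e UNIV + of_real k * sum f UNIV"
   for a b c d e f :: "'k => complex"
   unfolding sum_product by (simp add: sum.distrib sum_subtractf k_def flip: sum_distrib_left[of "of_nat CARD('k)"])
  from this[of "\<lambda>i. (X ** Y) $ i $ i" "\<lambda>i. X $ i $ i" "\<lambda>i. Y $ i $ i" "\<lambda>i. Y $ i $ i" "\<lambda>i. X $ i $ i" "\<lambda>i. (Y ** X) $ i $ i"]
  have "(\<Sum>i\<in>UNIV. \<Sum>j\<in>UNIV. (X ** Y) $ i $ i - X $ i $ i * Y $ j $ j - Y $ i $ i * X $ j $ j + (Y ** X) $ j $ j)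
    = of_real k * trace (X ** Y) - 2 * (trace X * trace Y) + of_real k * trace (Y ** X)"
   by (simp add: trace_def)
  then show ?thesis by (simp only: Re_sum[symmetric])
 qed
 also have "\<dots> = 2 * k * Re (trace (X ** Y))"
  using assms by (simp add: su_iff trace_mul_sym[of Y X])
 also have "Re (trace (X ** Y)) = (\<Sum>i\<in>UNIV. \<Sum>j\<in>UNIV. Re (X $ i $ j * Y $ j $ i))"
  by (simp add: trace_def matrix_matrix_mult_def)
 finally show ?thesis by (simp add: k_def)
qed

section \<open>Invariant metrics in coordinates\<close>

text \<open>The metric parameter of an off-diagonal block pair, with the value 0 inside a block. It
  turns every invariant metric into a weighted sum over matrix entries.\<close>

definition wt :: "real \<times> real => block => block => real" where
 "wt q a b = (if a = b then 0 else if {a, b} = {First, Second} then fst q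
  else if {a, b} = {First, Third} then snd q else 1 - fst q - snd q)"

lemma wt_simps [simp]:
 "wt q a a = 0" "wt q First Second = fst q" "wt q Second First = fst q" "wt q First Third = snd q"
 "wt q Third First = snd q" "wt q Second Third = 1 - fst q - snd q" "wt q Third Second = 1 - fst q - snd q"
 by (auto simp: wt_def doubleton_eq_iff)

lemma wt_sym: "wt q a b = wt q b a"
 by (cases a; cases b) simp_all

lemma wt_pos: "q \<in> int_S ==> a \<noteq> b ==> wt q a b > 0"
 by (cases a; cases b; auto simp: interior_simplex_S)

definition skew :: "'k::finite cmat => bool" where "skew X \<longleftrightarrow> ctranspose X = - X"

lemma skew_nth: "skew X ==> X $ j $ i = - cnj (X $ i $ j)"
proof -
 assume "skew X"
 then have "ctranspose X $ j $ i = (- X) $ j $ i" by (simp only: skew_def)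
 then show "X $ j $ i = - cnj (X $ i $ j)" by simp
qed

lemma skew_cnj: "skew X ==> cnj (X $ j $ i) = - X $ i $ j"
 using skew_nth[of X i j] by simp

lemma skewI: "(\<And>i j. cnj (X $ j $ i) = - X $ i $ j) ==> skew X"
 by (simp add: skew_def cmat_eq_iff)

lemma summand_part_su:
 assumes "skew X" "a \<noteq> b" shows "summand_part bl a b X \<in> su"
proof -
 have "trace (summand_part bl a b X) = 0"
  using assms(2) by (auto simp: trace_def summand_part_def intro!: sum.neutral)
 moreover have "ctranspose (summand_part bl a b X) = - summand_part bl a b X"
  using skew_cnj[OF assms(1)] by (auto simp: cmat_eq_iff summand_part_def insert_commute)
 ultimately show ?thesis by (simp add: su_iff)
qed

lemma neg_killing_eq:
 fixes X Y :: "'k::finite cmat"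
 assumes "X \<in> su" "Y \<in> su"
 shows "neg_killing X Y = 2 * real CARD('k) * (\<Sum>i\<in>UNIV. \<Sum>j\<in>UNIV. Re (X $ i $ j * cnj (Y $ i $ j)))"
proof -
 have "skew Y" using assms(2) by (simp add: su_iff skew_def)
 then have "X $ i $ j * Y $ j $ i = - (X $ i $ j * cnj (Y $ i $ j))" for i j
  using skew_cnj[of Y i j] by simp
 then have "Re (X $ i $ j * Y $ j $ i) = - Re (X $ i $ j * cnj (Y $ i $ j))" for i j
  by (simp only: uminus_complex.simps)
 then show ?thesis unfolding neg_killing_def killing_form_eq[OF assms] by (simp only: sum_negf)
qed

lemma flag_metric_eq:
 fixes X Y :: "'k::finite cmat"
 assumes "skew X" "skew Y"
 shows "flag_metric bl q X Y
  = 2 * real CARD('k) * (\<Sum>i\<in>UNIV. \<Sum>j\<in>UNIV. wt q (bl i) (bl j) * Re (X $ i $ j * cnj (Y $ i $ j)))"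
proof -
 obtain x y where q: "q = (x, y)" by fastforce
 have nk: "neg_killing (summand_part bl a b X) (summand_part bl a b Y) = 2 * real CARD('k) *
   (\<Sum>i\<in>UNIV. \<Sum>j\<in>UNIV. (if {bl i, bl j} = {a, b} then 1 else 0) * Re (X $ i $ j * cnj (Y $ i $ j)))" if "a \<noteq> b" for a b
  unfolding neg_killing_eq[OF summand_part_su[OF assms(1) that] summand_part_su[OF assms(2) that]]
  by (auto simp: summand_part_def intro!: sum.cong)
 have w: "wt (x, y) a b = x * (if {a, b} = {First, Second} then 1 else 0) + y * (if {a, b} = {First, Third} then 1 else 0)
   + (1 - x - y) * (if {a, b} = {Second, Third} then 1 else 0)" for a b
  by (cases a; cases b; simp add: doubleton_eq_iff)
 have lin: "x * (K * (\<Sum>i\<in>UNIV. \<Sum>j\<in>UNIV. A i j * g i j)) + y * (K * (\<Sum>i\<in>UNIV. \<Sum>j\<in>UNIV. B i j * g i j))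
   + z * (K * (\<Sum>i\<in>UNIV. \<Sum>j\<in>UNIV. C i j * g i j))
   = K * (\<Sum>i\<in>UNIV. \<Sum>j\<in>UNIV. (x * A i j + y * B i j + z * C i j) * g i j)"
  for x y z K :: real and A B C g :: "'k => 'k => real"
  by (simp add: sum_distrib_left sum.distrib algebra_simps)
 show ?thesis
  unfolding flag_metric_def q prod.case w
  by (simp only: nk block.distinct not_False_eq_True lin)
qed

section \<open>The Ricci curvature\<close>

abbreviation isotropy_m ("\<mm>") where "\<mm> \<equiv> isotropy_complement"

lemma complement_part_nth [simp]: "complement_part bl X $ i $ j = (if bl i = bl j then 0 else X $ i $ j)"
 by (simp add: complement_part_def)

lemma mem_isotropy_complement:
 "X \<in> \<mm> bl \<longleftrightarrow> skew X \<and> (\<forall>i j. bl i = bl j \<longrightarrow> X $ i $ j = 0)"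
 by (auto simp: isotropy_complement_def su_iff skew_def trace_def intro!: sum.neutral)

lemma subspace_isotropy_complement: "subspace (\<mm> bl)"
 by (rule subspaceI) (auto simp: mem_isotropy_complement skew_def, simp add: cmat_eq_iff)

lemma bracket_skew: "skew X ==> skew Y ==> skew (bracket X Y)"
 by (simp add: skew_def bracket_def ctranspose_mult matrix_mult_minus)

lemma complement_part_skew: "skew X ==> complement_part bl X \<in> \<mm> bl"
 by (auto simp: mem_isotropy_complement skew_cnj intro!: skewI)

text \<open>Renaming summation indices plays the role of the cyclicity of the trace once the
  products carry block weights.\<close>

lemma sum3_rotate:
 fixes f :: "'k::finite => 'k => 'k => 'b::comm_monoid_add"
 shows "(\<Sum>i\<in>UNIV. \<Sum>j\<in>UNIV. \<Sum>l\<in>UNIV. f i j l) = (\<Sum>i\<in>UNIV. \<Sum>j\<in>UNIV. \<Sum>l\<in>UNIV. f j l i)"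
  and "(\<Sum>i\<in>UNIV. \<Sum>j\<in>UNIV. \<Sum>l\<in>UNIV. f i j l) = (\<Sum>i\<in>UNIV. \<Sum>j\<in>UNIV. \<Sum>l\<in>UNIV. f l i j)"
  and "(\<Sum>i\<in>UNIV. \<Sum>j\<in>UNIV. \<Sum>l\<in>UNIV. f i j l) = (\<Sum>i\<in>UNIV. \<Sum>j\<in>UNIV. \<Sum>l\<in>UNIV. f i l j)"
  and "(\<Sum>i\<in>UNIV. \<Sum>j\<in>UNIV. \<Sum>l\<in>UNIV. f i j l) = (\<Sum>i\<in>UNIV. \<Sum>j\<in>UNIV. \<Sum>l\<in>UNIV. f l j i)"
proof -
 have a: "(\<Sum>i\<in>UNIV. \<Sum>j\<in>UNIV. \<Sum>l\<in>UNIV. g i j l) = (\<Sum>i\<in>UNIV. \<Sum>j\<in>UNIV. \<Sum>l\<in>UNIV. g i l j)" for g :: "'k => 'k => 'k => 'b"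
  by (rule sum.cong[OF refl]) (rule sum.swap)
 have b: "(\<Sum>i\<in>UNIV. \<Sum>j\<in>UNIV. \<Sum>l\<in>UNIV. g i j l) = (\<Sum>i\<in>UNIV. \<Sum>j\<in>UNIV. \<Sum>l\<in>UNIV. g j i l)" for g :: "'k => 'k => 'k => 'b"
  by (rule sum.swap)
 show "(\<Sum>i\<in>UNIV. \<Sum>j\<in>UNIV. \<Sum>l\<in>UNIV. f i j l) = (\<Sum>i\<in>UNIV. \<Sum>j\<in>UNIV. \<Sum>l\<in>UNIV. f i l j)" by (rule a)
 show "(\<Sum>i\<in>UNIV. \<Sum>j\<in>UNIV. \<Sum>l\<in>UNIV. f i j l) = (\<Sum>i\<in>UNIV. \<Sum>j\<in>UNIV. \<Sum>l\<in>UNIV. f j l i)"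
  by (rule trans[OF a[of f] b[of "\<lambda>i j l. f i l j"]])
 show "(\<Sum>i\<in>UNIV. \<Sum>j\<in>UNIV. \<Sum>l\<in>UNIV. f i j l) = (\<Sum>i\<in>UNIV. \<Sum>j\<in>UNIV. \<Sum>l\<in>UNIV. f l i j)"
  by (rule trans[OF b[of f] a[of "\<lambda>i j l. f j i l"]])
 show "(\<Sum>i\<in>UNIV. \<Sum>j\<in>UNIV. \<Sum>l\<in>UNIV. f i j l) = (\<Sum>i\<in>UNIV. \<Sum>j\<in>UNIV. \<Sum>l\<in>UNIV. f l j i)"
  by (rule trans[OF trans[OF b[of f] a[of "\<lambda>i j l. f j i l"]] b[of "\<lambda>i j l. f l i j"]])
qed

text \<open>Skewness removes the conjugate, so the sum consists of plain products of entries, which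
  can be rearranged by renaming indices.\<close>

lemma flag_metric_eq_trace:
 fixes X Y :: "'k::finite cmat"
 assumes "skew X" "skew Y"
 shows "flag_metric bl q X Y
  = - 2 * real CARD('k) * Re (\<Sum>i\<in>UNIV. \<Sum>j\<in>UNIV. of_real (wt q (bl i) (bl j)) * (X $ i $ j * Y $ j $ i))"
proof -
 have "of_real (wt q (bl i) (bl j)) * (X $ i $ j * Y $ j $ i)
   = - (of_real (wt q (bl i) (bl j)) * (X $ i $ j * cnj (Y $ i $ j)))" for i j
  using skew_cnj[OF assms(2), of i j] by simp
 then have "Re (\<Sum>i\<in>UNIV. \<Sum>j\<in>UNIV. of_real (wt q (bl i) (bl j)) * (X $ i $ j * Y $ j $ i))
   = - (\<Sum>i\<in>UNIV. \<Sum>j\<in>UNIV. wt q (bl i) (bl j) * Re (X $ i $ j * cnj (Y $ i $ j)))"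
  by (simp only: sum_negf Re_sum uminus_complex.simps Re_complex_of_real times_complex.simps Im_complex_of_real mult_zero_left diff_zero)
 then show ?thesis unfolding flag_metric_eq[OF assms] by simp
qed

lemma flag_metric_sym: "skew X ==> skew Y ==> flag_metric bl q X Y = flag_metric bl q Y X"
 by (simp add: flag_metric_eq mult.commute)

lemma flag_metric_diff:
 assumes "skew X" "skew Y" "skew Z"
 shows "flag_metric bl q (X - Y) Z = flag_metric bl q X Z - flag_metric bl q Y Z"
proof -
 have sk: "skew (X - Y)" using assms by (simp add: skew_def)
 show ?thesis
  unfolding flag_metric_eq[OF assms(1,3)] flag_metric_eq[OF assms(2,3)] flag_metric_eq[OF sk assms(3)]
  by (simp only: vector_minus_component left_diff_distrib minus_complex.simps right_diff_distrib sum_subtractf)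
qed

lemma flag_metric_zero:
 assumes q: "q \<in> int_S" and X: "X \<in> \<mm> bl" and z: "flag_metric bl q X X = 0"
 shows "X = 0"
proof -
 have sk: "skew X" using X by (simp add: mem_isotropy_complement)
 have wn: "wt q a b \<ge> 0" for a b using wt_pos[OF q, of a b] by (cases "a = b") auto
 have cn: "Re (x * cnj x) \<ge> 0" for x by (simp add: complex_mult_cnj)
 have "(\<Sum>i\<in>UNIV. \<Sum>j\<in>UNIV. wt q (bl i) (bl j) * Re (X $ i $ j * cnj (X $ i $ j))) = 0"
  using z by (simp add: flag_metric_eq[OF sk sk])
 then have "\<forall>i. (\<Sum>j\<in>UNIV. wt q (bl i) (bl j) * Re (X $ i $ j * cnj (X $ i $ j))) = 0"
  by (subst (asm) sum_nonneg_eq_0_iff) (auto intro!: sum_nonneg mult_nonneg_nonneg wn cn)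
 then have "\<forall>i j. wt q (bl i) (bl j) * Re (X $ i $ j * cnj (X $ i $ j)) = 0"
  by (subst (asm) sum_nonneg_eq_0_iff) (auto intro!: mult_nonneg_nonneg wn cn)
 then have "X $ i $ j = 0" if "bl i \<noteq> bl j" for i j
  using wt_pos[OF q that] by (force simp: complex_mult_cnj sum_power2_eq_zero_iff complex_eq_iff)
 then show ?thesis using X by (auto simp: cmat_eq_iff mem_isotropy_complement)
qed

text \<open>Nomizu's \<open>U\<close> in closed form, obtained by comparing the coefficients of the
  entries of \<open>Z\<close> in its defining equation. The diagonal blocks are set to 0, where the
  denominator would vanish.\<close>

definition nomizu_mat :: "('k::finite => block) => real \<times> real => 'k cmat => 'k cmat => 'k cmat" where
 "nomizu_mat bl q X Y = (\<chi> i j. if bl i = bl j then 0 else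
   \<Sum>l\<in>UNIV. of_real ((wt q (bl l) (bl j) - wt q (bl i) (bl l)) / (2 * wt q (bl i) (bl j)))
    * (X $ i $ l * Y $ l $ j + Y $ i $ l * X $ l $ j))"

lemma nomizu_mat_complement:
 assumes "skew X" "skew Y" shows "nomizu_mat bl q X Y \<in> \<mm> bl"
proof -
 have "skew (nomizu_mat bl q X Y)"
 proof (rule skewI)
  fix i j
  show "cnj (nomizu_mat bl q X Y $ j $ i) = - nomizu_mat bl q X Y $ i $ j"
   unfolding nomizu_mat_def
   by (auto simp: skew_cnj[OF assms(1)] skew_cnj[OF assms(2)] sum_negf[symmetric] wt_sym[of q "bl j"] wt_sym[of q _ "bl i"]
     intro!: sum.cong) (simp add: field_simps diff_divide_distrib)
 qed
 then show ?thesis by (simp add: mem_isotropy_complement nomizu_mat_def)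
qed

text \<open>Existence is the closed form: renaming indices collects both sides of the defining
  equation as coefficients of \<open>Z $ j $ i\<close>. Uniqueness is the definiteness of the metric
  on the complement, tested with the difference of two solutions.\<close>

lemma nomizu_U_eq:
 fixes X Y :: "'k::finite cmat"
 assumes q: "q \<in> int_S" and X: "X \<in> \<mm> bl" and Y: "Y \<in> \<mm> bl"
 shows "nomizu_U bl q X Y = nomizu_mat bl q X Y"
 unfolding nomizu_U_def
proof (rule the_equality)
 have sk: "skew X" "skew Y" using X Y by (auto simp: mem_isotropy_complement)
 note Um = nomizu_mat_complement[OF sk, of bl q]
 show *: "nomizu_mat bl q X Y \<in> \<mm> bl \<and> (\<forall>Z\<in>\<mm> bl.
   2 * flag_metric bl q (nomizu_mat bl q X Y) Z = flag_metric bl q (complement_part bl (bracket Z X)) Y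
    + flag_metric bl q X (complement_part bl (bracket Z Y)))"
 proof (intro conjI ballI Um)
  fix Z assume Z: "Z \<in> \<mm> bl"
  then have skZ: "skew Z" by (simp add: mem_isotropy_complement)
  define K where "K = - 2 * real CARD('k)"
  define w where "w i j = complex_of_real (wt q (bl i) (bl j))" for i j
  have ws: "w i j = w j i" for i j by (simp add: w_def wt_sym)
  have C: "skew (complement_part bl (bracket Z A))" if "skew A" for A
   using complement_part_skew[OF bracket_skew[OF skZ that]] by (simp add: mem_isotropy_complement)
  have gC: "flag_metric bl q (complement_part bl (bracket Z A)) B
    = K * Re (\<Sum>i\<in>UNIV. \<Sum>j\<in>UNIV. \<Sum>l\<in>UNIV. w i j * (Z $ i $ l * A $ l $ j * B $ j $ i) - w i j * (A $ i $ l * Z $ l $ j * B $ j $ i))"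
   if "skew A" "skew B" for A B
  proof -
   have "of_real (wt q (bl i) (bl j)) * (complement_part bl (bracket Z A) $ i $ j * B $ j $ i)
    = (\<Sum>l\<in>UNIV. w i j * (Z $ i $ l * A $ l $ j * B $ j $ i) - w i j * (A $ i $ l * Z $ l $ j * B $ j $ i))" for i j
    by (auto simp: w_def bracket_nth sum_distrib_left sum_distrib_right algebra_simps intro!: sum.cong)
   then show ?thesis unfolding flag_metric_eq_trace[OF C[OF that(1)] that(2)] K_def by simp
  qed
  have S: "(\<Sum>i\<in>UNIV. \<Sum>j\<in>UNIV. \<Sum>l\<in>UNIV. w i j * (Z $ i $ l * A $ l $ j * B $ j $ i) - w i j * (A $ i $ l * Z $ l $ j * B $ j $ i))
    = (\<Sum>i\<in>UNIV. \<Sum>j\<in>UNIV. \<Sum>l\<in>UNIV. (w l j * (A $ i $ l * B $ l $ j) - w i l * (B $ i $ l * A $ l $ j)) * Z $ j $ i)" for A B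
  proof -
   have 1: "(\<Sum>i\<in>UNIV. \<Sum>j\<in>UNIV. \<Sum>l\<in>UNIV. w i j * (Z $ i $ l * A $ l $ j * B $ j $ i))
    = (\<Sum>i\<in>UNIV. \<Sum>j\<in>UNIV. \<Sum>l\<in>UNIV. w j l * (Z $ j $ i * A $ i $ l * B $ l $ j))"
    by (rule sum3_rotate(1))
   have 2: "(\<Sum>i\<in>UNIV. \<Sum>j\<in>UNIV. \<Sum>l\<in>UNIV. w i j * (A $ i $ l * Z $ l $ j * B $ j $ i))
    = (\<Sum>i\<in>UNIV. \<Sum>j\<in>UNIV. \<Sum>l\<in>UNIV. w l i * (A $ l $ j * Z $ j $ i * B $ i $ l))"
    by (rule sum3_rotate(2))
   have "(\<Sum>i\<in>UNIV. \<Sum>j\<in>UNIV. \<Sum>l\<in>UNIV. w i j * (Z $ i $ l * A $ l $ j * B $ j $ i) - w i j * (A $ i $ l * Z $ l $ j * B $ j $ i))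
    = (\<Sum>i\<in>UNIV. \<Sum>j\<in>UNIV. \<Sum>l\<in>UNIV. w j l * (Z $ j $ i * A $ i $ l * B $ l $ j) - w l i * (A $ l $ j * Z $ j $ i * B $ i $ l))"
    unfolding sum_subtractf 1 2 ..
   also have "\<dots> = (\<Sum>i\<in>UNIV. \<Sum>j\<in>UNIV. \<Sum>l\<in>UNIV. (w l j * (A $ i $ l * B $ l $ j) - w i l * (B $ i $ l * A $ l $ j)) * Z $ j $ i)"
   proof (intro sum.cong refl)
    fix i j l
    show "w j l * (Z $ j $ i * A $ i $ l * B $ l $ j) - w l i * (A $ l $ j * Z $ j $ i * B $ i $ l)
     = (w l j * (A $ i $ l * B $ l $ j) - w i l * (B $ i $ l * A $ l $ j)) * Z $ j $ i"
     unfolding ws[of j l] ws[of l i] by (simp add: algebra_simps)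
   qed
   finally show ?thesis .
  qed
  have U: "2 * (w i j * (nomizu_mat bl q X Y $ i $ j * Z $ j $ i))
    = (\<Sum>l\<in>UNIV. (w l j - w i l) * (X $ i $ l * Y $ l $ j + Y $ i $ l * X $ l $ j) * Z $ j $ i)" for i j
  proof (cases "bl i = bl j")
   case True
   then have "Z $ j $ i = 0" using Z by (simp add: mem_isotropy_complement)
   then show ?thesis by simp
  next
   case False
   then have "w i j \<noteq> 0" using wt_pos[OF q False] by (simp add: w_def)
   then have c: "2 * (w i j * (of_real ((wt q (bl l) (bl j) - wt q (bl i) (bl l)) / (2 * wt q (bl i) (bl j))) * t * z))
     = (w l j - w i l) * t * z" for l t z
    by (simp add: w_def)
   show ?thesis using False
    by (simp only: nomizu_mat_def vec_lambda_beta if_False sum_distrib_left sum_distrib_right c)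
  qed
  have "2 * flag_metric bl q (nomizu_mat bl q X Y) Z
   = K * Re (\<Sum>i\<in>UNIV. \<Sum>j\<in>UNIV. 2 * (w i j * (nomizu_mat bl q X Y $ i $ j * Z $ j $ i)))"
   using Um unfolding flag_metric_eq_trace[OF _ skZ] mem_isotropy_complement
   by (simp add: flag_metric_eq_trace[OF _ skZ] K_def w_def flip: sum_distrib_left)
  also have "\<dots> = K * Re (\<Sum>i\<in>UNIV. \<Sum>j\<in>UNIV. \<Sum>l\<in>UNIV. (w l j - w i l) * (X $ i $ l * Y $ l $ j + Y $ i $ l * X $ l $ j) * Z $ j $ i)"
   unfolding U ..
  also have "(\<Sum>i\<in>UNIV. \<Sum>j\<in>UNIV. \<Sum>l\<in>UNIV. (w l j - w i l) * (X $ i $ l * Y $ l $ j + Y $ i $ l * X $ l $ j) * Z $ j $ i)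
   = (\<Sum>i\<in>UNIV. \<Sum>j\<in>UNIV. \<Sum>l\<in>UNIV. (w l j * (X $ i $ l * Y $ l $ j) - w i l * (Y $ i $ l * X $ l $ j)) * Z $ j $ i)
   + (\<Sum>i\<in>UNIV. \<Sum>j\<in>UNIV. \<Sum>l\<in>UNIV. (w l j * (Y $ i $ l * X $ l $ j) - w i l * (X $ i $ l * Y $ l $ j)) * Z $ j $ i)"
   unfolding sum.distrib[symmetric] by (intro sum.cong refl) (simp add: algebra_simps)
  finally show "2 * flag_metric bl q (nomizu_mat bl q X Y) Z = flag_metric bl q (complement_part bl (bracket Z X)) Y
    + flag_metric bl q X (complement_part bl (bracket Z Y))"
   unfolding flag_metric_sym[OF sk(1) C[OF sk(2)]] gC[OF sk] gC[OF sk(2,1)] S by (simp add: algebra_simps)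
 qed
 fix W assume W: "W \<in> \<mm> bl \<and> (\<forall>Z\<in>\<mm> bl.
   2 * flag_metric bl q W Z = flag_metric bl q (complement_part bl (bracket Z X)) Y
    + flag_metric bl q X (complement_part bl (bracket Z Y)))"
 define D where "D = W - nomizu_mat bl q X Y"
 have D: "D \<in> \<mm> bl"
  unfolding D_def using W Um by (intro subspace_diff[OF subspace_isotropy_complement]) auto
 then have skD: "skew D" "skew W" "skew (nomizu_mat bl q X Y)" using W Um by (auto simp: mem_isotropy_complement)
 have "flag_metric bl q W D = flag_metric bl q (nomizu_mat bl q X Y) D" using W * D by force
 then have "flag_metric bl q D D = 0"
  using flag_metric_diff[OF skD(2,3,1), of bl q] by (simp add: D_def)
 then show "W = nomizu_mat bl q X Y" using flag_metric_zero[OF q D] by (simp add: D_def)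
qed

text \<open>The coefficient of \<open>X $ i $ l * Y $ l $ j\<close> in the Levi-Civita product, for
  \<open>i\<close>, \<open>l\<close>, \<open>j\<close> in the blocks \<open>a\<close>,
  \<open>b\<close>, \<open>c\<close>; \<open>lc_minus\<close> is that of the opposite product, with
  a minus sign.\<close>

definition lc_plus :: "real \<times> real => block => block => block => real" where
 "lc_plus q a b c = (wt q a c + wt q b c - wt q a b) / (2 * wt q a c)"

definition lc_minus :: "real \<times> real => block => block => block => real" where
 "lc_minus q a b c = (wt q a c - wt q b c + wt q a b) / (2 * wt q a c)"

definition lc_mat :: "('k::finite => block) => real \<times> real => 'k cmat => 'k cmat => 'k cmat" where
 "lc_mat bl q X Y = (\<chi> i j. if bl i = bl j then 0 else
   \<Sum>l\<in>UNIV. of_real (lc_plus q (bl i) (bl l) (bl j)) * (X $ i $ l * Y $ l $ j)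
    - of_real (lc_minus q (bl i) (bl l) (bl j)) * (Y $ i $ l * X $ l $ j))"

lemma lc_mat_eq:
 assumes q: "q \<in> int_S"
 shows "(1/2) *\<^sub>R complement_part bl (bracket X Y) + nomizu_mat bl q X Y = lc_mat bl q X Y"
proof -
 have "((1/2) *\<^sub>R complement_part bl (bracket X Y) + nomizu_mat bl q X Y) $ i $ j = lc_mat bl q X Y $ i $ j" for i j
 proof (cases "bl i = bl j")
  case False
  define W where "W = complex_of_real (wt q (bl i) (bl j))"
  have W: "W \<noteq> 0" using wt_pos[OF q False] by (simp add: W_def)
  have "(1/2) * (x - y) + (u - v) / (2 * W) * (x + y) = (W + u - v) / (2 * W) * x - (W - u + v) / (2 * W) * y" for x y u v :: complex
   using W by (simp add: field_simps)
  then have "of_real (lc_plus q (bl i) (bl l) (bl j)) * x - of_real (lc_minus q (bl i) (bl l) (bl j)) * y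
    = (1/2) * (x - y) + of_real ((wt q (bl l) (bl j) - wt q (bl i) (bl l)) / (2 * wt q (bl i) (bl j))) * (x + y)" for l and x y :: complex
   by (simp add: lc_plus_def lc_minus_def W_def)
  then show ?thesis using False
   by (simp add: nomizu_mat_def lc_mat_def bracket_nth scaleR_sum_right sum_divide_distrib sum.distrib[symmetric] scaleR_conv_of_real[where 'a = complex])
 qed (simp add: nomizu_mat_def lc_mat_def)
 then show ?thesis by (simp add: cmat_eq_iff)
qed

lemma levi_civita_eq:
 assumes "q \<in> int_S" "X \<in> \<mm> bl" "Y \<in> \<mm> bl"
 shows "levi_civita bl q X Y = lc_mat bl q X Y"
 unfolding levi_civita_def nomizu_U_eq[OF assms] lc_mat_eq[OF assms(1)] ..

lemma lc_mat_complement: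
 assumes "q \<in> int_S" "skew X" "skew Y"
 shows "lc_mat bl q X Y \<in> \<mm> bl"
 unfolding lc_mat_eq[OF assms(1), symmetric]
 using complement_part_skew[OF bracket_skew[OF assms(2,3)]] nomizu_mat_complement[OF assms(2,3)]
 by (intro subspace_add subspace_scale subspace_isotropy_complement)

text \<open>The curvature with the closed form of the connection. In contrast to
  \<open>curvature\<close> it is meaningful and complex linear in \<open>X\<close> on all matrices,
  as the trace formula requires; hence \<open>X\<close> comes last.\<close>

definition curv_mat :: "('k::finite => block) => real \<times> real => 'k cmat => 'k cmat => 'k cmat => 'k cmat" where
 "curv_mat bl q Y Z X = lc_mat bl q X (lc_mat bl q Y Z) - lc_mat bl q Y (lc_mat bl q X Z)
  - lc_mat bl q (complement_part bl (bracket X Y)) Z - bracket (bracket X Y - complement_part bl (bracket X Y)) Z"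

lemma curvature_eq:
 assumes "q \<in> int_S" "X \<in> \<mm> bl" "Y \<in> \<mm> bl" "Z \<in> \<mm> bl"
 shows "curvature bl q X Y Z = curv_mat bl q Y Z X"
proof -
 have sk: "skew X" "skew Y" "skew Z" using assms by (auto simp: mem_isotropy_complement)
 show ?thesis
  unfolding curvature_def curv_mat_def
  using assms lc_mat_complement[OF assms(1) sk(2,3)] lc_mat_complement[OF assms(1) sk(1,3)]
   complement_part_skew[OF bracket_skew[OF sk(1,2)]]
  by (simp add: levi_civita_eq)
qed

lemma curv_mat_complement:
 assumes q: "q \<in> int_S" and XYZ: "X \<in> \<mm> bl" "Y \<in> \<mm> bl" "Z \<in> \<mm> bl"
 shows "curv_mat bl q Y Z X \<in> \<mm> bl"
proof -
 have sk: "skew X" "skew Y" "skew Z" using XYZ by (auto simp: mem_isotropy_complement)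
 have lc: "lc_mat bl q A B \<in> \<mm> bl" "skew (lc_mat bl q A B)" if "skew A" "skew B" for A B
  using lc_mat_complement[OF q that] by (auto simp: mem_isotropy_complement)
 have cp: "skew (complement_part bl A)" if "skew A" for A
  using complement_part_skew[OF that] by (simp add: mem_isotropy_complement)
 define H where "H = bracket X Y - complement_part bl (bracket X Y)"
 have skH: "skew H" using cp[OF bracket_skew[OF sk(1,2)]] bracket_skew[OF sk(1,2)] by (simp add: H_def skew_def)
 have "bracket H Z $ i $ j = 0" if "bl i = bl j" for i j
 proof -
  have e: "H $ i $ l * Z $ l $ j = 0" "Z $ i $ l * H $ l $ j = 0" for l
   using XYZ(3) that by (auto simp: H_def mem_isotropy_complement)
  show ?thesis by (simp only: bracket_nth e diff_self sum.neutral_const)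
 qed
 then have "bracket H Z \<in> \<mm> bl" using bracket_skew[OF skH sk(3)] by (simp add: mem_isotropy_complement)
 then show ?thesis unfolding curv_mat_def H_def[symmetric]
  using lc(1)[OF sk(1) lc(2)[OF sk(2,3)]] lc(1)[OF sk(2) lc(2)[OF sk(1,3)]]
   lc(1)[OF cp[OF bracket_skew[OF sk(1,2)]] sk(3)]
  by (intro subspace_diff subspace_isotropy_complement)
qed

lemma lc_mat_clinear: "lc_mat bl q (X + X') Y = lc_mat bl q X Y + lc_mat bl q X' Y"
 "lc_mat bl q X (Y + Y') = lc_mat bl q X Y + lc_mat bl q X Y'"
 "lc_mat bl q (cscale c X) Y = cscale c (lc_mat bl q X Y)"
 "lc_mat bl q X (cscale c Y) = cscale c (lc_mat bl q X Y)"
 by (auto simp: cmat_eq_iff lc_mat_def sum.distrib[symmetric] sum_distrib_left algebra_simps intro!: sum.cong)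

lemma bracket_clinear: "bracket (X + X') Y = bracket X Y + bracket X' Y" "bracket (cscale c X) Y = cscale c (bracket X Y)"
 by (auto simp: cmat_eq_iff bracket_nth sum.distrib[symmetric] sum_distrib_left algebra_simps intro!: sum.cong)

lemma complement_part_clinear: "complement_part bl (X + Y) = complement_part bl X + complement_part bl Y"
 "complement_part bl (cscale c X) = cscale c (complement_part bl X)"
 by (auto simp: cmat_eq_iff)

lemma curv_mat_clinear: "clinear_map (\<lambda>X. curv_mat bl q Y Z (complement_part bl X))"
proof -
 have cs: "cscale c A - cscale c B = cscale c (A - B)" for c and A B :: "'a cmat"
  by (simp add: cmat_eq_iff algebra_simps)
 show ?thesis
  unfolding clinear_map_def curv_mat_def complement_part_clinear bracket_clinear lc_mat_clinear cs add_diff_add by simp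
qed

lemma Ric_eq_sum:
 fixes Y Z :: "'k::finite cmat"
 assumes q: "q \<in> int_S" and YZ: "Y \<in> \<mm> bl" "Z \<in> \<mm> bl"
 shows "Ric bl q Y Z = (\<Sum>i\<in>UNIV. \<Sum>j\<in>UNIV. Re (curv_mat bl q Y Z (complement_part bl (unit_mat i j)) $ i $ j))"
proof -
 define P :: "'k cmat => 'k cmat" where "P X = complement_part bl ((1/2) *\<^sub>R (X - ctranspose X))" for X
 define F where "F X = curv_mat bl q Y Z (complement_part bl X)" for X
 have Fc: "clinear_map F" unfolding F_def by (rule curv_mat_clinear)
 have Plin: "linear P" by (rule linearI) (auto simp: P_def cmat_eq_iff algebra_simps)
 have Pin: "P X \<in> \<mm> bl" for X
  unfolding P_def by (rule complement_part_skew) (simp add: skew_def algebra_simps)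
 have cpid: "complement_part bl X = X" if "X \<in> \<mm> bl" for X
  using that by (auto simp: mem_isotropy_complement cmat_eq_iff)
 have Pid: "P X = X" if "X \<in> \<mm> bl" for X
 proof -
  have "(1/2) *\<^sub>R (X - ctranspose X) = X"
   using that by (simp add: mem_isotropy_complement skew_def scaleR_2[symmetric])
  then show ?thesis by (simp add: P_def cpid[OF that])
 qed
 have "Ric bl q Y Z = (\<Sum>e\<in>Basis. F (P e) \<bullet> e)"
  unfolding Ric_def
  by (rule trace_on_eq_sum_Basis[OF subspace_isotropy_complement Plin Pin Pid clinear_map_linear[OF Fc]])
   (use YZ in \<open>auto simp: F_def cpid curv_mat_complement[OF q] curvature_eq[OF q]\<close>)
 also have "\<dots> = (\<Sum>e\<in>Basis. F ((1/2) *\<^sub>R (e - ctranspose e)) \<bullet> e)"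
  by (simp only: F_def P_def cpid[OF Pin[unfolded P_def]])
 also have "\<dots> = (\<Sum>i\<in>UNIV. \<Sum>j\<in>UNIV. Re (F (unit_mat i j) $ i $ j))"
  by (rule sum_Basis_skew_part[OF Fc])
 finally show ?thesis unfolding F_def .
qed

text \<open>The contribution of one index of block \<open>c\<close> to minus the Ricci coefficient
  of the block pair \<open>a\<close>, \<open>b\<close>. The value -1 comes from the isotropy part of
  the bracket in the curvature.\<close>

definition ric_term :: "real \<times> real => block => block => block => real" where
 "ric_term q a b c = (if c = a \<or> c = b then - 1
   else lc_plus q a b c * lc_minus q b a c + lc_minus q c a b * lc_plus q c b a - lc_plus q c b a - lc_minus q b a c)"

lemma curv_mat_unit:
 assumes ij: "bl i \<noteq> bl j" and Y: "Y \<in> \<mm> bl" and Z: "Z \<in> \<mm> bl"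
 shows "curv_mat bl q Y Z (unit_mat i j) $ i $ j = (\<Sum>l\<in>UNIV.
   (if bl l = bl j then 0 else of_real (lc_plus q (bl i) (bl l) (bl j) * lc_minus q (bl l) (bl i) (bl j)) * (Y $ i $ l * Z $ l $ i))
  + (if bl l = bl i then 0 else of_real (lc_minus q (bl i) (bl l) (bl j) * lc_plus q (bl i) (bl j) (bl l)) * (Y $ l $ j * Z $ j $ l))
  - (if bl l = bl i then 1 else of_real (lc_plus q (bl i) (bl l) (bl j))) * (Y $ j $ l * Z $ l $ j)
  - (if bl l = bl j then 1 else of_real (lc_minus q (bl i) (bl l) (bl j))) * (Y $ l $ i * Z $ i $ l))"
proof -
 have z0: "Y $ a $ b = 0" "Z $ a $ b = 0" if "bl a = bl b" for a b using Y Z that by (auto simp: mem_isotropy_complement)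
 have d: "(\<Sum>l\<in>UNIV. f l * (unit_mat i j $ a $ l * g l) - f' l * (g' l * unit_mat i j $ l $ b))
   = (if a = i then f j * g j else 0) - (if b = j then f' i * g' i else 0)" for f g f' g' a b
 proof -
  have "f l * (unit_mat i j $ a $ l * g l) - f' l * (g' l * unit_mat i j $ l $ b)
    = (if l = j then (if a = i then f j * g j else 0) else 0) - (if l = i then (if b = j then f' i * g' i else 0) else 0)" for l
   by auto
  then show ?thesis by (simp add: sum_subtractf)
 qed
 have lcu: "lc_mat bl q (unit_mat i j) W $ a $ b = (if bl a = bl b then 0 else
   (if a = i then of_real (lc_plus q (bl a) (bl j) (bl b)) * W $ j $ b else 0)
   - (if b = j then of_real (lc_minus q (bl a) (bl i) (bl b)) * W $ a $ i else 0))" for W a b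
  by (simp add: lc_mat_def d del: unit_mat_nth)
 have bru: "bracket (unit_mat i j) Y $ a $ b = (if a = i then Y $ j $ b else 0) - (if b = j then Y $ a $ i else 0)" for a b
  using d[where f = "\<lambda>_. 1" and f' = "\<lambda>_. 1" and g = "\<lambda>l. Y $ l $ b" and g' = "\<lambda>l. Y $ a $ l" and a = a and b = b]
  by (simp add: bracket_nth del: unit_mat_nth)
 define V where "V = lc_mat bl q Y Z"
 have V0: "V $ a $ b = 0" if "bl a = bl b" for a b using that by (simp add: V_def lc_mat_def)
 \<comment> \<open>This entry only involves diagonal entries of \<open>V\<close>, and
   \<open>V\<close> is 0 on diagonal blocks.\<close>
 have T1: "lc_mat bl q (unit_mat i j) V $ i $ j = 0" by (simp add: lcu V0)
 have T2: "lc_mat bl q Y (lc_mat bl q (unit_mat i j) Z) $ i $ j = (\<Sum>l\<in>UNIV.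
   - (if bl l = bl j then 0 else of_real (lc_plus q (bl i) (bl l) (bl j) * lc_minus q (bl l) (bl i) (bl j)) * (Y $ i $ l * Z $ l $ i))
   - (if bl l = bl i then 0 else of_real (lc_minus q (bl i) (bl l) (bl j) * lc_plus q (bl i) (bl j) (bl l)) * (Y $ l $ j * Z $ j $ l)))"
  using ij unfolding lc_mat_def[of bl q Y] by (auto simp: lcu z0 intro!: sum.cong)
 have T3: "lc_mat bl q (complement_part bl (bracket (unit_mat i j) Y)) Z $ i $ j = (\<Sum>l\<in>UNIV.
   (if bl l = bl i then 0 else of_real (lc_plus q (bl i) (bl l) (bl j))) * (Y $ j $ l * Z $ l $ j)
   + (if bl l = bl j then 0 else of_real (lc_minus q (bl i) (bl l) (bl j))) * (Y $ l $ i * Z $ i $ l))"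
  using ij unfolding lc_mat_def by (auto simp: bru z0 intro!: sum.cong)
 have T4: "bracket (bracket (unit_mat i j) Y - complement_part bl (bracket (unit_mat i j) Y)) Z $ i $ j = (\<Sum>l\<in>UNIV.
   (if bl l = bl i then 1 else 0) * (Y $ j $ l * Z $ l $ j) + (if bl l = bl j then 1 else 0) * (Y $ l $ i * Z $ i $ l))"
  using ij unfolding bracket_nth[of _ Z] by (auto simp: bru z0 intro!: sum.cong)
 show ?thesis
  unfolding curv_mat_def vector_minus_component V_def[symmetric] T1 T2 T3 T4
  by (simp add: sum_subtractf[symmetric] sum_negf[symmetric]) (auto intro!: sum.cong simp: algebra_simps)
qed

text \<open>The four kinds of terms in the curvature are products of entries at opposite positions.
  After renaming indices each contains \<open>Y $ i $ j * Z $ j $ i\<close>, so the Ricci form is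
  diagonal in the matrix entries and comparable to the metric coefficient by coefficient.\<close>

lemma Ric_eq:
 fixes Y Z :: "'k::finite cmat"
 assumes q: "q \<in> int_S" and Y: "Y \<in> \<mm> bl" and Z: "Z \<in> \<mm> bl"
 shows "Ric bl q Y Z = (\<Sum>i\<in>UNIV. \<Sum>j\<in>UNIV. - (\<Sum>l\<in>UNIV. ric_term q (bl i) (bl j) (bl l)) * Re (Y $ i $ j * cnj (Z $ i $ j)))"
proof -
 have z0: "Y $ a $ b = 0" "Z $ a $ b = 0" if "bl a = bl b" for a b using Y Z that by (auto simp: mem_isotropy_complement)
 define I where "I i j = (if bl i = bl j then 0 else 1 :: complex)" for i j
 define t1 where "t1 i j l = I i j * (if bl l = bl j then 0 else of_real (lc_plus q (bl i) (bl l) (bl j) * lc_minus q (bl l) (bl i) (bl j)) * (Y $ i $ l * Z $ l $ i))" for i j l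
 define t2 where "t2 i j l = I i j * (if bl l = bl i then 0 else of_real (lc_minus q (bl i) (bl l) (bl j) * lc_plus q (bl i) (bl j) (bl l)) * (Y $ l $ j * Z $ j $ l))" for i j l
 define t3 where "t3 i j l = I i j * ((if bl l = bl i then 1 else of_real (lc_plus q (bl i) (bl l) (bl j))) * (Y $ j $ l * Z $ l $ j))" for i j l
 define t4 where "t4 i j l = I i j * ((if bl l = bl j then 1 else of_real (lc_minus q (bl i) (bl l) (bl j))) * (Y $ l $ i * Z $ i $ l))" for i j l
 have "curv_mat bl q Y Z (complement_part bl (unit_mat i j)) $ i $ j = (\<Sum>l\<in>UNIV. t1 i j l + t2 i j l - t3 i j l - t4 i j l)" for i j
 proof (cases "bl i = bl j")
  case True
  then have "complement_part bl (unit_mat i j) = complement_part bl (cscale 0 (unit_mat i j))"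
   by (auto simp: cmat_eq_iff)
  then have "curv_mat bl q Y Z (complement_part bl (unit_mat i j))
    = cscale 0 (curv_mat bl q Y Z (complement_part bl (unit_mat i j)))"
   using curv_mat_clinear[of bl q Y Z] unfolding clinear_map_def by metis
  then have "curv_mat bl q Y Z (complement_part bl (unit_mat i j)) $ i $ j = 0"
   by (metis cscale_nth mult_zero_left)
  then show ?thesis using True by (simp add: t1_def t2_def t3_def t4_def I_def)
 next
  case False
  then have "complement_part bl (unit_mat i j) = unit_mat i j" by (auto simp: cmat_eq_iff)
  then show ?thesis using False by (simp add: curv_mat_unit[OF False Y Z] t1_def t2_def t3_def t4_def I_def)
 qed
 then have "Ric bl q Y Z = Re (\<Sum>i\<in>UNIV. \<Sum>j\<in>UNIV. \<Sum>l\<in>UNIV. t1 i j l + t2 i j l - t3 i j l - t4 i j l)"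
  unfolding Ric_eq_sum[OF q Y Z] by (simp only: Re_sum)
 also have "(\<Sum>i\<in>UNIV. \<Sum>j\<in>UNIV. \<Sum>l\<in>UNIV. t1 i j l + t2 i j l - t3 i j l - t4 i j l)
  = (\<Sum>i\<in>UNIV. \<Sum>j\<in>UNIV. \<Sum>l\<in>UNIV. t1 i l j + t2 l j i - t3 l i j - t4 j l i)"
  unfolding sum.distrib sum_subtractf
  using sum3_rotate(3)[of t1] sum3_rotate(4)[of t2] sum3_rotate(2)[of t3] sum3_rotate(1)[of t4] by simp
 also have "\<dots> = (\<Sum>i\<in>UNIV. \<Sum>j\<in>UNIV. \<Sum>l\<in>UNIV. of_real (ric_term q (bl i) (bl j) (bl l)) * (Y $ i $ j * Z $ j $ i))"
 proof (intro sum.cong refl)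
  fix i j l
  show "t1 i l j + t2 l j i - t3 l i j - t4 j l i = of_real (ric_term q (bl i) (bl j) (bl l)) * (Y $ i $ j * Z $ j $ i)"
  proof (cases "bl i = bl j")
   case True
   then show ?thesis by (simp add: t1_def t2_def t3_def t4_def z0)
  next
   case False
   then show ?thesis
    by (cases "bl l = bl i"; cases "bl l = bl j") (auto simp: t1_def t2_def t3_def t4_def I_def ric_term_def algebra_simps)
  qed
 qed
 also have "\<dots> = (\<Sum>i\<in>UNIV. \<Sum>j\<in>UNIV. - (of_real (\<Sum>l\<in>UNIV. ric_term q (bl i) (bl j) (bl l)) * (Y $ i $ j * cnj (Z $ i $ j))))"
 proof -
  have "Z $ j $ i = - cnj (Z $ i $ j)" for i j using Z skew_nth by (auto simp: mem_isotropy_complement)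
  then have "Y $ i $ j * Z $ j $ i = - (Y $ i $ j * cnj (Z $ i $ j))" for i j by (metis mult_minus_right)
  then have "(\<Sum>l\<in>UNIV. of_real (ric_term q (bl i) (bl j) (bl l)) * (Y $ i $ j * Z $ j $ i))
    = of_real (\<Sum>l\<in>UNIV. ric_term q (bl i) (bl j) (bl l)) * (- (Y $ i $ j * cnj (Z $ i $ j)))" for i j
   by (simp only: of_real_sum sum_distrib_right)
  then show ?thesis by (simp only: mult_minus_right)
 qed
 finally show ?thesis by (simp only: Re_sum uminus_complex.simps times_complex.simps Re_complex_of_real
   Im_complex_of_real mult_zero_left diff_zero mult_minus_left)
qed

section \<open>Einstein metrics\<close>

text \<open>For \<open>a \<noteq> b\<close>, the general element of the real root space of the
  positions \<open>(a, b)\<close> and \<open>(b, a)\<close>, a plane with complex coordinate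
  \<open>z\<close>.\<close>

definition block_mat :: "'k::finite => 'k => complex => 'k cmat" where
 "block_mat a b z = (\<chi> i j. if i = a \<and> j = b then z else if i = b \<and> j = a then - cnj z else 0)"

lemma block_mat_entries:
 assumes "a \<noteq> b"
 shows "block_mat a b z $ a $ b = z" "block_mat a b z $ b $ a = - cnj z"
 using assms by (simp_all add: block_mat_def)

lemma block_mat_zero: "\<not> (i = a \<and> j = b) ==> \<not> (i = b \<and> j = a) ==> block_mat a b z $ i $ j = 0"
 by (simp only: block_mat_def vec_lambda_beta if_False)

lemma block_mat_skew:
 assumes "a \<noteq> b" shows "skew (block_mat a b z)"
proof (rule skewI)
 fix i j
 consider "i = a" "j = b" | "i = b" "j = a" | "\<not> (i = a \<and> j = b)" "\<not> (i = b \<and> j = a)" by blast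
 then show "cnj (block_mat a b z $ j $ i) = - block_mat a b z $ i $ j"
 proof cases
  case 3
  then have n: "\<not> (j = a \<and> i = b)" "\<not> (j = b \<and> i = a)" by blast+
  show ?thesis unfolding block_mat_zero[OF 3] block_mat_zero[OF n] by simp
 qed (simp_all only: block_mat_entries[OF assms] complex_cnj_minus complex_cnj_cnj minus_minus)
qed

lemma block_mat_complement:
 assumes "bl a \<noteq> bl b" shows "block_mat a b z \<in> \<mm> bl"
proof -
 have ne: "a \<noteq> b" using assms by blast
 have "block_mat a b z $ i $ j = 0" if "bl i = bl j" for i j
  by (rule block_mat_zero) (use assms that in metis)+
 then show ?thesis using block_mat_skew[OF ne] by (simp only: mem_isotropy_complement) blast
qed

lemma sum_two_entries:
 fixes f :: "'k::finite => 'k => real"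
 assumes "a \<noteq> b" and zero: "\<And>i j. \<not> (i = a \<and> j = b) ==> \<not> (i = b \<and> j = a) ==> f i j = 0"
 shows "(\<Sum>i\<in>UNIV. \<Sum>j\<in>UNIV. f i j) = f a b + f b a"
proof -
 have "(\<Sum>i\<in>UNIV. \<Sum>j\<in>UNIV. f i j) = (\<Sum>(i, j)\<in>UNIV \<times> UNIV. f i j)" by (rule sum.cartesian_product)
 also have "\<dots> = (\<Sum>(i, j)\<in>{(a, b), (b, a)}. f i j)"
  by (rule sum.mono_neutral_right) (use zero in auto)
 finally show ?thesis using assms(1) by simp
qed

lemma block_mat_sum:
 fixes a b :: "'k::finite"
 assumes "a \<noteq> b"
 shows "(\<Sum>i\<in>UNIV. \<Sum>j\<in>UNIV. h i j * Re (block_mat a b z $ i $ j * cnj (Y $ i $ j)))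
  = h a b * Re (z * cnj (Y $ a $ b)) - h b a * Re (cnj z * cnj (Y $ b $ a))"
proof -
 have "(\<Sum>i\<in>UNIV. \<Sum>j\<in>UNIV. h i j * Re (block_mat a b z $ i $ j * cnj (Y $ i $ j)))
  = h a b * Re (block_mat a b z $ a $ b * cnj (Y $ a $ b)) + h b a * Re (block_mat a b z $ b $ a * cnj (Y $ b $ a))"
 proof (rule sum_two_entries[OF assms])
  fix i j assume "\<not> (i = a \<and> j = b)" "\<not> (i = b \<and> j = a)"
  from block_mat_zero[OF this, of z] show "h i j * Re (block_mat a b z $ i $ j * cnj (Y $ i $ j)) = 0"
   by (simp only: mult_zero_left zero_complex.simps mult_zero_right)
 qed
 then show ?thesis
  unfolding block_mat_entries[OF assms] by (simp only: mult_minus_left uminus_complex.simps mult_minus_right)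
qed

lemma flag_metric_block_mat:
 fixes a b :: "'k::finite"
 assumes "a \<noteq> b" "skew Y"
 shows "flag_metric bl q (block_mat a b z) Y = 4 * real CARD('k) * wt q (bl a) (bl b) * Re (z * cnj (Y $ a $ b))"
proof -
 note sk = block_mat_skew[OF assms(1), of z]
 have "cnj (Y $ b $ a) = - Y $ a $ b" by (rule skew_cnj[OF assms(2)])
 then have "cnj z * cnj (Y $ b $ a) = - cnj (z * cnj (Y $ a $ b))" by simp
 then have "Re (cnj z * cnj (Y $ b $ a)) = - Re (z * cnj (Y $ a $ b))" by (simp only: uminus_complex.simps cnj.simps)
 then show ?thesis
  unfolding flag_metric_eq[OF sk assms(2)] block_mat_sum[OF assms(1)] by (simp only: wt_sym[of q "bl b"]) (simp add: algebra_simps)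
qed

lemma sum_UNIV_Plus:
 fixes f :: "'c::finite + 'd::finite => real"
 shows "sum f UNIV = (\<Sum>x\<in>UNIV. f (Inl x)) + (\<Sum>y\<in>UNIV. f (Inr y))"
 by (subst UNIV_Plus_UNIV[symmetric], subst sum.Plus) auto

lemma sum_flag_blocks:
 fixes g :: "block => real"
 shows "(\<Sum>l\<in>UNIV. g (flag_blocks (l :: 'm::finite + 'n::finite + 'p::finite)))
  = real CARD('m) * g First + real CARD('n) * g Second + real CARD('p) * g Third"
 by (simp add: sum_UNIV_Plus flag_blocks_def)

lemma ric_term_third:
 assumes "u > 0" "v > 0" "wt q a b = w" "wt q a c = u" "wt q b c = v" "c \<noteq> a" "c \<noteq> b"
 shows "ric_term q a b c = - 1 + (u\<^sup>2 + v\<^sup>2 - w\<^sup>2) / (2 * u * v)"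
proof -
 have s: "wt q b a = w" "wt q c a = u" "wt q c b = v" using assms by (simp_all add: wt_sym)
 show ?thesis
  unfolding ric_term_def lc_plus_def lc_minus_def assms(3-5) s using assms(1,2,6,7)
  by (simp add: field_simps power2_eq_square)
qed

text \<open>With \<open>A\<close>, \<open>B\<close>, \<open>C\<close> for the three expressions, the
  field is \<open>x' = x ((x A + y B + z C) - A)\<close>, and likewise for the other coordinates.
  Since \<open>x A + y B + z C\<close> is a mean of the three, an interior point is an equilibrium
  iff they are equal.\<close>

lemma ricci_field_zero_iff:
 fixes m n p :: nat
 assumes q: "(x, y) \<in> int_S" and z: "z = 1 - x - y"
 shows "ricci_field m n p (x, y) = 0 \<longleftrightarrow>
  2 * (real m + real n + real p) * y * z + real p * (x\<^sup>2 - y\<^sup>2 - z\<^sup>2) = 2 * (real m + real n + real p) * x * z + real n * (y\<^sup>2 - x\<^sup>2 - z\<^sup>2) \<and>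
  2 * (real m + real n + real p) * y * z + real p * (x\<^sup>2 - y\<^sup>2 - z\<^sup>2) = 2 * (real m + real n + real p) * x * y + real m * (z\<^sup>2 - x\<^sup>2 - y\<^sup>2)"
proof -
 define N where "N = real m + real n + real p"
 have pos: "x > 0" "y > 0" "z > 0" using q z by (auto simp: interior_simplex_S)
 define A where "A = 2 * N * y * z + real p * (x\<^sup>2 - y\<^sup>2 - z\<^sup>2)"
 define B where "B = 2 * N * x * z + real n * (y\<^sup>2 - x\<^sup>2 - z\<^sup>2)"
 define C where "C = 2 * N * x * y + real m * (z\<^sup>2 - x\<^sup>2 - y\<^sup>2)"
 define M N' P where "M = real m" and "N' = real n" and "P = real p"
 have 1: "(1 - 2 * x) * gf m p n y x z = x * A + y * B + z * C - A"
  "(1 - 2 * y) * gf m n p x y z = x * A + y * B + z * C - B"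
  unfolding A_def B_def C_def N_def gf_def z M_def[symmetric] N'_def[symmetric] P_def[symmetric]
  by (simp_all add: algebra_simps power2_eq_square)
 have "ricci_field m n p (x, y) = 0 \<longleftrightarrow> (1 - 2 * x) * gf m p n y x z = 0 \<and> (1 - 2 * y) * gf m n p x y z = 0"
  using pos by (simp add: ricci_field_eq z zero_prod_def)
 also have "\<dots> \<longleftrightarrow> A = B \<and> A = C"
 proof
  assume "(1 - 2 * x) * gf m p n y x z = 0 \<and> (1 - 2 * y) * gf m n p x y z = 0"
  then have e: "x * A + y * B + z * C = A" "x * A + y * B + z * C = B" unfolding 1 by simp_all
  then have "A = B" by simp
  then have "z * (C - A) = (x * A + y * B + z * C) - A" by (simp add: z algebra_simps)
  then have "z * (C - A) = 0" using e(1) by simp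
  then show "A = B \<and> A = C" using \<open>A = B\<close> pos by simp
 next
  assume AB: "A = B \<and> A = C"
  then have "x * A + y * B + z * C = (x + y + z) * A" by (simp add: algebra_simps)
  also have "x + y + z = 1" using z by simp
  finally show "(1 - 2 * x) * gf m p n y x z = 0 \<and> (1 - 2 * y) * gf m n p x y z = 0"
   unfolding 1 using AB by simp
 qed
 finally show ?thesis unfolding A_def B_def C_def N_def .
qed

text \<open>Metric and Ricci form are diagonal with one coefficient per block pair; the Ricci
  coefficients are \<open>A / (2 y z)\<close>, \<open>B / (2 x z)\<close>,
  \<open>C / (2 x y)\<close>. Proportionality to \<open>x\<close>, \<open>y\<close>,
  \<open>z\<close> therefore means \<open>A = B = C\<close>. Root vectors extract the
  coefficients.\<close>

lemma einstein_iff: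
 fixes bl :: "'m::finite + 'n::finite + 'p::finite => block"
 assumes bl: "bl = flag_blocks" and q: "q \<in> int_S"
 shows "einstein bl q \<longleftrightarrow> ricci_field CARD('m) CARD('n) CARD('p) q = 0"
proof -
 obtain x y where xy: "q = (x, y)" by fastforce
 define z where "z = 1 - x - y"
 have pos: "x > 0" "y > 0" "z > 0" using q by (auto simp: interior_simplex_S xy z_def)
 define m n p where "m = real CARD('m)" and "n = real CARD('n)" and "p = real CARD('p)"
 define N where "N = m + n + p"
 have K: "real CARD('m + 'n + 'p) = N" by (simp add: N_def m_def n_def p_def)
 have Npos: "N > 0" by (simp add: N_def m_def n_def p_def add_pos_pos)
 define r where "r a b = - (\<Sum>l\<in>UNIV. ric_term q a b (bl l))" for a b
 have r: "r a b = - (m * ric_term q a b First + n * ric_term q a b Second + p * ric_term q a b Third)" for a b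
  unfolding r_def bl sum_flag_blocks m_def n_def p_def ..
 define A where "A = 2 * N * y * z + p * (x\<^sup>2 - y\<^sup>2 - z\<^sup>2)"
 define B where "B = 2 * N * x * z + n * (y\<^sup>2 - x\<^sup>2 - z\<^sup>2)"
 define C where "C = 2 * N * x * y + m * (z\<^sup>2 - x\<^sup>2 - y\<^sup>2)"
 have w: "wt q First Second = x" "wt q First Third = y" "wt q Second Third = z" "wt q Second First = x"
  "wt q Third First = y" "wt q Third Second = z"
  by (simp_all add: xy z_def)
 have same: "ric_term q a b a = - 1" "ric_term q a b b = - 1" for a b by (simp_all add: ric_term_def)
 have t: "ric_term q First Second Third = - 1 + (y\<^sup>2 + z\<^sup>2 - x\<^sup>2) / (2 * y * z)"
  "ric_term q Second First Third = - 1 + (z\<^sup>2 + y\<^sup>2 - x\<^sup>2) / (2 * z * y)"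
  "ric_term q First Third Second = - 1 + (x\<^sup>2 + z\<^sup>2 - y\<^sup>2) / (2 * x * z)"
  "ric_term q Third First Second = - 1 + (z\<^sup>2 + x\<^sup>2 - y\<^sup>2) / (2 * z * x)"
  "ric_term q Second Third First = - 1 + (x\<^sup>2 + y\<^sup>2 - z\<^sup>2) / (2 * x * y)"
  "ric_term q Third Second First = - 1 + (y\<^sup>2 + x\<^sup>2 - z\<^sup>2) / (2 * y * x)"
  by (rule ric_term_third; use pos w in simp)+
 have rA: "r First Second = A / (2 * y * z)" "r Second First = A / (2 * y * z)"
  unfolding r same t A_def N_def using pos by (simp_all add: field_simps)
 have rB: "r First Third = B / (2 * x * z)" "r Third First = B / (2 * x * z)"
  unfolding r same t B_def N_def using pos by (simp_all add: field_simps)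
 have rC: "r Second Third = C / (2 * x * y)" "r Third Second = C / (2 * x * y)"
  unfolding r same t C_def N_def using pos by (simp_all add: field_simps)
 have Ric: "Ric bl q Y Z = (\<Sum>i\<in>UNIV. \<Sum>j\<in>UNIV. r (bl i) (bl j) * Re (Y $ i $ j * cnj (Z $ i $ j)))"
  if "Y \<in> \<mm> bl" "Z \<in> \<mm> bl" for Y Z
  unfolding Ric_eq[OF q that] r_def ..
 have rs: "r a b = r b a" for a b using rA rB rC by (cases a; cases b) auto
 have "einstein bl q \<longleftrightarrow> A = B \<and> A = C"
 proof
  assume "einstein bl q"
  then obtain c where c: "\<And>X Y. X \<in> \<mm> bl ==> Y \<in> \<mm> bl ==>
    Ric bl q X Y = c * flag_metric bl q X Y" unfolding einstein_def by blast
  have e: "r (bl a) (bl b) = c * (2 * N * wt q (bl a) (bl b))" if ab: "bl a \<noteq> bl b" for a b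
  proof -
   have ne: "a \<noteq> b" using ab by auto
   note X = block_mat_complement[of bl a b 1, OF ab]
   have sk: "skew (block_mat a b 1)" using X by (simp add: mem_isotropy_complement)
   have "Ric bl q (block_mat a b 1) (block_mat a b 1) = 2 * r (bl a) (bl b)"
    unfolding Ric[OF X X] block_mat_sum[OF ne] block_mat_entries[OF ne] using rs[of "bl b" "bl a"] by simp
   moreover have "flag_metric bl q (block_mat a b 1) (block_mat a b 1) = 4 * N * wt q (bl a) (bl b)"
    unfolding flag_metric_block_mat[OF ne sk] K block_mat_entries[OF ne] by simp
   ultimately have "2 * r (bl a) (bl b) = c * (4 * N * wt q (bl a) (bl b))" using c[OF X X] by simp
   also have "\<dots> = 2 * (c * (2 * N * wt q (bl a) (bl b)))" by simp
   finally show ?thesis by linarith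
  qed
  have "A / (2 * y * z) = c * (2 * N * x)" "B / (2 * x * z) = c * (2 * N * y)" "C / (2 * x * y) = c * (2 * N * z)"
   using e[of "Inl undefined" "Inr (Inl undefined)"] e[of "Inl undefined" "Inr (Inr undefined)"]
    e[of "Inr (Inl undefined)" "Inr (Inr undefined)"]
   by (simp_all add: bl flag_blocks_def rA rB rC xy z_def[symmetric])
  then have "A = c * 4 * N * x * y * z" "B = c * 4 * N * x * y * z" "C = c * 4 * N * x * y * z"
   using pos by (simp_all add: field_simps)
  then show "A = B \<and> A = C" by simp
 next
  assume ABC: "A = B \<and> A = C"
  \<comment> \<open>Obtained by solving the first of the three proportionalities for the Einstein
    constant.\<close>
  define c where "c = A / (4 * N * x * y * z)"
  have e: "A / (2 * y * z) = c * (2 * N * x)" "B / (2 * x * z) = c * (2 * N * y)" "C / (2 * x * y) = c * (2 * N * z)"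
   using pos Npos ABC by (simp_all add: c_def field_simps)
  have rw: "r a b = c * (2 * N * wt q a b)" if "a \<noteq> b" for a b
   using that by (cases a; cases b) (simp_all only: rA rB rC w e simp_thms)
  show "einstein bl q"
   unfolding einstein_def
  proof (intro exI[of _ c] ballI)
   fix X Y assume X: "X \<in> \<mm> bl" and Y: "Y \<in> \<mm> bl"
   then have sk: "skew X" "skew Y" by (auto simp: mem_isotropy_complement)
   have "r (bl i) (bl j) * Re (X $ i $ j * cnj (Y $ i $ j)) = c * (2 * N * (wt q (bl i) (bl j) * Re (X $ i $ j * cnj (Y $ i $ j))))" for i j
    using X rw[of "bl i" "bl j"] by (cases "bl i = bl j") (auto simp: mem_isotropy_complement)
   then show "Ric bl q X Y = c * flag_metric bl q X Y"
    unfolding Ric[OF X Y] flag_metric_eq[OF sk] K by (simp only: sum_distrib_left)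
  qed
 qed
 also have "\<dots> \<longleftrightarrow> ricci_field CARD('m) CARD('n) CARD('p) q = 0"
  using ricci_field_zero_iff[of x y z "CARD('m)" "CARD('n)" "CARD('p)"] q
  by (simp add: xy z_def A_def B_def C_def N_def m_def n_def p_def)
 finally show ?thesis .
qed

text \<open>An interior equilibrium is its own orbit, so the classification of the limits of orbits
 determines it.\<close>

lemma interior_equilibria:
 assumes mnp: "m > 0" "n > 0" "p > 0" and q: "q \<in> int_S" and eq: "ricci_field m n p q = 0"
 shows "q \<in> {pt_N m n p, pt_R m n p, pt_S m n p, pt_T m n p}"
proof -
 have qS: "q \<in> simplex_S" using q interior_subset by blast
 have "flow_line m n p (\<lambda>_. q)" unfolding flow_line_def using qS eq by simp
 then have const: "ricci_flow m n p q = (\<lambda>_. q)"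
  using flow_line_unique ricci_flow[OF qS] by blast
 have lim: "(ricci_flow m n p q \<longlongrightarrow> v) at_top ==> v = q" for v
  unfolding const using tendsto_unique[OF trivial_limit_at_top_linorder tendsto_const[of q at_top]] by blast
 have pos: "0 < fst q" "0 < snd q" "fst q + snd q < 1" using q by (auto simp: interior_simplex_S)
 have nv: "q \<noteq> pt_K" "q \<noteq> pt_L" "q \<noteq> pt_M" using pos by (auto simp: pt_K_def pt_L_def pt_M_def)
 have "q \<in> cut_set m n p"
 proof (rule ccontr)
  assume "q \<notin> cut_set m n p"
  then show False using forward_limits[OF mnp, of q] q lim nv by blast
 qed
 moreover have "q \<in> {pt_T m n p}" if "q \<in> closed_segment pt_K pt_L"
 proof -
  have h: "snd q = 1/2" using that by (auto simp: closed_segment_def pt_K_def pt_L_def field_simps)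
  then have "((\<lambda>t. snd (ricci_flow m n p q t)) \<longlongrightarrow> 1/2) at_top" by (simp only: const h tendsto_const)
  from side_KL[OF mnp q this] show ?thesis using lim nv by blast
 qed
 moreover have "q \<in> {pt_S m n p}" if "q \<in> closed_segment pt_L pt_M"
 proof -
  have h: "fst q = 1/2" using that by (auto simp: closed_segment_def pt_L_def pt_M_def field_simps)
  then have "((\<lambda>t. fst (ricci_flow m n p q t)) \<longlongrightarrow> 1/2) at_top" by (simp only: const h tendsto_const)
  from side_LM[OF mnp q this] show ?thesis using lim nv by blast
 qed
 moreover have "q \<in> {pt_R m n p}" if "q \<in> closed_segment pt_K pt_M"
 proof -
  have h: "coord3 q = 1/2" using that by (auto simp: closed_segment_def pt_K_def pt_M_def coord3_def field_simps)
  then have "((\<lambda>t. coord3 (ricci_flow m n p q t)) \<longlongrightarrow> 1/2) at_top" by (simp only: const h tendsto_const)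
  from side_KM[OF mnp q this] show ?thesis using lim nv by blast
 qed
 ultimately show ?thesis unfolding cut_set_def stable_manifold_def using lim by blast
qed

lemma equilibria_interior:
 assumes mnp: "m > 0" "n > 0" "p > 0"
 shows "{pt_N m n p, pt_R m n p, pt_S m n p, pt_T m n p} \<subseteq> int_S"
proof -
 have I: "(u / D, v / D) \<in> int_S" if "0 < u" "0 < v" "u + v < D" for u v D :: real
 proof -
  have "u / D + v / D < 1" using that by (simp add: add_divide_distrib[symmetric])
  then show ?thesis using that by (simp add: interior_simplex_S)
 qed
 have half: "(1/2, v / D) \<in> int_S" "(v / D, 1/2) \<in> int_S" if "0 < v" "2 * v < D" for v D :: real
 proof -
  have "v / D < 1/2" using that by (simp add: field_simps)
  moreover have "0 < v / D" using that by simp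
  ultimately show "(1/2, v / D) \<in> int_S" "(v / D, 1/2) \<in> int_S"
   unfolding interior_simplex_S mem_Collect_eq prod.case by linarith+
 qed
 have "pt_N m n p \<in> int_S" "pt_R m n p \<in> int_S"
  unfolding pt_N_def pt_R_def by (rule I; use mnp in simp)+
 moreover have "pt_S m n p \<in> int_S" unfolding pt_S_def by (rule half(1); use mnp in simp)
 moreover have "pt_T m n p \<in> int_S" unfolding pt_T_def by (rule half(2); use mnp in simp)
 ultimately show ?thesis by blast
qed

lemma einstein_set:
 fixes bl :: "'m::finite + 'n::finite + 'p::finite => block"
 assumes bl: "bl = flag_blocks" and mnp: "m = CARD('m)" "n = CARD('n)" "p = CARD('p)"
 shows "{q \<in> int_S. einstein bl q} = {pt_N m n p, pt_R m n p, pt_S m n p, pt_T m n p}"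
proof -
 have pos: "m > 0" "n > 0" "p > 0" using mnp by simp_all
 have "ricci_field m n p q = 0" if "q \<in> {pt_N m n p, pt_R m n p, pt_S m n p, pt_T m n p}" for q
  using that pt_N_repeller[OF pos] pt_R_saddle[OF pos] pt_S_saddle[OF pos] pt_T_saddle[OF pos]
  unfolding repeller_def hyperbolic_saddle_def by blast
 then show ?thesis
  using einstein_iff[OF bl] interior_equilibria[OF pos] equilibria_interior[OF pos] unfolding mnp by blast
qed

section \<open>Kaehler metrics\<close>

definition sgn_J :: "('k::finite => block) => (block => block => real) => 'k cmat => 'k cmat" where
 "sgn_J bl s X = (\<chi> i j. \<i> * of_real (s (bl i) (bl j)) * X $ i $ j)"

lemma isotropy_group_conj_nth:
 assumes "A \<in> isotropy_group bl"
 shows "sgn_J bl s (A ** X ** ctranspose A) = A ** sgn_J bl s X ** ctranspose A"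
proof -
 have A: "A $ i $ j = 0" if "bl i \<noteq> bl j" for i j using assms that by (simp add: isotropy_group_def)
 have e: "(A ** Y ** ctranspose A) $ i $ j = (\<Sum>l\<in>UNIV. (\<Sum>k\<in>UNIV. A $ i $ k * Y $ k $ l) * cnj (A $ j $ l))" for Y i j
  by (simp add: matrix_matrix_mult_def)
 have c: "\<i> * of_real (s (bl i) (bl j)) * (A $ i $ k * X $ k $ l * cnj (A $ j $ l))
   = A $ i $ k * (\<i> * of_real (s (bl k) (bl l)) * X $ k $ l) * cnj (A $ j $ l)" for i j k l
  using A[of i k] A[of j l] by (cases "bl i = bl k"; cases "bl j = bl l") auto
 show ?thesis
  by (simp only: cmat_eq_iff e sgn_J_def vec_lambda_beta sum_distrib_left sum_distrib_right c) blast
qed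

text \<open>For a structure acting by \<open>\<plusminus>\<i>\<close> on the blocks, the remaining
  conditions decouple into relations for triples of blocks: \<open>nij\<close> expresses
  integrability and excludes the cyclic sign patterns, \<open>closed\<close> expresses that the
  fundamental form is closed.\<close>

lemma kaehlerI:
 fixes bl :: "'k::finite => block"
 assumes anti: "\<And>a b. s b a = - s a b" and sq: "\<And>a b. a \<noteq> b ==> s a b * s a b = 1"
  and nij: "\<And>a b c. a \<noteq> b ==> b \<noteq> c ==> a \<noteq> c ==> s a c * s a b + s a c * s b c - s a b * s b c = 1"
  and closed: "\<And>a b c. s a b * wt q a b + s b c * wt q b c = s a c * wt q a c"
 shows "kaehler bl q"
 unfolding kaehler_def
proof (intro exI[of _ "sgn_J bl s"] conjI ballI)
 let ?J = "sgn_J bl s"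
 have J: "?J X $ i $ j = \<i> * of_real (s (bl i) (bl j)) * X $ i $ j" for X i j by (simp add: sgn_J_def)
 have Jm: "?J X \<in> \<mm> bl" if "X \<in> \<mm> bl" for X
 proof -
  have "skew (?J X)"
  proof (rule skewI)
   fix i j
   have "cnj (X $ j $ i) = - X $ i $ j" using that by (intro skew_cnj) (simp add: mem_isotropy_complement)
   then show "cnj (?J X $ j $ i) = - ?J X $ i $ j" by (simp add: J anti[of "bl i" "bl j"])
  qed
  then show ?thesis using that by (simp add: mem_isotropy_complement J)
 qed
 show "invariant_complex_structure bl (?J)"
  unfolding invariant_complex_structure_def
 proof (intro conjI ballI)
  show "linear (?J)" by (rule linearI) (auto simp: cmat_eq_iff J algebra_simps)
  fix X assume X: "X \<in> \<mm> bl"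
  show "?J X \<in> \<mm> bl" by (rule Jm[OF X])
  have ii: "\<i> * of_real u * (\<i> * of_real u * x) = - of_real (u * u) * x" for u x by (simp add: algebra_simps)
  have "\<i> * of_real (s (bl i) (bl j)) * (\<i> * of_real (s (bl i) (bl j)) * X $ i $ j) = - X $ i $ j" for i j
   unfolding ii using X sq[of "bl i" "bl j"] by (cases "bl i = bl j") (auto simp: mem_isotropy_complement)
  then show "?J (?J X) = - X" by (simp only: cmat_eq_iff J vector_uminus_component)  auto
  show "?J (A ** X ** ctranspose A) = A ** ?J X ** ctranspose A" if "A \<in> isotropy_group bl" for A
   by (rule isotropy_group_conj_nth[OF that])
  fix Y assume Y: "Y \<in> \<mm> bl"
  \<comment> \<open>The summand of the Nijenhuis tensor at the middle index \<open>l\<close>. If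
    \<open>l\<close> shares a block with \<open>i\<close> or \<open>j\<close>, one factor is 0;
    otherwise the bracketed coefficient is \<open>nij\<close>.\<close>
  have t: "(\<i> * of_real (s (bl i) (bl l)) * X $ i $ l) * (\<i> * of_real (s (bl l) (bl j)) * Y $ l $ j)
   - \<i> * of_real (s (bl i) (bl j)) * ((\<i> * of_real (s (bl i) (bl l)) * X $ i $ l) * Y $ l $ j)
   - \<i> * of_real (s (bl i) (bl j)) * (X $ i $ l * (\<i> * of_real (s (bl l) (bl j)) * Y $ l $ j))
   - X $ i $ l * Y $ l $ j = 0"
   if X: "X \<in> \<mm> bl" and Y: "Y \<in> \<mm> bl" and ij: "bl i \<noteq> bl j" for X Y i j l
  proof (cases "bl i = bl l \<or> bl l = bl j")
   case True
   then have "X $ i $ l = 0 \<or> Y $ l $ j = 0" using X Y by (auto simp: mem_isotropy_complement)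
   then show ?thesis by auto
  next
   case False
   define u v r where "u = s (bl i) (bl l)" and "v = s (bl l) (bl j)" and "r = s (bl i) (bl j)"
   have "r * u + r * v - u * v = 1" unfolding u_def v_def r_def using nij False ij by blast
   then have "of_real (r * u + r * v - u * v) = (1 :: complex)" by simp
   then have "of_real r * of_real u + of_real r * of_real v - of_real u * of_real v = (1 :: complex)" by simp
   then show ?thesis unfolding u_def[symmetric] v_def[symmetric] r_def[symmetric] using i_squared by algebra
  qed
  have "(complement_part bl (bracket (?J X) (?J Y)) - ?J (complement_part bl (bracket (?J X) Y))
    - ?J (complement_part bl (bracket X (?J Y))) - complement_part bl (bracket X Y)) $ i $ j = 0" for i j
  proof (cases "bl i = bl j")
   case True
   then show ?thesis by (simp add: J)
  next
   case False
   have "(complement_part bl (bracket (?J X) (?J Y)) - ?J (complement_part bl (bracket (?J X) Y))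
    - ?J (complement_part bl (bracket X (?J Y))) - complement_part bl (bracket X Y)) $ i $ j
    = (\<Sum>l\<in>UNIV. ((\<i> * of_real (s (bl i) (bl l)) * X $ i $ l) * (\<i> * of_real (s (bl l) (bl j)) * Y $ l $ j)
      - \<i> * of_real (s (bl i) (bl j)) * ((\<i> * of_real (s (bl i) (bl l)) * X $ i $ l) * Y $ l $ j)
      - \<i> * of_real (s (bl i) (bl j)) * (X $ i $ l * (\<i> * of_real (s (bl l) (bl j)) * Y $ l $ j))
      - X $ i $ l * Y $ l $ j)
     - ((\<i> * of_real (s (bl i) (bl l)) * Y $ i $ l) * (\<i> * of_real (s (bl l) (bl j)) * X $ l $ j)
      - \<i> * of_real (s (bl i) (bl j)) * ((\<i> * of_real (s (bl i) (bl l)) * Y $ i $ l) * X $ l $ j)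
      - \<i> * of_real (s (bl i) (bl j)) * (Y $ i $ l * (\<i> * of_real (s (bl l) (bl j)) * X $ l $ j))
      - Y $ i $ l * X $ l $ j))"
    using False by (simp only: vector_minus_component complement_part_nth if_False J bracket_nth sum_distrib_left sum_subtractf[symmetric])
     (intro sum.cong refl, simp add: algebra_simps)
   then show ?thesis by (simp only: t[OF X Y False] t[OF Y X False] diff_self sum.neutral_const)
  qed
  then show "complement_part bl (bracket (?J X) (?J Y)) - ?J (complement_part bl (bracket (?J X) Y))
    - ?J (complement_part bl (bracket X (?J Y))) - complement_part bl (bracket X Y) = 0"
   by (simp only: cmat_eq_iff zero_index) simp
 qed
 show "flag_metric bl q (?J X) (?J Y) = flag_metric bl q X Y"
  if X: "X \<in> \<mm> bl" and Y: "Y \<in> \<mm> bl" for X Y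
 proof -
  have sk: "skew X" "skew Y" "skew (?J X)" "skew (?J Y)"
   using X Y Jm[OF X] Jm[OF Y] by (auto simp: mem_isotropy_complement)
  have "wt q (bl i) (bl j) * Re (?J X $ i $ j * cnj (?J Y $ i $ j)) = wt q (bl i) (bl j) * Re (X $ i $ j * cnj (Y $ i $ j))" for i j
  proof (cases "bl i = bl j")
   case False
   have "\<i> * of_real u * x * cnj (\<i> * of_real u * y) = of_real (u * u) * (x * cnj y)" for u x y by (simp add: algebra_simps)
   then show ?thesis unfolding J using sq[OF False] by simp
  qed simp
  then show ?thesis unfolding flag_metric_eq[OF sk(1,2)] flag_metric_eq[OF sk(3,4)] by (simp only:)
 qed
 fix X Y Z assume XYZ: "X \<in> \<mm> bl" "Y \<in> \<mm> bl" "Z \<in> \<mm> bl"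
 then have sk: "skew X" "skew Y" "skew Z" by (auto simp: mem_isotropy_complement)
 \<comment> \<open>The coefficients of the fundamental form. Closedness makes them a cocycle, and
   the cyclic sum of the trilinear form \<open>T\<close> collects exactly
   \<open>\<sigma> i j + \<sigma> j l + \<sigma> l i\<close>.\<close>
 define \<sigma> where "\<sigma> i j = \<i> * complex_of_real (s (bl i) (bl j) * wt q (bl i) (bl j))" for i j
 have \<sigma>: "\<sigma> i j + \<sigma> j l + \<sigma> l i = 0" for i j l
 proof -
  have "s (bl i) (bl j) * wt q (bl i) (bl j) + s (bl j) (bl l) * wt q (bl j) (bl l) + s (bl l) (bl i) * wt q (bl l) (bl i) = 0"
   using closed[of "bl i" "bl j" "bl l"] anti[of "bl l" "bl i"] by (simp add: wt_sym[of q "bl l" "bl i"])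
  then show ?thesis unfolding \<sigma>_def distrib_left[symmetric] of_real_add[symmetric] by simp
 qed
 define T where "T A B C = (\<Sum>i\<in>UNIV. \<Sum>j\<in>UNIV. \<Sum>l\<in>UNIV. \<sigma> i j * (A $ i $ l * B $ l $ j * C $ j $ i))" for A B C :: "'k cmat"
 have g: "flag_metric bl q (?J (complement_part bl (bracket A B))) C = - 2 * real CARD('k) * Re (T A B C - T B A C)"
  if sk: "skew A" "skew B" "skew C" for A B C
 proof -
  have "skew (?J (complement_part bl (bracket A B)))"
   using Jm[OF complement_part_skew[OF bracket_skew[OF sk(1,2)]]] by (simp add: mem_isotropy_complement)
  moreover have "of_real (wt q (bl i) (bl j)) * (?J (complement_part bl (bracket A B)) $ i $ j * C $ j $ i)
    = (\<Sum>l\<in>UNIV. \<sigma> i j * (A $ i $ l * B $ l $ j * C $ j $ i) - \<sigma> i j * (B $ i $ l * A $ l $ j * C $ j $ i))" for i j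
  proof (cases "bl i = bl j")
   case True
   then show ?thesis by (simp add: \<sigma>_def)
  next
   case False
   have "of_real (wt q (bl i) (bl j)) * (\<i> * of_real (s (bl i) (bl j)) * (a * b - b' * a') * c)
     = \<sigma> i j * (a * b * c) - \<sigma> i j * (b' * a' * c)" for a b a' b' c
    by (simp add: \<sigma>_def algebra_simps)
   note e = this
   have "of_real (wt q (bl i) (bl j)) * (?J (complement_part bl (bracket A B)) $ i $ j * C $ j $ i)
     = (\<Sum>l\<in>UNIV. of_real (wt q (bl i) (bl j)) * (\<i> * of_real (s (bl i) (bl j)) * (A $ i $ l * B $ l $ j - B $ i $ l * A $ l $ j) * C $ j $ i))"
    using False by (simp only: J complement_part_nth if_False bracket_nth sum_subtractf[symmetric] sum_distrib_left sum_distrib_right)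
   then show ?thesis unfolding e .
  qed
  ultimately show ?thesis unfolding T_def sum_subtractf[symmetric] by (simp only: flag_metric_eq_trace[OF _ sk(3)])
 qed
 have cyc: "T A B C + T B C A + T C A B = 0" for A B C
 proof -
  have 1: "T B C A = (\<Sum>i\<in>UNIV. \<Sum>j\<in>UNIV. \<Sum>l\<in>UNIV. \<sigma> l i * (B $ l $ j * C $ j $ i * A $ i $ l))"
   unfolding T_def by (rule sum3_rotate(2))
  have 2: "T C A B = (\<Sum>i\<in>UNIV. \<Sum>j\<in>UNIV. \<Sum>l\<in>UNIV. \<sigma> j l * (C $ j $ i * A $ i $ l * B $ l $ j))"
   unfolding T_def by (rule sum3_rotate(1))
  have "T A B C + T B C A + T C A B = (\<Sum>i\<in>UNIV. \<Sum>j\<in>UNIV. \<Sum>l\<in>UNIV. (\<sigma> i j + \<sigma> j l + \<sigma> l i) * (A $ i $ l * B $ l $ j * C $ j $ i))"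
   unfolding 1 2 unfolding T_def sum.distrib[symmetric] by (intro sum.cong refl) (simp add: algebra_simps)
  then show ?thesis by (simp add: \<sigma>)
 qed
 have "Re (T X Y Z - T Y X Z) + Re (T Y Z X - T Z Y X) + Re (T Z X Y - T X Z Y)
   = Re ((T X Y Z + T Y Z X + T Z X Y) - (T Y X Z + T X Z Y + T Z Y X))" by simp
 also have "\<dots> = 0" unfolding cyc by simp
 finally have "Re (T X Y Z - T Y X Z) + Re (T Y Z X - T Z Y X) + Re (T Z X Y - T X Z Y) = 0" .
 then show "flag_metric bl q (?J (complement_part bl (bracket X Y))) Z
   + flag_metric bl q (?J (complement_part bl (bracket Y Z))) X
   + flag_metric bl q (?J (complement_part bl (bracket Z X))) Y = 0"
  unfolding g[OF sk(1,2,3)] g[OF sk(2,3,1)] g[OF sk(3,1,2)] distrib_left[symmetric] by (simp only: mult_zero_right)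
qed

text \<open>A linear order of the blocks is a choice of positive roots, hence an invariant complex
  structure. Closedness then asks that the weight between the extreme blocks be the sum of the two
  others.\<close>

lemma kaehler_order:
 fixes rk :: "block => nat"
 assumes inj: "inj rk" and add: "\<And>a b c. rk a < rk b ==> rk b < rk c ==> wt q a c = wt q a b + wt q b c"
 shows "kaehler bl q"
proof -
 define s :: "block => block => real" where "s a b = (if rk a < rk b then 1 else if rk b < rk a then - 1 else 0)" for a b
 have ne: "rk a < rk b \<or> rk b < rk a" if "a \<noteq> b" for a b using inj that by (metis injD linorder_neqE_nat)
 have eq: "rk a = rk b \<longleftrightarrow> a = b" for a b using inj by (auto dest: injD)
 show ?thesis
 proof (rule kaehlerI[of s])
  show "s b a = - s a b" for a b by (auto simp: s_def)
  show "s a b * s a b = 1" if "a \<noteq> b" for a b using ne[OF that] by (auto simp: s_def)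
  show "s a c * s a b + s a c * s b c - s a b * s b c = 1" if "a \<noteq> b" "b \<noteq> c" "a \<noteq> c" for a b c
   using ne[OF that(1)] ne[OF that(2)] ne[OF that(3)] by (auto simp: s_def)
  show "s a b * wt q a b + s b c * wt q b c = s a c * wt q a c" for a b c
  proof (cases "a = b \<or> b = c \<or> a = c")
   case True
   then show ?thesis by (auto simp: s_def wt_sym)
  next
   case False
   then have rks: "rk a < rk b \<or> rk b < rk a" "rk b < rk c \<or> rk c < rk b" "rk a < rk c \<or> rk c < rk a" using ne by blast+
   have s: "s u v = 1 \<and> s v u = - 1" if "rk u < rk v" for u v using that by (simp add: s_def)
   define A B C where "A = wt q a b" and "B = wt q b c" and "C = wt q a c"
   have r: "wt q b a = A" "wt q c b = B" "wt q c a = C" by (simp_all add: A_def B_def C_def wt_sym)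
   note t = add[of a b c] add[of a c b] add[of b a c] add[of b c a] add[of c a b] add[of c b a]
   note t' = t[unfolded r, folded A_def B_def C_def]
   from rks consider "rk a < rk b" "rk b < rk c" | "rk a < rk c" "rk c < rk b" | "rk b < rk a" "rk a < rk c"
    | "rk b < rk c" "rk c < rk a" | "rk c < rk a" "rk a < rk b" | "rk c < rk b" "rk b < rk a" by linarith
   then show ?thesis
   proof cases
    case 1 then show ?thesis using t'(1) s[of a b] s[of b c] s[of a c] by (simp flip: A_def B_def C_def)
   next
    case 2 then show ?thesis using t'(2) s[of a b] s[of c b] s[of a c] by (simp flip: A_def B_def C_def)
   next
    case 3 then show ?thesis using t'(3) s[of b a] s[of b c] s[of a c] by (simp flip: A_def B_def C_def)
   next
    case 4 then show ?thesis using t'(4) s[of b a] s[of b c] s[of c a] by (simp flip: A_def B_def C_def)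
   next
    case 5 then show ?thesis using t'(5) s[of a b] s[of c b] s[of c a] by (simp flip: A_def B_def C_def)
   next
    case 6 then show ?thesis using t'(6) s[of b a] s[of c b] s[of c a] by (simp flip: A_def B_def C_def)
   qed
  qed
 qed
qed

text \<open>Each alternative says that one of \<open>x\<close>, \<open>y\<close>, \<open>z\<close>
  is the sum of the two others; the two blocks of that parameter are placed at the ends of the
  order.\<close>

lemma kaehler_RST:
 assumes "2 * x = 1 \<or> 2 * y = 1 \<or> 2 * x + 2 * y = 1"
 shows "kaehler bl (x, y)"
proof -
 consider "2 * x = 1" | "2 * y = 1" | "2 * x + 2 * y = 1" using assms by blast
 then show ?thesis
 proof cases
  case 1
  define rk :: "block => nat" where "rk = case_block 0 2 1"
  show ?thesis
  proof (rule kaehler_order[of rk])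
   show "inj rk" by (rule injI) (auto simp: rk_def split: block.splits)
   show "wt (x, y) a c = wt (x, y) a b + wt (x, y) b c" if "rk a < rk b" "rk b < rk c" for a b c
    using that 1 by (cases a; cases b; cases c) (auto simp: rk_def)
  qed
 next
  case 2
  define rk :: "block => nat" where "rk = case_block 0 1 2"
  show ?thesis
  proof (rule kaehler_order[of rk])
   show "inj rk" by (rule injI) (auto simp: rk_def split: block.splits)
   show "wt (x, y) a c = wt (x, y) a b + wt (x, y) b c" if "rk a < rk b" "rk b < rk c" for a b c
    using that 2 by (cases a; cases b; cases c) (auto simp: rk_def)
  qed
 next
  case 3
  define rk :: "block => nat" where "rk = case_block 1 0 2"
  show ?thesis
  proof (rule kaehler_order[of rk])
   show "inj rk" by (rule injI) (auto simp: rk_def split: block.splits)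
   show "wt (x, y) a c = wt (x, y) a b + wt (x, y) b c" if "rk a < rk b" "rk b < rk c" for a b c
    using that 3 by (cases a; cases b; cases c) (auto simp: rk_def)
  qed
 qed
qed

section \<open>Sign condition on the weights of a Kaehler metric\<close>

definition diag_mat :: "('k::finite => complex) => 'k cmat" where
 "diag_mat t = (\<chi> i j. if i = j then t i else 0)"

lemma diag_mat_mult: "(diag_mat t ** A) $ i $ j = t i * A $ i $ j" "(A ** diag_mat t) $ i $ j = A $ i $ j * t j"
 by (simp_all add: matrix_matrix_mult_def diag_mat_def if_distrib[of "\<lambda>x. x * _"] if_distrib[of "\<lambda>x. _ * x"] cong: if_cong)

lemma ctranspose_diag_mat: "ctranspose (diag_mat t) = diag_mat (\<lambda>i. cnj (t i))"
 by (simp add: cmat_eq_iff diag_mat_def)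

lemma diag_mat_conj: "(diag_mat t ** A ** ctranspose (diag_mat t)) $ i $ j = t i * A $ i $ j * cnj (t j)"
 unfolding ctranspose_diag_mat diag_mat_mult ..

lemma diag_mat_isotropy:
 fixes bl :: "'k::finite => block"
 assumes "\<And>i. cnj (t i) * t i = 1" "prod t UNIV = 1"
 shows "diag_mat t \<in> isotropy_group bl"
proof -
 have "det (diag_mat t) = prod t UNIV"
  by (subst det_diagonal) (auto simp: diag_mat_def)
 moreover have "(ctranspose (diag_mat t) ** diag_mat t) $ i $ j = mat 1 $ i $ j" for i j
  unfolding ctranspose_diag_mat diag_mat_mult using assms(1) by (auto simp: diag_mat_def mat_def)
 then have "ctranspose (diag_mat t) ** diag_mat t = mat 1" by (simp only: cmat_eq_iff) simp
 ultimately show ?thesis using assms(2) by (auto simp: isotropy_group_def SU_def diag_mat_def)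
qed

text \<open>An \<open>Ad\<close>-invariant almost complex structure commutes with the maximal torus, so it preserves the
 root spaces.\<close>

lemma J_root_space:
 fixes bl :: "'k::finite => block"
 assumes J: "invariant_complex_structure bl J" and ab: "bl a \<noteq> bl b"
  and kl: "\<not> (k = a \<and> l = b)" "\<not> (k = b \<and> l = a)"
 shows "J (block_mat a b z) $ k $ l = 0"
proof -
 define W where "W = J (block_mat a b z)"
 have ne: "a \<noteq> b" using ab by blast
 note X = block_mat_complement[of bl a b z, OF ab]
 have W: "W \<in> \<mm> bl" unfolding W_def using J X by (simp add: invariant_complex_structure_def)
 have torus: "W $ k $ l = 0"
  if t: "\<And>i. cnj (t i) * t i = 1" "prod t UNIV = 1" "t a = t b" "t k * cnj (t l) \<noteq> 1" for t k l
 proof -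
  have "diag_mat t ** block_mat a b z ** ctranspose (diag_mat t) = block_mat a b z"
   unfolding cmat_eq_iff diag_mat_conj
  proof (intro allI)
   fix i j
   have u: "t b * x * cnj (t b) = x" for x using t(1)[of b] by (simp add: mult.commute mult.left_commute)
   consider "i = a" "j = b" | "i = b" "j = a" | "\<not> (i = a \<and> j = b)" "\<not> (i = b \<and> j = a)" by blast
   then show "t i * block_mat a b z $ i $ j * cnj (t j) = block_mat a b z $ i $ j"
   proof cases
    case 3
    show ?thesis unfolding block_mat_zero[OF 3] by simp
   qed (simp_all only: t(3) u)
  qed
  moreover have "J (diag_mat t ** block_mat a b z ** ctranspose (diag_mat t)) = diag_mat t ** W ** ctranspose (diag_mat t)"
   using J X diag_mat_isotropy[OF t(1,2), of bl] unfolding invariant_complex_structure_def W_def by blast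
  ultimately have "W $ k $ l = t k * W $ k $ l * cnj (t l)" by (metis W_def diag_mat_conj)
  then have "W $ k $ l * (t k * cnj (t l) - 1) = 0" by (simp add: algebra_simps)
  then show ?thesis using t(4) by simp
 qed
 have out: "W $ k $ l = 0" if "k \<noteq> a" "k \<noteq> b" "k \<noteq> l" for k l
 proof (cases "l = a \<or> l = b")
  case True
  \<comment> \<open>Equal entries at \<open>a\<close> and \<open>b\<close> make conjugation fix the
    root vector; the entry at \<open>k\<close> restores determinant 1. Position
    \<open>(k, l)\<close> is multiplied by \<open>\<i>\<close>, so \<open>W\<close> vanishes
    there.\<close>
  define t where "t = ((\<lambda>_. 1 :: complex)(a := \<i>, b := \<i>, k := - 1))"
  have "prod t UNIV = 1"
  proof -
   have "prod t UNIV = (\<Prod>i\<in>{a, b, k}. t i)" by (rule prod.mono_neutral_right) (auto simp: t_def)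
   then show ?thesis using that ne by (simp add: t_def)
  qed
  then show ?thesis using that ne True by (intro torus[of t]) (auto simp: t_def)
 next
  case False
  \<comment> \<open>Here \<open>a\<close> and \<open>b\<close> are different from both
    \<open>k\<close> and \<open>l\<close> and carry the entry 1; the position \<open>(k, l)\<close>
    changes sign.\<close>
  define t where "t = ((\<lambda>_. 1 :: complex)(k := \<i>, l := - \<i>))"
  have "prod t UNIV = 1"
  proof -
   have "prod t UNIV = (\<Prod>i\<in>{k, l}. t i)" by (rule prod.mono_neutral_right) (auto simp: t_def)
   then show ?thesis using that by (simp add: t_def)
  qed
  then show ?thesis using that False by (intro torus[of t]) (auto simp: t_def)
 qed
 have diag: "W $ k $ k = 0" for k using W by (simp add: mem_isotropy_complement)
 have sk: "skew W" using W by (simp add: mem_isotropy_complement)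
 consider "k = l" | "k \<noteq> l" "k \<noteq> a" "k \<noteq> b" | "k \<noteq> l" "l \<noteq> a" "l \<noteq> b" using kl by blast
 then have "W $ k $ l = 0"
 proof cases
  case 3
  then have "W $ l $ k = 0" using out by metis
  then show ?thesis using skew_nth[OF sk, of k l] by simp
 qed (use out diag in blast)+
 then show ?thesis unfolding W_def .
qed

lemma block_mat_eqI:
 assumes "skew W" "a \<noteq> b" "\<And>k l. \<not> (k = a \<and> l = b) ==> \<not> (k = b \<and> l = a) ==> W $ k $ l = 0"
 shows "W = block_mat a b (W $ a $ b)"
 unfolding cmat_eq_iff
proof (intro allI)
 fix i j
 consider "i = a" "j = b" | "i = b" "j = a" | "\<not> (i = a \<and> j = b)" "\<not> (i = b \<and> j = a)" by blast
 then show "W $ i $ j = block_mat a b (W $ a $ b) $ i $ j"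
 proof cases
  case 2
  show ?thesis unfolding 2 block_mat_entries[OF assms(2)] by (rule skew_nth[OF assms(1)])
 next
  case 3
  show ?thesis unfolding block_mat_zero[OF 3] by (rule assms(3)[OF 3])
 qed (simp only: block_mat_entries[OF assms(2)])
qed

lemma block_mat_scaleR: "a \<noteq> b ==> r *\<^sub>R block_mat a b z = block_mat a b (of_real r * z)"
proof -
 assume ne: "a \<noteq> b"
 have "r *\<^sub>R block_mat a b z = block_mat a b ((r *\<^sub>R block_mat a b z) $ a $ b)"
 proof (rule block_mat_eqI[OF _ ne])
  show "skew (r *\<^sub>R block_mat a b z)" using block_mat_skew[OF ne, of z] by (simp add: skew_def)
  show "(r *\<^sub>R block_mat a b z) $ k $ l = 0" if "\<not> (k = a \<and> l = b)" "\<not> (k = b \<and> l = a)" for k l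
   unfolding vector_scaleR_component block_mat_zero[OF that] by simp
 qed
 then show ?thesis by (simp only: vector_scaleR_component block_mat_entries[OF ne] scaleR_conv_of_real[where 'a = complex])
qed

text \<open>On the root plane \<open>J\<close> is an isometry with square -1, hence a rotation by a
  right angle: the Hermitian condition for the pairs \<open>J X\<close>, \<open>X\<close> and
  \<open>X\<close>, \<open>X\<close> gives \<open>Re \<zeta> = 0\<close> and
  \<open>\<bar>\<zeta>\<bar> = 1\<close>.\<close>

lemma kaehler_J_sign:
 fixes bl :: "'k::finite => block"
 assumes J: "invariant_complex_structure bl J" and ab: "bl a \<noteq> bl b" and q: "q \<in> int_S"
  and herm: "\<And>X Y. X \<in> \<mm> bl ==> Y \<in> \<mm> bl ==>
    flag_metric bl q (J X) (J Y) = flag_metric bl q X Y"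
 obtains s :: real where "s = 1 \<or> s = - 1" "J (block_mat a b 1) = block_mat a b (of_real s * \<i>)"
  "J (block_mat a b \<i>) = block_mat a b (of_real (- s))"
proof -
 have ne: "a \<noteq> b" using ab by blast
 define X where "X = block_mat a b 1"
 have Xm: "X \<in> \<mm> bl" unfolding X_def by (rule block_mat_complement[of bl a b, OF ab])
 define \<zeta> where "\<zeta> = J X $ a $ b"
 have JX: "J X \<in> \<mm> bl" "J (J X) = - X" and lin: "linear J"
  using J Xm by (auto simp: invariant_complex_structure_def)
 have skJ: "skew (J X)" "skew X" using JX Xm by (auto simp: mem_isotropy_complement)
 have JXb: "J X = block_mat a b \<zeta>"
  unfolding \<zeta>_def by (rule block_mat_eqI[OF skJ(1) ne]) (unfold X_def, rule J_root_space[OF J ab])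
 define K where "K = 4 * real CARD('k) * wt q (bl a) (bl b)"
 have K: "K > 0" using wt_pos[OF q ab] by (simp add: K_def)
 have g: "flag_metric bl q (block_mat a b z) (block_mat a b z') = K * Re (z * cnj z')" for z z'
  unfolding flag_metric_block_mat[OF ne block_mat_skew[OF ne]] block_mat_entries[OF ne] K_def ..
 have f: "flag_metric bl q (J (J X)) (J X) = flag_metric bl q (J X) X" by (rule herm[OF JX(1) Xm])
 have JJ: "J (J X) = block_mat a b (- 1)"
  unfolding JX(2) unfolding X_def using block_mat_scaleR[OF ne, of "- 1" 1] by simp
 have "K * Re (- 1 * cnj \<zeta>) = K * Re (\<zeta> * cnj 1)" using f unfolding JJ unfolding JXb unfolding X_def g .
 then have re: "Re \<zeta> = 0" using K by simp
 have "K * Re (\<zeta> * cnj \<zeta>) = K * Re (1 * cnj 1)" using herm[OF Xm Xm] unfolding JXb unfolding X_def g .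
 then have "(Im \<zeta>)\<^sup>2 = 1" using K re by (simp add: power2_eq_square)
 then have s: "Im \<zeta> = 1 \<or> Im \<zeta> = - 1" by (simp add: power2_eq_1_iff)
 have z: "\<zeta> = of_real (Im \<zeta>) * \<i>" using re by (simp add: complex_eq_iff)
 have ss: "Im \<zeta> * Im \<zeta> = 1" using s by auto
 have "block_mat a b \<i> = Im \<zeta> *\<^sub>R J X"
  unfolding JXb block_mat_scaleR[OF ne] by (subst z) (simp add: ss mult.assoc[symmetric] flip: of_real_mult)
 then have "J (block_mat a b \<i>) = Im \<zeta> *\<^sub>R (- X)" by (simp add: linear_scale[OF lin] JX(2))
 also have "\<dots> = (- Im \<zeta>) *\<^sub>R X" by simp
 also have "\<dots> = block_mat a b (of_real (- Im \<zeta>))" unfolding X_def block_mat_scaleR[OF ne] by simp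
 finally have "J (block_mat a b \<i>) = block_mat a b (of_real (- Im \<zeta>))" .
 moreover have "J (block_mat a b 1) = block_mat a b (of_real (Im \<zeta>) * \<i>)" using JXb z by (simp add: X_def)
 ultimately show ?thesis using that s by blast
qed

lemma bracket_block_mat:
 assumes ne: "a \<noteq> b" "b \<noteq> c" "a \<noteq> c"
 shows "bracket (block_mat a b z) (block_mat b c w) = block_mat a c (z * w)"
proof -
 have sk: "skew (bracket (block_mat a b z) (block_mat b c w))"
  by (rule bracket_skew[OF block_mat_skew[OF ne(1)] block_mat_skew[OF ne(2)]])
 have e: "block_mat a b z $ i $ l * block_mat b c w $ l $ j = (if l = b then (if i = a \<and> j = c then z * w else 0) else 0)"
  "block_mat b c w $ i $ l * block_mat a b z $ l $ j = (if l = b then (if i = c \<and> j = a then cnj w * cnj z else 0) else 0)" for i l j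
 proof -
  show "block_mat a b z $ i $ l * block_mat b c w $ l $ j = (if l = b then (if i = a \<and> j = c then z * w else 0) else 0)"
  proof (cases "l = b")
   case False
   then have "block_mat a b z $ i $ l = 0 \<or> block_mat b c w $ l $ j = 0"
    using ne block_mat_zero[of i a l b z] block_mat_zero[of l b j c w] by metis
   then show ?thesis using False by auto
  next
   case True
   have "block_mat a b z $ i $ b = (if i = a then z else 0)" "block_mat b c w $ b $ j = (if j = c then w else 0)"
    using ne block_mat_zero[of i a b b z] block_mat_zero[of b b j c w] block_mat_entries by metis+
   then show ?thesis using True by auto
  qed
  show "block_mat b c w $ i $ l * block_mat a b z $ l $ j = (if l = b then (if i = c \<and> j = a then cnj w * cnj z else 0) else 0)"
  proof (cases "l = b")
   case False
   then have "block_mat b c w $ i $ l = 0 \<or> block_mat a b z $ l $ j = 0"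
    using ne block_mat_zero[of l a j b z] block_mat_zero[of i b l c w] by metis
   then show ?thesis using False by auto
  next
   case True
   have "block_mat a b z $ b $ j = (if j = a then - cnj z else 0)" "block_mat b c w $ i $ b = (if i = c then - cnj w else 0)"
    using ne block_mat_zero[of b a j b z] block_mat_zero[of i b b c w] block_mat_entries by metis+
   then show ?thesis using True by auto
  qed
 qed
 have n: "bracket (block_mat a b z) (block_mat b c w) $ i $ j
   = (if i = a \<and> j = c then z * w else 0) - (if i = c \<and> j = a then cnj w * cnj z else 0)" for i j
  by (simp only: bracket_nth e sum_subtractf sum.delta' finite UNIV_I if_True sum.delta)
 have "bracket (block_mat a b z) (block_mat b c w)
   = block_mat a c (bracket (block_mat a b z) (block_mat b c w) $ a $ c)"
  by (rule block_mat_eqI[OF sk ne(3)]) (simp only: n if_False diff_self)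
 also have "bracket (block_mat a b z) (block_mat b c w) $ a $ c = z * w" unfolding n using ne(3) by simp
 finally show ?thesis .
qed

lemma block_mat_flip: "a \<noteq> b ==> block_mat b a z = block_mat a b (- cnj z)"
proof -
 assume ne: "a \<noteq> b"
 have "block_mat b a z = block_mat a b (block_mat b a z $ a $ b)"
  by (rule block_mat_eqI[OF block_mat_skew[OF ne[symmetric]] ne]) (rule block_mat_zero)
 then show ?thesis unfolding block_mat_entries[OF ne[symmetric]] .
qed

text \<open>Closedness is tested on three root vectors, one for each block pair, such that the
  bracket of any two lies in the root space of the third.\<close>

lemma kaehler_weights:
 fixes bl :: "'k::finite => block"
 assumes q: "q \<in> int_S" and kq: "kaehler bl q"
  and abc: "bl a = First" "bl b = Second" "bl c = Third"
 shows "\<exists>r s t. (r = 1 \<or> r = - 1) \<and> (s = 1 \<or> s = - 1) \<and> (t = 1 \<or> t = - 1) \<and>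
  r * fst q + s * snd q + t * (1 - fst q - snd q) = (0 :: real)"
proof -
 obtain J where J: "invariant_complex_structure bl J"
  and herm: "\<And>X Y. X \<in> \<mm> bl ==> Y \<in> \<mm> bl ==>
    flag_metric bl q (J X) (J Y) = flag_metric bl q X Y"
  and cl: "\<And>X Y Z. X \<in> \<mm> bl ==> Y \<in> \<mm> bl ==> Z \<in> \<mm> bl ==>
    flag_metric bl q (J (complement_part bl (bracket X Y))) Z
   + flag_metric bl q (J (complement_part bl (bracket Y Z))) X
   + flag_metric bl q (J (complement_part bl (bracket Z X))) Y = 0"
  using kq unfolding kaehler_def by blast
 have ne: "bl a \<noteq> bl b" "bl b \<noteq> bl c" "bl a \<noteq> bl c" using abc by simp_all
 then have ne': "a \<noteq> b" "b \<noteq> c" "a \<noteq> c" by blast+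
 obtain r where r: "r = 1 \<or> r = - 1" "J (block_mat a b 1) = block_mat a b (of_real r * \<i>)"
  "J (block_mat a b \<i>) = block_mat a b (of_real (- r))" by (rule kaehler_J_sign[OF J ne(1) q herm])
 obtain s where s: "s = 1 \<or> s = - 1" "J (block_mat a c 1) = block_mat a c (of_real s * \<i>)"
  "J (block_mat a c \<i>) = block_mat a c (of_real (- s))" by (rule kaehler_J_sign[OF J ne(3) q herm])
 obtain t where t: "t = 1 \<or> t = - 1" "J (block_mat b c 1) = block_mat b c (of_real t * \<i>)"
  "J (block_mat b c \<i>) = block_mat b c (of_real (- t))" by (rule kaehler_J_sign[OF J ne(2) q herm])
 have cp: "complement_part bl (block_mat k l z) = block_mat k l z" if "bl k \<noteq> bl l" for k l z
  using block_mat_complement[of bl k l z, OF that] unfolding mem_isotropy_complement cmat_eq_iff complement_part_nth by metis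
 have g: "flag_metric bl q (block_mat k l z) (block_mat k l z') = 4 * real CARD('k) * wt q (bl k) (bl l) * Re (z * cnj z')"
  if "bl k \<noteq> bl l" for k l z z'
 proof -
  have kl: "k \<noteq> l" using that by blast
  show ?thesis using flag_metric_block_mat[OF kl block_mat_skew[OF kl, of z'], of bl q z] by (simp only: block_mat_entries[OF kl])
 qed
 have b1: "bracket (block_mat a b 1) (block_mat b c 1) = block_mat a c 1"
  using bracket_block_mat[OF ne'] by simp
 have "bracket (block_mat b c 1) (block_mat c a \<i>) = block_mat b a (1 * \<i>)"
  by (rule bracket_block_mat) (use ne' in auto)
 then have b2: "bracket (block_mat b c 1) (block_mat c a \<i>) = block_mat a b \<i>"
  using block_mat_flip[OF ne'(1), of \<i>] by simp
 have "bracket (block_mat c a \<i>) (block_mat a b 1) = block_mat c b (\<i> * 1)"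
  by (rule bracket_block_mat) (use ne' in auto)
 then have b3: "bracket (block_mat c a \<i>) (block_mat a b 1) = block_mat b c \<i>"
  using block_mat_flip[OF ne'(2), of \<i>] by simp
 have ca: "block_mat c a \<i> = block_mat a c \<i>" using block_mat_flip[OF ne'(3), of \<i>] by simp
 \<comment> \<open>The factor \<open>\<i>\<close> in one of the three vectors makes the three
   pairings real and nonzero; with three real vectors all of them would vanish.\<close>
 have "flag_metric bl q (block_mat a c (of_real s * \<i>)) (block_mat a c \<i>)
   + flag_metric bl q (block_mat a b (of_real (- r))) (block_mat a b 1)
   + flag_metric bl q (block_mat b c (of_real (- t))) (block_mat b c 1) = 0"
  using cl[OF block_mat_complement[of bl a b 1, OF ne(1)] block_mat_complement[of bl b c 1, OF ne(2)]
    block_mat_complement[of bl c a \<i>, OF ne(3)[symmetric]]]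
  unfolding b1 b2 b3 cp[OF ne(1)] cp[OF ne(2)] cp[OF ne(3)] r(3) s(2) t(3) unfolding ca .
 then have "4 * real CARD('k) * (s * snd q + (- r) * fst q + (- t) * (1 - fst q - snd q)) = 0"
  unfolding g[OF ne(1)] g[OF ne(2)] g[OF ne(3)] abc wt_simps by (simp add: algebra_simps)
 then have "(- r) * fst q + s * snd q + (- t) * (1 - fst q - snd q) = 0" by simp
 moreover have "- r = 1 \<or> - r = - 1" "- t = 1 \<or> - t = - 1" using r(1) t(1) by auto
 ultimately show ?thesis using s(1) by blast
qed

lemma einstein_kaehler_sets:
 fixes bl :: "'m::finite + 'n::finite + 'p::finite => block"
 assumes bl: "bl = flag_blocks" and mnp: "m = CARD('m)" "n = CARD('n)" "p = CARD('p)"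
 shows "{q \<in> int_S. einstein bl q \<and> kaehler bl q} = {pt_R m n p, pt_S m n p, pt_T m n p}"
  and "{q \<in> int_S. einstein bl q \<and> \<not> kaehler bl q} = {pt_N m n p}"
proof -
 have pos: "m > 0" "n > 0" "p > 0" using mnp by simp_all
 then have rpos: "real m > 0" "real n > 0" "real p > 0" by simp_all
 note E = einstein_set[OF bl mnp]
 have K: "kaehler bl (pt_R m n p)" "kaehler bl (pt_S m n p)" "kaehler bl (pt_T m n p)"
 proof -
  have D: "2 * real m + real n + real p > 0" using rpos by simp
  have "2 * (u / (2 * d)) + 2 * (v / (2 * d)) = 1" if "u + v = d" "d > 0" for u v d :: real
   using that by (simp add: add_divide_distrib[symmetric])
  from this[OF _ D, of "real m + real n" "real m + real p"]
  show "kaehler bl (pt_R m n p)" unfolding pt_R_def by (intro kaehler_RST disjI2) simp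
  show "kaehler bl (pt_S m n p)" "kaehler bl (pt_T m n p)"
   unfolding pt_S_def pt_T_def by (rule kaehler_RST; simp)+
 qed
 have N: "\<not> kaehler bl (pt_N m n p)"
 proof
  assume k: "kaehler bl (pt_N m n p)"
  have qi: "pt_N m n p \<in> int_S" using equilibria_interior[OF pos] by blast
  obtain r s t :: real where rst: "r = 1 \<or> r = - 1" "s = 1 \<or> s = - 1" "t = 1 \<or> t = - 1"
   "r * fst (pt_N m n p) + s * snd (pt_N m n p) + t * (1 - fst (pt_N m n p) - snd (pt_N m n p)) = 0"
   using kaehler_weights[OF qi k, of "Inl undefined" "Inr (Inl undefined)" "Inr (Inr undefined)"]
   by (auto simp: bl flag_blocks_def)
  define S where "S = real m + real n + real p"
  have S: "S > 0" using rpos by (simp add: S_def)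
  have x: "2 * S * fst (pt_N m n p) = real m + real n" "2 * S * snd (pt_N m n p) = real m + real p"
   using S by (simp_all add: pt_N_def S_def)
  have "r * (2 * S * fst (pt_N m n p)) + s * (2 * S * snd (pt_N m n p))
    + t * (2 * S - 2 * S * fst (pt_N m n p) - 2 * S * snd (pt_N m n p)) = 2 * S *
    (r * fst (pt_N m n p) + s * snd (pt_N m n p) + t * (1 - fst (pt_N m n p) - snd (pt_N m n p)))"
   by (simp add: algebra_simps)
  \<comment> \<open>Impossible: each of the three sums is positive and smaller than the sum of the
    two others.\<close>
  then have "r * (real m + real n) + s * (real m + real p) + t * (real n + real p) = 0"
   unfolding rst(4) x by (simp add: S_def algebra_simps)
  then show False using rst(1,2,3) rpos by (elim disjE) simp_all
 qed
 have E': "q \<in> int_S \<and> einstein bl q \<longleftrightarrow> q = pt_N m n p \<or> q = pt_R m n p \<or> q = pt_S m n p \<or> q = pt_T m n p" for q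
  using E by blast
 show "{q \<in> int_S. einstein bl q \<and> kaehler bl q} = {pt_R m n p, pt_S m n p, pt_T m n p}"
  unfolding conj_assoc[symmetric] E' using K N by auto
 show "{q \<in> int_S. einstein bl q \<and> \<not> kaehler bl q} = {pt_N m n p}"
  unfolding conj_assoc[symmetric] E' using K N by auto
qed

section \<open>Plane rotations\<close>

lemma SU_D: "A \<in> SU ==> ctranspose A ** A = mat 1" "A \<in> SU ==> A ** ctranspose A = mat 1" "A \<in> SU ==> det A = 1"
 by (auto simp: SU_def matrix_left_right_inverse)

lemma SU_mat1 [simp]: "mat 1 \<in> SU"
proof -
 have "ctranspose (mat 1) = (mat 1 :: 'k::finite cmat)" by (simp add: vec_eq_iff mat_def)
 then show ?thesis by (simp add: SU_def)
qed

lemma SU_mult: "A \<in> SU ==> B \<in> SU ==> A ** B \<in> SU"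
proof -
 assume A: "A \<in> SU" and B: "B \<in> SU"
 have "ctranspose (A ** B) ** (A ** B) = ctranspose B ** (ctranspose A ** A) ** B"
  by (simp add: ctranspose_mult matrix_mul_assoc)
 also have "\<dots> = mat 1" by (simp add: SU_D(1)[OF A] SU_D(1)[OF B])
 finally show ?thesis using SU_D(3)[OF A] SU_D(3)[OF B] by (simp add: SU_def det_mul)
qed

lemma SU_ctranspose: "A \<in> SU ==> ctranspose A \<in> SU"
proof -
 assume A: "A \<in> SU"
 have "det (A ** ctranspose A) = 1" by (simp add: SU_D(2)[OF A])
 then have "det (ctranspose A) = 1" by (simp add: det_mul SU_D(3)[OF A])
 then show ?thesis by (simp add: SU_def SU_D(2)[OF A])
qed

lemma SU_cancel: "A \<in> SU ==> ctranspose A ** (A ** B) = B" "A \<in> SU ==> A ** (ctranspose A ** B) = B"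
 by (simp_all add: matrix_mul_assoc SU_D)

lemma SU_col:
 assumes "A \<in> SU" shows "(\<Sum>k\<in>UNIV. cnj (A $ k $ i) * A $ k $ j) = (if i = j then 1 else 0)"
proof -
 have "(ctranspose A ** A) $ i $ j = (\<Sum>k\<in>UNIV. cnj (A $ k $ i) * A $ k $ j)"
  by (simp add: matrix_matrix_mult_def)
 then show ?thesis by (simp add: SU_D(1)[OF assms] mat_def)
qed

lemma SU_entry_le:
 assumes "A \<in> SU" shows "cmod (A $ i $ j) \<le> 1"
proof -
 have "complex_of_real (\<Sum>k\<in>UNIV. (cmod (A $ k $ j))\<^sup>2) = 1"
  using SU_col[OF assms, of j j] by (simp only: of_real_sum complex_norm_square mult.commute simp_thms if_True)
 then have "(\<Sum>k\<in>UNIV. (cmod (A $ k $ j))\<^sup>2) = 1" using of_real_eq_1_iff by blast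
 moreover have "(cmod (A $ i $ j))\<^sup>2 \<le> (\<Sum>k\<in>UNIV. (cmod (A $ k $ j))\<^sup>2)"
  by (rule member_le_sum) auto
 ultimately show ?thesis by (simp add: abs_square_le_1)
qed

definition rot :: "'k::finite => 'k => complex => complex => 'k cmat" where
 "rot i j a b = (\<chi> x y. if x = i then (if y = i then a else if y = j then b else 0)
   else if x = j then (if y = i then - cnj b else if y = j then cnj a else 0)
   else if x = y then 1 else 0)"

lemma rot_mult:
 assumes "i \<noteq> j"
 shows "(rot i j a b ** A) $ x $ y = (if x = i then a * A $ i $ y + b * A $ j $ y
  else if x = j then - cnj b * A $ i $ y + cnj a * A $ j $ y else A $ x $ y)"
proof -
 have e: "(rot i j a b ** A) $ x $ y = (\<Sum>k\<in>UNIV. rot i j a b $ x $ k * A $ k $ y)"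
  by (simp add: matrix_matrix_mult_def)
 show ?thesis
 proof (cases "x = i \<or> x = j")
  case True
  have "(\<Sum>k\<in>UNIV. rot i j a b $ x $ k * A $ k $ y) = (\<Sum>k\<in>{i, j}. rot i j a b $ x $ k * A $ k $ y)"
   by (rule sum.mono_neutral_right) (use True in \<open>auto simp: rot_def\<close>)
  then show ?thesis unfolding e using True assms by (auto simp: rot_def)
 next
  case False
  have "(\<Sum>k\<in>UNIV. rot i j a b $ x $ k * A $ k $ y) = (\<Sum>k\<in>{x}. rot i j a b $ x $ k * A $ k $ y)"
   by (rule sum.mono_neutral_right) (use False in \<open>auto simp: rot_def\<close>)
  then show ?thesis unfolding e using False by (simp add: rot_def)
 qed
qed

lemma ctranspose_rot: "i \<noteq> j ==> ctranspose (rot i j a b) = rot i j (cnj a) (- b)"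
 by (auto simp: vec_eq_iff rot_def)

text \<open>In the Leibniz expansion a permutation contributes only if it fixes every index other
  than \<open>i\<close> and \<open>j\<close>, which leaves the identity and the
  transposition.\<close>

lemma det_rot:
 assumes ij: "i \<noteq> j" and ab: "(cmod a)\<^sup>2 + (cmod b)\<^sup>2 = 1"
 shows "det (rot i j a b) = 1"
proof -
 define f where "f p = of_int (sign p) * (\<Prod>k\<in>UNIV. rot i j a b $ k $ p k)" for p :: "'a => 'a"
 have neq: "id \<noteq> Transposition.transpose i j" using ij by (metis id_apply transpose_apply_first)
 have zero: "f p = 0" if p: "p permutes UNIV" and n: "p \<notin> {id, Transposition.transpose i j}" for p
 proof (rule ccontr)
  assume "f p \<noteq> 0"
  then have nz: "rot i j a b $ k $ p k \<noteq> 0" for k by (auto simp: f_def)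
  have fx: "p k = k" if "k \<noteq> i" "k \<noteq> j" for k using nz[of k] that by (auto simp: rot_def split: if_splits)
  have 1: "p i = i \<or> p i = j" using nz[of i] by (auto simp: rot_def split: if_splits)
  have 2: "p j = i \<or> p j = j" using nz[of j] by (auto simp: rot_def split: if_splits)
  have inj: "p i \<noteq> p j" using permutes_inj[OF p] ij by (auto dest: injD)
  consider "p i = i" "p j = j" | "p i = j" "p j = i" using 1 2 inj by auto
  then show False
  proof cases
   case 1
   then have "p = id" using fx by (intro ext) (metis id_apply)
   then show False using n by simp
  next
   case 2
   then have "p = Transposition.transpose i j" using fx by (intro ext) (metis transpose_apply_first transpose_apply_second transpose_apply_other)
   then show False using n by simp
  qed
 qed
 have split: "(\<Prod>k\<in>UNIV. g k) = g i * g j * (\<Prod>k\<in>UNIV - {i} - {j}. g k)" for g :: "'a => complex"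
  using ij by (subst prod.remove[of UNIV i], simp, simp, subst prod.remove[of "UNIV - {i}" j]) (simp_all add: mult.assoc)
 have one: "(\<Prod>k\<in>UNIV - {i} - {j}. rot i j a b $ k $ p k) = 1" if "\<And>k. k \<noteq> i ==> k \<noteq> j ==> p k = k" for p
  by (rule prod.neutral) (use that in \<open>auto simp: rot_def\<close>)
 have "det (rot i j a b) = sum f {p. p permutes UNIV}" unfolding det_def f_def ..
 also have "\<dots> = sum f {id, Transposition.transpose i j}"
  by (rule sum.mono_neutral_right) (use zero in \<open>auto simp: permutes_id permutes_swap_id\<close>)
 also have "\<dots> = f id + f (Transposition.transpose i j)" using neq by simp
 also have "f id = a * cnj a"
  unfolding f_def split using ij by (simp add: one) (simp add: rot_def)
 also have "f (Transposition.transpose i j) = b * cnj b"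
  unfolding f_def split using ij by (simp add: one sign_swap_id transpose_apply_other) (simp add: rot_def)
 also have "a * cnj a + b * cnj b = complex_of_real ((cmod a)\<^sup>2 + (cmod b)\<^sup>2)"
  by (simp only: of_real_add complex_norm_square)
 finally show ?thesis by (simp add: ab)
qed

lemma rot_SU:
 assumes ij: "i \<noteq> j" and ab: "(cmod a)\<^sup>2 + (cmod b)\<^sup>2 = 1"
 shows "rot i j a b \<in> SU"
proof -
 have n: "a * cnj a + b * cnj b = 1"
  using arg_cong[OF ab, of complex_of_real] by (simp only: of_real_add complex_norm_square of_real_1)
 then have n': "cnj a * a + b * cnj b = 1" "cnj b * b + a * cnj a = 1" by (simp_all add: algebra_simps)
 have "(rot i j (cnj a) (- b) ** rot i j a b) $ x $ y = mat 1 $ x $ y" for x y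
  unfolding rot_mult[OF ij] using ij n n' by (auto simp: rot_def mat_def)
 then have "ctranspose (rot i j a b) ** rot i j a b = mat 1"
  unfolding ctranspose_rot[OF ij] by (simp only: vec_eq_iff) blast
 then show ?thesis using det_rot[OF assms] by (simp add: SU_def)
qed

text \<open>A Givens rotation: these \<open>a\<close>, \<open>b\<close> send the second of the
  entries \<open>v\<close>, \<open>w\<close> to 0. The values for \<open>r = 0\<close> give the
  identity rotation.\<close>

lemma pivot:
 fixes v w :: complex
 defines "r \<equiv> sqrt ((cmod v)\<^sup>2 + (cmod w)\<^sup>2)"
 defines "a \<equiv> if r = 0 then 1 else cnj v / of_real r" and "b \<equiv> if r = 0 then 0 else cnj w / of_real r"
 shows "(cmod a)\<^sup>2 + (cmod b)\<^sup>2 = 1" "- cnj b * v + cnj a * w = 0"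
proof -
 have r2: "r\<^sup>2 = (cmod v)\<^sup>2 + (cmod w)\<^sup>2" by (simp add: r_def)
 show "(cmod a)\<^sup>2 + (cmod b)\<^sup>2 = 1"
 proof (cases "r = 0")
  case False
  have "(cmod a)\<^sup>2 + (cmod b)\<^sup>2 = ((cmod v)\<^sup>2 + (cmod w)\<^sup>2) / r\<^sup>2"
   using False by (simp add: a_def b_def norm_divide power_divide add_divide_distrib)
  then show ?thesis unfolding r2[symmetric] using False by simp
 qed (simp add: a_def b_def)
 show "- cnj b * v + cnj a * w = 0"
 proof (cases "r = 0")
  case True
  then have "w = 0" using r2 by (simp add: add_nonneg_eq_0_iff)
  then show ?thesis using True by (simp add: a_def b_def)
 qed (simp add: a_def b_def)
qed

text \<open>Taking for \<open>F\<close> the trivial filter removes the convergence hypotheses; for a nontrivial filter all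
 the rotations that are used converge to the identity.\<close>

lemma rotation_generation:
 fixes A :: "'x => 'k::finite cmat" and f :: "'k => 'a"
 assumes one: "(\<lambda>_. mat 1) \<in> Z" and mult: "\<And>A B. A \<in> Z ==> B \<in> Z ==> (\<lambda>x. A x ** B x) \<in> Z"
  and rot: "\<And>i j a b. i \<noteq> j ==> (\<And>x. (cmod (a x))\<^sup>2 + (cmod (b x))\<^sup>2 = 1) ==> (a \<longlongrightarrow> 1) F ==>
    f i = f j \<or> (\<forall>x. b x = 0) ==> (\<lambda>x. rot i j (a x) (b x)) \<in> Z"
  and A: "\<And>x. A x \<in> SU" "\<And>i j. ((\<lambda>x. A x $ i $ j) \<longlongrightarrow> mat 1 $ i $ j) F"
   "\<And>x i j. f i \<noteq> f j ==> A x $ i $ j = 0"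
 shows "A \<in> Z"
proof -
 define good where "good A \<longleftrightarrow> (\<forall>x. A x \<in> SU) \<and> (\<forall>i j. ((\<lambda>x. A x $ i $ j) \<longlongrightarrow> mat 1 $ i $ j) F) \<and>
  (\<forall>x i j. f i \<noteq> f j \<longrightarrow> A x $ i $ j = 0)" for A :: "'x => 'k cmat"
 have stp: "good (\<lambda>x. rot i j (a x) (b x) ** A x)" (is ?good)
  and backw: "(\<lambda>x. rot i j (a x) (b x) ** A x) \<in> Z ==> A \<in> Z"
  if g: "good A" and ij: "i \<noteq> j" and ab: "\<And>x. (cmod (a x))\<^sup>2 + (cmod (b x))\<^sup>2 = 1" and a: "(a \<longlongrightarrow> 1) F"
   and fb: "f i = f j \<or> (\<forall>x. b x = 0)" for A i j a b
 proof -
  have "((\<lambda>x. (cmod (b x))\<^sup>2) \<longlongrightarrow> 0) F"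
  proof -
   have "((\<lambda>x. 1 - (cmod (a x))\<^sup>2) \<longlongrightarrow> 1 - (cmod 1)\<^sup>2) F" by (intro tendsto_intros a)
   moreover have "1 - (cmod (a x))\<^sup>2 = (cmod (b x))\<^sup>2" for x using ab[of x] by simp
   ultimately show ?thesis by simp
  qed
  then have "((\<lambda>x. sqrt ((cmod (b x))\<^sup>2)) \<longlongrightarrow> sqrt 0) F" by (rule tendsto_real_sqrt)
  then have b: "(b \<longlongrightarrow> 0) F" by (simp add: tendsto_norm_zero_iff)
  have Asu: "A x \<in> SU" and Al: "((\<lambda>x. A x $ k $ l) \<longlongrightarrow> mat 1 $ k $ l) F"
   and A0: "f k \<noteq> f l ==> A x $ k $ l = 0" for x k l using g by (auto simp: good_def)
  have "((\<lambda>x. (rot i j (a x) (b x) ** A x) $ k $ l) \<longlongrightarrow> mat 1 $ k $ l) F" for k l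
  proof -
   have "((\<lambda>x. a x * A x $ i $ l + b x * A x $ j $ l) \<longlongrightarrow> 1 * mat 1 $ i $ l + 0 * mat 1 $ j $ l) F"
    "((\<lambda>x. - cnj (b x) * A x $ i $ l + cnj (a x) * A x $ j $ l) \<longlongrightarrow> - cnj 0 * mat 1 $ i $ l + cnj 1 * mat 1 $ j $ l) F"
    by (intro tendsto_intros a b Al)+
   then show ?thesis unfolding rot_mult[OF ij] using Al[of k l] by (cases "k = i"; cases "k = j") simp_all
  qed
  moreover have "(rot i j (a x) (b x) ** A x) $ k $ l = 0" if kl: "f k \<noteq> f l" for x k l
  proof (cases "f i = f j")
   case True
   then have "A x $ i $ l = 0 \<and> A x $ j $ l = 0" if "k = i \<or> k = j"
    using kl that A0[of i l x] A0[of j l x] by metis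
   then show ?thesis unfolding rot_mult[OF ij] using A0[OF kl] by auto
  next
   case False
   then show ?thesis unfolding rot_mult[OF ij] using A0[OF kl] fb by auto
  qed
  ultimately show ?good using Asu SU_mult[OF rot_SU[OF ij ab]] by (auto simp: good_def)
  assume Z: "(\<lambda>x. rot i j (a x) (b x) ** A x) \<in> Z"
  have "(\<lambda>x. rot i j (cnj (a x)) (- b x)) \<in> Z"
   using ij ab fb tendsto_cnj[OF a] by (intro rot) auto
  from mult[OF this Z] have "(\<lambda>x. rot i j (cnj (a x)) (- b x) ** (rot i j (a x) (b x) ** A x)) \<in> Z" .
  moreover have "rot i j (cnj (a x)) (- b x) ** (rot i j (a x) (b x) ** A x) = A x" for x
   unfolding ctranspose_rot[OF ij, symmetric] by (rule SU_cancel(1)[OF rot_SU[OF ij ab]])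
  ultimately show "A \<in> Z" by simp
 qed
 \<comment> \<open>An arbitrary index that collects the phases: a rotation with second entry 0 in
   the plane of \<open>k\<close> and \<open>c\<close> makes the diagonal entry at \<open>k\<close>
   equal to 1 and passes its phase to \<open>c\<close>, where the determinant finally forces the
   value 1.\<close>
 obtain c :: 'k where True by blast
 have diag: "A \<in> Z" if "finite K" "good A" "\<And>x i j. i \<noteq> j ==> A x $ i $ j = 0"
   "\<And>x k. k \<notin> K ==> k \<noteq> c ==> A x $ k $ k = 1" for K A
  using that
 proof (induction K arbitrary: A)
  case empty
  have "A x = mat 1" for x
  proof -
   have "det (A x) = (\<Prod>k\<in>UNIV. A x $ k $ k)" by (rule det_diagonal) (use empty in simp)
   also have "\<dots> = A x $ c $ c * (\<Prod>k\<in>UNIV - {c}. A x $ k $ k)" by (subst prod.remove[of UNIV c]) auto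
   also have "(\<Prod>k\<in>UNIV - {c}. A x $ k $ k) = 1" by (rule prod.neutral) (use empty in auto)
   finally have "A x $ c $ c = 1" using empty(1) SU_D(3)[of "A x"] by (simp add: good_def)
   then have "A x $ k $ k = 1" for k using empty(3)[of k x] by (cases "k = c") auto
   then show ?thesis using empty(2) by (auto simp: vec_eq_iff mat_def)
  qed
  then have "A = (\<lambda>_. mat 1)" by (rule ext)
  then show ?case using one by simp
 next
  case (insert k K)
  show ?case
  proof (cases "k = c")
   case True
   then show ?thesis using insert.prems by (intro insert.IH) auto
  next
   case False
   have u: "cnj (A x $ k $ k) * A x $ k $ k = 1" for x
   proof -
    have "(\<Sum>l\<in>UNIV. cnj (A x $ l $ k) * A x $ l $ k) = (\<Sum>l\<in>{k}. cnj (A x $ l $ k) * A x $ l $ k)"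
     by (rule sum.mono_neutral_right) (use insert.prems(2) in auto)
    then show ?thesis using SU_col[of "A x" k k] insert.prems(1) by (simp add: good_def)
   qed
   have ab: "(cmod (cnj (A x $ k $ k)))\<^sup>2 + (cmod 0)\<^sup>2 = 1" for x
    using arg_cong[OF u[of x], of Re] by (simp add: cmod_power2 flip: power2_eq_square)
   have "((\<lambda>x. A x $ k $ k) \<longlongrightarrow> mat 1 $ k $ k) F" using insert.prems(1) unfolding good_def by blast
   then have "((\<lambda>x. A x $ k $ k) \<longlongrightarrow> 1) F" by (simp add: mat_def)
   from tendsto_cnj[OF this] have a: "((\<lambda>x. cnj (A x $ k $ k)) \<longlongrightarrow> 1) F" by simp
   note st = stp[OF insert.prems(1) False ab a] backw[OF insert.prems(1) False ab a]
   show ?thesis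
   proof (rule st(2))
    show "(\<lambda>x. rot k c (cnj (A x $ k $ k)) 0 ** A x) \<in> Z"
    proof (rule insert.IH)
     show "good (\<lambda>x. rot k c (cnj (A x $ k $ k)) 0 ** A x)" using st(1) by simp
     show "(rot k c (cnj (A x $ k $ k)) 0 ** A x) $ i $ j = 0" if "i \<noteq> j" for x i j
      unfolding rot_mult[OF False] using insert.prems(2)[OF that, of x] by auto
     show "(rot k c (cnj (A x $ k $ k)) 0 ** A x) $ l $ l = 1" if "l \<notin> K" "l \<noteq> c" for x l
      unfolding rot_mult[OF False] using u[of x] insert.prems(3)[of l x] that by auto
    qed
   qed simp
  qed
 qed
 \<comment> \<open>Gaussian elimination by plane rotations. \<open>T\<close> holds the columns that
   may still have entries off the diagonal, and the inner induction clears column \<open>c\<close>,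
   with \<open>U\<close> the rows still to be treated. Entries between different
   \<open>f\<close>-blocks vanish already, so rotations inside blocks suffice.\<close>
 have cols: "A \<in> Z" if "finite T" "good A" "\<And>x i j. j \<notin> T ==> i \<noteq> j ==> A x $ i $ j = 0" for T A
  using that
 proof (induction T arbitrary: A)
  case empty
  then show ?case by (intro diag[of UNIV]) auto
 next
  case (insert c T)
  have "A \<in> Z" if "finite U" "good A" "\<And>x i j. j \<notin> insert c T ==> i \<noteq> j ==> A x $ i $ j = 0"
   "\<And>x i. i \<notin> U ==> i \<noteq> c ==> A x $ i $ c = 0" for U A
   using that
  proof (induction U arbitrary: A)
   case empty
   have "A x $ i $ j = 0" if "j \<notin> T" "i \<noteq> j" for x i j
    using empty(2)[of j i x] empty(3)[of i x] that by (cases "j = c") auto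
   then show ?case by (rule insert.IH[OF empty(1)])
  next
   case (insert i U)
   note gA = insert.prems(1) and dA = insert.prems(2) and cA = insert.prems(3)
   have skip: ?case if "i = c \<or> (\<forall>x. A x $ i $ c = 0)"
   proof (rule insert.IH[OF gA dA])
    show "A x $ k $ c = 0" if "k \<notin> U" "k \<noteq> c" for x k
     using cA[of k x] that \<open>i = c \<or> (\<forall>x. A x $ i $ c = 0)\<close> by (cases "k = i") auto
   qed
   show ?case
   proof (cases "i = c \<or> i \<notin> T \<or> f i \<noteq> f c")
    case True
    \<comment> \<open>Column \<open>i\<close> is reduced to a diagonal entry of modulus 1, so
      orthogonality of the columns \<open>i\<close> and \<open>c\<close> kills this entry.\<close>
    have "A x $ i $ c = 0" if i: "i \<noteq> c" "i \<notin> T" for x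
    proof -
     have Ax: "A x \<in> SU" using gA by (simp add: good_def)
     have s: "(\<Sum>k\<in>UNIV. cnj (A x $ k $ i) * A x $ k $ j) = cnj (A x $ i $ i) * A x $ i $ j" for j
     proof -
      have "(\<Sum>k\<in>UNIV. cnj (A x $ k $ i) * A x $ k $ j) = (\<Sum>k\<in>{i}. cnj (A x $ k $ i) * A x $ k $ j)"
       by (rule sum.mono_neutral_right) (use dA[of i _ x] i in auto)
      then show ?thesis by simp
     qed
     show ?thesis using SU_col[OF Ax, of i c] SU_col[OF Ax, of i i] i(1) unfolding s by auto
    qed
    moreover have "A x $ i $ c = 0" if "f i \<noteq> f c" for x using gA that by (simp add: good_def)
    ultimately show ?thesis using skip True by blast
   next
    case False
    then have ic: "c \<noteq> i" and iT: "i \<in> T" and fi: "f c = f i" by auto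
    define v w r where "v x = A x $ c $ c" and "w x = A x $ i $ c" and "r x = sqrt ((cmod (v x))\<^sup>2 + (cmod (w x))\<^sup>2)" for x
    define a b where "a x = (if r x = 0 then 1 else cnj (v x) / of_real (r x))"
     and "b x = (if r x = 0 then 0 else cnj (w x) / of_real (r x))" for x
    have ab: "(cmod (a x))\<^sup>2 + (cmod (b x))\<^sup>2 = 1" and z: "- cnj (b x) * v x + cnj (a x) * w x = 0" for x
     unfolding a_def b_def r_def by (rule pivot)+
    have "((\<lambda>x. A x $ c $ c) \<longlongrightarrow> mat 1 $ c $ c) F" "((\<lambda>x. A x $ i $ c) \<longlongrightarrow> mat 1 $ i $ c) F"
     using gA unfolding good_def by blast+
    then have vw: "(v \<longlongrightarrow> 1) F" "(w \<longlongrightarrow> 0) F" using ic unfolding v_def w_def by (simp_all add: mat_def)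
    then have "(r \<longlongrightarrow> sqrt ((cmod 1)\<^sup>2 + (cmod 0)\<^sup>2)) F" unfolding r_def by (intro tendsto_intros)
    then have r: "(r \<longlongrightarrow> 1) F" by simp
    then have ev: "eventually (\<lambda>x. r x \<noteq> 0) F" by (rule tendsto_imp_eventually_ne) simp
    have "((\<lambda>x. cnj (v x) / of_real (r x)) \<longlongrightarrow> cnj 1 / of_real 1) F" by (intro tendsto_intros vw r) simp
    then have "((\<lambda>x. cnj (v x) / of_real (r x)) \<longlongrightarrow> 1) F" by simp
    then have a: "(a \<longlongrightarrow> 1) F"
     by (rule Lim_transform_eventually) (use ev in eventually_elim, simp add: a_def)
    note st = stp[OF gA ic ab a] backw[OF gA ic ab a]
    show ?thesis
    proof (rule st(2))
     show "(\<lambda>x. rot c i (a x) (b x) ** A x) \<in> Z"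
     proof (rule insert.IH)
      show "good (\<lambda>x. rot c i (a x) (b x) ** A x)" using st(1) fi by simp
      show "(rot c i (a x) (b x) ** A x) $ k $ j = 0" if "j \<notin> insert c T" "k \<noteq> j" for x k j
      proof -
       have "c \<noteq> j" "i \<noteq> j" using that(1) iT by auto
       then show ?thesis unfolding rot_mult[OF ic] using dA[OF that(1)] that(2) by auto
      qed
      show "(rot c i (a x) (b x) ** A x) $ k $ c = 0" if "k \<notin> U" "k \<noteq> c" for x k
       unfolding rot_mult[OF ic] using z[of x] cA[of k x] that by (auto simp: v_def w_def)
     qed
    qed (use fi in simp)
   qed
  qed
  from this[of UNIV A] insert.prems show ?case by auto
 qed
 show ?thesis using A by (intro cols[of UNIV]) (auto simp: good_def)
qed

section \<open>Length pseudo-metrics on the special unitary group\<close>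

text \<open>A seminorm for arbitrary weights thanks to the absolute values; weight 0 makes a
  direction free of charge.\<close>

definition wnorm :: "('k => 'k => real) => 'k::finite cmat => real" where
 "wnorm om X = sqrt (\<Sum>i\<in>UNIV. \<Sum>j\<in>UNIV. \<bar>om i j\<bar> * (cmod (X $ i $ j))\<^sup>2)"

lemma wnorm_nonneg [simp]: "0 \<le> wnorm om X"
 by (simp add: wnorm_def sum_nonneg)

lemma wnorm_scaleR: "wnorm om (r *\<^sub>R X) = \<bar>r\<bar> * wnorm om X"
proof -
 have "\<bar>om i j\<bar> * (cmod ((r *\<^sub>R X) $ i $ j))\<^sup>2 = r\<^sup>2 * (\<bar>om i j\<bar> * (cmod (X $ i $ j))\<^sup>2)" for i j
  by (simp add: power_mult_distrib)
 then have "wnorm om (r *\<^sub>R X) = sqrt (r\<^sup>2 * (\<Sum>i\<in>UNIV. \<Sum>j\<in>UNIV. \<bar>om i j\<bar> * (cmod (X $ i $ j))\<^sup>2))"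
  unfolding wnorm_def by (simp only: sum_distrib_left)
 then show ?thesis by (simp add: real_sqrt_mult wnorm_def)
qed

lemma wnorm_le:
 assumes "\<And>i j. \<bar>om i j\<bar> \<le> c\<^sup>2 * \<bar>om' i j\<bar>" "0 \<le> c"
 shows "wnorm om X \<le> c * wnorm om' X"
proof -
 have "wnorm om X \<le> sqrt (\<Sum>i\<in>UNIV. \<Sum>j\<in>UNIV. c\<^sup>2 * (\<bar>om' i j\<bar> * (cmod (X $ i $ j))\<^sup>2))"
  unfolding wnorm_def real_sqrt_le_iff mult.assoc[symmetric]
  by (intro sum_mono mult_right_mono assms(1)) simp
 also have "\<dots> = c * wnorm om' X"
  unfolding wnorm_def sum_distrib_left[symmetric] real_sqrt_mult using assms(2) by simp
 finally show ?thesis .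
qed

lemma wnorm_le_add:
 assumes "\<And>i j. \<bar>om i j\<bar> \<le> \<bar>om' i j\<bar> + k\<^sup>2" "0 \<le> k"
 shows "wnorm om X \<le> wnorm om' X + k * wnorm (\<lambda>_ _. 1) X"
proof -
 have "wnorm om X \<le> sqrt (\<Sum>i\<in>UNIV. \<Sum>j\<in>UNIV. (\<bar>om' i j\<bar> + k\<^sup>2) * (cmod (X $ i $ j))\<^sup>2)"
  unfolding wnorm_def real_sqrt_le_iff by (intro sum_mono mult_right_mono assms(1)) simp
 also have "\<dots> = sqrt ((\<Sum>i\<in>UNIV. \<Sum>j\<in>UNIV. \<bar>om' i j\<bar> * (cmod (X $ i $ j))\<^sup>2)
   + k\<^sup>2 * (\<Sum>i\<in>UNIV. \<Sum>j\<in>UNIV. (cmod (X $ i $ j))\<^sup>2))"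
  by (simp add: distrib_right sum.distrib sum_distrib_left)
 also have "\<dots> \<le> sqrt (\<Sum>i\<in>UNIV. \<Sum>j\<in>UNIV. \<bar>om' i j\<bar> * (cmod (X $ i $ j))\<^sup>2)
   + sqrt (k\<^sup>2 * (\<Sum>i\<in>UNIV. \<Sum>j\<in>UNIV. (cmod (X $ i $ j))\<^sup>2))"
  by (intro sqrt_add_le_add_sqrt sum_nonneg mult_nonneg_nonneg) simp_all
 also have "\<dots> = wnorm om' X + k * wnorm (\<lambda>_ _. 1) X"
  using assms(2) by (simp add: wnorm_def real_sqrt_mult)
 finally show ?thesis .
qed

definition speed :: "('k => 'k => real) => 'k::finite cmat => 'k cmat => real" where
 "speed om A Y = wnorm om (ctranspose A ** Y)"

abbreviation clen where
 "clen om cv D a b \<equiv> integral {a..b} (\<lambda>t. speed om (cv t) (D t))"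

lemma speed_nonneg [simp]: "0 \<le> speed om A Y"
 by (simp add: speed_def)

lemma matrix_scaleR_right: "A ** (r *\<^sub>R X) = r *\<^sub>R (A ** X)" for A X :: "'k::finite cmat"
 by (simp add: vec_eq_iff matrix_matrix_mult_def scaleR_sum_right)

lemma speed_scaleR: "speed om A (r *\<^sub>R Y) = \<bar>r\<bar> * speed om A Y"
 by (simp add: speed_def matrix_scaleR_right wnorm_scaleR)

lemma speed_left_mult: "A \<in> SU ==> speed om (A ** B) (A ** Y) = speed om B Y"
 by (simp add: speed_def ctranspose_mult SU_cancel(1) flip: matrix_mul_assoc)

lemma speed_eq:
 "speed om A Y = sqrt (\<Sum>i\<in>UNIV. \<Sum>j\<in>UNIV. \<bar>om i j\<bar> * (cmod (\<Sum>k\<in>UNIV. cnj (A $ k $ i) * Y $ k $ j))\<^sup>2)"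
 by (simp add: speed_def wnorm_def matrix_matrix_mult_def)

lemma isCont_speed:
 assumes "isCont cv t" "isCont D t" shows "isCont (\<lambda>s. speed om (cv s) (D s)) t"
 using assms unfolding isCont_def speed_eq by (intro tendsto_intros tendsto_vec_nth)

lemma cmat_entry_le: "cmod (X $ i $ j) \<le> norm X" for X :: "'k::finite cmat"
 using Finite_Cartesian_Product.norm_nth_le[of "X $ i" j] Finite_Cartesian_Product.norm_nth_le[of X i] by linarith

lemma speed_bound:
 fixes A Y :: "'k::finite cmat"
 assumes "A \<in> SU"
 shows "speed om A Y \<le> sqrt (\<Sum>i\<in>UNIV. \<Sum>j\<in>UNIV. \<bar>om i j\<bar>) * (real CARD('k) * norm Y)"
proof -
 have "cmod (\<Sum>k\<in>UNIV. cnj (A $ k $ i) * Y $ k $ j) \<le> real CARD('k) * norm Y" for i j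
 proof -
  have "cmod (cnj (A $ k $ i) * Y $ k $ j) \<le> 1 * norm Y" for k
   unfolding norm_mult complex_mod_cnj by (intro mult_mono SU_entry_le[OF assms] cmat_entry_le) simp_all
  then have "cmod (\<Sum>k\<in>UNIV. cnj (A $ k $ i) * Y $ k $ j) \<le> real (card (UNIV :: 'k set)) * (1 * norm Y)"
   by (intro sum_norm_bound)
  then show ?thesis by simp
 qed
 then have "(cmod (\<Sum>k\<in>UNIV. cnj (A $ k $ i) * Y $ k $ j))\<^sup>2 \<le> (real CARD('k) * norm Y)\<^sup>2" for i j
  by (rule power_mono) simp
 then have "speed om A Y \<le> sqrt (\<Sum>i\<in>UNIV. \<Sum>j\<in>UNIV. \<bar>om i j\<bar> * (real CARD('k) * norm Y)\<^sup>2)"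
  unfolding speed_eq real_sqrt_le_iff by (intro sum_mono mult_left_mono) simp_all
 also have "\<dots> = sqrt (\<Sum>i\<in>UNIV. \<Sum>j\<in>UNIV. \<bar>om i j\<bar>) * (real CARD('k) * norm Y)"
  by (simp only: sum_distrib_right[symmetric] real_sqrt_mult real_sqrt_abs) simp
 finally show ?thesis .
qed

lemma integrable_off_finite:
 fixes f :: "real => real"
 assumes S: "finite S" and f: "\<And>t. t \<in> {a<..<b} - S ==> isCont f t" "\<And>t. t \<in> {a<..<b} - S ==> \<bar>f t\<bar> \<le> B"
 shows "f integrable_on {a..b}"
proof -
 define T where "T = {a<..<b} - S"
 have T: "open T" unfolding T_def by (intro open_Diff finite_imp_closed S) simp
 have neg: "negligible ({a..b} - T)" "negligible (T - {a..b})"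
 proof -
  show "negligible ({a..b} - T)"
   by (rule negligible_finite, rule finite_subset[of _ "S \<union> {a, b}"]) (use S in \<open>auto simp: T_def\<close>)
  have "T - {a..b} = {}" by (auto simp: T_def)
  then show "negligible (T - {a..b})" by simp
 qed
 have eq: "g integrable_on {a..b} \<longleftrightarrow> g integrable_on T" for g :: "real => real"
  by (rule integrable_spike_set_eq) (rule negligible_subset[OF negligible_Un[OF neg]], blast)
 have "continuous_on T f" using f(1) by (intro continuous_at_imp_continuous_on) (auto simp: T_def)
 then have m: "f \<in> borel_measurable (lebesgue_on T)"
  by (rule continuous_imp_measurable_on_sets_lebesgue) (use T in \<open>simp add: borel_open\<close>)
 have "(\<lambda>_. B) integrable_on {a..b}" by (rule integrable_const_ivl)
 then have c: "(\<lambda>_. B) integrable_on T" unfolding eq .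
 show ?thesis unfolding eq
  by (rule measurable_bounded_by_integrable_imp_integrable[OF m c])
   (use f(2) T in \<open>auto simp: T_def borel_open\<close>)
qed

text \<open>The derivative is a separate function, constrained only off a finite set, so that
  joining and reversing arcs need no care at the break points. Its boundedness makes the length
  finite for all weights at once; one arc can then be measured with different weights.\<close>

definition arc_on :: "real => real => (real => 'k::finite cmat) => (real => 'k cmat) => bool" where
 "arc_on a b cv D \<longleftrightarrow> continuous_on {a..b} cv \<and> cv ` {a..b} \<subseteq> SU \<and>
   (\<exists>S B. finite S \<and> (\<forall>t \<in> {a<..<b} - S. (cv has_vector_derivative D t) (at t) \<and> isCont D t \<and> norm (D t) \<le> B))"

lemma arc_speed_integrable:
 assumes "arc_on a b cv D" shows "(\<lambda>t. speed om (cv t) (D t)) integrable_on {a..b}"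
proof -
 obtain S B where S: "finite S" and SB: "\<And>t. t \<in> {a<..<b} - S ==>
   (cv has_vector_derivative D t) (at t) \<and> isCont D t \<and> norm (D t) \<le> B"
  using assms unfolding arc_on_def by blast
 show ?thesis
 proof (rule integrable_off_finite[OF S])
  fix t assume t: "t \<in> {a<..<b} - S"
  then have "isCont cv t" using SB has_vector_derivative_continuous by blast
  then show "isCont (\<lambda>t. speed om (cv t) (D t)) t" using SB[OF t] by (intro isCont_speed) auto
  have "cv t \<in> SU" using assms t unfolding arc_on_def by auto
  from speed_bound[OF this, of om "D t"]
  have "speed om (cv t) (D t) \<le> sqrt (\<Sum>i\<in>UNIV. \<Sum>j\<in>UNIV. \<bar>om i j\<bar>) * (real CARD('a) * norm (D t))" .
  also have "\<dots> \<le> sqrt (\<Sum>i\<in>UNIV. \<Sum>j\<in>UNIV. \<bar>om i j\<bar>) * (real CARD('a) * B)"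
   using SB[OF t] by (intro mult_left_mono) (auto intro: sum_nonneg)
  finally show "\<bar>speed om (cv t) (D t)\<bar> \<le> sqrt (\<Sum>i\<in>UNIV. \<Sum>j\<in>UNIV. \<bar>om i j\<bar>) * (real CARD('a) * B)" by simp
 qed
qed

lemma arc_affine:
 assumes arc: "arc_on a b cv D" and ab: "a < b"
  and r: "0 < r \<and> r * a' + c = a \<and> r * b' + c = b \<or> r < 0 \<and> r * a' + c = b \<and> r * b' + c = a"
 shows "arc_on a' b' (\<lambda>t. cv (r * t + c)) (\<lambda>t. r *\<^sub>R D (r * t + c))"
  and "integral {a'..b'} (\<lambda>t. speed om (cv (r * t + c)) (r *\<^sub>R D (r * t + c))) = clen om cv D a b"
proof -
 have r0: "r \<noteq> 0" using r by auto
 have cl: "r * t + c \<in> {a..b}" if "t \<in> {a'..b'}" for t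
  using r mult_left_mono[of a' t r] mult_left_mono[of t b' r] mult_left_mono_neg[of a' t r] mult_left_mono_neg[of t b' r] that
  by auto
 have op: "r * t + c \<in> {a<..<b}" if "t \<in> {a'<..<b'}" for t
 proof -
  have "r * t \<noteq> r * a'" "r * t \<noteq> r * b'" using that r0 by auto
  then show ?thesis using cl[of t] r that by auto
 qed
 obtain S B where S: "finite S" and SB: "\<And>t. t \<in> {a<..<b} - S ==>
   (cv has_vector_derivative D t) (at t) \<and> isCont D t \<and> norm (D t) \<le> B"
  using arc unfolding arc_on_def by blast
 have lin: "isCont (\<lambda>t. r * t + c) t" for t by simp
 show "arc_on a' b' (\<lambda>t. cv (r * t + c)) (\<lambda>t. r *\<^sub>R D (r * t + c))"
  unfolding arc_on_def
 proof (intro conjI exI[of _ "(\<lambda>s. (s - c) / r) ` S"] exI[of _ "\<bar>r\<bar> * B"] ballI)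
  show "continuous_on {a'..b'} (\<lambda>t. cv (r * t + c))"
   by (rule continuous_on_compose2[of "{a..b}" cv]) (use arc cl in \<open>auto simp: arc_on_def intro!: continuous_intros\<close>)
  show "(\<lambda>t. cv (r * t + c)) ` {a'..b'} \<subseteq> SU" using arc cl unfolding arc_on_def by blast
  show "finite ((\<lambda>s. (s - c) / r) ` S)" using S by simp
  fix t assume t: "t \<in> {a'<..<b'} - (\<lambda>s. (s - c) / r) ` S"
  have "r * t + c \<notin> S"
  proof
   assume "r * t + c \<in> S"
   then have "(r * t + c - c) / r \<in> (\<lambda>s. (s - c) / r) ` S" by (rule imageI)
   then show False using t r0 by simp
  qed
  then have u: "r * t + c \<in> {a<..<b} - S" using op t by auto
  have "((\<lambda>t. r * t + c) has_vector_derivative r) (at t)"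
   unfolding has_real_derivative_iff_has_vector_derivative[symmetric] by (auto intro!: derivative_eq_intros)
  from vector_diff_chain_at[OF this, of cv] SB[OF u]
  show "((\<lambda>t. cv (r * t + c)) has_vector_derivative r *\<^sub>R D (r * t + c)) (at t)" by (simp add: o_def)
  show "isCont (\<lambda>t. r *\<^sub>R D (r * t + c)) t"
   using SB[OF u] by (intro continuous_intros isCont_o2[OF lin]) auto
  show "norm (r *\<^sub>R D (r * t + c)) \<le> \<bar>r\<bar> * B" using SB[OF u] by (simp add: mult_left_mono)
 qed
 have "((\<lambda>t. speed om (cv t) (D t)) has_integral clen om cv D a b) (cbox a b)"
  using arc_speed_integrable[OF arc] by (simp add: has_integral_integral)
 from has_integral_affinity[OF this r0, of c]
 have *: "((\<lambda>t. speed om (cv (r * t + c)) (D (r * t + c))) has_integral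
   (1 / \<bar>r\<bar>) * clen om cv D a b) ((\<lambda>x. (1 / r) * x + - ((1 / r) * c)) ` {a..b})"
  by simp
 have im: "(\<lambda>x. (1 / r) * x + - ((1 / r) * c)) ` {a..b} = {a'..b'}"
  unfolding image_affinity_atLeastAtMost using r ab by (auto simp: field_simps)
 from integral_unique[OF has_integral_mult_right[OF *[unfolded im], of "\<bar>r\<bar>"]]
 show "integral {a'..b'} (\<lambda>t. speed om (cv (r * t + c)) (r *\<^sub>R D (r * t + c))) = clen om cv D a b"
  unfolding speed_scaleR using r0 by simp
qed

lemma arc_join:
 assumes 1: "arc_on a b cv1 D1" and 2: "arc_on b c cv2 D2" and e: "cv1 b = cv2 b" and abc: "a < b" "b < c"
 defines "cv \<equiv> \<lambda>t. if t \<le> b then cv1 t else cv2 t" and "D \<equiv> \<lambda>t. if t \<le> b then D1 t else D2 t"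
 shows "arc_on a c cv D"
  and "clen om cv D a c =
   clen om cv1 D1 a b + clen om cv2 D2 b c"
proof -
 obtain S1 B1 where S1: "finite S1" and SB1: "\<And>t. t \<in> {a<..<b} - S1 ==>
   (cv1 has_vector_derivative D1 t) (at t) \<and> isCont D1 t \<and> norm (D1 t) \<le> B1"
  using 1 unfolding arc_on_def by blast
 obtain S2 B2 where S2: "finite S2" and SB2: "\<And>t. t \<in> {b<..<c} - S2 ==>
   (cv2 has_vector_derivative D2 t) (at t) \<and> isCont D2 t \<and> norm (D2 t) \<le> B2"
  using 2 unfolding arc_on_def by blast
 show A: "arc_on a c cv D"
  unfolding arc_on_def
 proof (intro conjI exI[of _ "S1 \<union> S2 \<union> {b}"] exI[of _ "max B1 B2"] ballI)
  have "continuous_on ({a..b} \<union> {b..c}) cv"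
   unfolding cv_def by (rule continuous_on_cases) (use 1 2 e in \<open>auto simp: arc_on_def\<close>)
  then show "continuous_on {a..c} cv" using abc by (simp add: ivl_disj_un_two_touch)
  show "cv ` {a..c} \<subseteq> SU"
  proof (rule image_subsetI)
   fix t assume t: "t \<in> {a..c}"
   have "cv1 t \<in> SU" if "t \<le> b" using 1 t that unfolding arc_on_def by auto
   moreover have "cv2 t \<in> SU" if "b \<le> t" using 2 t that unfolding arc_on_def by auto
   ultimately show "cv t \<in> SU" by (simp add: cv_def)
  qed
  show "finite (S1 \<union> S2 \<union> {b})" using S1 S2 by simp
  fix t assume t: "t \<in> {a<..<c} - (S1 \<union> S2 \<union> {b})"
  consider "t < b" | "b < t" using t by fastforce
  then have "(cv has_vector_derivative D t) (at t) \<and> isCont D t \<and> norm (D t) \<le> max B1 B2"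
  proof cases
   case 1
   have d: "(cv1 has_vector_derivative D1 t) (at t)" "isCont D1 t" "norm (D1 t) \<le> B1" using SB1[of t] t 1 by auto
   have "(cv has_vector_derivative D1 t) (at t)"
    by (rule has_vector_derivative_transform_within_open[OF d(1), of "{..<b}"]) (use 1 in \<open>auto simp: cv_def\<close>)
   moreover have "eventually (\<lambda>s. D s = D1 s) (nhds t)"
    unfolding eventually_nhds by (rule exI[of _ "{..<b}"]) (use 1 in \<open>auto simp: D_def\<close>)
   ultimately show ?thesis using d 1 by (auto simp: isCont_cong D_def)
  next
   case 2
   have d: "(cv2 has_vector_derivative D2 t) (at t)" "isCont D2 t" "norm (D2 t) \<le> B2" using SB2[of t] t 2 by auto
   have "(cv has_vector_derivative D2 t) (at t)"
    by (rule has_vector_derivative_transform_within_open[OF d(1), of "{b<..}"]) (use 2 in \<open>auto simp: cv_def\<close>)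
   moreover have "eventually (\<lambda>s. D s = D2 s) (nhds t)"
    unfolding eventually_nhds by (rule exI[of _ "{b<..}"]) (use 2 in \<open>auto simp: D_def\<close>)
   ultimately show ?thesis using d 2 by (auto simp: isCont_cong D_def)
  qed
  then show "(cv has_vector_derivative D t) (at t)" "isCont D t" "norm (D t) \<le> max B1 B2" by auto
 qed
 have "clen om cv D a c =
   clen om cv D a b + clen om cv D b c"
  using Henstock_Kurzweil_Integration.integral_combine[OF _ _ arc_speed_integrable[OF A], of b om] abc by simp
 also have "clen om cv D a b = clen om cv1 D1 a b"
  by (rule integral_cong) (simp add: cv_def D_def)
 also have "clen om cv D b c = clen om cv2 D2 b c"
  by (rule integral_spike[of "{b}"]) (auto simp: cv_def D_def)
 finally show "clen om cv D a c =
   clen om cv1 D1 a b + clen om cv2 D2 b c" .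
qed

text \<open>A bound \<open>l\<close> instead of the exact length: such bounds add up along joined
  arcs, and distances are infima of them.\<close>

definition reach :: "('k => 'k => real) => 'k::finite cmat => 'k cmat => real => bool" where
 "reach om A B l \<longleftrightarrow> (\<exists>cv D. arc_on 0 1 cv D \<and> cv 0 = A \<and> cv 1 = B \<and>
   clen om cv D 0 1 \<le> l)"

lemma reach_mono: "reach om A B l ==> l \<le> l' ==> reach om A B l'"
 unfolding reach_def using order_trans by blast

lemma reach_nonneg: "reach om A B l ==> 0 \<le> l"
proof -
 assume "reach om A B l"
 then obtain cv D where arc: "arc_on 0 1 cv D" and l: "clen om cv D 0 1 \<le> l"
  unfolding reach_def by blast
 have "0 \<le> clen om cv D 0 1"
  by (rule integral_nonneg[OF arc_speed_integrable[OF arc]]) simp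
 then show ?thesis using l by simp
qed

lemma reach_SU: "reach om A B l ==> A \<in> SU \<and> B \<in> SU"
 unfolding reach_def arc_on_def by force

lemma reach_arc:
 assumes "arc_on a b cv D" "a < b"
 shows "reach om (cv a) (cv b) (clen om cv D a b)"
 using arc_affine(1)[OF assms, where r = "b - a" and c = a and a' = 0 and b' = 1]
  arc_affine(2)[OF assms, where r = "b - a" and c = a and a' = 0 and b' = 1 and om = om] assms(2) unfolding reach_def
 by (intro exI[of _ "\<lambda>t. cv ((b - a) * t + a)"] exI[of _ "\<lambda>t. (b - a) *\<^sub>R D ((b - a) * t + a)"]) simp

lemma reach_refl: assumes "A \<in> SU" shows "reach om A A 0"
proof -
 have "arc_on 0 1 (\<lambda>_. A) (\<lambda>_. 0)"
  using assms unfolding arc_on_def by (auto intro!: exI[of _ "{}"] exI[of _ 0])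
 moreover have "speed om A 0 = 0" using speed_scaleR[of om A 0 0] by simp
 ultimately show ?thesis unfolding reach_def by (intro exI[of _ "\<lambda>_. A"] exI[of _ "\<lambda>_. 0"]) simp
qed

lemma reach_sym: "reach om A B l ==> reach om B A l"
proof -
 assume "reach om A B l"
 then obtain cv D where arc: "arc_on 0 1 cv D" and e: "cv 0 = A" "cv 1 = B"
  and l: "clen om cv D 0 1 \<le> l"
  unfolding reach_def by blast
 have "arc_on 0 1 (\<lambda>t. cv (- 1 * t + 1)) (\<lambda>t. - 1 *\<^sub>R D (- 1 * t + 1))"
  "integral {0..1} (\<lambda>t. speed om (cv (- 1 * t + 1)) (- 1 *\<^sub>R D (- 1 * t + 1))) = clen om cv D 0 1"
  by (rule arc_affine[OF arc]; simp)+
 then show ?thesis unfolding reach_def using e l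
  by (intro exI[of _ "\<lambda>t. cv (- 1 * t + 1)"] exI[of _ "\<lambda>t. - 1 *\<^sub>R D (- 1 * t + 1)"]) simp
qed

lemma reach_trans: assumes "reach om A B l" "reach om B C l'" shows "reach om A C (l + l')"
proof -
 obtain cv D where arc: "arc_on 0 1 cv D" and e: "cv 0 = A" "cv 1 = B"
  and l: "clen om cv D 0 1 \<le> l"
  using assms(1) unfolding reach_def by blast
 obtain cv' D' where arc': "arc_on 0 1 cv' D'" and e': "cv' 0 = B" "cv' 1 = C"
  and l': "clen om cv' D' 0 1 \<le> l'"
  using assms(2) unfolding reach_def by blast
 have s: "arc_on 1 2 (\<lambda>t. cv' (1 * t + - 1)) (\<lambda>t. 1 *\<^sub>R D' (1 * t + - 1))"
  "integral {1..2} (\<lambda>t. speed om (cv' (1 * t + - 1)) (1 *\<^sub>R D' (1 * t + - 1))) = clen om cv' D' 0 1"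
  by (rule arc_affine[OF arc']; simp)+
 have j: "cv 1 = cv' (1 * 1 + - 1)" using e e' by simp
 note J = arc_join[OF arc s(1) j]
 have "reach om A C (clen om cv D 0 1 + clen om cv' D' 0 1)"
  using reach_arc[OF J(1), of om] J(2)[of om] e e' s(2) by simp
 then show ?thesis by (rule reach_mono) (use l l' in simp)
qed

lemma bounded_linear_matrix_mult: "bounded_linear (\<lambda>X :: 'k cmat. A ** X)" for A :: "'k::finite cmat"
 unfolding linear_conv_bounded_linear[symmetric]
 by (rule linearI) (simp_all add: matrix_add_ldistrib matrix_scaleR_right)

lemma reach_left:
 fixes A :: "'k::finite cmat"
 assumes "reach om B C l" "A \<in> SU"
 shows "reach om (A ** B) (A ** C) l"
proof -
 obtain cv D where arc: "arc_on 0 1 cv D" and e: "cv 0 = B" "cv 1 = C"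
  and l: "clen om cv D 0 1 \<le> l"
  using assms(1) unfolding reach_def by blast
 obtain S M where S: "finite S" and SB: "\<And>t. t \<in> {0<..<1} - S ==>
   (cv has_vector_derivative D t) (at t) \<and> isCont D t \<and> norm (D t) \<le> M"
  using arc unfolding arc_on_def by blast
 interpret bounded_linear "\<lambda>X :: 'k cmat. A ** X" by (rule bounded_linear_matrix_mult)
 obtain K where K: "K > 0" "\<And>X :: 'k cmat. norm (A ** X) \<le> norm X * K" using pos_bounded by blast
 have "arc_on 0 1 (\<lambda>t. A ** cv t) (\<lambda>t. A ** D t)"
  unfolding arc_on_def
 proof (intro conjI exI[of _ S] exI[of _ "M * K"] ballI)
  show "continuous_on {0..1} (\<lambda>t. A ** cv t)" using arc unfolding arc_on_def by (intro continuous_on) auto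
  show "(\<lambda>t. A ** cv t) ` {0..1} \<subseteq> SU" using arc SU_mult[OF assms(2)] unfolding arc_on_def by auto
  show "finite S" by (rule S)
  fix t :: real assume t: "t \<in> {0<..<1} - S"
  show "((\<lambda>t. A ** cv t) has_vector_derivative A ** D t) (at t)" using SB[OF t] has_vector_derivative by blast
  show "isCont (\<lambda>t. A ** D t) t" using SB[OF t] isCont by blast
  show "norm (A ** D t) \<le> M * K" using SB[OF t] K(2)[of "D t"] mult_right_mono[of "norm (D t)" M K] K(1) by linarith
 qed
 moreover have "integral {0..1} (\<lambda>t. speed om (A ** cv t) (A ** D t)) \<le> l"
  unfolding speed_left_mult[OF assms(2)] by (rule l)
 ultimately show ?thesis unfolding reach_def using e by (intro exI[of _ "\<lambda>t. A ** cv t"] exI[of _ "\<lambda>t. A ** D t"]) simp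
qed

text \<open>Left-invariance turns the triangle inequality into subadditivity over products, the form
  that fits factorizations into rotations.\<close>

lemma reach_mult:
 assumes "reach om (mat 1) A l" "reach om (mat 1) B l'" shows "reach om (mat 1) (A ** B) (l + l')"
 using reach_trans[OF assms(1), of "A ** B" l'] reach_left[OF assms(2), of A] reach_SU[OF assms(1)] by simp

section \<open>Lengths of plane rotations\<close>

definition rotgen :: "'k::finite => 'k => complex => complex => 'k cmat" where
 "rotgen i j w u = (\<chi> x y. if x = i then (if y = i then w else if y = j then u else 0)
   else if x = j then (if y = i then - cnj u else if y = j then cnj w else 0) else 0)"

lemma rotgen_wnorm:
 fixes i j :: "'k::finite"
 assumes ij: "i \<noteq> j"
 shows "wnorm om (rotgen i j w u) = sqrt ((\<bar>om i i\<bar> + \<bar>om j j\<bar>) * (cmod w)\<^sup>2 + (\<bar>om i j\<bar> + \<bar>om j i\<bar>) * (cmod u)\<^sup>2)"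
proof -
 define g where "g x y = \<bar>om x y\<bar> * (cmod (rotgen i j w u $ x $ y))\<^sup>2" for x y
 have z: "g x y = 0" if "x \<notin> {i, j} \<or> y \<notin> {i, j}" for x y using that by (auto simp: g_def rotgen_def)
 have r: "(\<Sum>y\<in>UNIV. g x y) = g x i + g x j" for x
 proof -
  have "(\<Sum>y\<in>UNIV. g x y) = (\<Sum>y\<in>{i, j}. g x y)" by (rule sum.mono_neutral_right) (use z in auto)
  then show ?thesis using ij by simp
 qed
 have "(\<Sum>x\<in>UNIV. \<Sum>y\<in>UNIV. g x y) = (\<Sum>x\<in>{i, j}. \<Sum>y\<in>UNIV. g x y)"
  by (rule sum.mono_neutral_right) (use z in auto)
 then have "(\<Sum>x\<in>UNIV. \<Sum>y\<in>UNIV. g x y) = g i i + g i j + (g j i + g j j)" using ij by (simp add: r)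
 then show ?thesis using ij unfolding wnorm_def g_def by (simp add: rotgen_def algebra_simps)
qed

text \<open>The generator \<open>W\<close> squares to minus the projection \<open>P\<close> onto the
  plane of \<open>i\<close> and \<open>j\<close>. Its one-parameter group is therefore
  \<open>Q + cos P + sin W\<close>, a curve with constant logarithmic derivative
  \<open>\<theta> *\<^sub>R W\<close>.\<close>

lemma reach_rotgen:
 fixes i j :: "'k::finite"
 assumes ij: "i \<noteq> j" and w: "cnj w = - w" and n: "(cmod w)\<^sup>2 + (cmod u)\<^sup>2 = 1"
 shows "reach om (mat 1) (rot i j (of_real (cos \<theta>) + of_real (sin \<theta>) * w) (of_real (sin \<theta>) * u))
  (\<bar>\<theta>\<bar> * wnorm om (rotgen i j w u))"
proof -
 define a b where "a t = complex_of_real (cos (t * \<theta>)) + of_real (sin (t * \<theta>)) * w"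
  and "b t = complex_of_real (sin (t * \<theta>)) * u" for t :: real
 define cv where "cv t = rot i j (a t) (b t)" for t
 define Q P W where "Q = rot i j 0 0" and "P = rotgen i j 1 0" and "W = rotgen i j w u"
 define D where "D t = \<theta> *\<^sub>R (cos (t * \<theta>) *\<^sub>R W - sin (t * \<theta>) *\<^sub>R P)" for t
 have ww: "w * cnj w + u * cnj u = 1"
  using arg_cong[OF n, of complex_of_real] by (simp only: of_real_add complex_norm_square of_real_1)
 have cv: "cv t = Q + cos (t * \<theta>) *\<^sub>R P + sin (t * \<theta>) *\<^sub>R W" for t
  unfolding cv_def Q_def P_def W_def a_def b_def
  by (auto simp: vec_eq_iff rot_def rotgen_def scaleR_conv_of_real[where 'a = complex])
 have der: "(cv has_vector_derivative D t) (at t)" for t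
 proof -
  have "((\<lambda>t. Q + cos (t * \<theta>) *\<^sub>R P + sin (t * \<theta>) *\<^sub>R W) has_vector_derivative
    (- sin (t * \<theta>) * \<theta>) *\<^sub>R P + (cos (t * \<theta>) * \<theta>) *\<^sub>R W) (at t)"
   by (auto intro!: derivative_eq_intros)
  then show ?thesis unfolding cv[abs_def] D_def by (simp add: algebra_simps)
 qed
 have cD: "isCont D t" for t unfolding D_def by (intro continuous_intros)
 have SU: "cv t \<in> SU" for t unfolding cv_def
 proof (rule rot_SU[OF ij])
  have cs: "(of_real (cos (t * \<theta>)) :: complex)\<^sup>2 + (of_real (sin (t * \<theta>)))\<^sup>2 = 1"
   by (simp only: of_real_power[symmetric] of_real_add[symmetric] sin_cos_squared_add2 of_real_1)
  have "a t * cnj (a t) + b t * cnj (b t) = 1"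
   unfolding a_def b_def complex_cnj_add complex_cnj_mult complex_cnj_complex_of_real w
   using ww[unfolded w] cs by algebra
  then have "complex_of_real ((cmod (a t))\<^sup>2 + (cmod (b t))\<^sup>2) = 1"
   by (simp only: of_real_add complex_norm_square)
  then show "(cmod (a t))\<^sup>2 + (cmod (b t))\<^sup>2 = 1" using of_real_eq_1_iff by blast
 qed
 have sp: "ctranspose (cv t) ** D t = \<theta> *\<^sub>R W" for t
 proof -
  define c s where "c = complex_of_real (cos (t * \<theta>))" and "s = complex_of_real (sin (t * \<theta>))"
  have cs: "c * c + s * s = 1"
   unfolding c_def s_def of_real_mult[symmetric] of_real_add[symmetric]
   using sin_cos_squared_add3[of "t * \<theta>"] by simp
  have ab: "a t = c + s * w" "cnj (a t) = c - s * w" "b t = s * u" "cnj (b t) = s * cnj u"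
   by (simp_all add: a_def b_def c_def s_def w)
  have cc: "cnj c = c" "cnj s = s" by (simp_all add: c_def s_def)
  have De: "D t $ x $ y = of_real \<theta> * (c * W $ x $ y - s * P $ x $ y)" for x y
   by (simp add: D_def c_def s_def scaleR_conv_of_real[where 'a = complex])
  have We: "W $ i $ i = w" "W $ i $ j = u" "W $ j $ i = - cnj u" "W $ j $ j = - w"
   "P $ i $ i = 1" "P $ i $ j = 0" "P $ j $ i = 0" "P $ j $ j = 1"
   using ij by (simp_all add: W_def P_def rotgen_def w)
  define U T where "U = cnj u" and "T = complex_of_real \<theta>"
  have U: "u * U = 1 + w * w" using ww unfolding w U_def by (simp add: algebra_simps)
  have k: "(c - s * w) * (T * (c * w - s * 1)) + - (s * u) * (T * (c * - U - s * 0)) = T * (w * (c * c + s * s) + c * s * (u * U - (1 + w * w)))"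
   "(c - s * w) * (T * (c * u - s * 0)) + - (s * u) * (T * (c * - w - s * 1)) = T * (u * (c * c + s * s))"
   "(s * U) * (T * (c * w - s * 1)) + (c + s * w) * (T * (c * - U - s * 0)) = T * (- U * (c * c + s * s))"
   "(s * U) * (T * (c * u - s * 0)) + (c + s * w) * (T * (c * - w - s * 1)) = T * (- w * (c * c + s * s) + c * s * (u * U - (1 + w * w)))"
   by (simp_all add: algebra_simps)
  note k = k[unfolded cs U, unfolded U_def T_def]
  have W0: "W $ x $ y = 0" "P $ x $ y = 0" if "x \<notin> {i, j} \<or> y \<notin> {i, j}" for x y
   using that by (auto simp: W_def P_def rotgen_def)
  have "(rot i j (cnj (a t)) (- b t) ** D t) $ x $ y = of_real \<theta> * W $ x $ y" for x y
  proof -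
   consider "x = i" "y = i" | "x = i" "y = j" | "x = j" "y = i" | "x = j" "y = j" | "x \<notin> {i, j} \<or> y \<notin> {i, j}" by blast
   then show ?thesis
   proof cases
    case 1 then show ?thesis using ij k(1) unfolding rot_mult[OF ij] De by (simp add: We ab cc w)
   next
    case 2 then show ?thesis using ij k(2) unfolding rot_mult[OF ij] De by (simp add: We ab cc w)
   next
    case 3 then show ?thesis using ij k(3) unfolding rot_mult[OF ij] De by (simp add: We ab cc w)
   next
    case 4 then show ?thesis using ij k(4) unfolding rot_mult[OF ij] De by (simp add: We ab cc w)
   next
    case 5
    have "D t $ x' $ y = 0" if "x' \<notin> {i, j} \<or> y \<notin> {i, j}" for x' unfolding De W0[OF that] by simp
    then show ?thesis using 5 W0[OF 5] unfolding rot_mult[OF ij] by auto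
   qed
  qed
  then show ?thesis unfolding cv_def ctranspose_rot[OF ij]
   by (simp only: vec_eq_iff vector_scaleR_component scaleR_conv_of_real[where 'a = complex]) simp
 qed
 have "arc_on 0 1 cv D"
  unfolding arc_on_def
 proof (intro conjI exI[of _ "{}"])
  show "continuous_on {0..1} cv"
   using der by (intro continuous_at_imp_continuous_on) (auto intro: has_vector_derivative_continuous)
  show "cv ` {0..1} \<subseteq> SU" using SU by auto
  have "norm (D t) \<le> \<bar>\<theta>\<bar> * (norm W + norm P)" for t
  proof -
   have "norm (cos (t * \<theta>) *\<^sub>R W - sin (t * \<theta>) *\<^sub>R P) \<le> 1 * norm W + 1 * norm P"
    by (rule order_trans[OF norm_triangle_ineq4], unfold norm_scaleR, intro add_mono mult_right_mono) auto
   then show ?thesis unfolding D_def norm_scaleR by (intro mult_left_mono) auto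
  qed
  then show "\<exists>B. finite {} \<and> (\<forall>t\<in>{0<..<1} - {}. (cv has_vector_derivative D t) (at t) \<and> isCont D t \<and> norm (D t) \<le> B)"
   using der cD by blast
 qed
 moreover have "cv 0 = mat 1" unfolding cv_def a_def b_def using ij by (auto simp: vec_eq_iff rot_def mat_def)
 moreover have "clen om cv D 0 1 = \<bar>\<theta>\<bar> * wnorm om W"
  unfolding speed_def sp wnorm_scaleR by simp
 ultimately show ?thesis unfolding reach_def W_def[symmetric]
  by (intro exI[of _ cv] exI[of _ D]) (simp add: cv_def a_def b_def)
qed

text \<open>Every rotation lies on such a one-parameter group, with
  \<open>cos \<theta> = Re a\<close>; where \<open>sin \<theta> = 0\<close> the generator is chosen
  diagonal. For \<open>b = 0\<close> only diagonal weights enter, so that pure phases cost nothing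
  when these vanish.\<close>

lemma reach_rot:
 fixes i j :: "'k::finite"
 assumes ij: "i \<noteq> j" and ab: "(cmod a)\<^sup>2 + (cmod b)\<^sup>2 = 1"
 shows "reach om (mat 1) (rot i j a b)
  (arccos (Re a) * sqrt (\<bar>om i i\<bar> + \<bar>om j j\<bar> + (if b = 0 then 0 else \<bar>om i j\<bar> + \<bar>om j i\<bar>)))"
proof -
 define \<theta> where "\<theta> = arccos (Re a)"
 have e: "(Re a)\<^sup>2 + (Im a)\<^sup>2 + (cmod b)\<^sup>2 = 1" using ab by (simp add: cmod_power2)
 have "(Re a)\<^sup>2 \<le> 1" using e zero_le_power2[of "Im a"] zero_le_power2[of "cmod b"] by linarith
 then have ra: "\<bar>Re a\<bar> \<le> 1" by (simp add: abs_square_le_1)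
 have c: "cos \<theta> = Re a" unfolding \<theta>_def using ra by (intro cos_arccos_abs)
 have s2: "(sin \<theta>)\<^sup>2 = (Im a)\<^sup>2 + (cmod b)\<^sup>2" using e sin_cos_squared_add[of \<theta>] c by simp
 have t0: "0 \<le> \<theta>" unfolding \<theta>_def using ra by (intro arccos_lbound) auto
 obtain w u where w: "cnj w = - w" and n: "(cmod w)\<^sup>2 + (cmod u)\<^sup>2 = 1" and ub: "b = 0 ==> u = 0"
  and rot: "of_real (cos \<theta>) + of_real (sin \<theta>) * w = a" "of_real (sin \<theta>) * u = b"
 proof (cases "sin \<theta> = 0")
  case True
  then have "Im a = 0" "b = 0" using s2 by (auto simp: add_nonneg_eq_0_iff)
  then show ?thesis using that[of \<i> 0] True c by (simp add: complex_eq_iff)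
 next
  case False
  have "(cmod (\<i> * of_real (Im a) / of_real (sin \<theta>)))\<^sup>2 + (cmod (b / of_real (sin \<theta>)))\<^sup>2 = ((Im a)\<^sup>2 + (cmod b)\<^sup>2) / (sin \<theta>)\<^sup>2"
   by (simp add: norm_divide norm_mult power_divide add_divide_distrib)
  also have "\<dots> = 1" unfolding s2[symmetric] using False by simp
  finally show ?thesis
   using that[of "\<i> * of_real (Im a) / of_real (sin \<theta>)" "b / of_real (sin \<theta>)"] False c by (simp add: complex_eq_iff)
 qed
 have le: "(cmod w)\<^sup>2 \<le> 1" "(cmod u)\<^sup>2 \<le> 1" using n zero_le_power2[of "cmod w"] zero_le_power2[of "cmod u"] by linarith+
 have "(\<bar>om i i\<bar> + \<bar>om j j\<bar>) * (cmod w)\<^sup>2 \<le> (\<bar>om i i\<bar> + \<bar>om j j\<bar>) * 1"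
  "(\<bar>om i j\<bar> + \<bar>om j i\<bar>) * (cmod u)\<^sup>2 \<le> (\<bar>om i j\<bar> + \<bar>om j i\<bar>) * 1"
  using le by (intro mult_left_mono; simp)+
 then have "wnorm om (rotgen i j w u) \<le> sqrt (\<bar>om i i\<bar> + \<bar>om j j\<bar> + (if b = 0 then 0 else \<bar>om i j\<bar> + \<bar>om j i\<bar>))"
  unfolding rotgen_wnorm[OF ij] using ub by auto
 then show ?thesis
  using reach_rotgen[OF ij w n, of om \<theta>] t0 unfolding rot \<theta>_def[symmetric]
  by (elim reach_mono) (simp add: mult_left_mono)
qed

text \<open>Continuity of the length at the identity: the rotations in the factorization tend to the
  identity together with \<open>A\<close>, hence so do their angles. For the trivial filter it says
  that the group is connected by arcs.\<close>

lemma reach_tendsto: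
 fixes A :: "'x => 'k::finite cmat"
 assumes "\<And>x. A x \<in> SU" "\<And>i j. ((\<lambda>x. A x $ i $ j) \<longlongrightarrow> mat 1 $ i $ j) F"
 shows "\<exists>l. (\<forall>x. reach om (mat 1) (A x) (l x)) \<and> (l \<longlongrightarrow> 0) F"
proof -
 define Z where "Z = {A :: 'x => 'k cmat. \<exists>l. (\<forall>x. reach om (mat 1) (A x) (l x)) \<and> (l \<longlongrightarrow> 0) F}"
 have "A \<in> Z"
 proof (rule rotation_generation[where f = "\<lambda>_. ()" and F = F])
  show "(\<lambda>_. mat 1) \<in> Z" unfolding Z_def using reach_refl[of "mat 1"] by (auto intro!: exI[of _ "\<lambda>_. 0"])
  show "(\<lambda>x. A x ** B x) \<in> Z" if A: "A \<in> Z" and B: "B \<in> Z" for A B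
  proof -
   obtain l l' where l: "\<forall>x. reach om (mat 1) (A x) (l x)" "(l \<longlongrightarrow> 0) F"
    and l': "\<forall>x. reach om (mat 1) (B x) (l' x)" "(l' \<longlongrightarrow> 0) F" using A B unfolding Z_def by blast
   have "((\<lambda>x. l x + l' x) \<longlongrightarrow> 0) F" using tendsto_add[OF l(2) l'(2)] by simp
   then show ?thesis using l(1) l'(1) unfolding Z_def by (auto intro!: exI[of _ "\<lambda>x. l x + l' x"] reach_mult)
  qed
  show "(\<lambda>x. rot i j (a x) (b x)) \<in> Z"
   if ij: "i \<noteq> j" and ab: "\<And>x. (cmod (a x))\<^sup>2 + (cmod (b x))\<^sup>2 = 1" and a: "(a \<longlongrightarrow> 1) F" for i j and a b :: "'x => complex"
  proof -
   define C where "C = sqrt (\<bar>om i i\<bar> + \<bar>om j j\<bar> + (\<bar>om i j\<bar> + \<bar>om j i\<bar>))"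
   have rg: "Re (a x) \<in> {- 1..1}" for x
   proof -
    have "(cmod (a x))\<^sup>2 \<le> 1" using ab[of x] zero_le_power2[of "cmod (b x)"] by linarith
    then have "cmod (a x) \<le> 1" by (simp add: abs_square_le_1)
    then show ?thesis using abs_Re_le_cmod[of "a x"] by auto
   qed
   have "((\<lambda>x. Re (a x)) \<longlongrightarrow> Re 1) F" by (intro tendsto_intros a)
   then have "((\<lambda>x. arccos (Re (a x))) \<longlongrightarrow> arccos (Re 1)) F"
    by (intro continuous_on_tendsto_compose[OF continuous_on_arccos']) (use rg in auto)
   then have "((\<lambda>x. arccos (Re (a x)) * C) \<longlongrightarrow> 0 * C) F" by (intro tendsto_mult_right) simp
   moreover have "reach om (mat 1) (rot i j (a x) (b x)) (arccos (Re (a x)) * C)" for x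
    by (rule reach_mono[OF reach_rot[OF ij ab]]) (use rg[of x] in \<open>auto simp: C_def intro!: mult_left_mono arccos_lbound\<close>)
   ultimately show ?thesis unfolding Z_def by (auto intro!: exI[of _ "\<lambda>x. arccos (Re (a x)) * C"])
  qed
 qed (use assms in auto)
 then show ?thesis unfolding Z_def by blast
qed

text \<open>A block diagonal matrix factors into phases and rotations inside the blocks, where all
  weights are 0. The families of the factorization are indexed by a single point.\<close>

lemma reach_zero:
 fixes A :: "'k::finite cmat"
 assumes om: "\<And>i j. f i = f j ==> om i j = 0" and A: "A \<in> SU" "\<And>i j. f i \<noteq> f j ==> A $ i $ j = 0"
 shows "reach om (mat 1) A 0"
proof -
 define Z where "Z = {A :: unit => 'k cmat. reach om (mat 1) (A ()) 0}"
 have "(\<lambda>_. A) \<in> Z"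
 proof (rule rotation_generation[where f = f and F = bot])
  show "(\<lambda>_. mat 1) \<in> Z" unfolding Z_def using reach_refl[of "mat 1"] by simp
  show "(\<lambda>x. A x ** B x) \<in> Z" if "A \<in> Z" "B \<in> Z" for A B
   using reach_mult[of om "A ()" 0 "B ()" 0] that unfolding Z_def by simp
  show "(\<lambda>x. rot i j (a x) (b x)) \<in> Z"
   if ij: "i \<noteq> j" and ab: "\<And>x. (cmod (a x))\<^sup>2 + (cmod (b x))\<^sup>2 = 1" and fb: "f i = f j \<or> (\<forall>x. b x = 0)"
   for i j and a b :: "unit => complex"
  proof -
   have "\<bar>om i i\<bar> + \<bar>om j j\<bar> + (if b () = 0 then 0 else \<bar>om i j\<bar> + \<bar>om j i\<bar>) = 0" using fb om by auto
   then show ?thesis using reach_rot[OF ij ab, of om "()"] unfolding Z_def by simp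
  qed
 qed (use A in auto)
 then show ?thesis unfolding Z_def by simp
qed

section \<open>The pseudo-metrics and their dependence on the weights\<close>

definition sdist :: "('k => 'k => real) => 'k::finite cmat => 'k cmat => real" where
 "sdist om A B = Inf {l. reach om A B l}"

lemma reach_exists:
 assumes "A \<in> SU" "B \<in> SU" obtains l where "reach om A B l"
proof -
 have "ctranspose A ** B \<in> SU" using assms by (intro SU_mult SU_ctranspose)
 then obtain l where "reach om (mat 1) (ctranspose A ** B) l"
  using reach_tendsto[of "\<lambda>_ :: unit. ctranspose A ** B" bot om] by auto
 from reach_left[OF this assms(1)] show thesis using that by (simp add: SU_cancel(2)[OF assms(1)])
qed

lemma sdist_le: "reach om A B l ==> sdist om A B \<le> l"
 unfolding sdist_def by (rule cInf_lower) (auto intro!: bdd_belowI[of _ 0] reach_nonneg)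

lemma sdist_greatest:
 assumes "A \<in> SU" "B \<in> SU" "\<And>l. reach om A B l ==> c \<le> l" shows "c \<le> sdist om A B"
 unfolding sdist_def by (rule cInf_greatest) (use reach_exists[OF assms(1,2), of om] assms(3) in auto)

lemma sdist_reach:
 assumes "A \<in> SU" "B \<in> SU" "sdist om A B < e" shows "reach om A B e"
proof -
 have "\<exists>l. reach om A B l \<and> l < e"
  using sdist_greatest[OF assms(1,2), of om e] assms(3) by (meson not_less)
 then show ?thesis using reach_mono by (metis less_imp_le)
qed

lemma sdist_nonneg: "A \<in> SU ==> B \<in> SU ==> 0 \<le> sdist om A B"
 by (rule sdist_greatest) (auto intro: reach_nonneg)

lemma sdist_eq_0: "reach om A B 0 ==> sdist om A B = 0"
 using sdist_le[of om A B 0] sdist_nonneg[of A B om] reach_SU[of om A B 0] by auto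

lemma sdist_sym: "sdist om A B = sdist om B A"
proof -
 have "reach om A B l \<longleftrightarrow> reach om B A l" for l using reach_sym by blast
 then show ?thesis by (simp add: sdist_def)
qed

lemma sdist_triangle:
 assumes "A \<in> SU" "B \<in> SU" "C \<in> SU" shows "sdist om A C \<le> sdist om A B + sdist om B C"
proof (rule field_le_epsilon)
 fix e :: real assume "0 < e"
 then have "reach om A B (sdist om A B + e/2)" "reach om B C (sdist om B C + e/2)"
  using assms by (auto intro!: sdist_reach)
 from sdist_le[OF reach_trans[OF this]] show "sdist om A C \<le> sdist om A B + sdist om B C + e" by simp
qed

lemma sdist_left:
 assumes M: "M \<in> SU" shows "sdist om (M ** A) (M ** B) = sdist om A B"
proof -
 have "reach om (M ** A) (M ** B) l \<longleftrightarrow> reach om A B l" for l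
  using reach_left[OF _ M, of om A B l] reach_left[OF _ SU_ctranspose[OF M], of om "M ** A" "M ** B" l]
  by (auto simp: SU_cancel(1)[OF M])
 then show ?thesis by (simp add: sdist_def)
qed

text \<open>The two weights are compared along the same arc; the square on \<open>c\<close>
  disappears with the square root in the norm.\<close>

lemma sdist_scale:
 assumes w: "\<And>i j. \<bar>om i j\<bar> \<le> c\<^sup>2 * \<bar>om' i j\<bar>" and c: "0 < c" and AB: "A \<in> SU" "B \<in> SU"
 shows "sdist om A B \<le> c * sdist om' A B"
proof -
 have "sdist om A B / c \<le> sdist om' A B"
 proof (rule sdist_greatest[OF AB])
  fix l assume "reach om' A B l"
  then obtain cv D where arc: "arc_on 0 1 cv D" and e: "cv 0 = A" "cv 1 = B"
   and l: "clen om' cv D 0 1 \<le> l"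
   unfolding reach_def by blast
  have "clen om cv D 0 1 \<le> integral {0..1} (\<lambda>t. c * speed om' (cv t) (D t))"
   by (intro integral_le arc_speed_integrable[OF arc] integrable_on_mult_right)
    (use c in \<open>auto simp: speed_def intro!: wnorm_le[OF w]\<close>)
  also have "\<dots> \<le> c * l" using l c by simp
  finally have "sdist om A B \<le> c * l"
   by (intro sdist_le) (use arc e in \<open>auto simp: reach_def\<close>)
  then show "sdist om A B / c \<le> l" using c by (simp add: field_simps)
 qed
 then show ?thesis using c by (simp add: field_simps)
qed

text \<open>The quotients of \<open>B\<close> and nearby points form a family in the group that
  tends to the identity. Outside the group it takes the value \<open>mat 1\<close>, because the
  family has to lie in \<open>SU\<close> for every index.\<close>

lemma sdist_continuous:
 fixes B :: "'k::finite cmat"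
 assumes B: "B \<in> SU" and e: "0 < e"
 shows "\<exists>d>0. \<forall>B'\<in>SU. dist B' B < d \<longrightarrow> sdist om B B' < e"
proof -
 define F where "F = inf (nhds B) (principal SU)"
 define A where "A x = (if x \<in> SU then ctranspose B ** x else mat 1)" for x
 have "((\<lambda>x. A x $ i $ j) \<longlongrightarrow> mat 1 $ i $ j) F" for i j
 proof -
  have id: "((\<lambda>x. x) \<longlongrightarrow> B) (nhds B)" by (rule filterlim_ident)
  have "((\<lambda>x. \<Sum>k\<in>UNIV. ctranspose B $ i $ k * x $ k $ j) \<longlongrightarrow> (\<Sum>k\<in>UNIV. ctranspose B $ i $ k * B $ k $ j)) (nhds B)"
   by (intro tendsto_intros tendsto_vec_nth id)
  then have "((\<lambda>x. (ctranspose B ** x) $ i $ j) \<longlongrightarrow> (ctranspose B ** B) $ i $ j) (nhds B)"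
   by (simp add: matrix_matrix_mult_def)
  then have "((\<lambda>x. (ctranspose B ** x) $ i $ j) \<longlongrightarrow> mat 1 $ i $ j) F"
   unfolding SU_D(1)[OF B] F_def by (rule tendsto_mono[OF inf_le1])
  then show ?thesis
   by (rule Lim_transform_eventually) (simp add: F_def A_def eventually_inf_principal)
 qed
 moreover have "A x \<in> SU" for x using B by (simp add: A_def SU_mult SU_ctranspose)
 ultimately obtain l where l: "\<And>x. reach om (mat 1) (A x) (l x)" "(l \<longlongrightarrow> 0) F"
  using reach_tendsto[of A F om] by blast
 have "eventually (\<lambda>x. l x < e) F" using order_tendstoD(2)[OF l(2) e] .
 then obtain d where d: "d > 0" "\<And>x. dist x B < d ==> x \<in> SU ==> l x < e"
  unfolding F_def eventually_inf_principal eventually_nhds_metric by blast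
 have "sdist om B x < e" if x: "x \<in> SU" "dist x B < d" for x
 proof -
  have "reach om (B ** mat 1) (B ** A x) (l x)" by (rule reach_left[OF l(1) B])
  then have "reach om B x (l x)" using x by (simp add: A_def SU_cancel(2)[OF B])
  then show ?thesis using sdist_le[of om B x "l x"] d(2)[OF x(2,1)] by simp
 qed
 then show ?thesis using d(1) by blast
qed

lemma compact_SU: "compact (SU :: 'k::finite cmat set)"
proof -
 have eq: "SU = {A :: 'k cmat. (\<forall>i j. (\<Sum>k\<in>UNIV. cnj (A $ k $ i) * A $ k $ j) = mat 1 $ i $ j) \<and> det A = 1}"
  by (auto simp: SU_def vec_eq_iff matrix_matrix_mult_def)
 have "closed (SU :: 'k cmat set)"
  unfolding eq
 proof (intro closed_Collect_conj closed_Collect_all closed_Collect_eq continuous_on_const)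
  show "continuous_on UNIV (\<lambda>A :: 'k cmat. \<Sum>k\<in>UNIV. cnj (A $ k $ i) * A $ k $ j)" for i j
   by (intro continuous_at_imp_continuous_on ballI, unfold isCont_def)
    (intro tendsto_intros tendsto_vec_nth)
  show "continuous_on UNIV (det :: 'k cmat => complex)"
   by (intro continuous_at_imp_continuous_on ballI, unfold isCont_def det_def)
    (intro tendsto_intros tendsto_vec_nth)
 qed
 moreover have "bounded (SU :: 'k cmat set)"
  unfolding bounded_iff
 proof (intro exI ballI)
  fix A :: "'k cmat" assume A: "A \<in> SU"
  have "norm A \<le> (\<Sum>i\<in>UNIV. norm (A $ i))" unfolding norm_vec_def[of A] by (rule L2_set_le_sum) simp
  also have "\<dots> \<le> (\<Sum>i\<in>UNIV. \<Sum>j\<in>UNIV. cmod (A $ i $ j))"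
   by (intro sum_mono, unfold norm_vec_def[of "A $ _"]) (rule L2_set_le_sum, simp)
  also have "\<dots> \<le> (\<Sum>i\<in>(UNIV :: 'k set). \<Sum>j\<in>(UNIV :: 'k set). 1)" by (intro sum_mono SU_entry_le[OF A])
  finally show "norm A \<le> (\<Sum>i\<in>(UNIV :: 'k set). \<Sum>j\<in>(UNIV :: 'k set). 1)" .
 qed
 ultimately show ?thesis by (simp add: compact_eq_bounded_closed)
qed

text \<open>Upper bound: on a nearly shortest arc for \<open>om\<close>, raising all weights by
  \<open>k\<^sup>2\<close> adds at most \<open>k\<close> times the length \<open>L\<close> for
  constant weight 1. Lower bound: eventually \<open>om\<close> is at most
  \<open>(1 + h)\<^sup>2\<close> times \<open>w\<close> at every entry, trivially so where
  \<open>om\<close> is 0. Degenerate limits are therefore no exception.\<close>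

lemma sdist_tendsto:
 fixes w :: "'x => 'k => 'k::finite => real"
 assumes lim: "\<And>i j. ((\<lambda>x. w x i j) \<longlongrightarrow> om i j) F" and AB: "A \<in> SU" "B \<in> SU" and e: "0 < e"
 shows "eventually (\<lambda>x. \<bar>sdist (w x) A B - sdist om A B\<bar> < e) F"
proof -
 define s where "s = sdist om A B"
 have s0: "0 \<le> s" unfolding s_def by (rule sdist_nonneg[OF AB])
 obtain cv D where arc: "arc_on 0 1 cv D" and ends: "cv 0 = A" "cv 1 = B"
  and len: "clen om cv D 0 1 \<le> s + e/4"
  using sdist_reach[OF AB, of om "s + e/4"] e unfolding reach_def s_def by auto
 define L where "L = clen (\<lambda>_ _. 1) cv D 0 1"
 have L: "0 \<le> L" unfolding L_def by (rule integral_nonneg[OF arc_speed_integrable[OF arc]]) simp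
 \<comment> \<open>Keeps the additional length \<open>k * L\<close> below \<open>e / 4\<close>, also
   for \<open>L = 0\<close>.\<close>
 define k where "k = e / (4 * (L + 1))"
 have k: "0 < k" "k * L \<le> e/4" using e L by (simp_all add: k_def field_simps)
 have "eventually (\<lambda>x. \<bar>w x i j\<bar> < \<bar>om i j\<bar> + k\<^sup>2) F" for i j
  by (rule order_tendstoD(2)[OF tendsto_rabs[OF lim]]) (use k in simp)
 then have "eventually (\<lambda>x. \<forall>i j. \<bar>w x i j\<bar> < \<bar>om i j\<bar> + k\<^sup>2) F" by (intro eventually_all_finite)
 then have up: "eventually (\<lambda>x. sdist (w x) A B \<le> s + e/2) F"
 proof eventually_elim
  case (elim x)
  have "speed (w x) (cv t) (D t) \<le> speed om (cv t) (D t) + k * speed (\<lambda>_ _. 1) (cv t) (D t)" for t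
   unfolding speed_def using elim k(1) by (intro wnorm_le_add) (auto intro: less_imp_le)
  then have "clen (w x) cv D 0 1 \<le>
    integral {0..1} (\<lambda>t. speed om (cv t) (D t) + k * speed (\<lambda>_ _. 1) (cv t) (D t))"
   by (intro integral_le arc_speed_integrable[OF arc] integrable_add integrable_on_mult_right)
  also have "\<dots> = clen om cv D 0 1 + k * L"
   unfolding L_def
   by (subst Henstock_Kurzweil_Integration.integral_add)
    (auto intro!: arc_speed_integrable[OF arc] integrable_on_mult_right)
  also have "\<dots> \<le> s + e/2" using len k(2) by simp
  finally show ?case by (intro sdist_le) (use arc ends in \<open>auto simp: reach_def\<close>)
 qed
 \<comment> \<open>By the upper bound \<open>sdist (w x) A B\<close> is at most
   \<open>s + e/2\<close>, so the factor \<open>1 + h\<close> costs at most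
   \<open>h * (s + e/2) < e\<close>.\<close>
 define h where "h = e / (2 * (s + e))"
 have h: "0 < h" "h * (s + e/2) < e"
 proof -
  show "0 < h" using s0 e by (simp add: h_def)
  have "h * (s + e/2) \<le> h * (s + e)" using \<open>0 < h\<close> e by simp
  also have "\<dots> = e/2" using s0 e by (simp add: h_def field_simps)
  finally show "h * (s + e/2) < e" using e by simp
 qed
 have "eventually (\<lambda>x. \<bar>om i j\<bar> \<le> (1 + h)\<^sup>2 * \<bar>w x i j\<bar>) F" for i j
 proof (cases "om i j = 0")
  case False
  have "\<bar>om i j\<bar> / (1 + h)\<^sup>2 < \<bar>om i j\<bar>"
  proof -
   have "1 < (1 + h)\<^sup>2" using h by (simp add: one_less_power)
   then have "\<bar>om i j\<bar> * 1 < \<bar>om i j\<bar> * (1 + h)\<^sup>2" using False by (intro mult_strict_left_mono) auto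
   then show ?thesis using h by (simp add: divide_less_eq)
  qed
  from order_tendstoD(1)[OF tendsto_rabs[OF lim] this] show ?thesis
  proof eventually_elim
   case (elim x)
   have "0 < (1 + h)\<^sup>2" using h by simp
   then show ?case using elim by (simp add: divide_less_eq mult.commute)
  qed
 qed simp
 then have "eventually (\<lambda>x. \<forall>i j. \<bar>om i j\<bar> \<le> (1 + h)\<^sup>2 * \<bar>w x i j\<bar>) F" by (intro eventually_all_finite)
 then show ?thesis using up
 proof eventually_elim
  case (elim x)
  have "s \<le> (1 + h) * sdist (w x) A B"
   unfolding s_def by (rule sdist_scale[OF _ _ AB]) (use elim h in auto)
  moreover have "h * sdist (w x) A B \<le> h * (s + e/2)" using elim h by (intro mult_left_mono) auto
  ultimately show ?case using elim(2) h(2) e unfolding s_def[symmetric] by (simp add: algebra_simps abs_less_iff)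
 qed
qed

text \<open>Pointwise convergence is uniform because the pseudo-metrics are left-invariant and
 equicontinuous on a compact group.\<close>

lemma sdist_uniform:
 fixes w :: "'x => 'k => 'k::finite => real"
 assumes lim: "\<And>i j. ((\<lambda>x. w x i j) \<longlongrightarrow> om i j) F" and e: "0 < e"
 shows "eventually (\<lambda>x. \<forall>A\<in>SU. \<forall>B\<in>SU. \<bar>sdist (w x) A B - sdist om A B\<bar> \<le> e) F"
proof -
 \<comment> \<open>Both the limit weights and, eventually, the weights \<open>w x\<close> are at
   most \<open>M\<^sup>2\<close>; hence all the pseudo-metrics share the modulus of continuity of
   \<open>M\<close> times the one with constant weight 1.\<close>
 define M where "M = 1 + (\<Sum>i\<in>UNIV. \<Sum>j\<in>UNIV. \<bar>om i j\<bar>)"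
 have M1: "1 \<le> M" unfolding M_def by (simp add: sum_nonneg)
 have le: "\<bar>om i j\<bar> + 1 \<le> M\<^sup>2 * \<bar>1 :: real\<bar>" for i j
 proof -
  have "\<bar>om i j\<bar> \<le> (\<Sum>j\<in>UNIV. \<bar>om i j\<bar>)" by (rule member_le_sum) auto
  also have "\<dots> \<le> (\<Sum>i\<in>UNIV. \<Sum>j\<in>UNIV. \<bar>om i j\<bar>)"
   by (rule member_le_sum[of i UNIV "\<lambda>i. \<Sum>j\<in>UNIV. \<bar>om i j\<bar>"]) (auto intro: sum_nonneg)
  finally have "\<bar>om i j\<bar> + 1 \<le> M" by (simp add: M_def)
  also have "\<dots> \<le> M\<^sup>2" using M1 by (simp add: self_le_power)
  finally show ?thesis by simp
 qed
 define one where "one = (\<lambda>(_::'k) (_::'k). 1 :: real)"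
 have omM: "sdist om A B \<le> M * sdist one A B" if "A \<in> SU" "B \<in> SU" for A B
 proof (rule sdist_scale[OF _ _ that])
  show "\<bar>om i j\<bar> \<le> M\<^sup>2 * \<bar>one i j\<bar>" for i j using le[of i j] by (simp add: one_def)
 qed (use M1 in simp)
 have "\<exists>d>0. \<forall>B'\<in>SU. dist B' B < d \<longrightarrow> sdist one B B' < e / (4 * M)" if "B \<in> SU" for B
  by (rule sdist_continuous[OF that]) (use e M1 in simp)
 then obtain d where d: "\<And>B. B \<in> SU ==> 0 < d B"
  "\<And>B B'. B \<in> SU ==> B' \<in> SU ==> dist B' B < d B ==> sdist one B B' < e / (4 * M)" by metis
 obtain C where C: "C \<subseteq> SU" "finite C" "(SU :: 'k cmat set) \<subseteq> (\<Union>B\<in>C. ball B (d B))"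
 proof (rule compactE_image[OF compact_SU, of SU "\<lambda>B. ball B (d B)"])
  show "SU \<subseteq> (\<Union>B\<in>SU. ball B (d B))" using d(1) by force
 qed auto
 have "eventually (\<lambda>x. \<forall>B\<in>C. \<bar>sdist (w x) (mat 1) B - sdist om (mat 1) B\<bar> < e/2) F"
  by (rule eventually_ball_finite[OF C(2)], intro ballI sdist_tendsto[OF lim]) (use C(1) e in auto)
 moreover have "eventually (\<lambda>x. \<bar>w x i j\<bar> < \<bar>om i j\<bar> + 1) F" for i j
  by (rule order_tendstoD(2)[OF tendsto_rabs[OF lim]]) simp
 then have "eventually (\<lambda>x. \<forall>i j. \<bar>w x i j\<bar> < \<bar>om i j\<bar> + 1) F" by (intro eventually_all_finite)
 ultimately show ?thesis
 proof eventually_elim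
  case (elim x)
  have wM: "sdist (w x) A B \<le> M * sdist one A B" if "A \<in> SU" "B \<in> SU" for A B
  proof (rule sdist_scale[OF _ _ that])
   show "\<bar>w x i j\<bar> \<le> M\<^sup>2 * \<bar>one i j\<bar>" for i j
   proof -
    have "\<bar>w x i j\<bar> < \<bar>om i j\<bar> + 1" using elim(2) by blast
    then show ?thesis using le[of i j] by (simp add: one_def)
   qed
  qed (use M1 in simp)
  show ?case
  proof (intro ballI)
   fix A B :: "'k cmat" assume AB: "A \<in> SU" "B \<in> SU"
   define B' where "B' = ctranspose A ** B"
   have B': "B' \<in> SU" unfolding B'_def using AB by (intro SU_mult SU_ctranspose)
   have eq: "sdist \<nu> A B = sdist \<nu> (mat 1) B'" for \<nu>
    using sdist_left[OF AB(1), of \<nu> "mat 1" B'] by (simp add: B'_def SU_cancel(2)[OF AB(1)])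
   obtain B0 where B0: "B0 \<in> C" "dist B' B0 < d B0" using C(3) B' by (auto simp: dist_commute)
   have S0: "B0 \<in> SU" using B0 C by auto
   have close: "\<bar>sdist \<nu> (mat 1) B' - sdist \<nu> (mat 1) B0\<bar> \<le> e/4"
    if \<nu>: "\<And>A B. A \<in> SU ==> B \<in> SU ==> sdist \<nu> A B \<le> M * sdist one A B" for \<nu>
   proof -
    have "M * sdist one B0 B' \<le> M * (e / (4 * M))" using d(2)[OF S0 B' B0(2)] M1 by (intro mult_left_mono) auto
    then have "sdist \<nu> B0 B' \<le> e/4" using \<nu>[OF S0 B'] M1 by simp
    then show ?thesis
     using sdist_triangle[OF SU_mat1 S0 B', of \<nu>] sdist_triangle[OF SU_mat1 B' S0, of \<nu>] sdist_sym[of \<nu> B0 B']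
     by linarith
   qed
   have "\<bar>sdist (w x) (mat 1) B0 - sdist om (mat 1) B0\<bar> < e/2" using elim(1) B0(1) by blast
   then show "\<bar>sdist (w x) A B - sdist om A B\<bar> \<le> e"
    unfolding eq using close[of "w x", OF wM] close[of om, OF omM] by linarith
  qed
 qed
qed

section \<open>Distances of invariant metrics\<close>

text \<open>Obtained by differentiating the orthonormality relations of the columns.\<close>

lemma skew_logarithmic_derivative:
 fixes cv :: "real => 'k::finite cmat"
 assumes cv: "\<And>s. s \<in> {a<..<b} ==> cv s \<in> SU" and t: "t \<in> {a<..<b}" and D: "(cv has_vector_derivative D) (at t)"
 shows "skew (ctranspose (cv t) ** D)"
proof (rule skewI)
 fix i j
 have ent: "((\<lambda>s. cv s $ k $ l) has_vector_derivative D $ k $ l) (at t)" for k l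
  by (rule bounded_linear.has_vector_derivative[OF bounded_linear_vec_nth],
    rule bounded_linear.has_vector_derivative[OF bounded_linear_vec_nth D])
 have "((\<lambda>s. \<Sum>k\<in>UNIV. cnj (cv s $ k $ i) * cv s $ k $ j) has_vector_derivative
   (\<Sum>k\<in>UNIV. cnj (cv t $ k $ i) * D $ k $ j + cnj (D $ k $ i) * cv t $ k $ j)) (at t)"
  by (intro has_vector_derivative_sum has_vector_derivative_mult has_vector_derivative_cnj ent)
 moreover have "((\<lambda>s. \<Sum>k\<in>UNIV. cnj (cv s $ k $ i) * cv s $ k $ j) has_vector_derivative 0) (at t)"
  by (rule has_vector_derivative_transform_within_open[of "\<lambda>_. if i = j then 1 else 0" _ _ "{a<..<b}"])
   (use t SU_col[OF cv] in \<open>auto intro: has_vector_derivative_const\<close>)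
 ultimately have "(\<Sum>k\<in>UNIV. cnj (cv t $ k $ i) * D $ k $ j + cnj (D $ k $ i) * cv t $ k $ j) = 0"
  by (rule vector_derivative_unique_at)
 then have "(ctranspose (cv t) ** D) $ i $ j + cnj ((ctranspose (cv t) ** D) $ j $ i) = 0"
  by (simp add: matrix_matrix_mult_def sum.distrib mult.commute)
 then show "cnj ((ctranspose (cv t) ** D) $ j $ i) = - (ctranspose (cv t) ** D) $ i $ j"
  by (simp add: add_eq_0_iff)
qed

text \<open>The derivative may be unbounded near a break point, so the curve is not an
  \<open>arc_on\<close>. Between break points it is one on every compact subinterval, and the two
  remaining end pieces have small distance by continuity. The induction over \<open>S\<close> splits
  at the break points.\<close>

lemma sdist_le_length:
 assumes "finite S" "a \<le> b" "continuous_on {a..b} cv" "cv ` {a..b} \<subseteq> SU"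
  "\<And>t. t \<in> {a<..<b} - S ==> (cv has_vector_derivative D t) (at t) \<and> isCont D t"
  "(\<lambda>t. speed om (cv t) (D t)) integrable_on {a..b}"
 shows "sdist om (cv a) (cv b) \<le> clen om cv D a b"
 using assms
proof (induction S arbitrary: a b rule: finite_induct)
 case empty
 note ab = empty(1) and cont = empty(2) and SU = empty(3) and D = empty(4) and int = empty(5)
 have in_SU: "cv t \<in> SU" if "t \<in> {a..b}" for t using SU that by blast
 show ?case
 proof (cases "a = b")
  case True
  then show ?thesis using sdist_eq_0[OF reach_refl[OF in_SU[of a]]] by simp
 next
  case False
  then have ab: "a < b" using ab by simp
  show ?thesis
  proof (rule field_le_epsilon)
   fix e :: real assume e: "0 < e"
   have near: "\<exists>h>0. \<forall>t\<in>{a..b}. \<bar>t - c\<bar> < h \<longrightarrow> sdist om (cv c) (cv t) < e/2" if c: "c \<in> {a..b}" for c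
   proof -
    obtain d where d: "d > 0" "\<And>B. B \<in> SU ==> dist B (cv c) < d ==> sdist om (cv c) B < e/2"
     using sdist_continuous[OF in_SU[OF c], of "e/2"] e by (metis half_gt_zero)
    obtain h where "h > 0" "\<forall>t\<in>{a..b}. dist t c < h \<longrightarrow> dist (cv t) (cv c) < d"
     using cont c d(1) unfolding continuous_on_iff by blast
    then show ?thesis using d(2) in_SU by (auto simp: dist_real_def)
   qed
   obtain h1 where h1: "h1 > 0" "\<forall>t\<in>{a..b}. \<bar>t - a\<bar> < h1 \<longrightarrow> sdist om (cv a) (cv t) < e/2"
    using near[of a] ab by auto
   obtain h2 where h2: "h2 > 0" "\<forall>t\<in>{a..b}. \<bar>t - b\<bar> < h2 \<longrightarrow> sdist om (cv b) (cv t) < e/2"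
    using near[of b] ab by auto
   \<comment> \<open>Near enough to the ends for distances below \<open>e/2\<close>, and within the
     outer thirds of the interval so that \<open>a' < b'\<close>.\<close>
   define a' b' where "a' = a + min (h1/2) ((b - a)/3)" and "b' = b - min (h2/2) ((b - a)/3)"
   have a': "a < a'" "a' - a < h1" "a' \<le> a + (b - a)/3" using h1(1) ab unfolding a'_def by (auto simp: min_def)
   have b': "b' < b" "b - b' < h2" "b' \<ge> b - (b - a)/3" using h2(1) ab unfolding b'_def by (auto simp: min_def)
   have ab': "a' < b'"
   proof -
    have "a + (b - a)/3 < b - (b - a)/3" using ab by (simp add: field_simps)
    then show ?thesis using a'(3) b'(3) by linarith
   qed
   have ins: "a' \<in> {a..b}" "b' \<in> {a..b}" using a' b' ab' by auto
   have sub: "{a'..b'} \<subseteq> {a<..<b}" using a'(1) b'(1) by auto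
   have "continuous_on {a'..b'} D" using D sub by (intro continuous_at_imp_continuous_on) auto
   then have "bounded (D ` {a'..b'})" by (intro compact_imp_bounded compact_continuous_image) auto
   then obtain M where M: "\<And>t. t \<in> {a'..b'} ==> norm (D t) \<le> M" unfolding bounded_iff by blast
   have arc: "arc_on a' b' cv D"
    unfolding arc_on_def
   proof (intro conjI exI[of _ "{}"] exI[of _ M] ballI)
    show "continuous_on {a'..b'} cv" by (rule continuous_on_subset[OF cont]) (use sub in auto)
    show "cv ` {a'..b'} \<subseteq> SU" using in_SU sub by auto
    fix t assume "t \<in> {a'<..<b'} - {}"
    then have t: "t \<in> {a'..b'}" "t \<in> {a<..<b} - {}" using a'(1) b'(1) by auto
    show "(cv has_vector_derivative D t) (at t)" "isCont D t" "norm (D t) \<le> M" using D[OF t(2)] M[OF t(1)] by auto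
   qed simp
   have sub': "{a'..b'} \<subseteq> {a..b}" using a' b' by auto
   have "sdist om (cv a') (cv b') \<le> clen om cv D a' b'"
    by (rule sdist_le[OF reach_arc[OF arc ab']])
   also have "\<dots> \<le> clen om cv D a b"
    by (rule integral_subset_le[OF sub' arc_speed_integrable[OF arc] int]) simp
   finally have "sdist om (cv a') (cv b') \<le> clen om cv D a b" .
   moreover have "sdist om (cv a) (cv a') < e/2" "sdist om (cv b) (cv b') < e/2"
    using h1(2) h2(2) ins a' b' by auto
   moreover have "sdist om (cv a) (cv b) \<le> sdist om (cv a) (cv a') + sdist om (cv a') (cv b)"
    "sdist om (cv a') (cv b) \<le> sdist om (cv a') (cv b') + sdist om (cv b') (cv b)"
    using ins ab by (auto intro!: sdist_triangle in_SU)
   ultimately show "sdist om (cv a) (cv b) \<le> clen om cv D a b + e"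
    using sdist_sym[of om "cv b'" "cv b"] by linarith
  qed
 qed
next
 case (insert s S)
 note cont = insert.prems(2) and SU = insert.prems(3) and D = insert.prems(4) and int = insert.prems(5)
 have part: "sdist om (cv a') (cv b') \<le> clen om cv D a' b'"
  if "a \<le> a'" "a' \<le> b'" "b' \<le> b" "s \<notin> {a'<..<b'}" for a' b'
 proof (rule insert.IH[OF that(2)])
  have sub: "{a'..b'} \<subseteq> {a..b}" using that by auto
  show "continuous_on {a'..b'} cv" by (rule continuous_on_subset[OF cont sub])
  show "cv ` {a'..b'} \<subseteq> SU" using SU sub by blast
  show "(cv has_vector_derivative D t) (at t) \<and> isCont D t" if "t \<in> {a'<..<b'} - S" for t
   using that \<open>a \<le> a'\<close> \<open>b' \<le> b\<close> \<open>s \<notin> {a'<..<b'}\<close> by (intro D) auto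
  show "(\<lambda>t. speed om (cv t) (D t)) integrable_on {a'..b'}" by (rule integrable_on_subinterval[OF int sub])
 qed
 show ?case
 proof (cases "s \<in> {a<..<b}")
  case False
  then show ?thesis using part[of a b] insert.prems(1) by simp
 next
  case True
  then have "sdist om (cv a) (cv b) \<le> sdist om (cv a) (cv s) + sdist om (cv s) (cv b)"
   using SU by (intro sdist_triangle) auto
  also have "\<dots> \<le> clen om cv D a s + clen om cv D s b"
   using True by (intro add_mono part) auto
  also have "\<dots> = clen om cv D a b"
   using True by (intro Henstock_Kurzweil_Integration.integral_combine int) auto
  finally show ?thesis .
 qed
qed

text \<open>Curves for \<open>riemannian_dist\<close> may start and end anywhere in two fibres,
  those for \<open>sdist\<close> at the given matrices. Moving inside a fibre is free by
  \<open>stab\<close>, so the infima agree. The form \<open>g\<close> is only evaluated on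
  logarithmic derivatives, which are skew.\<close>

lemma riemannian_dist_eq:
 fixes g :: "'k::finite cmat => 'k cmat => real" and act :: "'k cmat => 'x => 'x"
 assumes g: "\<And>X. skew X ==> sqrt (g X X) = wnorm om X"
  and stab: "\<And>A B. A \<in> SU ==> B \<in> SU ==> act A x0 = act B x0 ==> reach om (mat 1) (ctranspose A ** B) 0"
  and AB: "A \<in> SU" "B \<in> SU"
 shows "riemannian_dist act x0 g (act A x0) (act B x0) = sdist om A B"
proof -
 have sp: "curve_speed g cv t = speed om (cv t) (D t)"
  if cv: "cv ` {0..1} \<subseteq> SU" and t: "t \<in> {0<..<1}" and D: "(cv has_vector_derivative D t) (at t)" for cv D t
 proof -
  have "at t within {0..1} = at t" using t by (intro at_within_interior) auto
  then have "vector_derivative cv (at t within {0..1}) = D t" using vector_derivative_at[OF D] by simp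
  moreover have "skew (ctranspose (cv t) ** D t)"
   by (rule skew_logarithmic_derivative[of 0 1 cv, OF _ t D]) (use cv in auto)
  ultimately show ?thesis unfolding curve_speed_def Let_def speed_def by (simp add: g)
 qed
 have eq: "integral {0..1} (curve_speed g cv) = clen om cv D 0 1"
  "curve_speed g cv integrable_on {0..1} \<longleftrightarrow> (\<lambda>t. speed om (cv t) (D t)) integrable_on {0..1}"
  if cv: "cv ` {0..1} \<subseteq> SU" and S: "finite S"
   and D: "\<And>t. t \<in> {0<..<1} - S ==> (cv has_vector_derivative D t) (at t)" for cv D S
 proof -
  have n: "negligible (S \<union> {0, 1})" using S by (intro negligible_finite) simp
  have e: "curve_speed g cv t = speed om (cv t) (D t)" if "t \<in> {0..1} - (S \<union> {0, 1})" for t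
   using that by (intro sp[OF cv] D) auto
  show "integral {0..1} (curve_speed g cv) = clen om cv D 0 1"
   by (rule integral_spike[OF n]) (simp add: e)
  show "curve_speed g cv integrable_on {0..1} \<longleftrightarrow> (\<lambda>t. speed om (cv t) (D t)) integrable_on {0..1}"
   by (rule integrable_spike_finite_eq[of "S \<union> {0, 1}"]) (use S e in auto)
 qed
 have stab': "sdist om C C' = 0" if "C \<in> SU" "C' \<in> SU" "act C x0 = act C' x0" for C C'
  using sdist_left[OF that(1), of om "mat 1" "ctranspose C ** C'"] sdist_eq_0[OF stab[OF that]]
  by (simp add: SU_cancel(2)[OF that(1)])
 define X where "X = {integral {0..1} (curve_speed g cv) | cv.
      cv piecewise_C1_differentiable_on {0..1} \<and> cv ` {0..1} \<subseteq> SU \<and>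
      curve_speed g cv integrable_on {0..1} \<and> act (cv 0) x0 = act A x0 \<and> act (cv 1) x0 = act B x0}"
 have lower: "sdist om A B \<le> v" if vX: "v \<in> X" for v
 proof -
  obtain cv where v: "v = integral {0..1} (curve_speed g cv)" and pc: "cv piecewise_C1_differentiable_on {0..1}"
   and cv: "cv ` {0..1} \<subseteq> SU" and int: "curve_speed g cv integrable_on {0..1}"
   and ends: "act (cv 0) x0 = act A x0" "act (cv 1) x0 = act B x0"
   using vX unfolding X_def by blast
  obtain S where cont: "continuous_on {0..1} cv" and S: "finite S" and C1: "cv C1_differentiable_on ({0..1} - S)"
   using pc unfolding piecewise_C1_differentiable_on_def by blast
  obtain D where D: "\<And>t. t \<in> {0..1} - S ==> (cv has_vector_derivative D t) (at t)"
   and cD: "continuous_on ({0..1} - S) D" using C1 unfolding C1_differentiable_on_def by blast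
  have op: "open ({0<..<1} - S)" using S by (intro open_Diff finite_imp_closed) auto
  have "continuous_on ({0<..<1} - S) D" by (rule continuous_on_subset[OF cD]) auto
  then have isD: "isCont D t" if "t \<in> {0<..<1} - S" for t using continuous_on_eq_continuous_at[OF op] that by blast
  have D': "\<And>t. t \<in> {0<..<1} - S ==> (cv has_vector_derivative D t) (at t)" using D by auto
  have "sdist om (cv 0) (cv 1) \<le> clen om cv D 0 1"
   by (rule sdist_le_length[OF S _ cont cv]) (use D' isD int eq(2)[OF cv S D'] in auto)
  also have "\<dots> = v" unfolding v by (rule eq(1)[OF cv S D', symmetric])
  finally have "sdist om (cv 0) (cv 1) \<le> v" .
  moreover have g01: "cv 0 \<in> SU" "cv 1 \<in> SU" using cv by auto
  moreover have "sdist om A (cv 0) = 0" "sdist om (cv 1) B = 0" using stab' g01 AB ends by simp_all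
  ultimately show ?thesis
   using sdist_triangle[OF AB(1) g01(1) AB(2), of om] sdist_triangle[OF g01 AB(2), of om] by linarith
 qed
 have upper: "\<exists>v\<in>X. v \<le> l" if l: "reach om A B l" for l
 proof -
  obtain cv D where arc: "arc_on 0 1 cv D" and e: "cv 0 = A" "cv 1 = B"
   and l: "clen om cv D 0 1 \<le> l"
   using l unfolding reach_def by blast
  obtain S M where S: "finite S" and SB: "\<And>t. t \<in> {0<..<1} - S ==>
    (cv has_vector_derivative D t) (at t) \<and> isCont D t \<and> norm (D t) \<le> M"
   and cont: "continuous_on {0..1} cv" and cv: "cv ` {0..1} \<subseteq> SU"
   using arc unfolding arc_on_def by blast
  have SD: "(cv has_vector_derivative D t) (at t)" "isCont D t" if "t \<in> {0<..<1} - S" for t using SB[OF that] by auto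
  have "cv C1_differentiable_on ({0..1} - (S \<union> {0, 1}))"
   unfolding C1_differentiable_on_def
   by (intro exI[of _ D] conjI ballI continuous_at_imp_continuous_on SD) auto
  then have "cv piecewise_C1_differentiable_on {0..1}"
   unfolding piecewise_C1_differentiable_on_def using cont S by (intro conjI exI[of _ "S \<union> {0, 1}"]) auto
  moreover have "curve_speed g cv integrable_on {0..1}"
   using eq(2)[OF cv S SD(1)] arc_speed_integrable[OF arc] by blast
  ultimately have "integral {0..1} (curve_speed g cv) \<in> X" unfolding X_def using cv e by blast
  then show ?thesis using eq(1)[OF cv S SD(1)] l by auto
 qed
 obtain l0 where "reach om A B l0" using reach_exists[OF AB] .
 then have ne: "X \<noteq> {}" using upper by blast
 have bdd: "bdd_below X" using lower by (intro bdd_belowI) blast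
 have "sdist om A B \<le> Inf X" by (rule cInf_greatest[OF ne lower])
 moreover have "Inf X \<le> sdist om A B"
 proof (rule sdist_greatest[OF AB])
  fix l assume "reach om A B l"
  then obtain v where "v \<in> X" "v \<le> l" using upper by blast
  then show "Inf X \<le> l" using cInf_lower[OF _ bdd] by (meson order_trans)
 qed
 ultimately show ?thesis unfolding riemannian_dist_def X_def by simp
qed

text \<open>Along a curve, the projection \<open>cv P cv\<^sup>*\<close> for a coordinate projection \<open>P\<close> moves at most as fast
 as the curve itself, up to a constant.\<close>

lemma sdist_zero_block:
 fixes A :: "'k::finite cmat"
 assumes om: "\<And>i j. f i \<noteq> f j ==> om i j \<noteq> 0" and A: "A \<in> SU" and zero: "sdist om (mat 1) A = 0" and ij: "f i \<noteq> f j"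
 shows "A $ i $ j = 0"
proof -
 \<comment> \<open>\<open>\<Phi> M\<close> is the squared length of the part of row \<open>i\<close>
   lying in the block of \<open>j\<close>: 0 at the identity, because \<open>i\<close> is in another
   block, and at least the squared modulus of the entry in question.\<close>
 define \<delta> where "\<delta> k = (if f k = f j then 1 else 0 :: real)" for k
 define \<Phi> where "\<Phi> M = (\<Sum>k\<in>UNIV. of_real (\<delta> k) * (M $ i $ k * cnj (M $ i $ k)))" for M :: "'k cmat"
 define C where "C = (\<Sum>k\<in>UNIV. \<Sum>l\<in>UNIV. if f k = f l then 0 else 1 / sqrt \<bar>om l k\<bar>)"
 have C0: "0 \<le> C" unfolding C_def by (intro sum_nonneg) simp
 have bound: "cmod (\<Sum>k\<in>UNIV. of_real (\<delta> k) * (M $ i $ k * cnj ((M ** X) $ i $ k) + (M ** X) $ i $ k * cnj (M $ i $ k))) \<le> C * wnorm om X"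
  if M: "M \<in> SU" and X: "skew X" for M X
 proof -
  have 1: "(\<Sum>k\<in>UNIV. of_real (\<delta> k) * (M $ i $ k * cnj ((M ** X) $ i $ k)))
    = (\<Sum>k\<in>UNIV. \<Sum>l\<in>UNIV. - of_real (\<delta> l) * (M $ i $ l * X $ l $ k * cnj (M $ i $ k)))"
  proof -
   have "of_real (\<delta> k) * (M $ i $ k * cnj ((M ** X) $ i $ k))
     = (\<Sum>l\<in>UNIV. - of_real (\<delta> k) * (M $ i $ k * X $ k $ l * cnj (M $ i $ l)))" for k
    by (simp add: matrix_matrix_mult_def sum_distrib_left skew_cnj[OF X] algebra_simps sum_negf)
   then show ?thesis by (subst sum.swap) simp
  qed
  have 2: "(\<Sum>k\<in>UNIV. of_real (\<delta> k) * ((M ** X) $ i $ k * cnj (M $ i $ k)))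
    = (\<Sum>k\<in>UNIV. \<Sum>l\<in>UNIV. of_real (\<delta> k) * (M $ i $ l * X $ l $ k * cnj (M $ i $ k)))"
   by (simp add: matrix_matrix_mult_def sum_distrib_left sum_distrib_right)
  \<comment> \<open>By skewness the derivative is a commutator with the block projection. Its
    coefficients \<open>\<delta> k - \<delta> l\<close> vanish inside a block, so only entries with
    nonzero weight remain, and these are controlled by the norm.\<close>
  have 3: "(\<Sum>k\<in>UNIV. of_real (\<delta> k) * (M $ i $ k * cnj ((M ** X) $ i $ k) + (M ** X) $ i $ k * cnj (M $ i $ k)))
    = (\<Sum>k\<in>UNIV. \<Sum>l\<in>UNIV. of_real (\<delta> k - \<delta> l) * (M $ i $ l * X $ l $ k * cnj (M $ i $ k)))"
   unfolding distrib_left sum.distrib 1 2 by (simp add: sum.distrib[symmetric] algebra_simps)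
  have "cmod (of_real (\<delta> k - \<delta> l) * (M $ i $ l * X $ l $ k * cnj (M $ i $ k)))
    \<le> (if f k = f l then 0 else 1 / sqrt \<bar>om l k\<bar>) * wnorm om X" for k l
  proof (cases "f k = f l")
   case True
   then show ?thesis by (simp add: \<delta>_def)
  next
   case False
   then have w: "0 < \<bar>om l k\<bar>" using om[of l k] by auto
   have "\<bar>om l k\<bar> * (cmod (X $ l $ k))\<^sup>2 \<le> (\<Sum>k\<in>UNIV. \<bar>om l k\<bar> * (cmod (X $ l $ k))\<^sup>2)"
    by (rule member_le_sum) auto
   also have "\<dots> \<le> (\<Sum>l\<in>UNIV. \<Sum>k\<in>UNIV. \<bar>om l k\<bar> * (cmod (X $ l $ k))\<^sup>2)"
    by (rule member_le_sum[of l UNIV "\<lambda>l. \<Sum>k\<in>UNIV. \<bar>om l k\<bar> * (cmod (X $ l $ k))\<^sup>2"]) (auto intro: sum_nonneg)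
   finally have "sqrt (\<bar>om l k\<bar> * (cmod (X $ l $ k))\<^sup>2) \<le> wnorm om X" unfolding wnorm_def real_sqrt_le_iff .
   then have "sqrt \<bar>om l k\<bar> * cmod (X $ l $ k) \<le> wnorm om X" by (simp add: real_sqrt_mult)
   then have x: "cmod (X $ l $ k) \<le> 1 / sqrt \<bar>om l k\<bar> * wnorm om X" using w by (simp add: field_simps)
   have "cmod (of_real (\<delta> k - \<delta> l) * (M $ i $ l * X $ l $ k * cnj (M $ i $ k)))
     = \<bar>\<delta> k - \<delta> l\<bar> * (cmod (M $ i $ l) * cmod (X $ l $ k) * cmod (M $ i $ k))"
    by (simp only: norm_mult norm_of_real complex_mod_cnj)
   also have "\<dots> \<le> 1 * (1 * cmod (X $ l $ k) * 1)"
    by (intro mult_mono SU_entry_le[OF M] mult_nonneg_nonneg) (auto simp: \<delta>_def)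
   finally show ?thesis using x False by simp
  qed
  then show ?thesis unfolding 3 C_def sum_distrib_right
   by (intro order_trans[OF norm_sum] sum_mono)
 qed
 have small: "cmod (\<Phi> A) \<le> C * e" if e: "0 < e" for e
 proof -
  obtain cv D where arc: "arc_on 0 1 cv D" and ends: "cv 0 = mat 1" "cv 1 = A"
   and len: "clen om cv D 0 1 \<le> e"
   using sdist_reach[OF SU_mat1 A, of om e] zero e unfolding reach_def by auto
  obtain S where S: "finite S" and D: "\<And>t. t \<in> {0<..<1} - S ==> (cv has_vector_derivative D t) (at t)"
   and cv: "\<And>t. t \<in> {0..1} ==> cv t \<in> SU" and cont: "continuous_on {0..1} cv"
   using arc unfolding arc_on_def by blast
  define d where "d t = (if t \<in> {0<..<1} - S
   then (\<Sum>k\<in>UNIV. of_real (\<delta> k) * (cv t $ i $ k * cnj (D t $ i $ k) + D t $ i $ k * cnj (cv t $ i $ k))) else 0)" for t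
  have der: "((\<lambda>t. \<Phi> (cv t)) has_vector_derivative d t) (at t)" if t: "t \<in> {0<..<1} - S" for t
  proof -
   have ent: "((\<lambda>s. cv s $ k $ l) has_vector_derivative D t $ k $ l) (at t)" for k l
    by (rule bounded_linear.has_vector_derivative[OF bounded_linear_vec_nth],
      rule bounded_linear.has_vector_derivative[OF bounded_linear_vec_nth D[OF t]])
   have "((\<lambda>t. \<Phi> (cv t)) has_vector_derivative
     (\<Sum>k\<in>UNIV. of_real (\<delta> k) * (cv t $ i $ k * cnj (D t $ i $ k) + D t $ i $ k * cnj (cv t $ i $ k)))) (at t)"
    unfolding \<Phi>_def
    by (intro has_vector_derivative_sum has_vector_derivative_mult_right has_vector_derivative_mult has_vector_derivative_cnj ent)
   then show ?thesis using t by (simp add: d_def)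
  qed
  have ent: "continuous_on {0..1} (\<lambda>s. cv s $ k $ l)" for k l
   using cont unfolding continuous_on_def by (auto intro!: tendsto_vec_nth)
  have "continuous_on {0..1} (\<lambda>t. \<Phi> (cv t))" unfolding \<Phi>_def by (intro continuous_intros ent)
  then have I: "(d has_integral (\<Phi> (cv 1) - \<Phi> (cv 0))) {0..1}"
   by (intro fundamental_theorem_of_calculus_interior_strong[OF S _ der]) auto
  have db: "cmod (d t) \<le> C * speed om (cv t) (D t)" for t
  proof (cases "t \<in> {0<..<1} - S")
   case False
   then show ?thesis using C0 by (auto simp: d_def)
  next
   case True
   have g: "cv t \<in> SU" using True cv by auto
   have sk: "skew (ctranspose (cv t) ** D t)"
    by (rule skew_logarithmic_derivative[of 0 1 cv, OF _ _ D[OF True]]) (use True cv in auto)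
   have "cv t ** (ctranspose (cv t) ** D t) = D t" by (rule SU_cancel(2)[OF g])
   then show ?thesis using bound[OF g sk] True unfolding d_def speed_def by simp
  qed
  have "norm (integral {0..1} d) \<le> integral {0..1} (\<lambda>t. C * speed om (cv t) (D t))"
   by (rule integral_norm_bound_integral[OF has_integral_integrable[OF I] _ db])
    (intro integrable_on_mult_right arc_speed_integrable[OF arc])
  also have "\<dots> \<le> C * e" using len C0 by (simp add: mult_left_mono)
  finally have "norm (\<Phi> (cv 1) - \<Phi> (cv 0)) \<le> C * e" unfolding integral_unique[OF I] .
  moreover have "\<Phi> (cv 0) = 0"
   unfolding \<Phi>_def ends by (rule sum.neutral) (use ij in \<open>auto simp: \<delta>_def mat_def\<close>)
  ultimately show ?thesis by (simp add: ends)
 qed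
 have "cmod (\<Phi> A) \<le> 0"
 proof (rule field_le_epsilon)
  fix e :: real assume e: "0 < e"
  have "C * (e / (C + 1)) \<le> e" using C0 e by (simp add: field_simps)
  then show "cmod (\<Phi> A) \<le> 0 + e" using small[of "e / (C + 1)"] C0 e by simp
 qed
 then have "\<Phi> A = 0" by simp
 moreover have "\<Phi> A = of_real (\<Sum>k\<in>UNIV. \<delta> k * (cmod (A $ i $ k))\<^sup>2)"
  unfolding \<Phi>_def by (simp only: complex_norm_square[symmetric] of_real_mult[symmetric] of_real_sum)
 ultimately have "(\<Sum>k\<in>UNIV. \<delta> k * (cmod (A $ i $ k))\<^sup>2) = 0" using of_real_eq_0_iff by metis
 then have "\<delta> j * (cmod (A $ i $ j))\<^sup>2 = 0"
  by (subst (asm) sum_nonneg_eq_0_iff) (auto simp: \<delta>_def dest!: spec[of _ j])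
 then show ?thesis by (simp add: \<delta>_def)
qed

lemma sdist_zero_mult:
 fixes A B :: "'k::finite cmat"
 assumes "\<And>i j. f i \<noteq> f j ==> om i j \<noteq> 0" "A \<in> SU" "B \<in> SU" "sdist om A B = 0" "f i \<noteq> f j"
 shows "(ctranspose A ** B) $ i $ j = 0"
proof (rule sdist_zero_block[of f om])
 show "ctranspose A ** B \<in> SU" using assms by (intro SU_mult SU_ctranspose)
 show "sdist om (mat 1) (ctranspose A ** B) = 0"
  using assms(4) sdist_left[OF assms(2), of om "mat 1" "ctranspose A ** B"] by (simp add: SU_cancel(2)[OF assms(2)])
qed (use assms in auto)

text \<open>Only planes between the two blocks other than \<open>b0\<close> cost anything. A
  rotation in such a plane is conjugate to one in a plane through an index \<open>l\<close> of
  \<open>b0\<close>, and rotations in planes through \<open>l\<close> are free.\<close>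

lemma reach_zero_pivot:
 fixes A :: "'k::finite cmat"
 assumes om: "\<And>i j. om i j \<noteq> 0 ==> f i \<noteq> f j \<and> f i \<noteq> b0 \<and> f j \<noteq> b0" and l: "f l = b0" and A: "A \<in> SU"
 shows "reach om (mat 1) A 0"
proof -
 have basic: "reach om (mat 1) (rot i j a b) 0"
  if ij: "i \<noteq> j" and ab: "(cmod a)\<^sup>2 + (cmod b)\<^sup>2 = 1" and z: "b = 0 \<or> om i j = 0 \<and> om j i = 0" for i j a b
 proof -
  have "om k k = 0" for k using om[of k k] by auto
  then have "\<bar>om i i\<bar> + \<bar>om j j\<bar> + (if b = 0 then 0 else \<bar>om i j\<bar> + \<bar>om j i\<bar>) = 0" using z by auto
  then show ?thesis using reach_rot[OF ij ab, of om] by simp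
 qed
 have R: "reach om (mat 1) (rot i j a b) 0"
  if ij: "i \<noteq> j" and ab: "(cmod a)\<^sup>2 + (cmod b)\<^sup>2 = 1" for i j a b
 proof (cases "om i j = 0 \<and> om j i = 0")
  case False
  then have il: "i \<noteq> l" and lj: "l \<noteq> j" using om[of i j] om[of j i] l by auto
  have z: "om k l = 0" "om l k = 0" for k using om[of k l] om[of l k] l by auto
  \<comment> \<open>The quarter turn in the plane of \<open>i\<close> and \<open>l\<close> carries
    the plane of \<open>l\<close> and \<open>j\<close> to that of \<open>i\<close> and
    \<open>j\<close>. The factor \<open>mat 1\<close> brings all products to the form of
    \<open>rot_mult\<close>.\<close>
  have "(rot i l 0 1 ** (rot l j a b ** mat 1)) $ x $ y = (rot i j a b ** (rot i l 0 1 ** mat 1)) $ x $ y" for x y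
   unfolding rot_mult[OF il] rot_mult[OF lj] rot_mult[OF ij] using il lj ij by auto
  then have "rot i l 0 1 ** (rot l j a b ** mat 1) = rot i j a b ** (rot i l 0 1 ** mat 1)"
   by (simp only: vec_eq_iff) blast
  then have e: "rot i l 0 1 ** rot l j a b = rot i j a b ** rot i l 0 1" by simp
  have w: "rot i l 0 1 \<in> SU" by (rule rot_SU[OF il]) simp
  have "rot i j a b = rot i l 0 1 ** rot l j a b ** ctranspose (rot i l 0 1)"
   unfolding e matrix_mul_assoc[symmetric] SU_D(2)[OF w] by simp
  also have "ctranspose (rot i l 0 1) = rot i l 0 (- 1)" unfolding ctranspose_rot[OF il] by simp
  finally have rw: "rot i j a b = rot i l 0 1 ** rot l j a b ** rot i l 0 (- 1)" .
  have "reach om (mat 1) (rot i l 0 1) 0" "reach om (mat 1) (rot l j a b) 0" "reach om (mat 1) (rot i l 0 (- 1)) 0"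
   by (rule basic[OF il] basic[OF lj]; use z ab in simp)+
  from reach_mult[OF reach_mult[OF this(1,2)] this(3)] show ?thesis unfolding rw by simp
 qed (use basic[OF ij ab] in simp)
 define Z where "Z = {A :: unit => 'k cmat. reach om (mat 1) (A ()) 0}"
 have "(\<lambda>_. A) \<in> Z"
 proof (rule rotation_generation[where f = "\<lambda>_. ()" and F = bot])
  show "(\<lambda>_. mat 1) \<in> Z" unfolding Z_def using reach_refl[of "mat 1"] by simp
  show "(\<lambda>x. A x ** B x) \<in> Z" if "A \<in> Z" "B \<in> Z" for A B
   using reach_mult[of om "A ()" 0 "B ()" 0] that unfolding Z_def by simp
 qed (use A R in \<open>auto simp: Z_def\<close>)
 then show ?thesis unfolding Z_def by simp
qed

section \<open>The flag manifold and the Grassmannians as orbits\<close>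

lemma isotropy_group_iff: "A \<in> isotropy_group bl \<longleftrightarrow> A \<in> SU \<and> (\<forall>i j. bl i \<noteq> bl j \<longrightarrow> A $ i $ j = 0)"
 by (simp add: isotropy_group_def)

lemma left_mult_eq_iff:
 fixes A B :: "'k::finite cmat"
 assumes A: "A \<in> SU" and B: "B \<in> SU"
 shows "left_mult A (isotropy_group bl) = left_mult B (isotropy_group bl) \<longleftrightarrow> ctranspose A ** B \<in> isotropy_group bl"
proof
 have one: "(mat 1 :: 'k cmat) \<in> isotropy_group bl" 
  unfolding isotropy_group_iff by (intro conjI SU_mat1) (auto simp: mat_def)
 assume "left_mult A (isotropy_group bl) = left_mult B (isotropy_group bl)"
 moreover have "B \<in> left_mult B (isotropy_group bl)" unfolding left_mult_def using one by force
 ultimately obtain h where "h \<in> isotropy_group bl" "B = A ** h" unfolding left_mult_def by blast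
 then show "ctranspose A ** B \<in> isotropy_group bl" by (simp add: SU_cancel(1)[OF A])
next
 have mult: "g ** h \<in> isotropy_group bl" if "g \<in> isotropy_group bl" "h \<in> isotropy_group bl" for g h :: "'k cmat"
 proof -
  have "(g ** h) $ i $ j = 0" if ij: "bl i \<noteq> bl j" for i j
  proof -
   have "g $ i $ k * h $ k $ j = 0" for k
    using \<open>g \<in> isotropy_group bl\<close> \<open>h \<in> isotropy_group bl\<close> ij unfolding isotropy_group_iff by (cases "bl i = bl k") auto
   then show ?thesis by (simp only: matrix_matrix_mult_def vec_lambda_beta sum.neutral_const)
  qed
  then show ?thesis using that by (simp add: isotropy_group_iff SU_mult)
 qed
 have inv: "ctranspose h \<in> isotropy_group bl" if "h \<in> isotropy_group bl" for h :: "'k cmat"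
  using that by (auto simp: isotropy_group_iff SU_ctranspose)
 have sub: "left_mult C (isotropy_group bl) \<subseteq> left_mult C' (isotropy_group bl)"
  if C': "C' \<in> SU" and h: "ctranspose C' ** C \<in> isotropy_group bl" for C C' :: "'k cmat"
 proof
  fix X assume "X \<in> left_mult C (isotropy_group bl)"
  then obtain g where g: "g \<in> isotropy_group bl" "X = C ** g" unfolding left_mult_def by blast
  have "X = C' ** ((ctranspose C' ** C) ** g)"
   unfolding g(2) matrix_mul_assoc[symmetric] SU_cancel(2)[OF C'] ..
  then show "X \<in> left_mult C' (isotropy_group bl)" unfolding left_mult_def using mult[OF h g(1)] by blast
 qed
 assume h: "ctranspose A ** B \<in> isotropy_group bl"
 then have "ctranspose B ** A \<in> isotropy_group bl" using inv[OF h] by (simp add: ctranspose_mult)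
 then show "left_mult A (isotropy_group bl) = left_mult B (isotropy_group bl)"
  using sub[OF A h] sub[OF B] by blast
qed

lemma flag_dist_eq:
 fixes bl :: "'k::finite => block"
 assumes q: "q \<in> int_S" and AB: "A \<in> SU" "B \<in> SU"
 shows "flag_dist bl q (left_mult A (isotropy_group bl)) (left_mult B (isotropy_group bl))
  = sdist (\<lambda>i j. 2 * real CARD('k) * wt q (bl i) (bl j)) A B"
 unfolding flag_dist_def
proof (rule riemannian_dist_eq[OF _ _ AB])
 have w: "0 \<le> wt q a b" for a b using wt_pos[OF q, of a b] by (cases "a = b") (auto intro: less_imp_le)
 fix X :: "'k cmat" assume "skew X"
 have "Re (X $ i $ j * cnj (X $ i $ j)) = (cmod (X $ i $ j))\<^sup>2" for i j
  by (simp add: cmod_power2 flip: power2_eq_square)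
 then show "sqrt (flag_metric bl q X X) = wnorm (\<lambda>i j. 2 * real CARD('k) * wt q (bl i) (bl j)) X"
  unfolding flag_metric_eq[OF \<open>skew X\<close> \<open>skew X\<close>] wnorm_def using w
  by (simp add: abs_mult sum_distrib_left mult.assoc)
next
 fix A B :: "'k cmat" assume AB: "A \<in> SU" "B \<in> SU" "left_mult A (isotropy_group bl) = left_mult B (isotropy_group bl)"
 then have "ctranspose A ** B \<in> isotropy_group bl" using left_mult_eq_iff[OF AB(1,2)] by blast
 then show "reach (\<lambda>i j. 2 * real CARD('k) * wt q (bl i) (bl j)) (mat 1) (ctranspose A ** B) 0"
  by (intro reach_zero[of bl]) (auto simp: isotropy_group_iff)
qed

section \<open>Grassmannians as orbits\<close>

lemma apply_plane_mult: "apply_plane A (apply_plane B V) = apply_plane (A ** B) V"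
 by (simp add: apply_plane_def image_image matrix_vector_mul_assoc)

lemma apply_plane_1 [simp]: "apply_plane (mat 1) V = V"
 by (simp add: apply_plane_def)

text \<open>Stability of the plane kills one off-diagonal block. The inverse of \<open>h\<close>,
  its conjugate transpose, stabilises the plane too and so kills the other one.\<close>

lemma apply_plane_stabiliser:
 fixes h :: "'k::finite cmat"
 assumes h: "h \<in> SU" and st: "apply_plane h (coordinate_plane I) = coordinate_plane I" and ij: "(i \<in> I) \<noteq> (j \<in> I)"
 shows "h $ i $ j = 0"
proof -
 have col: "g $ k $ l = 0" if "apply_plane g (coordinate_plane I) = coordinate_plane I" "l \<in> I" "k \<notin> I" for g :: "'k cmat" and k l
 proof -
  have "axis l 1 \<in> (coordinate_plane I :: (complex^'k) set)"
   using \<open>l \<in> I\<close> by (auto simp: coordinate_plane_def axis_def)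
  then have "g *v axis l 1 \<in> coordinate_plane I" using that(1) unfolding apply_plane_def by blast
  then have "(g *v axis l 1) $ k = 0" using \<open>k \<notin> I\<close> by (simp add: coordinate_plane_def)
  then show ?thesis by (simp add: matrix_vector_mul_component inner_axis matrix_vector_mult_def axis_def if_distrib cong: if_cong)
 qed
 have "apply_plane (ctranspose h) (coordinate_plane I) = coordinate_plane I"
  using arg_cong[OF st, of "apply_plane (ctranspose h)"] by (simp add: apply_plane_mult SU_D(1)[OF h])
 from col[OF this, of i j] col[OF st, of j i] ij show ?thesis by auto
qed

lemma apply_plane_stabiliser':
 fixes h :: "'k::finite cmat"
 assumes h: "h \<in> SU" and z: "\<And>i j. (i \<in> I) \<noteq> (j \<in> I) ==> h $ i $ j = 0"
 shows "apply_plane h (coordinate_plane I) = coordinate_plane I"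
proof -
 have sub: "apply_plane g (coordinate_plane I) \<subseteq> coordinate_plane I"
  if z: "\<And>i j. (i \<in> I) \<noteq> (j \<in> I) ==> g $ i $ j = 0" for g :: "'k cmat"
 proof -
  have "g *v v \<in> coordinate_plane I" if v: "v \<in> coordinate_plane I" for v
  proof -
   have "(\<Sum>k\<in>UNIV. g $ i $ k * v $ k) = 0" if "i \<notin> I" for i
   proof (rule sum.neutral, rule ballI)
    show "g $ i $ k * v $ k = 0" for k
     using z[of i k] v that by (cases "k \<in> I") (auto simp: coordinate_plane_def)
   qed
   then show ?thesis by (simp add: coordinate_plane_def matrix_vector_mult_def)
  qed
  then show ?thesis unfolding apply_plane_def by blast
 qed
 have "apply_plane h (apply_plane (ctranspose h) (coordinate_plane I)) \<subseteq> apply_plane h (coordinate_plane I)"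
  using sub[of "ctranspose h"] z by (auto simp: apply_plane_def)
 then show ?thesis using sub[of h] z by (auto simp: apply_plane_mult SU_D(2)[OF h])
qed

lemma apply_plane_eq_iff:
 fixes A B :: "'k::finite cmat"
 assumes A: "A \<in> SU" and B: "B \<in> SU"
 shows "apply_plane A (coordinate_plane I) = apply_plane B (coordinate_plane I)
  \<longleftrightarrow> (\<forall>i j. (i \<in> I) \<noteq> (j \<in> I) \<longrightarrow> (ctranspose A ** B) $ i $ j = 0)"
proof
 have h: "ctranspose A ** B \<in> SU" using A B by (intro SU_mult SU_ctranspose)
 {
  assume "apply_plane A (coordinate_plane I) = apply_plane B (coordinate_plane I)"
  from arg_cong[OF this, of "apply_plane (ctranspose A)"]
  have "apply_plane (ctranspose A ** B) (coordinate_plane I) = coordinate_plane I"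
   by (simp add: apply_plane_mult SU_D(1)[OF A])
  then show "\<forall>i j. (i \<in> I) \<noteq> (j \<in> I) \<longrightarrow> (ctranspose A ** B) $ i $ j = 0" using apply_plane_stabiliser[OF h] by blast
 }
 assume "\<forall>i j. (i \<in> I) \<noteq> (j \<in> I) \<longrightarrow> (ctranspose A ** B) $ i $ j = 0"
 then have "apply_plane (ctranspose A ** B) (coordinate_plane I) = coordinate_plane I"
  by (intro apply_plane_stabiliser'[OF h]) blast
 from arg_cong[OF this, of "apply_plane A"]
 show "apply_plane A (coordinate_plane I) = apply_plane B (coordinate_plane I)"
  by (simp add: apply_plane_mult SU_cancel(2)[OF A])
qed

text \<open>The constant 1/2 is the common value of the two nonzero metric parameters at
  \<open>K\<close>, \<open>L\<close> and \<open>M\<close>; with the factor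
  \<open>2 * CARD('k)\<close> of the Killing form the weights become
  \<open>CARD('k)\<close>.\<close>

lemma grassmannian_dist_eq:
 fixes I :: "'k::finite set"
 assumes AB: "A \<in> SU" "B \<in> SU"
 shows "grassmannian_dist I (1/2) (apply_plane A (coordinate_plane I)) (apply_plane B (coordinate_plane I))
  = sdist (\<lambda>i j. if (i \<in> I) = (j \<in> I) then 0 else real CARD('k)) A B"
 unfolding grassmannian_dist_def
proof (rule riemannian_dist_eq[OF _ _ AB])
 fix X :: "'k cmat" assume X: "skew X"
 define Y where "Y = plane_complement_part I X"
 have Y: "Y $ i $ j = (if (i \<in> I) = (j \<in> I) then 0 else X $ i $ j)" for i j
  by (simp add: Y_def plane_complement_part_def)
 have "skew Y" by (rule skewI) (use skew_cnj[OF X] in \<open>auto simp: Y\<close>)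
 moreover have "trace Y = 0" by (simp add: trace_def Y)
 ultimately have "Y \<in> su" by (simp add: su_iff skew_def)
 have e: "real CARD('k) * Re (Y $ i $ j * cnj (Y $ i $ j))
   = \<bar>if (i \<in> I) = (j \<in> I) then 0 else real CARD('k)\<bar> * (cmod (X $ i $ j))\<^sup>2" for i j
  by (simp add: Y cmod_power2 flip: power2_eq_square)
 have "1/2 * neg_killing Y Y = (\<Sum>i\<in>UNIV. \<Sum>j\<in>UNIV. real CARD('k) * Re (Y $ i $ j * cnj (Y $ i $ j)))"
  unfolding neg_killing_eq[OF \<open>Y \<in> su\<close> \<open>Y \<in> su\<close>] by (simp add: sum_distrib_left)
 then show "sqrt (1/2 * neg_killing (plane_complement_part I X) (plane_complement_part I X))
   = wnorm (\<lambda>i j. if (i \<in> I) = (j \<in> I) then 0 else real CARD('k)) X"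
  unfolding Y_def[symmetric] e wnorm_def by simp
next
 fix A B :: "'k cmat"
 assume AB: "A \<in> SU" "B \<in> SU" "apply_plane A (coordinate_plane I) = apply_plane B (coordinate_plane I)"
 then have "ctranspose A ** B \<in> SU" "\<And>i j. (i \<in> I) \<noteq> (j \<in> I) ==> (ctranspose A ** B) $ i $ j = 0"
  using apply_plane_eq_iff[OF AB(1,2), of I] by (auto intro: SU_mult SU_ctranspose)
 then show "reach (\<lambda>i j. if (i \<in> I) = (j \<in> I) then 0 else real CARD('k)) (mat 1) (ctranspose A ** B) 0"
  by (intro reach_zero[of "\<lambda>i. i \<in> I"]) auto
qed

lemma rot_mulv:
 assumes "i \<noteq> j"
 shows "(rot i j a b *v v) $ x = (if x = i then a * v $ i + b * v $ j else if x = j then - cnj b * v $ i + cnj a * v $ j else v $ x)"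
proof -
 have "(rot i j a b *v v) $ x = (rot i j a b ** (\<chi> y z. v $ y)) $ x $ i"
  by (simp add: matrix_vector_mult_def matrix_matrix_mult_def)
 then show ?thesis unfolding rot_mult[OF assms] by simp
qed

lemma SU_mulv_nonzero: "A \<in> SU ==> v \<noteq> 0 ==> A *v v \<noteq> 0"
proof
 assume A: "A \<in> SU" and v: "v \<noteq> 0" and z: "A *v v = 0"
 have "ctranspose A *v (A *v v) = v" by (simp add: matrix_vector_mul_assoc SU_D(1)[OF A])
 then show False using z v by simp
qed

text \<open>Givens rotations in planes of \<open>c\<close> and another index outside
  \<open>T\<close> clear the coordinates of \<open>v\<close> one by one; all of them fix the vectors
  supported on \<open>T\<close>.\<close>

lemma rotate_to_axis:
 fixes v :: "complex^'k::finite"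
 assumes "v \<noteq> 0" "\<And>i. i \<in> T ==> v $ i = 0" "c \<notin> T"
 shows "\<exists>R\<in>SU. (\<forall>u\<in>coordinate_plane T. R *v u = u) \<and> (\<exists>r. r \<noteq> 0 \<and> R *v v = r *s axis c 1)"
proof -
 have "\<exists>R\<in>SU. (\<forall>u\<in>coordinate_plane T. R *v u = u) \<and> (\<exists>r. r \<noteq> 0 \<and> R *v v = r *s axis c 1)"
  if "finite U" "U \<inter> T = {}" "v \<noteq> 0" "\<And>i. i \<notin> U ==> i \<noteq> c ==> v $ i = 0" for U and v :: "complex^'k"
  using that
 proof (induction U arbitrary: v)
  case empty
  then have "v = v $ c *s axis c 1" by (auto simp: vec_eq_iff axis_def)
  moreover from this have "v $ c \<noteq> 0" using empty(2) by auto
  ultimately show ?case by (intro bexI[of _ "mat 1"] conjI) (auto intro!: exI[of _ "v $ c"])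
 next
  case (insert i U)
  show ?case
  proof (cases "i = c")
   case True
   then show ?thesis using insert.prems by (intro insert.IH) auto
  next
   case False
   then have ci: "c \<noteq> i" by simp
   define r where "r = sqrt ((cmod (v $ c))\<^sup>2 + (cmod (v $ i))\<^sup>2)"
   define a b where "a = (if r = 0 then 1 else cnj (v $ c) / of_real r)"
    and "b = (if r = 0 then 0 else cnj (v $ i) / of_real r)"
   have ab: "(cmod a)\<^sup>2 + (cmod b)\<^sup>2 = 1" and z: "- cnj b * v $ c + cnj a * v $ i = 0"
    unfolding a_def b_def r_def by (rule pivot)+
   define R where "R = rot c i a b"
   have R: "R \<in> SU" unfolding R_def by (rule rot_SU[OF ci ab])
   have fx: "R *v u = u" if "u \<in> coordinate_plane T" for u
   proof -
    have "u $ c = 0" "u $ i = 0" using that assms(3) insert.prems(1) by (auto simp: coordinate_plane_def)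
    then show ?thesis unfolding R_def by (auto simp: vec_eq_iff rot_mulv[OF ci])
   qed
   have "\<exists>R'\<in>SU. (\<forall>u\<in>coordinate_plane T. R' *v u = u) \<and> (\<exists>r. r \<noteq> 0 \<and> R' *v (R *v v) = r *s axis c 1)"
   proof (rule insert.IH)
    show "U \<inter> T = {}" using insert.prems(1) by auto
    show "R *v v \<noteq> 0" by (rule SU_mulv_nonzero[OF R insert.prems(2)])
    show "(R *v v) $ k = 0" if "k \<notin> U" "k \<noteq> c" for k
     unfolding R_def rot_mulv[OF ci] using z insert.prems(3)[of k] that by auto
   qed
   then obtain R' where R': "R' \<in> SU" "\<forall>u\<in>coordinate_plane T. R' *v u = u" "\<exists>r. r \<noteq> 0 \<and> R' *v (R *v v) = r *s axis c 1"
    by blast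
   show ?thesis
    by (rule bexI[of _ "R' ** R"]) (use R' fx SU_mult[OF R'(1) R] in \<open>auto simp flip: matrix_vector_mul_assoc\<close>)
  qed
 qed
 from this[of "- T" v] assms(1,2) show ?thesis by auto
qed

lemma coordinate_plane_subspace: "vec.subspace (coordinate_plane I)"
 by (auto simp: vec.subspace_def coordinate_plane_def)

lemma coordinate_plane_dim: "vec.dim (coordinate_plane I :: (complex^'k::finite) set) = card I"
proof (rule vec.dim_unique)
 let ?B = "(\<lambda>i. axis i 1) ` I :: (complex^'k) set"
 show "?B \<subseteq> coordinate_plane I" by (auto simp: coordinate_plane_def axis_def)
 show "vec.independent ?B" by (rule vec.independent_mono[OF independent_cart_basis]) (auto simp: cart_basis_def)
 show "card ?B = card I" by (rule card_image) (auto simp: inj_on_def axis_eq_axis)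
 show "coordinate_plane I \<subseteq> vec.span ?B"
 proof
  fix v :: "complex^'k" assume v: "v \<in> coordinate_plane I"
  have "v = (\<Sum>i\<in>I. v $ i *s axis i 1)"
   using v by (auto simp: vec_eq_iff sum_component axis_def coordinate_plane_def if_distrib[of "\<lambda>x. _ * x"] cong: if_cong)
  also have "\<dots> \<in> vec.span ?B" by (intro vec.span_sum vec.span_scale vec.span_base) auto
  finally show "v \<in> vec.span ?B" .
 qed
qed

lemma apply_plane_subspace: "vec.subspace V ==> vec.subspace (apply_plane A V)"
 unfolding apply_plane_def vec.subspace_def
 by (auto simp: image_iff matrix_vector_right_distrib[symmetric] vector_scalar_commute[symmetric] intro: bexI[of _ 0])

lemma apply_plane_dim:
 fixes A :: "'k::finite cmat"
 assumes A: "A \<in> SU" shows "vec.dim (apply_plane A V) = vec.dim V"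
proof (rule antisym)
 have le: "vec.dim (apply_plane B W) \<le> vec.dim W" for B :: "'k cmat" and W
  unfolding apply_plane_def by (rule vec.dim_image_le[OF matrix_vector_mul_linear_gen])
 show "vec.dim (apply_plane A V) \<le> vec.dim V" by (rule le)
 show "vec.dim V \<le> vec.dim (apply_plane A V)"
  using le[of "ctranspose A" "apply_plane A V"] by (simp add: apply_plane_mult SU_D(1)[OF A])
qed

text \<open>Transitivity: the given plane is moved, one coordinate direction at a time, until it
  contains the coordinate plane, and equal dimensions give equality.\<close>

lemma grassmannian_orbit:
 fixes I :: "'k::finite set"
 shows "(\<lambda>A. apply_plane A (coordinate_plane I)) ` SU = grassmannian (card I)"
proof (intro equalityI subsetI)
 fix V assume "V \<in> (\<lambda>A. apply_plane A (coordinate_plane I)) ` SU"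
 then show "V \<in> grassmannian (card I)"
  by (auto simp: grassmannian_def apply_plane_dim coordinate_plane_dim intro!: apply_plane_subspace coordinate_plane_subspace)
next
 fix V :: "(complex^'k) set" assume "V \<in> grassmannian (card I)"
 then have V: "vec.subspace V" "vec.dim V = card I" by (auto simp: grassmannian_def)
 have "\<exists>A\<in>SU. coordinate_plane T \<subseteq> apply_plane A V" if "T \<subseteq> I" for T
  using finite[of T] that
 proof (induction T rule: finite_induct)
  case empty
  have "coordinate_plane {} \<subseteq> apply_plane (mat 1) V"
   using vec.subspace_0[OF V(1)] by (auto simp: coordinate_plane_def vec_eq_iff) (metis vec_eq_iff zero_index)
  then show ?case using SU_mat1 by blast
 next
  case (insert c T)
  then obtain A where A: "A \<in> SU" "coordinate_plane T \<subseteq> apply_plane A V" by blast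
  define W where "W = apply_plane A V"
  have W: "vec.subspace W" "vec.dim W = card I" unfolding W_def using apply_plane_subspace[OF V(1)] apply_plane_dim[OF A(1)] V(2) by auto
  have "card T < card I" using insert.hyps insert.prems by (intro psubset_card_mono) auto
  then have "W \<noteq> coordinate_plane T" using W(2) coordinate_plane_dim[of T] by auto
  then obtain w where w: "w \<in> W" "w \<notin> coordinate_plane T" using A(2) unfolding W_def by blast
  \<comment> \<open>Subtracting the part supported on \<open>T\<close>, which already lies in
    \<open>W\<close>, leaves a vector of \<open>W\<close> that can be rotated to axis
    \<open>c\<close> without moving the directions reached so far.\<close>
  define p where "p = (\<chi> i. if i \<in> T then w $ i else 0)"
  have p: "p \<in> coordinate_plane T" by (simp add: p_def coordinate_plane_def)
  define v where "v = w - p"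
  have vW: "v \<in> W" unfolding v_def using w(1) p A(2) by (intro vec.subspace_diff[OF W(1)]) (auto simp: W_def)
  have "v \<noteq> 0" using w(2) p by (auto simp: v_def)
  moreover have "v $ i = 0" if "i \<in> T" for i using that by (simp add: v_def p_def)
  ultimately obtain R r where R: "R \<in> SU" "\<And>u. u \<in> coordinate_plane T ==> R *v u = u" and r: "r \<noteq> 0" "R *v v = r *s axis c 1"
   using rotate_to_axis[of v T c] insert.hyps by blast
  have sub: "vec.subspace (apply_plane R W)" by (rule apply_plane_subspace[OF W(1)])
  have "coordinate_plane (insert c T) \<subseteq> apply_plane R W"
  proof
   fix u :: "complex^'k" assume u: "u \<in> coordinate_plane (insert c T)"
   define u' where "u' = (\<chi> i. if i \<in> T then u $ i else 0)"
   have u': "u' \<in> coordinate_plane T" by (simp add: u'_def coordinate_plane_def)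
   have "u = u' + (u $ c / r) *s (r *s axis c 1)"
    using u insert.hyps r(1) by (auto simp: vec_eq_iff u'_def axis_def coordinate_plane_def)
   moreover have "u' \<in> apply_plane R W"
    unfolding apply_plane_def using R(2)[OF u'] u' A(2) by (auto simp: W_def intro!: image_eqI[of _ _ u'])
   moreover have "r *s axis c 1 \<in> apply_plane R W" unfolding apply_plane_def r(2)[symmetric] using vW by blast
   ultimately show "u \<in> apply_plane R W"
    using vec.subspace_add[OF sub] vec.subspace_scale[OF sub] by metis
  qed
  then show ?case unfolding W_def apply_plane_mult using SU_mult[OF R(1) A(1)] by blast
 qed
 then obtain A where A: "A \<in> SU" "coordinate_plane I \<subseteq> apply_plane A V" by blast
 have "coordinate_plane I = apply_plane A V"
  by (rule vec.subspace_dim_equal[OF coordinate_plane_subspace apply_plane_subspace[OF V(1)] A(2)])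
   (simp add: apply_plane_dim[OF A(1)] coordinate_plane_dim V(2))
 then have "apply_plane (ctranspose A) (coordinate_plane I) = V"
  by (simp add: apply_plane_mult SU_D(1)[OF A(1)])
 then show "V \<in> (\<lambda>A. apply_plane A (coordinate_plane I)) ` SU" using SU_ctranspose[OF A(1)] by blast
qed

section \<open>Gromov-Hausdorff convergence\<close>

text \<open>A surjection \<open>f\<close> that distorts distances by at most \<open>r\<close> glues
  the two spaces: the distance from \<open>a\<close> to \<open>y\<close> is the length of the best
  route that crosses from some \<open>b\<close> to \<open>f b\<close>, plus a toll. The estimates
  \<open>h1\<close> to \<open>h4\<close> are the mixed triangle inequalities.\<close>

lemma gromov_hausdorff_dist_le:
 assumes M: "Metric_space M e" and M': "Metric_space M' e'"
  and de: "\<And>a b. a \<in> M ==> b \<in> M ==> d a b = e a b" "\<And>a b. a \<in> M' ==> b \<in> M' ==> d' a b = e' a b"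
  and f: "f ` M = M'" and close: "\<And>a b. a \<in> M ==> b \<in> M ==> \<bar>e a b - e' (f a) (f b)\<bar> \<le> r" and r: "0 < r"
 shows "gromov_hausdorff_dist M d M' d' \<le> ennreal r"
proof -
 interpret M: Metric_space M e by (rule M)
 interpret M': Metric_space M' e' by (rule M')
 have fM: "f a \<in> M'" if "a \<in> M" for a using f that by blast
 define h where "h a y = (INF b\<in>M. e a b + e' (f b) y)" for a y
 have lower: "h a y \<le> e a b + e' (f b) y" if "b \<in> M" for a y b
  unfolding h_def by (rule cINF_lower[OF _ that]) (auto intro!: bdd_belowI[of _ 0])
 have greatest: "c \<le> h a y" if "b \<in> M" "\<And>b. b \<in> M ==> c \<le> e a b + e' (f b) y" for c a b y
  unfolding h_def by (rule cINF_greatest) (use that in auto)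
 have h0: "0 \<le> h a y" if "a \<in> M" for a y by (rule greatest[OF that]) simp
 have h1: "h a y \<le> e a b + h b y" if "a \<in> M" "b \<in> M" "y \<in> M'" for a b y
 proof -
  have "h a y - e a b \<le> h b y"
  proof (rule greatest[OF that(1)])
   fix c assume c: "c \<in> M"
   show "h a y - e a b \<le> e b c + e' (f c) y" using lower[OF c, of a y] M.triangle[OF that(1,2) c] by linarith
  qed
  then show ?thesis by simp
 qed
 have h2: "h a y \<le> h a x + e' x y" if "a \<in> M" "x \<in> M'" "y \<in> M'" for a x y
 proof -
  have "h a y - e' x y \<le> h a x"
  proof (rule greatest[OF that(1)])
   fix c assume c: "c \<in> M"
   show "h a y - e' x y \<le> e a c + e' (f c) x" using lower[OF c, of a y] M'.triangle[OF fM[OF c] that(2,3)] by linarith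
  qed
  then show ?thesis by simp
 qed
 have h3: "e a b \<le> h a y + h b y + r" if "a \<in> M" "b \<in> M" "y \<in> M'" for a b y
 proof -
  have "e a b - r - h a y \<le> h b y"
  proof (rule greatest[OF that(1)])
   fix c assume c: "c \<in> M"
   have "e a b - r - (e b c + e' (f c) y) \<le> h a y"
   proof (rule greatest[OF that(1)])
    fix c' assume c': "c' \<in> M"
    show "e a b - r - (e b c + e' (f c) y) \<le> e a c' + e' (f c') y"
     using M.triangle[OF that(1) c' that(2)] M.triangle[OF c' c that(2)] M.commute[of c b] M'.commute[of y "f c"]
      M'.triangle[OF fM[OF c'] that(3) fM[OF c]] close[OF c' c] by linarith
   qed
   then show "e a b - r - h a y \<le> e b c + e' (f c) y" by linarith
  qed
  then show ?thesis by linarith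
 qed
 have h4: "e' x y \<le> h a x + h a y + r" if "a \<in> M" "x \<in> M'" "y \<in> M'" for a x y
 proof -
  have "e' x y - r - h a x \<le> h a y"
  proof (rule greatest[OF that(1)])
   fix c assume c: "c \<in> M"
   have "e' x y - r - (e a c + e' (f c) y) \<le> h a x"
   proof (rule greatest[OF that(1)])
    fix c' assume c': "c' \<in> M"
    show "e' x y - r - (e a c + e' (f c) y) \<le> e a c' + e' (f c') x"
     using M'.triangle[OF that(2) fM[OF c'] that(3)] M'.triangle[OF fM[OF c'] fM[OF c] that(3)] M'.commute[of x "f c'"]
      M.triangle[OF c' that(1) c] M.commute[of c' a] close[OF c' c] by linarith
   qed
   then show "e' x y - r - h a x \<le> e a c + e' (f c) y" by linarith
  qed
  then show ?thesis by linarith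
 qed
 \<comment> \<open>A toll of \<open>r/2\<close> separates the two copies and keeps \<open>a\<close>
   and \<open>f a\<close> at distance below \<open>r\<close>. A triangle that crosses twice pays it
   twice, which compensates for the distortion \<open>r\<close> in \<open>h3\<close> and
   \<open>h4\<close>.\<close>
 define g where "g a y = (if a \<in> M \<and> y \<in> M' then h a y + r/2 else 0)" for a y
 define D where "D u v = (case u of Inl a => (case v of Inl b => e a b | Inr y => g a y)
   | Inr x => (case v of Inl b => g b x | Inr y => e' x y))" for u v
 have D: "D (Inl a) (Inl b) = e a b" "D (Inl a) (Inr y) = g a y" "D (Inr x) (Inl b) = g b x" "D (Inr x) (Inr y) = e' x y" for a b x y
  by (simp_all add: D_def)
 have g: "g a y = h a y + r/2" if "a \<in> M" "y \<in> M'" for a y using that by (simp add: g_def)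
 have "Metric_space (M <+> M') D"
 proof
  fix u v w
  show "0 \<le> D u v" using h0 r by (cases u; cases v) (auto simp: D g_def)
  show "D u v = D v u" by (cases u; cases v) (auto simp: D M.commute M'.commute)
  show "D u v = 0 \<longleftrightarrow> u = v" if "u \<in> M <+> M'" "v \<in> M <+> M'"
   using that r h0 by (auto simp: D g add_nonneg_eq_0_iff)
  assume "u \<in> M <+> M'" "v \<in> M <+> M'" "w \<in> M <+> M'"
  then show "D u w \<le> D u v + D v w"
  proof (elim PlusE)
   fix a b c assume "u = Inl a" "v = Inl b" "w = Inl c" "a \<in> M" "b \<in> M" "c \<in> M"
   then show ?thesis using M.triangle by (simp add: D)
  next
   fix a b y assume "u = Inl a" "v = Inl b" "w = Inr y" "a \<in> M" "b \<in> M" "y \<in> M'"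
   then show ?thesis using h1 by (simp add: D g)
  next
   fix a y c assume "u = Inl a" "v = Inr y" "w = Inl c" "a \<in> M" "y \<in> M'" "c \<in> M"
   then show ?thesis using h3[of a c y] by (simp add: D g)
  next
   fix a x y assume "u = Inl a" "v = Inr x" "w = Inr y" "a \<in> M" "x \<in> M'" "y \<in> M'"
   then show ?thesis using h2 by (simp add: D g)
  next
   fix x b c assume "u = Inr x" "v = Inl b" "w = Inl c" "x \<in> M'" "b \<in> M" "c \<in> M"
   then show ?thesis using h1[of c b x] M.commute[of b c] by (simp add: D g)
  next
   fix x b y assume "u = Inr x" "v = Inl b" "w = Inr y" "x \<in> M'" "b \<in> M" "y \<in> M'"
   then show ?thesis using h4[of b x y] by (simp add: D g)
  next
   fix x y c assume "u = Inr x" "v = Inr y" "w = Inl c" "x \<in> M'" "y \<in> M'" "c \<in> M"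
   then show ?thesis using h2[of c y x] M'.commute[of x y] by (simp add: D g)
  next
   fix x y z assume "u = Inr x" "v = Inr y" "w = Inr z" "x \<in> M'" "y \<in> M'" "z \<in> M'"
   then show ?thesis using M'.triangle by (simp add: D)
  qed
 qed
 note metric = this
 have near: "D (Inl a) (Inr (f a)) < r" if a: "a \<in> M" for a
 proof -
  have "h a (f a) \<le> 0" using lower[OF a, of a "f a"] a fM[OF a] by simp
  then show ?thesis using r a fM[OF a] by (simp add: D g)
 qed
 have "\<exists>D. Metric_space (M <+> M') D \<and>
    (\<forall>a\<in>M. \<forall>b\<in>M. D (Inl a) (Inl b) = d a b) \<and>
    (\<forall>a\<in>M'. \<forall>b\<in>M'. D (Inr a) (Inr b) = d' a b) \<and>
    (\<forall>a\<in>M. \<exists>b\<in>M'. D (Inl a) (Inr b) < r) \<and>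
    (\<forall>b\<in>M'. \<exists>a\<in>M. D (Inl a) (Inr b) < r)"
 proof (intro exI[of _ D] conjI ballI)
  show "Metric_space (M <+> M') D" by (rule metric)
  show "D (Inl a) (Inl b) = d a b" if "a \<in> M" "b \<in> M" for a b using de(1)[OF that] D(1) by simp
  show "D (Inr a) (Inr b) = d' a b" if "a \<in> M'" "b \<in> M'" for a b using de(2)[OF that] D(4) by simp
  show "\<exists>b\<in>M'. D (Inl a) (Inr b) < r" if "a \<in> M" for a using near[OF that] fM[OF that] by blast
  show "\<exists>a\<in>M. D (Inl a) (Inr b) < r" if b: "b \<in> M'" for b
  proof -
   obtain a where "a \<in> M" "b = f a" using f b by blast
   then show ?thesis using near by blast
  qed
 qed
 then show ?thesis unfolding gromov_hausdorff_dist_def using r by (intro Inf_lower) auto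
qed

text \<open>The pseudo-metric becomes definite on the orbit because its zero set is contained in the
  fibres of \<open>P\<close>. The value 0 outside the orbit provides the symmetry and nonnegativity
  that \<open>Metric_space\<close> demands for all arguments.\<close>

lemma orbit_metric:
 assumes dist: "\<And>A B. A \<in> SU ==> B \<in> SU ==> d (P A) (P B) = sdist om A B"
  and zero: "\<And>A B. A \<in> SU ==> B \<in> SU ==> sdist om A B = 0 ==> P A = P B"
 shows "Metric_space (P ` SU) (\<lambda>a b. if a \<in> P ` SU \<and> b \<in> P ` SU then d a b else 0)"
proof
 fix a b c
 show "0 \<le> (if a \<in> P ` SU \<and> b \<in> P ` SU then d a b else 0)" by (auto simp: dist sdist_nonneg)
 have "d a b = d b a" if "a \<in> P ` SU" "b \<in> P ` SU" using that by (auto simp: dist sdist_sym)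
 then show "(if a \<in> P ` SU \<and> b \<in> P ` SU then d a b else 0) = (if b \<in> P ` SU \<and> a \<in> P ` SU then d b a else 0)" by simp
 assume a: "a \<in> P ` SU" and b: "b \<in> P ` SU"
 obtain A B where AB: "A \<in> SU" "a = P A" "B \<in> SU" "b = P B" using a b by blast
 have "d (P A) (P A) = 0" using AB(1) by (simp add: dist sdist_eq_0[OF reach_refl])
 then show "(if a \<in> P ` SU \<and> b \<in> P ` SU then d a b else 0) = 0 \<longleftrightarrow> a = b"
  using a b AB zero dist by metis
 assume c: "c \<in> P ` SU"
 then obtain C where C: "C \<in> SU" "c = P C" by blast
 show "(if a \<in> P ` SU \<and> c \<in> P ` SU then d a c else 0) \<le> (if a \<in> P ` SU \<and> b \<in> P ` SU then d a b else 0)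
   + (if b \<in> P ` SU \<and> c \<in> P ` SU then d b c else 0)"
  using a b c AB C sdist_triangle[of A B C] by (simp add: dist)
qed

text \<open>Both spaces are quotients of the same group, and the fibres of \<open>P\<close> lie in
  those of \<open>P'\<close>. So \<open>P'\<close> induces a map between the orbits, whose
  distortion is the uniform difference of the two pseudo-metrics.\<close>

lemma gromov_hausdorff_tendsto_orbit:
 fixes w :: "real => 'k::finite => 'k => real"
 assumes dist: "\<And>t A B. A \<in> SU ==> B \<in> SU ==> d t (P A) (P B) = sdist (w t) A B"
  and dist': "\<And>A B. A \<in> SU ==> B \<in> SU ==> d' (P' A) (P' B) = sdist om A B"
  and zero: "\<And>t A B. A \<in> SU ==> B \<in> SU ==> sdist (w t) A B = 0 ==> P A = P B"
  and zero': "\<And>A B. A \<in> SU ==> B \<in> SU ==> sdist om A B = 0 ==> P' A = P' B"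
  and fib: "\<And>A B. A \<in> SU ==> B \<in> SU ==> P A = P B ==> P' A = P' B"
  and lim: "\<And>i j. ((\<lambda>t. w t i j) \<longlongrightarrow> om i j) F"
 shows "gromov_hausdorff_tendsto (P ` SU) d (P' ` SU) d' F"
proof -
 define f where "f a = P' (SOME A. A \<in> SU \<and> P A = a)" for a
 have f: "f (P A) = P' A" if A: "A \<in> SU" for A
 proof -
  have "(SOME B. B \<in> SU \<and> P B = P A) \<in> SU \<and> P (SOME B. B \<in> SU \<and> P B = P A) = P A"
   by (rule someI[of "\<lambda>B. B \<in> SU \<and> P B = P A" A]) (use A in simp)
  then show ?thesis unfolding f_def using fib A by blast
 qed
 have le: "eventually (\<lambda>t. gromov_hausdorff_dist (P ` SU) (d t) (P' ` SU) d' \<le> ennreal r) F" if r: "0 < r" for r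
  using sdist_uniform[where w = w and om = om and F = F, OF lim r]
 proof eventually_elim
  case (elim t)
  show ?case
  proof (rule gromov_hausdorff_dist_le[OF orbit_metric orbit_metric, of "d t" P "w t" d' P' om "d t" d' f r])
   show "f ` P ` SU = P' ` SU" unfolding image_image using f by (intro image_cong) auto
   show "\<bar>(if a \<in> P ` SU \<and> b \<in> P ` SU then d t a b else 0)
     - (if f a \<in> P' ` SU \<and> f b \<in> P' ` SU then d' (f a) (f b) else 0)\<bar> \<le> r" if ab: "a \<in> P ` SU" "b \<in> P ` SU" for a b
   proof -
    obtain A B where "A \<in> SU" "a = P A" "B \<in> SU" "b = P B" using ab by blast
    then show ?thesis using elim by (simp add: f dist dist')
   qed
  qed (use dist dist' zero zero' r in auto)
 qed
 show ?thesis
  unfolding gromov_hausdorff_tendsto_def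
 proof (rule order_tendstoI)
  fix a :: ennreal assume "0 < a"
  then obtain r :: real where r: "0 < r" "ennreal r < a"
  proof (cases a)
   case (real x)
   then show thesis using that[of "x/2"] \<open>0 < a\<close> by (auto simp: ennreal_less_iff)
  next
   case top
   then show thesis using that[of 1] by (auto simp: ennreal_less_top)
  qed
  show "eventually (\<lambda>t. gromov_hausdorff_dist (P ` SU) (d t) (P' ` SU) d' < a) F"
   using le[OF r(1)] by eventually_elim (use r(2) in auto)
 qed simp
qed

section \<open>Collapse of the flag manifold\<close>

lemma tendsto_wt: "(\<phi> \<longlongrightarrow> v) F ==> ((\<lambda>t. wt (\<phi> t) a b) \<longlongrightarrow> wt v a b) F"
 by (cases a; cases b) (auto intro!: tendsto_intros)

lemma flag_manifold_orbit: "flag_manifold bl = (\<lambda>A. left_mult A (isotropy_group bl)) ` SU"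
 by (auto simp: flag_manifold_def)

lemma flag_sdist_zero:
 fixes bl :: "'k::finite => block"
 assumes q: "q \<in> int_S" and AB: "A \<in> SU" "B \<in> SU"
  and zero: "sdist (\<lambda>i j. 2 * real CARD('k) * wt q (bl i) (bl j)) A B = 0"
 shows "left_mult A (isotropy_group bl) = left_mult B (isotropy_group bl)"
proof -
 have "2 * real CARD('k) * wt q (bl i) (bl j) \<noteq> 0" if "bl i \<noteq> bl j" for i j
  using wt_pos[OF q that] by simp
 from sdist_zero_mult[of bl, OF this AB zero] have "(ctranspose A ** B) $ i $ j = 0" if "bl i \<noteq> bl j" for i j
  using that by blast
 then have "ctranspose A ** B \<in> isotropy_group bl"
  using AB by (simp add: isotropy_group_iff SU_mult SU_ctranspose)
 then show ?thesis using left_mult_eq_iff[OF AB] by blast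
qed

text \<open>At \<open>v\<close> the two blocks other than \<open>pv\<close> have weight 0 between
  them and fuse into one, spanning the base plane of the Grassmannian.\<close>

lemma flag_collapse_grassmannian:
 fixes bl :: "'k::finite => block"
 assumes \<phi>: "\<And>t. \<phi> t \<in> int_S" and lim: "(\<phi> \<longlongrightarrow> v) F"
  and v: "\<And>a b. wt v a b = (if (a = pv) = (b = pv) then 0 else 1/2)"
 shows "gromov_hausdorff_tendsto (flag_manifold bl) (\<lambda>t. flag_dist bl (\<phi> t))
  (grassmannian (card {i. bl i \<noteq> pv})) (grassmannian_dist {i. bl i \<noteq> pv} (1/2)) F"
proof -
 define I where "I = {i. bl i \<noteq> pv}"
 define om where "om i j = (if (i \<in> I) = (j \<in> I) then 0 else real CARD('k))" for i j
 show ?thesis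
  unfolding flag_manifold_orbit I_def[symmetric] grassmannian_orbit[of I, symmetric]
 proof (rule gromov_hausdorff_tendsto_orbit[where w = "\<lambda>t i j. 2 * real CARD('k) * wt (\<phi> t) (bl i) (bl j)" and om = om])
  fix A B :: "'k cmat" assume AB: "A \<in> SU" "B \<in> SU"
  show "flag_dist bl (\<phi> t) (left_mult A (isotropy_group bl)) (left_mult B (isotropy_group bl))
    = sdist (\<lambda>i j. 2 * real CARD('k) * wt (\<phi> t) (bl i) (bl j)) A B" for t
   by (rule flag_dist_eq[OF \<phi> AB])
  show "grassmannian_dist I (1/2) (apply_plane A (coordinate_plane I)) (apply_plane B (coordinate_plane I)) = sdist om A B"
   unfolding om_def by (rule grassmannian_dist_eq[OF AB])
  show "left_mult A (isotropy_group bl) = left_mult B (isotropy_group bl)"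
   if "sdist (\<lambda>i j. 2 * real CARD('k) * wt (\<phi> t) (bl i) (bl j)) A B = 0" for t
   by (rule flag_sdist_zero[OF \<phi> AB that])
  show "apply_plane A (coordinate_plane I) = apply_plane B (coordinate_plane I)" if z: "sdist om A B = 0"
   unfolding apply_plane_eq_iff[OF AB]
   using sdist_zero_mult[of "\<lambda>i. i \<in> I" om, OF _ AB z] by (auto simp: om_def)
  show "apply_plane A (coordinate_plane I) = apply_plane B (coordinate_plane I)"
   if "left_mult A (isotropy_group bl) = left_mult B (isotropy_group bl)"
   using that unfolding left_mult_eq_iff[OF AB] apply_plane_eq_iff[OF AB] isotropy_group_iff I_def by auto
 next
  fix i j
  have "((\<lambda>t. 2 * real CARD('k) * wt (\<phi> t) (bl i) (bl j)) \<longlongrightarrow> 2 * real CARD('k) * wt v (bl i) (bl j)) F"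
   by (intro tendsto_intros tendsto_wt lim)
  moreover have "2 * real CARD('k) * wt v (bl i) (bl j) = om i j" unfolding v om_def I_def by simp
  ultimately show "((\<lambda>t. 2 * real CARD('k) * wt (\<phi> t) (bl i) (bl j)) \<longlongrightarrow> om i j) F" by (simp only:)
 qed
qed

text \<open>At \<open>v\<close> every weight that involves the block \<open>pv\<close> is 0;
  rotations through an index \<open>l\<close> of that block connect everything free of charge, so
  the limit pseudo-metric is 0.\<close>

lemma flag_collapse_point:
 fixes bl :: "'k::finite => block"
 assumes \<phi>: "\<And>t. \<phi> t \<in> int_S" and lim: "(\<phi> \<longlongrightarrow> v) F"
  and v: "\<And>a b. wt v a b \<noteq> 0 ==> a \<noteq> b \<and> a \<noteq> pv \<and> b \<noteq> pv" and l: "bl l = pv"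
 shows "gromov_hausdorff_tendsto (flag_manifold bl) (\<lambda>t. flag_dist bl (\<phi> t)) {()} (\<lambda>_ _. 0) F"
proof -
 define om where "om i j = 2 * real CARD('k) * wt v (bl i) (bl j)" for i j
 have z: "sdist om A B = 0" if AB: "A \<in> SU" "B \<in> SU" for A B
 proof -
  have "reach om (mat 1) (ctranspose A ** B) 0"
   by (rule reach_zero_pivot[of om bl pv l, OF _ l]) (use v AB in \<open>auto simp: om_def intro: SU_mult SU_ctranspose\<close>)
  from sdist_eq_0[OF this] show ?thesis
   using sdist_left[OF AB(1), of om "mat 1" "ctranspose A ** B"] by (simp add: SU_cancel(2)[OF AB(1)])
 qed
 have u: "{()} = (\<lambda>_ :: 'k cmat. ()) ` SU" by (rule image_constant[OF SU_mat1, symmetric])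
 show ?thesis
  unfolding flag_manifold_orbit u
 proof (rule gromov_hausdorff_tendsto_orbit[where w = "\<lambda>t i j. 2 * real CARD('k) * wt (\<phi> t) (bl i) (bl j)" and om = om])
  fix A B :: "'k cmat" assume AB: "A \<in> SU" "B \<in> SU"
  show "flag_dist bl (\<phi> t) (left_mult A (isotropy_group bl)) (left_mult B (isotropy_group bl))
    = sdist (\<lambda>i j. 2 * real CARD('k) * wt (\<phi> t) (bl i) (bl j)) A B" for t
   by (rule flag_dist_eq[OF \<phi> AB])
  show "left_mult A (isotropy_group bl) = left_mult B (isotropy_group bl)"
   if "sdist (\<lambda>i j. 2 * real CARD('k) * wt (\<phi> t) (bl i) (bl j)) A B = 0" for t
   by (rule flag_sdist_zero[OF \<phi> AB that])
  show "0 = sdist om A B" using z[OF AB] by simp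
 next
  show "((\<lambda>t. 2 * real CARD('k) * wt (\<phi> t) (bl i) (bl j)) \<longlongrightarrow> om i j) F" for i j
   unfolding om_def by (intro tendsto_intros tendsto_wt lim)
 qed simp_all
qed

lemma card_flag_blocks:
  "card {i :: 'm::finite + 'n::finite + 'p::finite. flag_blocks i \<noteq> Third} = CARD('m) + CARD('n)"
  "card {i :: 'm::finite + 'n::finite + 'p::finite. flag_blocks i \<noteq> First} = CARD('n) + CARD('p)"
  "card {i :: 'm::finite + 'n::finite + 'p::finite. flag_blocks i \<noteq> Second} = CARD('m) + CARD('p)"
proof -
  have c: "real (card {i :: 'm + 'n + 'p. flag_blocks i \<noteq> b}) = real CARD('m) * (if First = b then 0 else 1)
      + real CARD('n) * (if Second = b then 0 else 1) + real CARD('p) * (if Third = b then 0 else 1)" for b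
  proof -
    have "real (card {i :: 'm + 'n + 'p. flag_blocks i \<noteq> b})
        = (\<Sum>i\<in>(UNIV :: ('m + 'n + 'p) set). if flag_blocks i = b then 0 else 1)"
      by (simp add: sum.If_cases Collect_neg_eq)
    then show ?thesis by (simp only: sum_flag_blocks[of "\<lambda>a. if a = b then 0 else 1"])
  qed
  show "card {i :: 'm + 'n + 'p. flag_blocks i \<noteq> Third} = CARD('m) + CARD('n)"
    "card {i :: 'm + 'n + 'p. flag_blocks i \<noteq> First} = CARD('n) + CARD('p)"
    "card {i :: 'm + 'n + 'p. flag_blocks i \<noteq> Second} = CARD('m) + CARD('p)"
    using c[of Third] c[of First] c[of Second] by (simp_all flip: of_nat_add)
qed

theorem theorem5p6:
  fixes m n p :: nat
    and \<beta> :: "'m::finite + 'n::finite + 'p::finite \<Rightarrow> block"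
  assumes "m = CARD('m)" and "n = CARD('n)" and "p = CARD('p)"
    and "\<beta> = flag_blocks"
  shows
    "(\<forall>q \<in> region_1 m n p \<union> region_3 m n p \<union> region_4 m n p.
        (ricci_flow m n p q \<longlongrightarrow> pt_K) at_top) \<and>
     (\<forall>q \<in> region_2 m n p \<union> region_5_6 m n p \<union> region_9 m n p.
        (ricci_flow m n p q \<longlongrightarrow> pt_L) at_top) \<and>
     (\<forall>q \<in> region_7 m n p \<union> region_8 m n p \<union> region_10 m n p.
        (ricci_flow m n p q \<longlongrightarrow> pt_M) at_top) \<and>
     (\<forall>q \<in> region_3 m n p \<union> region_8 m n p. (ricci_flow m n p q \<longlongrightarrow> pt_O) at_bot) \<and>
     (\<forall>q \<in> region_1 m n p \<union> region_2 m n p. (ricci_flow m n p q \<longlongrightarrow> pt_P) at_bot) \<and>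
     (\<forall>q \<in> region_9 m n p \<union> region_10 m n p. (ricci_flow m n p q \<longlongrightarrow> pt_Q) at_bot) \<and>

     {q \<in> interior simplex_S. einstein \<beta> q \<and> kaehler \<beta> q} = {pt_R m n p, pt_S m n p, pt_T m n p} \<and>
     (\<forall>q \<in> {pt_R m n p, pt_S m n p, pt_T m n p}. hyperbolic_saddle (ricci_field m n p) q) \<and>

     {q \<in> interior simplex_S. einstein \<beta> q \<and> \<not> kaehler \<beta> q} = {pt_N m n p} \<and>
     repeller (ricci_field m n p) (pt_N m n p) \<and>

     (\<exists>c>0. \<forall>q \<in> region_1 m n p \<union> region_3 m n p \<union> region_4 m n p.
        gromov_hausdorff_tendsto (flag_manifold \<beta>) (\<lambda>t. flag_dist \<beta> (ricci_flow m n p q t))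
          (grassmannian (m + n)) (grassmannian_dist {i. \<beta> i \<noteq> Third} c) at_top) \<and>
     (\<exists>c>0. \<forall>q \<in> region_2 m n p \<union> region_5_6 m n p \<union> region_9 m n p.
        gromov_hausdorff_tendsto (flag_manifold \<beta>) (\<lambda>t. flag_dist \<beta> (ricci_flow m n p q t))
          (grassmannian (n + p)) (grassmannian_dist {i. \<beta> i \<noteq> First} c) at_top) \<and>
     (\<exists>c>0. \<forall>q \<in> region_7 m n p \<union> region_8 m n p \<union> region_10 m n p.
        gromov_hausdorff_tendsto (flag_manifold \<beta>) (\<lambda>t. flag_dist \<beta> (ricci_flow m n p q t))
          (grassmannian (m + p)) (grassmannian_dist {i. \<beta> i \<noteq> Second} c) at_top) \<and>
     (\<forall>q \<in> interior simplex_S - triangle_KLM.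
        gromov_hausdorff_tendsto (flag_manifold \<beta>) (\<lambda>t. flag_dist \<beta> (ricci_flow m n p q t))
          {()} (\<lambda>_ _. 0) at_bot)"
proof -
  have mnp: "m > 0" "n > 0" "p > 0" using assms(1-3) by simp_all
  note forward = regions_forward[OF mnp] and backward = regions_backward[OF mnp]
  have int: "ricci_flow m n p q t \<in> interior simplex_S" if "q \<in> interior simplex_S" for q t
    by (rule ricci_flow_interior[OF mnp that])
  have collapse: "gromov_hausdorff_tendsto (flag_manifold \<beta>) (\<lambda>t. flag_dist \<beta> (ricci_flow m n p q t))
      (grassmannian (card {i. \<beta> i \<noteq> b0})) (grassmannian_dist {i. \<beta> i \<noteq> b0} (1/2)) at_top"
    if "q \<in> interior simplex_S \<and> (ricci_flow m n p q \<longlongrightarrow> v) at_top"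
      "\<And>a b. wt v a b = (if (a = b0) = (b = b0) then 0 else 1/2)" for q v b0
    using int that by (intro flag_collapse_grassmannian[where \<phi> = "ricci_flow m n p q" and v = v]) auto
  \<comment> \<open>At \<open>K\<close> the parameter \<open>x\<close> vanishes and fuses the first
    and second blocks; at \<open>L\<close> it is \<open>z\<close>, for the second and third, and at
    \<open>M\<close> it is \<open>y\<close>, for the first and third. The block left over is the one
    excluded from the base plane.\<close>
  have wK: "wt pt_K a b = (if (a = Third) = (b = Third) then 0 else 1/2)" for a b
    by (cases a; cases b) (simp_all add: pt_K_def)
  have wL: "wt pt_L a b = (if (a = First) = (b = First) then 0 else 1/2)" for a b
    by (cases a; cases b) (simp_all add: pt_L_def)
  have wM: "wt pt_M a b = (if (a = Second) = (b = Second) then 0 else 1/2)" for a b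
    by (cases a; cases b) (simp_all add: pt_M_def)
  have K: "gromov_hausdorff_tendsto (flag_manifold \<beta>) (\<lambda>t. flag_dist \<beta> (ricci_flow m n p q t))
      (grassmannian (m + n)) (grassmannian_dist {i. \<beta> i \<noteq> Third} (1/2)) at_top"
    if "q \<in> region_1 m n p \<union> region_3 m n p \<union> region_4 m n p" for q
    using collapse[OF forward(1)[OF that] wK] card_flag_blocks(1) assms by metis
  have L: "gromov_hausdorff_tendsto (flag_manifold \<beta>) (\<lambda>t. flag_dist \<beta> (ricci_flow m n p q t))
      (grassmannian (n + p)) (grassmannian_dist {i. \<beta> i \<noteq> First} (1/2)) at_top"
    if "q \<in> region_2 m n p \<union> region_5_6 m n p \<union> region_9 m n p" for q
    using collapse[OF forward(2)[OF that] wL] card_flag_blocks(2) assms by metis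
  have M: "gromov_hausdorff_tendsto (flag_manifold \<beta>) (\<lambda>t. flag_dist \<beta> (ricci_flow m n p q t))
      (grassmannian (m + p)) (grassmannian_dist {i. \<beta> i \<noteq> Second} (1/2)) at_top"
    if "q \<in> region_7 m n p \<union> region_8 m n p \<union> region_10 m n p" for q
    using collapse[OF forward(3)[OF that] wM] card_flag_blocks(3) assms by metis
  have point: "gromov_hausdorff_tendsto (flag_manifold \<beta>) (\<lambda>t. flag_dist \<beta> (ricci_flow m n p q t)) {()} (\<lambda>_ _. 0) at_bot"
    if q: "q \<in> interior simplex_S - triangle_KLM" for q
  proof -
    have qi: "q \<in> interior simplex_S" using q by blast
    have bl: "\<beta> (Inl undefined) = First" "\<beta> (Inr (Inl undefined)) = Second" "\<beta> (Inr (Inr undefined)) = Third"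
      by (simp_all add: assms(4) flag_blocks_def)
    \<comment> \<open>At \<open>O\<close>, \<open>P\<close>, \<open>Q\<close> only \<open>z\<close>,
      \<open>y\<close>, \<open>x\<close> respectively is nonzero; the free block is the one that
      this parameter does not involve.\<close>
    have w: "wt pt_O a b \<noteq> 0 \<Longrightarrow> a \<noteq> b \<and> a \<noteq> First \<and> b \<noteq> First" "wt pt_P a b \<noteq> 0 \<Longrightarrow> a \<noteq> b \<and> a \<noteq> Second \<and> b \<noteq> Second"
      "wt pt_Q a b \<noteq> 0 \<Longrightarrow> a \<noteq> b \<and> a \<noteq> Third \<and> b \<noteq> Third" for a b
      by (cases a; cases b; simp add: pt_O_def pt_P_def pt_Q_def)+
    consider "(ricci_flow m n p q \<longlongrightarrow> pt_O) at_bot" | "(ricci_flow m n p q \<longlongrightarrow> pt_P) at_bot"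
      | "(ricci_flow m n p q \<longlongrightarrow> pt_Q) at_bot" using outside_triangle_backward[OF mnp q] by blast
    then show ?thesis
    proof cases
      case 1 then show ?thesis
        using int[OF qi] w(1) bl(1) by (intro flag_collapse_point[where \<phi> = "ricci_flow m n p q" and v = pt_O and pv = First and l = "Inl undefined"]) auto
    next
      case 2 then show ?thesis
        using int[OF qi] w(2) bl(2) by (intro flag_collapse_point[where \<phi> = "ricci_flow m n p q" and v = pt_P and pv = Second and l = "Inr (Inl undefined)"]) auto
    next
      case 3 then show ?thesis
        using int[OF qi] w(3) bl(3) by (intro flag_collapse_point[where \<phi> = "ricci_flow m n p q" and v = pt_Q and pv = Third and l = "Inr (Inr undefined)"]) auto
    qed
  qed
  show ?thesis
  proof (intro conjI ballI)
    show "\<exists>c>0. \<forall>q \<in> region_1 m n p \<union> region_3 m n p \<union> region_4 m n p.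
        gromov_hausdorff_tendsto (flag_manifold \<beta>) (\<lambda>t. flag_dist \<beta> (ricci_flow m n p q t))
          (grassmannian (m + n)) (grassmannian_dist {i. \<beta> i \<noteq> Third} c) at_top"
      by (rule exI[of _ "1/2"]) (use K in simp)
    show "\<exists>c>0. \<forall>q \<in> region_2 m n p \<union> region_5_6 m n p \<union> region_9 m n p.
        gromov_hausdorff_tendsto (flag_manifold \<beta>) (\<lambda>t. flag_dist \<beta> (ricci_flow m n p q t))
          (grassmannian (n + p)) (grassmannian_dist {i. \<beta> i \<noteq> First} c) at_top"
      by (rule exI[of _ "1/2"]) (use L in simp)
    show "\<exists>c>0. \<forall>q \<in> region_7 m n p \<union> region_8 m n p \<union> region_10 m n p.
        gromov_hausdorff_tendsto (flag_manifold \<beta>) (\<lambda>t. flag_dist \<beta> (ricci_flow m n p q t))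
          (grassmannian (m + p)) (grassmannian_dist {i. \<beta> i \<noteq> Second} c) at_top"
      by (rule exI[of _ "1/2"]) (use M in simp)
    show "hyperbolic_saddle (ricci_field m n p) q" if "q \<in> {pt_R m n p, pt_S m n p, pt_T m n p}" for q
      using that pt_R_saddle[OF mnp] pt_S_saddle[OF mnp] pt_T_saddle[OF mnp] by blast
  qed (use forward backward point pt_N_repeller[OF mnp] einstein_kaehler_sets[OF assms(4,1,2,3)] in blast)+
qed

end
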